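(* Let $F:S\to T$ be a morphism of operads, with object function $f:I\to J$. Then the lax $S$-morphism $u_F:1\to\overline F(F\downarrow(-))$ exhibits the strict $T$-algebra $F\downarrow(-)$ as the internal $S$-algebra classifier relative to $F$; that is, for all strict $T$-algebras $B$ the functor $$T\text{-Alg}_s(F\downarrow(-),B)\longrightarrow S\text{-Alg}_l(1,\overline FB)$$ given by precomposition with $u_F$ (i.e. $g\mapsto\overline F(g)\circ u_F$) is an isomorphism of categories.
   Context: **Operads.** "Operad" means coloured symmetric operad in $\mathbf{Set}$ (symmetric multicategory). For $\alpha:(i_k)_{1\le k\le n}\to i$ and $\rho\in\Sigma_n$, the action gives $\alpha\rho:(i_{\rho k})_k\to i$; substitution is written $\alpha(\beta_k)_k:(i_{kl})_{kl}\to i$. **The 2-monad of an operad.** An operad $T$ with set of colours $J$ gives a 2-monad, also denoted $T$, on $\mathbf{Cat}/J$. For $X=(X_j)_{j\in J}$, $(TX)_j$ has as objects pairs $(\alpha,(x_k)_k)$ with $\alpha:(j_k)_{1\le k\le n}\to j$ in $T$ and $x_k\in X_{j_k}$; a morphism $(\alpha,(x_k)_k)\to(\beta,(y_k)_k)$ is $(\rho,(\gamma_k)_k)$ with $\rho\in\Sigma_n$, $\alpha=\beta\rho$ and $\gamma_k:x_k\to y_{\rho k}$ in $X_{j_k}$. The unit is $x\mapsto(1_j,(x))$; the multiplication is $(\alpha,(\alpha_k,(x_{kl})_l)_k)\mapsto(\alpha(\alpha_k)_k,(x_{kl})_{kl})$, and on morphisms substitutes permutations. **Algebras.** For a 2-monad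 $T$, a lax morphism $(A,a)\to(B,b)$ of strict $T$-algebras is $(g,\overline g)$ with $\overline g:bT(g)\to ga$, $\overline g\eta_A=1$, $\overline g\mu_A=(\overline gT(a))(bT(\overline g))$; it is strict if $\overline g$ is an identity; 2-cells are 2-cells $\phi:g\to g'$ with $\overline{g'}(bT(\phi))=(\phi a)\overline g$. $T\text{-Alg}_s$, $T\text{-Alg}_l$ are the 2-categories of strict $T$-algebras with strict, resp. lax, morphisms. **The adjunction of 2-monads of $F$.** $F_!=\Sigma_f:\mathbf{Cat}/I\to\mathbf{Cat}/J$ (composition with $f$), $F^*=\Delta_f$ (pullback along $f$), and $F^l:SF^*\to F^*T$ is given by $F^l_{Y,i}(\alpha,(y_k)_k)=(F\alpha,(y_k)_k)$ and $F^l_{Y,i}(\rho,(\gamma_k)_k)=(\rho,(\gamma_k)_k)$. $\overline F$ sends $(A,a)$ to $(F^*A,F^*(a)F^l_A)$ (and $g$ to $F^*g$), so $\overline F(A)_i=A_{fi}$. $1$ denotes the terminal $S$-algebra. **Bijective-monotone factorisation.** Every function $h:\underline m\to\underline n$ between finite ordinals ($\underline n=\{1<\dots<n\}$) factors uniquely as $h=\phi_h\rho_h$ with $\phi_h$ order preserving and $\rho_h\in\Sigma_m$ order preserving on the fibres of $h$. The same applies to functions between finite linearly ordered sets. **The category $F\downarrow j$** ($j\in J$). Objects: pairs $((i_k)_{1\le k\le n},\alpha)$ with $i_k\in I$ and $\alpha:(fi_k)_k\to j$ in $T$. A morphism $((i_{1,k_1})_{1\le k_1\le n_1},\alpha_1)\to((i_{2,k_2})_{1\le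 k_2\le n_2},\alpha_2)$ is $(h,(\beta_{k_2})_{k_2})$ with $h:\underline n_1\to\underline n_2$ a function (the indexing function) and $\beta_{k_2}:(i_{1,k_1})_{hk_1=k_2}\to i_{2,k_2}$ in $S$ (the decorating operations), such that $\alpha_2(F\beta_{k_2})_{k_2}\rho_h=\alpha_1$. Identities have identity indexing function and decorating operations. The composite of $(h_1,(\beta_{1,k_2})_{k_2})$ followed by $(h_2,(\beta_{2,k_3})_{k_3})$ has indexing function $h_2h_1$ and $k_3$-th decorating operation $\beta_{2,k_3}(\beta_{1,k_2})_{h_2k_2=k_3}$, with inputs reordered to $(i_{1,k_1})_{h_2h_1k_1=k_3}$ by acting with the bijective part of the factorisation of the restricted function $h_1:(h_2h_1)^{-1}\{k_3\}\to h_2^{-1}\{k_3\}$. **The strict $T$-algebra $F\downarrow(-)$.** Underlying object $(F\downarrow j)_{j\in J}$. For $\gamma:(j_k)_{1\le k\le p}\to j$ in $T$, the functor $F\downarrow\gamma:\prod_kF\downarrow j_k\to F\downarrow j$ sends $((i_{kl})_l,\alpha_k)_k$ to $((i_{kl})_{kl},\gamma(\alpha_k)_k)$ and $(h_k,(\beta_{k,l_2})_{l_2})_k$ to $(h_1+\dots+h_p,(\beta_{k,l_2})_{k,l_2})$ (ordinal sum). For $\rho\in\Sigma_p$ and objects $x_k=((i_{kl})_{1\le l\le n_k},\alpha_k)$ of $F\downarrow j_k$, the symmetry $\xi_{\gamma,\rho}:(F\downarrow\gamma\rho)(x_{\rho k})_k\to(F\downarrow\gamma)(x_k)_k$ has identity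 decorating operations and indexing function the block permutation taking the $l$-th element of the $k$-th block to the $l$-th element of the $\rho k$-th block. The action $T(F\downarrow(-))\to F\downarrow(-)$ sends $(\gamma,(x_k)_k)$ to $(F\downarrow\gamma)(x_k)_k$ and a morphism $(\rho,(g_k)_k):(\gamma\rho,(y_k)_k)\to(\gamma,(x_k)_k)$ to $\xi_{\gamma,\rho}\circ(F\downarrow\gamma\rho)(g_k)_k$. **The lax morphism $u_F$.** $u_F:1\to\overline F(F\downarrow(-))$ picks out $(i,1_{fi})\in F\downarrow fi$ for $i\in I$, and its lax coherence datum at an operation $\alpha:(i_k)_{1\le k\le n}\to i$ of $S$ is $(t_n,(\alpha)):((i_k)_k,F\alpha)\to(i,1_{fi})$, with $t_n:\underline n\to\underline1$ the unique function. *)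

theory Defs
  imports Main "HOL-Library.FuncSet" "HOL-Combinatorics.Permutations"
begin

text \<open>
  Conventions.  Finite ordinals are \<open>{..<n}\<close>, so positions count from 0.  Elements of the
  symmetric group are functions that permute \<open>{..<n}\<close>.  Functors and natural transformations are
  extensional (\<open>undefined\<close> off their domains), so equality of 1-cells and of 2-cells is plain
  equality, and isomorphisms of categories are strict.
\<close>


section \<open>Small categories\<close>

record ('o, 'm) cat =
  Obj :: "'o set"
  Arr :: "'m set"
  Dom :: "'m \<Rightarrow> 'o"
  Cod :: "'m \<Rightarrow> 'o"
  Ide :: "'o \<Rightarrow> 'm"
  Cmp :: "'m \<Rightarrow> 'm \<Rightarrow> 'm"  \<comment> \<open>\<open>Cmp C g f\<close> is \<open>f\<close> followed by \<open>g\<close>\<close>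

definition in_hom :: "('o, 'm) cat \<Rightarrow> 'm \<Rightarrow> 'o \<Rightarrow> 'o \<Rightarrow> bool" where
  "in_hom C m x y \<longleftrightarrow> m \<in> Arr C \<and> Dom C m = x \<and> Cod C m = y"

locale category =
  fixes C :: "('o, 'm) cat"
  assumes dom_obj: "m \<in> Arr C \<Longrightarrow> Dom C m \<in> Obj C"
    and cod_obj: "m \<in> Arr C \<Longrightarrow> Cod C m \<in> Obj C"
    and ide_hom: "x \<in> Obj C \<Longrightarrow> in_hom C (Ide C x) x x"
    and cmp_hom: "in_hom C m x y \<Longrightarrow> in_hom C m' y z \<Longrightarrow> in_hom C (Cmp C m' m) x z"
    and cmp_ide_left: "in_hom C m x y \<Longrightarrow> Cmp C (Ide C y) m = m"
    and cmp_ide_right: "in_hom C m x y \<Longrightarrow> Cmp C m (Ide C x) = m"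
    and cmp_assoc: "in_hom C m x y \<Longrightarrow> in_hom C m' y z \<Longrightarrow> in_hom C m'' z w \<Longrightarrow>
      Cmp C m'' (Cmp C m' m) = Cmp C (Cmp C m'' m') m"

text \<open>
  The category with given objects, hom-sets, identities and composition.  Hom-sets need not be
  disjoint, so an arrow is a triple (domain, datum, codomain).
\<close>

definition cat_of_homs ::
  "'o set \<Rightarrow> ('o \<Rightarrow> 'o \<Rightarrow> 'd set) \<Rightarrow> ('o \<Rightarrow> 'd) \<Rightarrow> ('o \<Rightarrow> 'o \<Rightarrow> 'o \<Rightarrow> 'd \<Rightarrow> 'd \<Rightarrow> 'd)
    \<Rightarrow> ('o, 'o \<times> 'd \<times> 'o) cat" where
  "cat_of_homs X H e c = \<lparr>
     Obj = X,
     Arr = {(x, d, y). x \<in> X \<and> y \<in> X \<and> d \<in> H x y},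
     Dom = (\<lambda>(x, d, y). x),
     Cod = (\<lambda>(x, d, y). y),
     Ide = (\<lambda>x. (x, e x, x)),
     Cmp = (\<lambda>(_, d', z) (x, d, y). (x, c x y z d' d, z)) \<rparr>"

abbreviation dom_of :: "'o \<times> 'd \<times> 'o \<Rightarrow> 'o" where "dom_of m \<equiv> fst m"
abbreviation datum_of :: "'o \<times> 'd \<times> 'o \<Rightarrow> 'd" where "datum_of m \<equiv> fst (snd m)"
abbreviation cod_of :: "'o \<times> 'd \<times> 'o \<Rightarrow> 'o" where "cod_of m \<equiv> snd (snd m)"

definition terminal_cat :: "(unit, unit) cat" where
  "terminal_cat = \<lparr> Obj = {()}, Arr = {()}, Dom = (\<lambda>_. ()), Cod = (\<lambda>_. ()),
     Ide = (\<lambda>_. ()), Cmp = (\<lambda>_ _. ()) \<rparr>"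

record ('o, 'm, 'p, 'q) func =
  FO :: "'o \<Rightarrow> 'p"
  FA :: "'m \<Rightarrow> 'q"

locale is_functor = A: category C + B: category D
  for C :: "('o, 'm) cat" and D :: "('p, 'q) cat" +
  fixes G :: "('o, 'm, 'p, 'q) func"
  assumes fo_maps: "FO G \<in> Obj C \<rightarrow>\<^sub>E Obj D"
    and fa_maps: "FA G \<in> Arr C \<rightarrow>\<^sub>E Arr D"
    and fa_hom: "in_hom C m x y \<Longrightarrow> in_hom D (FA G m) (FO G x) (FO G y)"
    and fa_ide: "x \<in> Obj C \<Longrightarrow> FA G (Ide C x) = Ide D (FO G x)"
    and fa_cmp: "in_hom C m x y \<Longrightarrow> in_hom C m' y z \<Longrightarrow>
      FA G (Cmp C m' m) = Cmp D (FA G m') (FA G m)"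

definition id_func :: "('o, 'm) cat \<Rightarrow> ('o, 'm, 'o, 'm) func" where
  "id_func C = \<lparr> FO = (\<lambda>x\<in>Obj C. x), FA = (\<lambda>m\<in>Arr C. m) \<rparr>"

definition comp_func ::
  "('o, 'm) cat \<Rightarrow> ('p, 'q, 'r, 's) func \<Rightarrow> ('o, 'm, 'p, 'q) func \<Rightarrow> ('o, 'm, 'r, 's) func" where
  "comp_func C H G = \<lparr> FO = compose (Obj C) (FO H) (FO G), FA = compose (Arr C) (FA H) (FA G) \<rparr>"

definition iso_of_categories ::
  "('o, 'm) cat \<Rightarrow> ('p, 'q) cat \<Rightarrow> ('o, 'm, 'p, 'q) func \<Rightarrow> bool" where
  "iso_of_categories C D G \<longleftrightarrow> is_functor C D G \<and>
     (\<exists>H. is_functor D C H \<and> comp_func C H G = id_func C \<and> comp_func D G H = id_func D)"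

definition is_nat_trans ::
  "('o, 'm) cat \<Rightarrow> ('p, 'q) cat \<Rightarrow> ('o, 'm, 'p, 'q) func \<Rightarrow> ('o, 'm, 'p, 'q) func
    \<Rightarrow> ('o \<Rightarrow> 'q) \<Rightarrow> bool" where
  "is_nat_trans C D G G' \<phi> \<longleftrightarrow>
     \<phi> \<in> extensional (Obj C) \<and>
     (\<forall>x\<in>Obj C. in_hom D (\<phi> x) (FO G x) (FO G' x)) \<and>
     (\<forall>m x y. in_hom C m x y \<longrightarrow> Cmp D (\<phi> y) (FA G m) = Cmp D (FA G' m) (\<phi> x))"


section \<open>The 2-category \<open>Cat/J\<close>\<close>

text \<open>
  An object of \<open>Cat/J\<close> is a family of categories indexed by \<open>J\<close>; 1-cells and 2-cells are
  families of functors and of natural transformations.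
\<close>

definition cell1 ::
  "'j set \<Rightarrow> ('j \<Rightarrow> ('o, 'm) cat) \<Rightarrow> ('j \<Rightarrow> ('p, 'q) cat)
    \<Rightarrow> ('j \<Rightarrow> ('o, 'm, 'p, 'q) func) \<Rightarrow> bool" where
  "cell1 J X Y g \<longleftrightarrow> g \<in> extensional J \<and> (\<forall>j\<in>J. is_functor (X j) (Y j) (g j))"

definition cell2 ::
  "'j set \<Rightarrow> ('j \<Rightarrow> ('o, 'm) cat) \<Rightarrow> ('j \<Rightarrow> ('p, 'q) cat)
    \<Rightarrow> ('j \<Rightarrow> ('o, 'm, 'p, 'q) func) \<Rightarrow> ('j \<Rightarrow> ('o, 'm, 'p, 'q) func)
    \<Rightarrow> ('j \<Rightarrow> 'o \<Rightarrow> 'q) \<Rightarrow> bool" where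
  "cell2 J X Y g g' \<phi> \<longleftrightarrow>
     \<phi> \<in> extensional J \<and> (\<forall>j\<in>J. is_nat_trans (X j) (Y j) (g j) (g' j) (\<phi> j))"

definition id1 :: "'j set \<Rightarrow> ('j \<Rightarrow> ('o, 'm) cat) \<Rightarrow> 'j \<Rightarrow> ('o, 'm, 'o, 'm) func" where
  "id1 J X = (\<lambda>j\<in>J. id_func (X j))"

definition comp1 ::
  "'j set \<Rightarrow> ('j \<Rightarrow> ('o, 'm) cat) \<Rightarrow> ('j \<Rightarrow> ('p, 'q, 'r, 's) func)
    \<Rightarrow> ('j \<Rightarrow> ('o, 'm, 'p, 'q) func) \<Rightarrow> 'j \<Rightarrow> ('o, 'm, 'r, 's) func" where
  "comp1 J X h g = (\<lambda>j\<in>J. comp_func (X j) (h j) (g j))"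

definition id2 ::
  "'j set \<Rightarrow> ('j \<Rightarrow> ('o, 'm) cat) \<Rightarrow> ('j \<Rightarrow> ('p, 'q) cat)
    \<Rightarrow> ('j \<Rightarrow> ('o, 'm, 'p, 'q) func) \<Rightarrow> 'j \<Rightarrow> 'o \<Rightarrow> 'q" where
  "id2 J X Y g = (\<lambda>j\<in>J. \<lambda>x\<in>Obj (X j). Ide (Y j) (FO (g j) x))"

text \<open>Vertical composition: \<open>\<phi>\<close> followed by \<open>\<psi>\<close>, for 2-cells between 1-cells \<open>X \<rightarrow> Y\<close>.\<close>

definition vcomp ::
  "'j set \<Rightarrow> ('j \<Rightarrow> ('o, 'm) cat) \<Rightarrow> ('j \<Rightarrow> ('p, 'q) cat)
    \<Rightarrow> ('j \<Rightarrow> 'o \<Rightarrow> 'q) \<Rightarrow> ('j \<Rightarrow> 'o \<Rightarrow> 'q) \<Rightarrow> 'j \<Rightarrow> 'o \<Rightarrow> 'q" where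
  "vcomp J X Y \<psi> \<phi> = (\<lambda>j\<in>J. \<lambda>x\<in>Obj (X j). Cmp (Y j) (\<psi> j x) (\<phi> j x))"

text \<open>The whiskerings \<open>h\<phi>\<close> and \<open>\<phi>g\<close>; in both, \<open>X\<close> is the domain of the resulting 1-cells.\<close>

definition lwhisker ::
  "'j set \<Rightarrow> ('j \<Rightarrow> ('o, 'm) cat) \<Rightarrow> ('j \<Rightarrow> ('p, 'q, 'r, 's) func)
    \<Rightarrow> ('j \<Rightarrow> 'o \<Rightarrow> 'q) \<Rightarrow> 'j \<Rightarrow> 'o \<Rightarrow> 's" where
  "lwhisker J X h \<phi> = (\<lambda>j\<in>J. \<lambda>x\<in>Obj (X j). FA (h j) (\<phi> j x))"

definition rwhisker ::
  "'j set \<Rightarrow> ('j \<Rightarrow> ('o, 'm) cat) \<Rightarrow> ('j \<Rightarrow> 'p \<Rightarrow> 's)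
    \<Rightarrow> ('j \<Rightarrow> ('o, 'm, 'p, 'q) func) \<Rightarrow> 'j \<Rightarrow> 'o \<Rightarrow> 's" where
  "rwhisker J X \<phi> g = (\<lambda>j\<in>J. \<lambda>x\<in>Obj (X j). \<phi> j (FO (g j) x))"

text \<open>
  The 2-functor \<open>F\<^sup>* : Cat/J \<rightarrow> Cat/I\<close> (pullback along \<open>f : I \<rightarrow> J\<close>) reindexes families; the same
  formula serves for objects, 1-cells and 2-cells.
\<close>

definition pull :: "'i set \<Rightarrow> ('i \<Rightarrow> 'j) \<Rightarrow> ('j \<Rightarrow> 'x) \<Rightarrow> 'i \<Rightarrow> 'x" where
  "pull I f X = (\<lambda>i\<in>I. X (f i))"


section \<open>Maps of concatenated blocks\<close>

text \<open>
  In a concatenation of blocks of lengths \<open>ns\<close>, \<open>block_pos ns k l\<close> is the position of the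
  \<open>l\<close>-th element of the \<open>k\<close>-th block, and \<open>block_split\<close> recovers \<open>(k, l)\<close> from the position.
\<close>

definition block_pos :: "nat list \<Rightarrow> nat \<Rightarrow> nat \<Rightarrow> nat" where
  "block_pos ns k l = sum_list (take k ns) + l"

fun block_split :: "nat list \<Rightarrow> nat \<Rightarrow> nat \<times> nat" where
  "block_split [] p = (0, p)"
| "block_split (n # ns) p =
     (if p < n then (0, p) else (let (k, l) = block_split ns (p - n) in (Suc k, l)))"

text \<open>
  The map from blocks of lengths \<open>ms\<close> to blocks of lengths \<open>ns\<close> taking the \<open>l\<close>-th element of the
  \<open>k\<close>-th block to the \<open>h k l\<close>-th element of the \<open>\<rho> k\<close>-th block.  With \<open>\<rho>\<close> the identity it is the
  ordinal sum of the \<open>h k\<close>; with each \<open>h k\<close> the identity it is a block permutation.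
\<close>

definition block_map :: "nat list \<Rightarrow> nat list \<Rightarrow> (nat \<Rightarrow> nat) \<Rightarrow> (nat \<Rightarrow> nat \<Rightarrow> nat) \<Rightarrow> nat \<Rightarrow> nat" where
  "block_map ms ns \<rho> h p =
     (if p < sum_list ms
      then (let (k, l) = block_split ms p in block_pos ns (\<rho> k) (h k l)) else p)"


section \<open>Operads\<close>

record ('j, 't) opd =
  Col :: "'j set"
  Ops :: "'t set"
  Src :: "'t \<Rightarrow> 'j list"
  Tgt :: "'t \<Rightarrow> 'j"
  One :: "'j \<Rightarrow> 't"
  Act :: "'t \<Rightarrow> (nat \<Rightarrow> nat) \<Rightarrow> 't"
  Sub :: "'t \<Rightarrow> 't list \<Rightarrow> 't"

definition arity :: "('j, 't) opd \<Rightarrow> 't \<Rightarrow> nat" where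
  "arity T \<alpha> = length (Src T \<alpha>)"

definition composable :: "('j, 't) opd \<Rightarrow> 't \<Rightarrow> 't list \<Rightarrow> bool" where
  "composable T \<alpha> \<beta>s \<longleftrightarrow> \<alpha> \<in> Ops T \<and> set \<beta>s \<subseteq> Ops T \<and> map (Tgt T) \<beta>s = Src T \<alpha>"

locale operad =
  fixes T :: "('j, 't) opd"
  assumes src_col: "\<alpha> \<in> Ops T \<Longrightarrow> set (Src T \<alpha>) \<subseteq> Col T"
    and tgt_col: "\<alpha> \<in> Ops T \<Longrightarrow> Tgt T \<alpha> \<in> Col T"
    and one_ops: "j \<in> Col T \<Longrightarrow> One T j \<in> Ops T"
    and one_src: "j \<in> Col T \<Longrightarrow> Src T (One T j) = [j]"
    and one_tgt: "j \<in> Col T \<Longrightarrow> Tgt T (One T j) = j"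
    and act_ops: "\<alpha> \<in> Ops T \<Longrightarrow> \<rho> permutes {..<arity T \<alpha>} \<Longrightarrow> Act T \<alpha> \<rho> \<in> Ops T"
    and act_src: "\<alpha> \<in> Ops T \<Longrightarrow> \<rho> permutes {..<arity T \<alpha>} \<Longrightarrow>
      Src T (Act T \<alpha> \<rho>) = permute_list \<rho> (Src T \<alpha>)"
    and act_tgt: "\<alpha> \<in> Ops T \<Longrightarrow> \<rho> permutes {..<arity T \<alpha>} \<Longrightarrow> Tgt T (Act T \<alpha> \<rho>) = Tgt T \<alpha>"
    and sub_ops: "composable T \<alpha> \<beta>s \<Longrightarrow> Sub T \<alpha> \<beta>s \<in> Ops T"
    and sub_src: "composable T \<alpha> \<beta>s \<Longrightarrow> Src T (Sub T \<alpha> \<beta>s) = concat (map (Src T) \<beta>s)"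
    and sub_tgt: "composable T \<alpha> \<beta>s \<Longrightarrow> Tgt T (Sub T \<alpha> \<beta>s) = Tgt T \<alpha>"
    and act_id: "\<alpha> \<in> Ops T \<Longrightarrow> Act T \<alpha> id = \<alpha>"
    and act_act: "\<alpha> \<in> Ops T \<Longrightarrow> \<rho> permutes {..<arity T \<alpha>} \<Longrightarrow> \<sigma> permutes {..<arity T \<alpha>} \<Longrightarrow>
      Act T (Act T \<alpha> \<rho>) \<sigma> = Act T \<alpha> (\<rho> \<circ> \<sigma>)"
    and sub_one_left: "\<alpha> \<in> Ops T \<Longrightarrow> Sub T (One T (Tgt T \<alpha>)) [\<alpha>] = \<alpha>"
    and sub_one_right: "\<alpha> \<in> Ops T \<Longrightarrow> Sub T \<alpha> (map (One T) (Src T \<alpha>)) = \<alpha>"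
    and sub_assoc: "composable T \<alpha> \<beta>s \<Longrightarrow> list_all2 (composable T) \<beta>s \<gamma>ss \<Longrightarrow>
      Sub T (Sub T \<alpha> \<beta>s) (concat \<gamma>ss) = Sub T \<alpha> (map2 (Sub T) \<beta>s \<gamma>ss)"
    and sub_act_outer: "composable T \<alpha> \<beta>s \<Longrightarrow> \<rho> permutes {..<arity T \<alpha>} \<Longrightarrow>
      Sub T (Act T \<alpha> \<rho>) (permute_list \<rho> \<beta>s) =
      Act T (Sub T \<alpha> \<beta>s)
        (block_map (map (arity T) (permute_list \<rho> \<beta>s)) (map (arity T) \<beta>s) \<rho> (\<lambda>_. id))"
    and sub_act_inner: "composable T \<alpha> \<beta>s \<Longrightarrow>
      list_all2 (\<lambda>\<beta> \<sigma>. \<sigma> permutes {..<arity T \<beta>}) \<beta>s \<sigma>s \<Longrightarrow>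
      Sub T \<alpha> (map2 (Act T) \<beta>s \<sigma>s) =
      Act T (Sub T \<alpha> \<beta>s) (block_map (map (arity T) \<beta>s) (map (arity T) \<beta>s) id (\<lambda>k. \<sigma>s ! k))"

text \<open>A morphism of operads consists of a map \<open>f\<close> of colours and a map \<open>F\<close> of operations.\<close>

locale operad_morphism =
  fixes S :: "('i, 's) opd" and T :: "('j, 't) opd" and f :: "'i \<Rightarrow> 'j" and F :: "'s \<Rightarrow> 't"
  assumes col_map: "i \<in> Col S \<Longrightarrow> f i \<in> Col T"
    and ops_map: "\<alpha> \<in> Ops S \<Longrightarrow> F \<alpha> \<in> Ops T"
    and src_map: "\<alpha> \<in> Ops S \<Longrightarrow> Src T (F \<alpha>) = map f (Src S \<alpha>)"
    and tgt_map: "\<alpha> \<in> Ops S \<Longrightarrow> Tgt T (F \<alpha>) = f (Tgt S \<alpha>)"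
    and one_map: "i \<in> Col S \<Longrightarrow> F (One S i) = One T (f i)"
    and act_map: "\<alpha> \<in> Ops S \<Longrightarrow> \<rho> permutes {..<arity S \<alpha>} \<Longrightarrow> F (Act S \<alpha> \<rho>) = Act T (F \<alpha>) \<rho>"
    and sub_map: "composable S \<alpha> \<beta>s \<Longrightarrow> F (Sub S \<alpha> \<beta>s) = Sub T (F \<alpha>) (map F \<beta>s)"


section \<open>The 2-monad of an operad\<close>

type_synonym ('t, 'o) mobj = "'t \<times> 'o list"
type_synonym ('t, 'o, 'm) marr = "('t, 'o) mobj \<times> ((nat \<Rightarrow> nat) \<times> 'm list) \<times> ('t, 'o) mobj"

definition mon_ob ::
  "('j, 't) opd \<Rightarrow> ('j \<Rightarrow> ('o, 'm) cat) \<Rightarrow> 'j \<Rightarrow> (('t, 'o) mobj, ('t, 'o, 'm) marr) cat" where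
  "mon_ob T X j = cat_of_homs
     {(\<alpha>, xs). \<alpha> \<in> Ops T \<and> Tgt T \<alpha> = j \<and> list_all2 (\<lambda>i x. x \<in> Obj (X i)) (Src T \<alpha>) xs}
     (\<lambda>(\<alpha>, xs) (\<beta>, ys). {(\<rho>, \<gamma>s).
        \<rho> permutes {..<arity T \<beta>} \<and> \<alpha> = Act T \<beta> \<rho> \<and> length \<gamma>s = arity T \<alpha> \<and>
        (\<forall>k<arity T \<alpha>. in_hom (X (Src T \<alpha> ! k)) (\<gamma>s ! k) (xs ! k) (ys ! \<rho> k))})
     (\<lambda>(\<alpha>, xs). (id, map2 (\<lambda>i. Ide (X i)) (Src T \<alpha>) xs))
     (\<lambda>(\<alpha>, xs) _ _ (\<sigma>, \<delta>s) (\<rho>, \<gamma>s).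
        (\<sigma> \<circ> \<rho>, map (\<lambda>k. Cmp (X (Src T \<alpha> ! k)) (\<delta>s ! \<rho> k) (\<gamma>s ! k)) [0..<arity T \<alpha>]))"

definition mon_obj_map :: "('j, 't) opd \<Rightarrow> ('j \<Rightarrow> ('o, 'm, 'p, 'q) func)
    \<Rightarrow> ('t, 'o) mobj \<Rightarrow> ('t, 'p) mobj" where
  "mon_obj_map T g = (\<lambda>(\<alpha>, xs). (\<alpha>, map2 (\<lambda>i. FO (g i)) (Src T \<alpha>) xs))"

definition mon_1 :: "('j, 't) opd \<Rightarrow> ('j \<Rightarrow> ('o, 'm) cat) \<Rightarrow> ('j \<Rightarrow> ('o, 'm, 'p, 'q) func)
    \<Rightarrow> 'j \<Rightarrow> (('t, 'o) mobj, ('t, 'o, 'm) marr, ('t, 'p) mobj, ('t, 'p, 'q) marr) func" where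
  "mon_1 T X g = (\<lambda>j\<in>Col T. \<lparr>
     FO = (\<lambda>x\<in>Obj (mon_ob T X j). mon_obj_map T g x),
     FA = (\<lambda>m\<in>Arr (mon_ob T X j). case m of (x, (\<rho>, \<gamma>s), y) \<Rightarrow>
       (mon_obj_map T g x, (\<rho>, map2 (\<lambda>i. FA (g i)) (Src T (fst x)) \<gamma>s), mon_obj_map T g y)) \<rparr>)"

text \<open>The action on a 2-cell \<open>\<phi> : g \<rightarrow> g'\<close> between 1-cells with domain \<open>X\<close>.\<close>

definition mon_2 :: "('j, 't) opd \<Rightarrow> ('j \<Rightarrow> ('o, 'm) cat)
    \<Rightarrow> ('j \<Rightarrow> ('o, 'm, 'p, 'q) func) \<Rightarrow> ('j \<Rightarrow> ('o, 'm, 'p, 'q) func)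
    \<Rightarrow> ('j \<Rightarrow> 'o \<Rightarrow> 'q) \<Rightarrow> 'j \<Rightarrow> ('t, 'o) mobj \<Rightarrow> ('t, 'p, 'q) marr" where
  "mon_2 T X g g' \<phi> = (\<lambda>j\<in>Col T. \<lambda>x\<in>Obj (mon_ob T X j).
     (mon_obj_map T g x, (id, map2 \<phi> (Src T (fst x)) (snd x)), mon_obj_map T g' x))"

definition mon_unit :: "('j, 't) opd \<Rightarrow> ('j \<Rightarrow> ('o, 'm) cat)
    \<Rightarrow> 'j \<Rightarrow> ('o, 'm, ('t, 'o) mobj, ('t, 'o, 'm) marr) func" where
  "mon_unit T X = (\<lambda>j\<in>Col T. \<lparr>
     FO = (\<lambda>x\<in>Obj (X j). (One T j, [x])),
     FA = (\<lambda>m\<in>Arr (X j).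
       ((One T j, [Dom (X j) m]), (id, [m]), (One T j, [Cod (X j) m]))) \<rparr>)"

definition mon_mult_obj ::
  "('j, 't) opd \<Rightarrow> ('t, ('t, 'o) mobj) mobj \<Rightarrow> ('t, 'o) mobj" where
  "mon_mult_obj T = (\<lambda>(\<alpha>, zs). (Sub T \<alpha> (map fst zs), concat (map snd zs)))"

definition mon_mult :: "('j, 't) opd \<Rightarrow> ('j \<Rightarrow> ('o, 'm) cat)
    \<Rightarrow> 'j \<Rightarrow> (('t, ('t, 'o) mobj) mobj, ('t, ('t, 'o) mobj, ('t, 'o, 'm) marr) marr,
              ('t, 'o) mobj, ('t, 'o, 'm) marr) func" where
  "mon_mult T X = (\<lambda>j\<in>Col T. \<lparr>
     FO = (\<lambda>z\<in>Obj (mon_ob T (mon_ob T X) j). mon_mult_obj T z),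
     FA = (\<lambda>m\<in>Arr (mon_ob T (mon_ob T X) j). case m of (z, (\<rho>, \<Gamma>s), w) \<Rightarrow>
       (mon_mult_obj T z,
        (block_map (map (\<lambda>x. arity T (fst x)) (snd z)) (map (\<lambda>x. arity T (fst x)) (snd w))
           \<rho> (\<lambda>k. fst (datum_of (\<Gamma>s ! k))),
         concat (map (\<lambda>\<Gamma>. snd (datum_of \<Gamma>)) \<Gamma>s)),
        mon_mult_obj T w)) \<rparr>)"


section \<open>Strict algebras, lax and strict morphisms\<close>

record ('j, 't, 'o, 'm) alg =
  Und :: "'j \<Rightarrow> ('o, 'm) cat"
  Str :: "'j \<Rightarrow> (('t, 'o) mobj, ('t, 'o, 'm) marr, 'o, 'm) func"

definition strict_algebra :: "('j, 't) opd \<Rightarrow> ('j, 't, 'o, 'm) alg \<Rightarrow> bool" where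
  "strict_algebra T A \<longleftrightarrow>
     (\<forall>j\<in>Col T. category (Und A j)) \<and>
     cell1 (Col T) (mon_ob T (Und A)) (Und A) (Str A) \<and>
     comp1 (Col T) (Und A) (Str A) (mon_unit T (Und A)) = id1 (Col T) (Und A) \<and>
     comp1 (Col T) (mon_ob T (mon_ob T (Und A))) (Str A) (mon_mult T (Und A)) =
     comp1 (Col T) (mon_ob T (mon_ob T (Und A))) (Str A) (mon_1 T (mon_ob T (Und A)) (Str A))"

text \<open>A lax morphism is a pair of a 1-cell \<open>g\<close> and a coherence 2-cell \<open>g\<^sub>c : b T(g) \<rightarrow> g a\<close>.\<close>

type_synonym ('j, 't, 'o, 'm, 'p, 'q) lax =
  "('j \<Rightarrow> ('o, 'm, 'p, 'q) func) \<times> ('j \<Rightarrow> ('t, 'o) mobj \<Rightarrow> 'q)"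

definition lax_dom :: "('j, 't) opd \<Rightarrow> ('j, 't, 'o, 'm) alg \<Rightarrow> ('j, 't, 'p, 'q) alg
    \<Rightarrow> ('j \<Rightarrow> ('o, 'm, 'p, 'q) func) \<Rightarrow> 'j \<Rightarrow> (('t, 'o) mobj, ('t, 'o, 'm) marr, 'p, 'q) func" where
  "lax_dom T A B g = comp1 (Col T) (mon_ob T (Und A)) (Str B) (mon_1 T (Und A) g)"

definition lax_cod :: "('j, 't) opd \<Rightarrow> ('j, 't, 'o, 'm) alg
    \<Rightarrow> ('j \<Rightarrow> ('o, 'm, 'p, 'q) func) \<Rightarrow> 'j \<Rightarrow> (('t, 'o) mobj, ('t, 'o, 'm) marr, 'p, 'q) func" where
  "lax_cod T A g = comp1 (Col T) (mon_ob T (Und A)) g (Str A)"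

definition lax_morphism :: "('j, 't) opd \<Rightarrow> ('j, 't, 'o, 'm) alg \<Rightarrow> ('j, 't, 'p, 'q) alg
    \<Rightarrow> ('j, 't, 'o, 'm, 'p, 'q) lax \<Rightarrow> bool" where
  "lax_morphism T A B = (\<lambda>(g, gc).
     cell1 (Col T) (Und A) (Und B) g \<and>
     cell2 (Col T) (mon_ob T (Und A)) (Und B) (lax_dom T A B g) (lax_cod T A g) gc \<and>
     rwhisker (Col T) (Und A) gc (mon_unit T (Und A)) = id2 (Col T) (Und A) (Und B) g \<and>
     rwhisker (Col T) (mon_ob T (mon_ob T (Und A))) gc (mon_mult T (Und A)) =
     vcomp (Col T) (mon_ob T (mon_ob T (Und A))) (Und B)
       (rwhisker (Col T) (mon_ob T (mon_ob T (Und A))) gc (mon_1 T (mon_ob T (Und A)) (Str A)))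
       (lwhisker (Col T) (mon_ob T (mon_ob T (Und A))) (Str B)
          (mon_2 T (mon_ob T (Und A)) (lax_dom T A B g) (lax_cod T A g) gc)))"

definition strict_morphism :: "('j, 't) opd \<Rightarrow> ('j, 't, 'o, 'm) alg \<Rightarrow> ('j, 't, 'p, 'q) alg
    \<Rightarrow> ('j, 't, 'o, 'm, 'p, 'q) lax \<Rightarrow> bool" where
  "strict_morphism T A B = (\<lambda>(g, gc).
     lax_morphism T A B (g, gc) \<and>
     lax_dom T A B g = lax_cod T A g \<and>
     gc = id2 (Col T) (mon_ob T (Und A)) (Und B) (lax_cod T A g))"

definition lax_2cell :: "('j, 't) opd \<Rightarrow> ('j, 't, 'o, 'm) alg \<Rightarrow> ('j, 't, 'p, 'q) alg
    \<Rightarrow> ('j, 't, 'o, 'm, 'p, 'q) lax \<Rightarrow> ('j, 't, 'o, 'm, 'p, 'q) lax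
    \<Rightarrow> ('j \<Rightarrow> 'o \<Rightarrow> 'q) \<Rightarrow> bool" where
  "lax_2cell T A B = (\<lambda>(g, gc) (g', gc') \<phi>.
     cell2 (Col T) (Und A) (Und B) g g' \<phi> \<and>
     vcomp (Col T) (mon_ob T (Und A)) (Und B) gc'
       (lwhisker (Col T) (mon_ob T (Und A)) (Str B) (mon_2 T (Und A) g g' \<phi>)) =
     vcomp (Col T) (mon_ob T (Und A)) (Und B)
       (rwhisker (Col T) (mon_ob T (Und A)) \<phi> (Str A)) gc)"

text \<open>The hom-categories of \<open>T-Alg\<^sub>l\<close> and \<open>T-Alg\<^sub>s\<close>.\<close>

type_synonym ('j, 't, 'o, 'm, 'p, 'q) lax_arr =
  "('j, 't, 'o, 'm, 'p, 'q) lax \<times> ('j \<Rightarrow> 'o \<Rightarrow> 'q) \<times> ('j, 't, 'o, 'm, 'p, 'q) lax"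

definition Alg_l :: "('j, 't) opd \<Rightarrow> ('j, 't, 'o, 'm) alg \<Rightarrow> ('j, 't, 'p, 'q) alg
    \<Rightarrow> (('j, 't, 'o, 'm, 'p, 'q) lax, ('j, 't, 'o, 'm, 'p, 'q) lax_arr) cat" where
  "Alg_l T A B = cat_of_homs
     {G. lax_morphism T A B G}
     (\<lambda>G G'. {\<phi>. lax_2cell T A B G G' \<phi>})
     (\<lambda>G. id2 (Col T) (Und A) (Und B) (fst G))
     (\<lambda>_ _ _ \<psi> \<phi>. vcomp (Col T) (Und A) (Und B) \<psi> \<phi>)"

definition Alg_s :: "('j, 't) opd \<Rightarrow> ('j, 't, 'o, 'm) alg \<Rightarrow> ('j, 't, 'p, 'q) alg
    \<Rightarrow> (('j, 't, 'o, 'm, 'p, 'q) lax, ('j, 't, 'o, 'm, 'p, 'q) lax_arr) cat" where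
  "Alg_s T A B = cat_of_homs
     {G. strict_morphism T A B G}
     (\<lambda>G G'. {\<phi>. lax_2cell T A B G G' \<phi>})
     (\<lambda>G. id2 (Col T) (Und A) (Und B) (fst G))
     (\<lambda>_ _ _ \<psi> \<phi>. vcomp (Col T) (Und A) (Und B) \<psi> \<phi>)"

text \<open>
  The composite of lax morphisms \<open>(g, g\<^sub>c) : A \<rightarrow> B\<close> and \<open>(h, h\<^sub>c) : B \<rightarrow> C\<close> has coherence 2-cell
  \<open>c T(h) T(g) \<rightarrow> h b T(g) \<rightarrow> h g a\<close>.
\<close>

definition lax_comp :: "('j, 't) opd \<Rightarrow> ('j, 't, 'o, 'm) alg \<Rightarrow> ('j, 't, 'r, 's) alg
    \<Rightarrow> ('j, 't, 'p, 'q, 'r, 's) lax \<Rightarrow> ('j, 't, 'o, 'm, 'p, 'q) lax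
    \<Rightarrow> ('j, 't, 'o, 'm, 'r, 's) lax" where
  "lax_comp T A C = (\<lambda>(h, hc) (g, gc).
     (comp1 (Col T) (Und A) h g,
      vcomp (Col T) (mon_ob T (Und A)) (Und C)
        (lwhisker (Col T) (mon_ob T (Und A)) h gc)
        (rwhisker (Col T) (mon_ob T (Und A)) hc (mon_1 T (Und A) g))))"

definition terminal_alg :: "('j, 't) opd \<Rightarrow> ('j, 't, unit, unit) alg" where
  "terminal_alg T = \<lparr> Und = (\<lambda>j. terminal_cat),
     Str = (\<lambda>j\<in>Col T. \<lparr> FO = (\<lambda>_. ()), FA = (\<lambda>_. ()) \<rparr>) \<rparr>"


section \<open>Change of operad\<close>

text \<open>The natural transformation \<open>F\<^sup>l : S F\<^sup>* \<rightarrow> F\<^sup>* T\<close> at \<open>Y\<close>.\<close>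

definition Fl :: "('i, 's) opd \<Rightarrow> ('i \<Rightarrow> 'j) \<Rightarrow> ('s \<Rightarrow> 't) \<Rightarrow> ('j \<Rightarrow> ('o, 'm) cat)
    \<Rightarrow> 'i \<Rightarrow> (('s, 'o) mobj, ('s, 'o, 'm) marr, ('t, 'o) mobj, ('t, 'o, 'm) marr) func" where
  "Fl S f F Y = (\<lambda>i\<in>Col S. \<lparr>
     FO = (\<lambda>(\<alpha>, ys)\<in>Obj (mon_ob S (pull (Col S) f Y) i). (F \<alpha>, ys)),
     FA = (\<lambda>((\<alpha>, xs), d, (\<beta>, ys))\<in>Arr (mon_ob S (pull (Col S) f Y) i).
             ((F \<alpha>, xs), d, (F \<beta>, ys))) \<rparr>)"

text \<open>The 2-functor from \<open>T\<close>-algebras to \<open>S\<close>-algebras, on objects, 1-cells and 2-cells.\<close>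

definition Fbar :: "('i, 's) opd \<Rightarrow> ('i \<Rightarrow> 'j) \<Rightarrow> ('s \<Rightarrow> 't)
    \<Rightarrow> ('j, 't, 'o, 'm) alg \<Rightarrow> ('i, 's, 'o, 'm) alg" where
  "Fbar S f F A = \<lparr>
     Und = pull (Col S) f (Und A),
     Str = comp1 (Col S) (mon_ob S (pull (Col S) f (Und A)))
             (pull (Col S) f (Str A)) (Fl S f F (Und A)) \<rparr>"

definition Fbar_1 :: "('i, 's) opd \<Rightarrow> ('i \<Rightarrow> 'j) \<Rightarrow> ('s \<Rightarrow> 't) \<Rightarrow> ('j, 't, 'o, 'm) alg
    \<Rightarrow> ('j, 't, 'o, 'm, 'p, 'q) lax \<Rightarrow> ('i, 's, 'o, 'm, 'p, 'q) lax" where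
  "Fbar_1 S f F A = (\<lambda>(g, gc).
     (pull (Col S) f g,
      rwhisker (Col S) (mon_ob S (pull (Col S) f (Und A)))
        (pull (Col S) f gc) (Fl S f F (Und A))))"

definition Fbar_2 :: "('i, 's) opd \<Rightarrow> ('i \<Rightarrow> 'j) \<Rightarrow> ('j \<Rightarrow> 'o \<Rightarrow> 'q) \<Rightarrow> 'i \<Rightarrow> 'o \<Rightarrow> 'q" where
  "Fbar_2 S f \<phi> = pull (Col S) f \<phi>"

text \<open>
  For a \<open>T\<close>-algebra \<open>A\<close> and a lax \<open>S\<close>-morphism \<open>U\<close> from \<open>1\<close> to the \<open>S\<close>-algebra of \<open>A\<close>, the functor
  of precomposition with \<open>U\<close>.
\<close>

definition precomp :: "('i, 's) opd \<Rightarrow> ('j, 't) opd \<Rightarrow> ('i \<Rightarrow> 'j) \<Rightarrow> ('s \<Rightarrow> 't)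
    \<Rightarrow> ('j, 't, 'o, 'm) alg \<Rightarrow> ('i, 's, unit, unit, 'o, 'm) lax \<Rightarrow> ('j, 't, 'p, 'q) alg
    \<Rightarrow> (('j, 't, 'o, 'm, 'p, 'q) lax, ('j, 't, 'o, 'm, 'p, 'q) lax_arr,
        ('i, 's, unit, unit, 'p, 'q) lax, ('i, 's, unit, unit, 'p, 'q) lax_arr) func" where
  "precomp S T f F A U B =
     (let P = (\<lambda>G. lax_comp S (terminal_alg S) (Fbar S f F B) (Fbar_1 S f F A G) U) in
      \<lparr> FO = (\<lambda>G\<in>Obj (Alg_s T A B). P G),
        FA = (\<lambda>(G, \<phi>, G')\<in>Arr (Alg_s T A B).
                (P G, rwhisker (Col S) (Und (terminal_alg S)) (Fbar_2 S f \<phi>) (fst U), P G')) \<rparr>)"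


section \<open>The bijective-monotone factorisation\<close>

text \<open>
  The factorisation \<open>h = \<phi>\<rho>\<close> of a function \<open>h\<close> on \<open>{..<m}\<close>.  The codomain may be any set of
  natural numbers, since the bijective part depends only on the order of the values of \<open>h\<close>.
\<close>

definition bm_factorisation :: "nat \<Rightarrow> (nat \<Rightarrow> nat) \<Rightarrow> (nat \<Rightarrow> nat) \<Rightarrow> (nat \<Rightarrow> nat) \<Rightarrow> bool" where
  "bm_factorisation m h \<phi> \<rho> \<longleftrightarrow>
     (\<forall>k<m. h k = \<phi> (\<rho> k)) \<and> mono_on {..<m} \<phi> \<and> \<rho> permutes {..<m} \<and>
     (\<forall>k<m. \<forall>l<m. k < l \<and> h k = h l \<longrightarrow> \<rho> k < \<rho> l)"

definition bij_part :: "nat \<Rightarrow> (nat \<Rightarrow> nat) \<Rightarrow> nat \<Rightarrow> nat" where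
  "bij_part m h = (THE \<rho>. \<exists>\<phi>. bm_factorisation m h \<phi> \<rho>)"

definition fibre :: "nat \<Rightarrow> (nat \<Rightarrow> nat) \<Rightarrow> nat \<Rightarrow> nat list" where
  "fibre n h k = filter (\<lambda>l. h l = k) [0..<n]"


section \<open>The category \<open>F \<down> j\<close>\<close>

type_synonym ('i, 't) dobj = "'i list \<times> 't"
type_synonym ('i, 's, 't) darr = "('i, 't) dobj \<times> ((nat \<Rightarrow> nat) \<times> 's list) \<times> ('i, 't) dobj"

definition down :: "('i, 's) opd \<Rightarrow> ('j, 't) opd \<Rightarrow> ('i \<Rightarrow> 'j) \<Rightarrow> ('s \<Rightarrow> 't) \<Rightarrow> 'j
    \<Rightarrow> (('i, 't) dobj, ('i, 's, 't) darr) cat" where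
  "down S T f F j = cat_of_homs
     {(is, \<alpha>). set is \<subseteq> Col S \<and> \<alpha> \<in> Ops T \<and> Src T \<alpha> = map f is \<and> Tgt T \<alpha> = j}
     (\<lambda>(is1, \<alpha>1) (is2, \<alpha>2). {(h, \<beta>s).
        h \<in> {..<length is1} \<rightarrow>\<^sub>E {..<length is2} \<and>
        length \<beta>s = length is2 \<and>
        (\<forall>k<length is2. \<beta>s ! k \<in> Ops S \<and>
           Src S (\<beta>s ! k) = map ((!) is1) (fibre (length is1) h k) \<and>
           Tgt S (\<beta>s ! k) = is2 ! k) \<and>
        Act T (Sub T \<alpha>2 (map F \<beta>s)) (bij_part (length is1) h) = \<alpha>1})
     (\<lambda>(is, \<alpha>). ((\<lambda>k\<in>{..<length is}. k), map (One S) is))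
     (\<lambda>(is1, _) (is2, _) (is3, _) (h2, \<beta>s2) (h1, \<beta>s1).
        (compose {..<length is1} h2 h1,
         map (\<lambda>k3.
           let L = fibre (length is1) (\<lambda>k. h2 (h1 k)) k3
           in Act S (Sub S (\<beta>s2 ! k3) (map ((!) \<beta>s1) (fibre (length is2) h2 k3)))
                (bij_part (length L) (\<lambda>p. h1 (L ! p))))
           [0..<length is3]))"


section \<open>The strict algebra \<open>F \<down> (-)\<close> and the lax morphism \<open>u\<^sub>F\<close>\<close>

definition down_op_obj :: "('j, 't) opd \<Rightarrow> 't \<Rightarrow> ('i, 't) dobj list \<Rightarrow> ('i, 't) dobj" where
  "down_op_obj T \<gamma> xs = (concat (map fst xs), Sub T \<gamma> (map snd xs))"

definition down_op_arr :: "('j, 't) opd \<Rightarrow> 't \<Rightarrow> ('i, 's, 't) darr list \<Rightarrow> ('i, 's, 't) darr" where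
  "down_op_arr T \<gamma> gs =
     (let ms = map (\<lambda>g. length (fst (dom_of g))) gs;
          ns = map (\<lambda>g. length (fst (cod_of g))) gs
      in (down_op_obj T \<gamma> (map dom_of gs),
          (restrict (block_map ms ns id (\<lambda>k. fst (datum_of (gs ! k)))) {..<sum_list ms},
           concat (map (\<lambda>g. snd (datum_of g)) gs)),
          down_op_obj T \<gamma> (map cod_of gs)))"

text \<open>The symmetry, from the value at \<open>\<gamma>\<rho>\<close> of the permuted objects to the value at \<open>\<gamma>\<close>.\<close>

definition down_sym :: "('i, 's) opd \<Rightarrow> ('j, 't) opd \<Rightarrow> 't \<Rightarrow> (nat \<Rightarrow> nat)
    \<Rightarrow> ('i, 't) dobj list \<Rightarrow> ('i, 's, 't) darr" where
  "down_sym S T \<gamma> \<rho> xs =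
     (let ns = map (\<lambda>x. length (fst x)) xs; ms = permute_list \<rho> ns
      in (down_op_obj T (Act T \<gamma> \<rho>) (permute_list \<rho> xs),
          (restrict (block_map ms ns \<rho> (\<lambda>_. id)) {..<sum_list ms},
           map (One S) (concat (map fst xs))),
          down_op_obj T \<gamma> xs))"

definition down_alg :: "('i, 's) opd \<Rightarrow> ('j, 't) opd \<Rightarrow> ('i \<Rightarrow> 'j) \<Rightarrow> ('s \<Rightarrow> 't)
    \<Rightarrow> ('j, 't, ('i, 't) dobj, ('i, 's, 't) darr) alg" where
  "down_alg S T f F = \<lparr>
     Und = down S T f F,
     Str = (\<lambda>j\<in>Col T. \<lparr>
       FO = (\<lambda>(\<gamma>, xs)\<in>Obj (mon_ob T (down S T f F) j). down_op_obj T \<gamma> xs),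
       FA = (\<lambda>(_, (\<rho>, gs), (\<gamma>, xs))\<in>Arr (mon_ob T (down S T f F) j).
               Cmp (down S T f F j)
                 (down_sym S T \<gamma> \<rho> xs) (down_op_arr T (Act T \<gamma> \<rho>) gs)) \<rparr>) \<rparr>"

definition u_lax :: "('i, 's) opd \<Rightarrow> ('j, 't) opd \<Rightarrow> ('i \<Rightarrow> 'j) \<Rightarrow> ('s \<Rightarrow> 't)
    \<Rightarrow> ('i, 's, unit, unit, ('i, 't) dobj, ('i, 's, 't) darr) lax" where
  "u_lax S T f F =
     ((\<lambda>i\<in>Col S. \<lparr>
         FO = (\<lambda>_. ([i], One T (f i))),
         FA = (\<lambda>_. Ide (down S T f F (f i)) ([i], One T (f i))) \<rparr>),
      (\<lambda>i\<in>Col S. \<lambda>(\<alpha>, _)\<in>Obj (mon_ob S (Und (terminal_alg S)) i).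
         ((Src S \<alpha>, F \<alpha>), (\<lambda>k\<in>{..<arity S \<alpha>}. 0, [\<alpha>]), ([i], One T (f i)))))"

end

theory Submission
  imports Defs
begin

text \<open>
  An operation whose inputs are labelled by a list of distinct labels can be permuted by
  prescribing the new list of labels.  Objects and arrows of \<open>TX\<close> and of \<open>F \<down> j\<close> are written with
  labelled inputs throughout, which turns the permutations occurring in the axioms of operads and
  in the bijective-monotone factorisation into equations between lists of labels.

  Every object \<open>((i\<^sub>k), \<alpha>)\<close> of \<open>F \<down> j\<close> is the value of \<open>\<alpha>\<close> at the objects \<open>(i\<^sub>k, 1)\<close>, and every
  arrow is a permutation of the inputs followed by the value of \<open>\<alpha>\<close> at the coherence arrows
  \<open>u\<^sub>F(\<beta>\<^sub>k)\<close> of the decorating operations.  Hence a strict morphism \<open>g\<close> and a 2-cell between strict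
  morphisms are determined by their restriction along \<open>u\<^sub>F\<close>.  Conversely, for a lax \<open>S\<close>-morphism
  from \<open>1\<close> with objects \<open>x\<^sub>i\<close> and coherence arrows \<open>c(\<beta>)\<close>, the same two-step formula in \<open>B\<close>
  defines the extension; compatibility of \<open>c\<close> with units, permutations and substitution makes it
  functorial and strict.
\<close>

section \<open>Labelled lists\<close>

text \<open>Why the two-step formula is functorial: composing two such arrows of \<open>B\<close>
  gives permutation, coherence, permutation, coherence. Naturality of the structure map exchanges
  the two middle factors, so that the permutations meet and the layers of coherence meet. The
  multiplication law of \<open>B\<close> arranges the two layers in blocks, and the substitution law
  of \<open>c\<close> makes each block one value of \<open>c\<close>. What remains is the reordering
  inside each decorating operation of a composite, which the permutation law of \<open>c\<close>
  absorbs. Labels have arbitrary type because the algebra structure concatenates: tagging labels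
  with the index of their block makes blocks disjoint, so that single functions on labels describe a
  whole family and its concatenation is again a labelling. The price is independence of the
  labelling, which comes down to the invariance of \<open>reord\<close> under injective renaming.
  Uniqueness rests on one case of the formula: the extension of \<open>u\<^sub>F\<close> along
  itself is the identity, and a strict \<open>g\<close> carries this factorisation of arrows to the
  extension of its own restriction.\<close>

definition pos :: "'l list \<Rightarrow> 'l \<Rightarrow> nat" where
  "pos L x = (LEAST p. L ! p = x)"

lemma nth_pos [simp]:
  assumes "x \<in> set L"
  shows "L ! pos L x = x"
  unfolding pos_def using assms by (auto simp: in_set_conv_nth intro: LeastI)

lemma pos_less [simp]:
  assumes "x \<in> set L"
  shows "pos L x < length L"
proof -
  obtain p where "p < length L" "L ! p = x"
    using assms by (auto simp: in_set_conv_nth)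
  then show ?thesis
    unfolding pos_def by (metis (mono_tags) Least_le le_less_trans)
qed

lemma pos_nth [simp]: "distinct L \<Longrightarrow> p < length L \<Longrightarrow> pos L (L ! p) = p"
  by (metis nth_eq_iff_index_eq nth_mem nth_pos pos_less)

lemma pos_eqI: "distinct L \<Longrightarrow> p < length L \<Longrightarrow> L ! p = x \<Longrightarrow> pos L x = p"
  by auto

lemma pos_inj: "x \<in> set L \<Longrightarrow> y \<in> set L \<Longrightarrow> pos L x = pos L y \<longleftrightarrow> x = y"
  by (metis nth_pos)

lemma pos_map:
  assumes "inj_on e (set L)" "distinct L" "x \<in> set L"
  shows "pos (map e L) (e x) = pos L x"
  by (rule pos_eqI) (use assms in \<open>auto simp: distinct_map\<close>)

lemma pos_upt [simp]: "k < n \<Longrightarrow> pos [0..<n] k = k"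
  by (rule pos_eqI) auto

definition reorders :: "'l list \<Rightarrow> 'l list \<Rightarrow> bool" where
  "reorders M N \<longleftrightarrow> distinct M \<and> distinct N \<and> set M = set N"

lemma reorders_length: "reorders M N \<Longrightarrow> length N = length M"
  by (metis distinct_card reorders_def)

lemma reorders_refl [simp]: "reorders M M \<longleftrightarrow> distinct M"
  by (simp add: reorders_def)

lemma reorders_sym: "reorders M N \<Longrightarrow> reorders N M"
  by (auto simp: reorders_def)

lemma reorders_trans: "reorders M N \<Longrightarrow> reorders N K \<Longrightarrow> reorders M K"
  by (auto simp: reorders_def)

text \<open>
  If the inputs of an operation are labelled by \<open>M\<close>, acting by \<open>reord M N\<close> lists them in the
  order \<open>N\<close>.  With labelled inputs, the identities between permutations in the axioms of an
  operad become identities between lists.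
\<close>

definition reord :: "'l list \<Rightarrow> 'l list \<Rightarrow> nat \<Rightarrow> nat" where
  "reord M N = (\<lambda>k. if k < length N then pos M (N ! k) else k)"

lemma nth_reord: "reorders M N \<Longrightarrow> k < length N \<Longrightarrow> M ! reord M N k = N ! k"
  by (simp add: reord_def reorders_def)

lemma reord_less: "reorders M N \<Longrightarrow> k < length N \<Longrightarrow> reord M N k < length M"
  by (simp add: reord_def reorders_def)

lemma reord_permutes:
  assumes "reorders M N"
  shows "reord M N permutes {..<length M}"
proof (rule bij_imp_permutes)
  have len: "length N = length M"
    by (rule reorders_length[OF assms])
  have "inj_on (reord M N) {..<length M}"
    by (rule inj_onI)
      (metis assms len lessThan_iff nth_eq_iff_index_eq nth_reord reorders_def)
  moreover have "reord M N ` {..<length M} \<subseteq> {..<length M}"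
    using assms len by (auto simp: reord_less)
  ultimately show "bij_betw (reord M N) {..<length M} {..<length M}"
    by (simp add: bij_betw_def endo_inj_surj)
  show "reord M N k = k" if "k \<notin> {..<length M}" for k
    using that len by (simp add: reord_def)
qed

lemma permute_list_reord:
  assumes "reorders M N"
  shows "permute_list (reord M N) (map g M) = map g N"
  by (rule nth_equalityI)
    (use assms reorders_length[OF assms] in \<open>auto simp: permute_list_def nth_reord reord_less\<close>)

text \<open>Every permutation of positions arises from relisting the labels in the order in which it
  fetches them. This is how an arbitrary arrow of \<open>TX\<close> acquires a labelled
  form.\<close>

lemma reord_unique:
  assumes "distinct M" "\<sigma> permutes {..<length M}"
  shows "reorders M (map (\<lambda>k. M ! \<sigma> k) [0..<length M])"
    and "reord M (map (\<lambda>k. M ! \<sigma> k) [0..<length M]) = \<sigma>"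
proof -
  let ?N = "map (\<lambda>k. M ! \<sigma> k) [0..<length M]"
  have lt: "\<sigma> k < length M" if "k < length M" for k
    using assms(2) that by (meson lessThan_iff permutes_in_image)
  have img: "\<sigma> ` {..<length M} = {..<length M}"
    by (rule permutes_image[OF assms(2)])
  have "distinct ?N"
    using assms(1) lt permutes_inj[OF assms(2)]
    by (simp add: distinct_map inj_on_def nth_eq_iff_index_eq)
  moreover have "set ?N = set M"
  proof -
    have "set ?N = (!) M ` \<sigma> ` {..<length M}" by (auto simp: image_image)
    also have "\<dots> = set M" unfolding img by (auto simp: set_conv_nth)
    finally show ?thesis .
  qed
  ultimately show "reorders M ?N"
    using assms by (simp add: reorders_def)
  show "reord M ?N = \<sigma>"
  proof
    fix k show "reord M ?N k = \<sigma> k"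
      using assms lt[of k] permutes_not_in[OF assms(2), of k]
      by (cases "k < length M") (simp_all add: reord_def)
  qed
qed

lemma reord_self [simp]: "distinct M \<Longrightarrow> reord M M = id"
  by (auto simp: reord_def fun_eq_iff)

lemma reord_comp:
  assumes "reorders M N" "reorders N K"
  shows "reord M N \<circ> reord N K = reord M K"
proof
  fix k
  show "(reord M N \<circ> reord N K) k = reord M K k"
  proof (cases "k < length K")
    case True
    then have "N ! reord N K k = K ! k" "reord N K k < length N"
      using assms(2) by (auto simp: nth_reord reord_less)
    then show ?thesis
      using True by (simp add: reord_def[of M])
  next
    case False
    then show ?thesis
      using assms by (simp add: reord_def reorders_length)
  qed
qed

text \<open>Only relative positions enter \<open>reord\<close>. All later statements that a
  construction does not depend on the chosen labels reduce to this one.\<close>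

lemma reord_map:
  assumes "inj_on e (set M)" "reorders M N"
  shows "reord (map e M) (map e N) = reord M N"
  using assms by (auto simp: reord_def fun_eq_iff pos_map reorders_def)

section \<open>Concatenated blocks and their block maps\<close>

lemma block_split:
  "p < sum_list ns \<Longrightarrow> block_split ns p = (k, l) \<Longrightarrow>
     k < length ns \<and> l < ns ! k \<and> block_pos ns k l = p"
proof (induction ns p arbitrary: k l rule: block_split.induct)
  case (2 n ns p)
  show ?case
  proof (cases "p < n")
    case True
    then show ?thesis using 2 by (auto simp: block_pos_def)
  next
    case False
    obtain k' l' where kl: "block_split ns (p - n) = (k', l')" by fastforce
    have "k' < length ns \<and> l' < ns ! k' \<and> block_pos ns k' l' = p - n"
      using 2 False kl by auto
    then have "k' < length ns" "l' < ns ! k'" "sum_list (take k' ns) + l' + n = p"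
      using False by (auto simp: block_pos_def)
    moreover have "k = Suc k'" "l = l'" using False kl 2(3) by auto
    ultimately show ?thesis by (simp add: block_pos_def)
  qed
qed simp

lemma concat_nth_block_pos:
  "k < length xss \<Longrightarrow> l < length (xss ! k) \<Longrightarrow>
     block_pos (map length xss) k l < length (concat xss) \<and>
     concat xss ! block_pos (map length xss) k l = xss ! k ! l"
proof (induction xss arbitrary: k)
  case (Cons xs xss)
  show ?case
  proof (cases k)
    case 0
    then show ?thesis using Cons by (simp add: block_pos_def nth_append)
  next
    case (Suc k')
    then have "block_pos (map length xss) k' l < length (concat xss) \<and>
        concat xss ! block_pos (map length xss) k' l = xss ! k' ! l"
      using Cons by auto
    then show ?thesis using Suc by (simp add: block_pos_def nth_append add.assoc)
  qed
qed simp

text \<open>If the labels of the concatenated target are distinct, a position there can be found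
  from its label, and the arithmetic of \<open>block_map\<close> disappears. The label map
  \<open>e\<close> serves two uses: the identity for permutations, an indexing function for ordinal
  sums.\<close>

lemma block_map_pos:
  assumes dist: "distinct (concat yss)"
    and h: "\<And>k l. k < length xss \<Longrightarrow> l < length (xss ! k) \<Longrightarrow>
      \<rho> k < length yss \<and> h k l < length (yss ! \<rho> k) \<and> yss ! \<rho> k ! h k l = e (xss ! k ! l)"
    and p: "p < length (concat xss)"
  shows "block_map (map length xss) (map length yss) \<rho> h p = pos (concat yss) (e (concat xss ! p))"
proof -
  obtain k l where kl: "block_split (map length xss) p = (k, l)" by fastforce
  have p': "p < sum_list (map length xss)"
    using p by (simp add: length_concat)
  have b: "k < length xss" "l < length (xss ! k)" "block_pos (map length xss) k l = p"
    using block_split[OF p' kl] by auto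
  have "concat xss ! p = xss ! k ! l"
    using concat_nth_block_pos[OF b(1,2)] b(3) by simp
  moreover have "pos (concat yss) (yss ! \<rho> k ! h k l) = block_pos (map length yss) (\<rho> k) (h k l)"
    using concat_nth_block_pos[of "\<rho> k" yss "h k l"] h[OF b(1,2)] by (intro pos_eqI dist) auto
  ultimately show ?thesis
    using h[OF b(1,2)] kl p' by (simp add: block_map_def)
qed

lemma distinct_concat_mapD:
  assumes "distinct (concat (map L M))" "m \<in> set M"
  shows "distinct (L m)"
  using assms by (auto simp: distinct_concat_iff)

lemma distinct_concat_map_eq:
  assumes "distinct (concat (map L M))" "distinct M" "m \<in> set M" "n \<in> set M"
    "l \<in> set (L m)" "l \<in> set (L n)"
  shows "m = n"
proof -
  obtain p q where pq: "p < length M" "M ! p = m" "q < length M" "M ! q = n"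
    using assms by (meson in_set_conv_nth)
  obtain u v where uv: "u < length (L m)" "L m ! u = l" "v < length (L n)" "L n ! v = l"
    using assms by (meson in_set_conv_nth)
  have "distinct (concat (map L M)) \<Longrightarrow> p < length M \<Longrightarrow> q < length M \<Longrightarrow>
      l \<in> set (L (M ! p)) \<Longrightarrow> l \<in> set (L (M ! q)) \<Longrightarrow> p = q" for p q
  proof (induction M arbitrary: p q)
    case (Cons x M)
    then show ?case
      by (cases p; cases q) (fastforce simp: in_set_conv_nth)+
  qed simp
  from this[OF assms(1), of p q] show ?thesis
    using pq assms by simp
qed

lemma distinct_concat_mapI:
  assumes "distinct M" "\<And>m. m \<in> set M \<Longrightarrow> distinct (L m)"
    "\<And>m n l. m \<in> set M \<Longrightarrow> n \<in> set M \<Longrightarrow> l \<in> set (L m) \<Longrightarrow> l \<in> set (L n) \<Longrightarrow> m = n"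
  shows "distinct (concat (map L M))"
  using assms
proof (induction M)
  case (Cons x M)
  then have "distinct (concat (map L M))" by simp
  then show ?case using Cons.prems by auto
qed simp

lemma reorders_concat:
  assumes "reorders M N" "distinct (concat (map L M))" "\<And>m. m \<in> set M \<Longrightarrow> reorders (L m) (K m)"
  shows "reorders (concat (map L M)) (concat (map K N))"
  unfolding reorders_def
proof (intro conjI)
  show "distinct (concat (map L M))" by fact
  have set: "set N = set M" "distinct M" "distinct N" using assms(1) by (auto simp: reorders_def)
  show "distinct (concat (map K N))"
  proof (rule distinct_concat_mapI)
    show "distinct N" by (rule set)
    show "distinct (K m)" if "m \<in> set N" for m
      using assms(3)[of m] that set by (simp add: reorders_def)
    show "m = n" if "m \<in> set N" "n \<in> set N" "l \<in> set (K m)" "l \<in> set (K n)" for m n l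
      using distinct_concat_map_eq[OF assms(2) set(2), of m n l] assms(3)[of m] assms(3)[of n] that set
      by (simp add: reorders_def)
  qed
  show "set (concat (map L M)) = set (concat (map K N))"
    using assms(3) set by (auto simp: reorders_def)
qed

text \<open>Common form of the block maps in both equivariance axioms, in the multiplication of the
  2-monad and in the symmetries of \<open>F \<down> (-)\<close>: each is a change of order of one
  concatenated list. Agreement of \<open>\<rho>\<close> and \<open>h\<close> with
  \<open>reord\<close> is asked only at valid indices, since the instances supply them as list
  entries or as \<open>id\<close>.\<close>

lemma block_map_reord:
  assumes MN: "reorders M N" and dist: "distinct (concat (map L M))"
    and LK: "\<And>m. m \<in> set M \<Longrightarrow> reorders (L m) (K m)"
    and ms: "ms = map (\<lambda>m. length (K m)) N" and ns: "ns = map (\<lambda>m. length (L m)) M"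
    and \<rho>: "\<And>k. k < length N \<Longrightarrow> \<rho> k = reord M N k"
    and h: "\<And>k. k < length N \<Longrightarrow> h k = reord (L (N ! k)) (K (N ! k))"
  shows "block_map ms ns \<rho> h = reord (concat (map L M)) (concat (map K N))"
proof
  fix p
  let ?x = "map K N" and ?y = "map L M"
  have ms': "ms = map length ?x" "ns = map length ?y" by (simp_all add: ms ns)
  show "block_map ms ns \<rho> h p = reord (concat ?y) (concat ?x) p"
  proof (cases "p < length (concat ?x)")
    case True
    have "block_map (map length ?x) (map length ?y) \<rho> h p = pos (concat ?y) (id (concat ?x ! p))"
    proof (rule block_map_pos[OF dist _ True])
      fix k l assume k: "k < length ?x" and l: "l < length (?x ! k)"
      have "N ! k \<in> set M" using k MN by (auto simp: reorders_def)
      then have r: "reorders (L (N ! k)) (K (N ! k))" by (rule LK)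
      show "\<rho> k < length ?y \<and> h k l < length (?y ! \<rho> k) \<and> ?y ! \<rho> k ! h k l = id (?x ! k ! l)"
        using k l r MN by (simp add: \<rho> h nth_reord reord_less)
    qed
    then show ?thesis using True by (simp add: ms' reord_def)
  next
    case False
    then show ?thesis by (simp add: block_map_def reord_def length_concat ms')
  qed
qed

section \<open>Fibres and the bijective part of a function\<close>

definition fib :: "'l list \<Rightarrow> ('l \<Rightarrow> 'k) \<Rightarrow> 'k \<Rightarrow> 'l list" where
  "fib L h k = filter (\<lambda>l. h l = k) L"

text \<open>With \<open>V\<close> the ordered codomain of \<open>h\<close>, this lists the domain so
  that \<open>h\<close> becomes monotone along the list, keeping the order of \<open>L\<close>
  inside fibres. Passing from this list to \<open>L\<close> is the bijective part of
  \<open>h\<close>.\<close>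

definition cfib :: "'l list \<Rightarrow> ('l \<Rightarrow> 'k) \<Rightarrow> 'k list \<Rightarrow> 'l list" where
  "cfib L h V = concat (map (fib L h) V)"

lemma fibre_eq_fib: "fibre n h k = fib [0..<n] h k"
  by (simp add: fibre_def fib_def)

lemma set_fib [simp]: "set (fib L h k) = {l \<in> set L. h l = k}"
  by (auto simp: fib_def)

lemma distinct_fib [simp]: "distinct L \<Longrightarrow> distinct (fib L h k)"
  by (simp add: fib_def)

lemma set_cfib [simp]: "set (cfib L h V) = {l \<in> set L. h l \<in> set V}"
  by (auto simp: cfib_def)

lemma distinct_cfib [simp]: "distinct L \<Longrightarrow> distinct V \<Longrightarrow> distinct (cfib L h V)"
  unfolding cfib_def by (rule distinct_concat_mapI) auto

lemma fib_map: "fib (map e L) h k = map e (fib L (h \<circ> e) k)"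
  by (simp add: fib_def filter_map comp_def)

lemma fib_cong: "(\<And>l. l \<in> set L \<Longrightarrow> (h l = k) = (h' l = k')) \<Longrightarrow> fib L h k = fib L h' k'"
  by (auto simp: fib_def intro: filter_cong)

lemma fib_fib: "(\<And>l. l \<in> set L \<Longrightarrow> h l = k \<Longrightarrow> h' l = k') \<Longrightarrow> fib (fib L h' k') h k = fib L h k"
  by (auto simp: fib_def intro: filter_cong)

lemma fib_id: "distinct L \<Longrightarrow> fib L (\<lambda>l. l) k = (if k \<in> set L then [k] else [])"
  by (induction L) (auto simp: fib_def filter_empty_conv)

lemma cfib_id: "distinct L \<Longrightarrow> set V \<subseteq> set L \<Longrightarrow> cfib L (\<lambda>l. l) V = V"
  by (induction V) (auto simp: cfib_def fib_id)

lemma reorders_cfib: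
  "distinct L \<Longrightarrow> distinct V \<Longrightarrow> (\<And>l. l \<in> set L \<Longrightarrow> h l \<in> set V) \<Longrightarrow> reorders (cfib L h V) L"
  by (auto simp: reorders_def)

lemma reorders_cfib_fib:
  "distinct L1 \<Longrightarrow> distinct L2 \<Longrightarrow> (\<And>l. l \<in> set L1 \<Longrightarrow> h1 l \<in> set L2) \<Longrightarrow>
    reorders (cfib L1 h1 (fib L2 h2 k)) (fib L1 (\<lambda>l. h2 (h1 l)) k)"
  by (auto simp: reorders_def)

lemma cfib_concat: "cfib L h (concat (map U V)) = concat (map (\<lambda>k. cfib L h (U k)) V)"
  by (induction V) (auto simp: cfib_def)

lemma cfib_cfib: "cfib L1 h1 (cfib L2 h2 V) = concat (map (\<lambda>k. cfib L1 h1 (fib L2 h2 k)) V)"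
  by (simp add: cfib_def[of L2] cfib_concat)

lemma fib_concat_map:
  assumes "distinct M" "m \<in> set M"
    "\<And>m' l. m' \<in> set M \<Longrightarrow> l \<in> set (L m') \<Longrightarrow> h l = k \<Longrightarrow> m' = m"
  shows "fib (concat (map L M)) h k = fib (L m) h k"
proof -
  obtain A B where M: "M = A @ m # B" using assms(2) by (meson split_list)
  have "h l \<noteq> k" if "m' \<in> set A \<union> set B" "l \<in> set (L m')" for m' l
    using assms(3)[of m' l] that assms(1) M by auto
  then have "filter (\<lambda>l. h l = k) (concat (map L A)) = []" "filter (\<lambda>l. h l = k) (concat (map L B)) = []"
    by (auto simp: filter_empty_conv)
  then show ?thesis by (simp add: M fib_def)
qed

text \<open>Grouping follows the order of the target, so the source blocks may come in any order
  \<open>N\<close>; since \<open>h\<close> respects blocks and the target blocks are disjoint, a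
  fibre meets only one source block.\<close>

lemma cfib_concat_map:
  assumes "distinct N" "set N = set M"
    "\<And>m l. m \<in> set M \<Longrightarrow> l \<in> set (L1 m) \<Longrightarrow> h l \<in> set (L2 m)"
    "distinct (concat (map L2 M))" "distinct M"
  shows "cfib (concat (map L1 N)) h (concat (map L2 M)) = concat (map (\<lambda>m. cfib (L1 m) h (L2 m)) M)"
proof -
  have "fib (concat (map L1 N)) h k = fib (L1 m) h k" if "m \<in> set M" "k \<in> set (L2 m)" for m k
    using fib_concat_map[of N m L1 h k] distinct_concat_map_eq[OF assms(4,5)] assms that by metis
  then have "cfib (concat (map L1 N)) h (L2 m) = cfib (L1 m) h (L2 m)" if "m \<in> set M" for m
    using that by (auto simp: cfib_def intro!: arg_cong[of _ _ concat])
  then show ?thesis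
    unfolding cfib_concat by (auto intro!: arg_cong[of _ _ concat])
qed

text \<open>Monotonicity of \<open>\<phi>\<close> decides the order of elements with different
  values, the fibre condition that of elements with equal values. So \<open>\<rho>\<close> sorts the
  domain lexicographically, by value and then by position.\<close>

lemma bm_factorisation_less:
  assumes bm: "bm_factorisation m h \<phi> \<rho>" and k: "k < m" and l: "l < m"
  shows "\<rho> k < \<rho> l \<longleftrightarrow> h k < h l \<or> h k = h l \<and> k < l"
proof -
  have perm: "\<rho> permutes {..<m}" and mono: "mono_on {..<m} \<phi>"
    and \<phi>: "\<And>k. k < m \<Longrightarrow> h k = \<phi> (\<rho> k)"
    and fib: "\<And>k l. k < m \<Longrightarrow> l < m \<Longrightarrow> k < l \<Longrightarrow> h k = h l \<Longrightarrow> \<rho> k < \<rho> l"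
    using bm by (auto simp: bm_factorisation_def)
  have lt: "\<rho> k < m" if "k < m" for k
    using perm that by (meson lessThan_iff permutes_in_image)
  have *: "h k \<le> h l" if "k < m" "l < m" "\<rho> k \<le> \<rho> l" for k l
    using mono_onD[OF mono, of "\<rho> k" "\<rho> l"] that lt by (simp add: \<phi>)
  show ?thesis
    using *[OF k l] *[OF l k] fib[OF k l] fib[OF l k]
    by (metis k l less_irrefl_nat less_le_not_le linorder_le_cases nat_neq_iff order.order_iff_strict)
qed

text \<open>A permutation is determined by the order it induces, because \<open>\<rho> k\<close>
  counts the elements placed before \<open>k\<close>. That order is the lexicographic one and
  depends on \<open>h\<close> alone.\<close>

lemma bm_factorisation_unique:
  assumes "bm_factorisation m h \<phi> \<rho>" "bm_factorisation m h \<phi>' \<sigma>"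
  shows "\<rho> = \<sigma>"
proof
  have card: "card {l. l < m \<and> \<rho> l < \<rho> k} = \<rho> k"
    if "bm_factorisation m h \<phi> \<rho>" "k < m" for \<rho> \<phi> k
  proof -
    have perm: "\<rho> permutes {..<m}" using that by (simp add: bm_factorisation_def)
    have "\<rho> k < m" using perm that(2) by (meson lessThan_iff permutes_in_image)
    have "{..<\<rho> k} \<subseteq> \<rho> ` {l. l < m \<and> \<rho> l < \<rho> k}"
    proof
      fix q assume "q \<in> {..<\<rho> k}"
      then have "q < m" "q < \<rho> k" using \<open>\<rho> k < m\<close> by auto
      then show "q \<in> \<rho> ` {l. l < m \<and> \<rho> l < \<rho> k}"
        using permutes_image[OF perm] by (metis (mono_tags, lifting) imageE image_eqI lessThan_iff mem_Collect_eq)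
    qed
    then have "\<rho> ` {l. l < m \<and> \<rho> l < \<rho> k} = {..<\<rho> k}" by auto
    then show ?thesis
      using card_image[of \<rho> "{l. l < m \<and> \<rho> l < \<rho> k}"] permutes_inj_on[OF perm] by simp
  qed
  fix k
  show "\<rho> k = \<sigma> k"
  proof (cases "k < m")
    case True
    have "{l. l < m \<and> \<rho> l < \<rho> k} = {l. l < m \<and> \<sigma> l < \<sigma> k}"
      using bm_factorisation_less[OF assms(1) _ True] bm_factorisation_less[OF assms(2) _ True] by auto
    then show ?thesis
      using card[OF assms(1) True] card[OF assms(2) True] by simp
  next
    case False
    then show ?thesis using assms by (auto simp: bm_factorisation_def permutes_def)
  qed
qed

lemma sorted_wrt_cfib:
  "sorted V \<Longrightarrow> distinct V \<Longrightarrow>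
    sorted_wrt (\<lambda>k l :: nat. h k < h l \<or> h k = h l \<and> k < l) (cfib [0..<m] h V)"
proof (induction V)
  case (Cons v V)
  have "sorted_wrt (<) (fib [0..<m] h v)"
    unfolding fib_def by (rule sorted_wrt_filter) simp
  then have "sorted_wrt (\<lambda>k l. h k < h l \<or> h k = h l \<and> k < l) (fib [0..<m] h v)"
    by (rule sorted_wrt_mono_rel[rotated]) auto
  then show ?case
    using Cons by (fastforce simp: cfib_def sorted_wrt_append)
qed (simp add: cfib_def)

text \<open>Listing fibres along an increasing \<open>V\<close> puts the domain in lexicographic
  order, so the change back to the natural order is a bijective part; uniqueness then evaluates the
  description operator. \<open>V\<close> is any increasing list containing the values, because
  composition in \<open>F \<down> j\<close> restricts codomains to fibres.\<close>

lemma bij_part_eq: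
  assumes V: "sorted V" "distinct V" and h: "\<And>k. k < m \<Longrightarrow> h k \<in> set V"
  shows "bij_part m h = reord (cfib [0..<m] h V) [0..<m]"
proof -
  let ?C = "cfib [0..<m] h V" and ?R = "\<lambda>k l. h k < h l \<or> h k = h l \<and> k < l"
  \<comment> \<open>The monotone part will be the function that reads off the value of
    \<open>h\<close> at a position of \<open>?C\<close>.\<close>
  have re: "reorders ?C [0..<m]"
    by (rule reorders_cfib) (use V h in auto)
  then have len: "length ?C = m" using reorders_length by fastforce
  have sw: "sorted_wrt ?R ?C" by (rule sorted_wrt_cfib[OF V])
  have "mono_on {..<m} (\<lambda>p. h (?C ! p))"
  proof (rule mono_onI)
    fix p q assume "p \<in> {..<m}" "q \<in> {..<m}" "p \<le> q"
    then show "h (?C ! p) \<le> h (?C ! q)"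
      using sorted_wrt_nth_less[OF sw, of p q] len by (cases "p = q") auto
  qed
  moreover have "reord ?C [0..<m] k < reord ?C [0..<m] l"
    if "k < m" "l < m" "k < l" "h k = h l" for k l
  proof (rule ccontr)
    assume "\<not> ?thesis"
    moreover have "k \<in> set ?C" "l \<in> set ?C" using that h by auto
    ultimately have "pos ?C l < pos ?C k"
      using that pos_inj[of k ?C l] by (simp add: reord_def)
    then have "?R (?C ! pos ?C l) (?C ! pos ?C k)"
      by (rule sorted_wrt_nth_less[OF sw]) (use \<open>k \<in> set ?C\<close> in simp)
    then show False using that \<open>k \<in> set ?C\<close> \<open>l \<in> set ?C\<close> by simp
  qed
  moreover have "h k = h (?C ! reord ?C [0..<m] k)" if "k < m" for k
    using nth_reord[OF re, of k] that by simp
  ultimately have bm: "bm_factorisation m h (\<lambda>p. h (?C ! p)) (reord ?C [0..<m])"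
    using reord_permutes[OF re] len by (simp add: bm_factorisation_def)
  show ?thesis
    unfolding bij_part_def
    by (rule the_equality) (use bm bm_factorisation_unique[OF _ bm] in blast)+
qed

lemma bij_part_cong: "(\<And>k. k < m \<Longrightarrow> h k = h' k) \<Longrightarrow> bij_part m h = bij_part m h'"
proof -
  assume "\<And>k. k < m \<Longrightarrow> h k = h' k"
  then have "bm_factorisation m h = bm_factorisation m h'"
    by (auto simp: bm_factorisation_def fun_eq_iff)
  then show ?thesis by (simp add: bij_part_def)
qed

lemma map_nth_fib: "map ((!) L) (fib [0..<length L] (\<lambda>p. h (L ! p)) k) = fib L h k"
  using fib_map[of "(!) L" "[0..<length L]" h k] by (simp add: map_nth comp_def)

lemma map_nth_cfib: "map ((!) L) (cfib [0..<length L] (\<lambda>p. h (L ! p)) V) = cfib L h V"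
  by (simp add: cfib_def map_concat comp_def map_nth_fib)

text \<open>Positions in a distinct list may be renamed to the labels found there without affecting
  \<open>reord\<close>.\<close>

lemma bij_part_list:
  assumes "distinct L" "sorted V" "distinct V" "\<And>l. l \<in> set L \<Longrightarrow> h l \<in> set V"
  shows "bij_part (length L) (\<lambda>p. h (L ! p)) = reord (cfib L h V) L"
proof -
  let ?C = "cfib [0..<length L] (\<lambda>p. h (L ! p)) V"
  have "bij_part (length L) (\<lambda>p. h (L ! p)) = reord ?C [0..<length L]"
    by (rule bij_part_eq) (use assms in auto)
  also have "\<dots> = reord (map ((!) L) ?C) (map ((!) L) [0..<length L])"
    by (rule reord_map[symmetric])
      (use assms in \<open>auto simp: inj_on_def nth_eq_iff_index_eq intro!: reorders_cfib\<close>)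
  finally show ?thesis unfolding map_nth_cfib[of L h V] map_nth .
qed

lemma fib_pos:
  assumes "distinct L2" "q < length L2" "\<And>l. l \<in> set L1 \<Longrightarrow> h l \<in> set L2"
  shows "fib L1 (\<lambda>l. pos L2 (h l)) q = fib L1 h (L2 ! q)"
  by (rule fib_cong) (metis assms nth_pos pos_nth)

lemma cfib_pos:
  assumes "distinct L2" "\<And>l. l \<in> set L1 \<Longrightarrow> h l \<in> set L2"
  shows "cfib L1 (\<lambda>l. pos L2 (h l)) [0..<length L2] = cfib L1 h L2"
proof -
  have "map (fib L1 (\<lambda>l. pos L2 (h l))) [0..<length L2] = map (\<lambda>q. fib L1 h (L2 ! q)) [0..<length L2]"
    by (intro map_cong refl fib_pos assms) simp_all
  also have "\<dots> = map (fib L1 h) (map ((!) L2) [0..<length L2])" by (simp add: comp_def)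
  also have "\<dots> = map (fib L1 h) L2" by (simp only: map_nth)
  finally show ?thesis by (simp add: cfib_def)
qed

text \<open>The labels of \<open>L2\<close> carry no order of their own; they are compared through
  their positions, and grouping by position along \<open>[0..<length L2]\<close> is grouping by
  label along \<open>L2\<close>.\<close>

lemma bij_part_pos:
  assumes "distinct L1" "distinct L2" "\<And>l. l \<in> set L1 \<Longrightarrow> h l \<in> set L2"
    "\<And>p. p < length L1 \<Longrightarrow> hh p = pos L2 (h (L1 ! p))"
  shows "bij_part (length L1) hh = reord (cfib L1 h L2) L1"
proof -
  have "bij_part (length L1) hh = bij_part (length L1) (\<lambda>p. pos L2 (h (L1 ! p)))"
    by (rule bij_part_cong) (rule assms(4))
  also have "\<dots> = reord (cfib L1 (\<lambda>l. pos L2 (h l)) [0..<length L2]) L1"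
    by (rule bij_part_list) (use assms in auto)
  finally show ?thesis by (simp only: cfib_pos[where h = h, OF assms(2,3)])
qed

section \<open>Operations with labelled inputs\<close>

definition relab :: "('j, 't) opd \<Rightarrow> 't \<Rightarrow> 'l list \<Rightarrow> 'l list \<Rightarrow> 't" where
  "relab T \<alpha> M N = Act T \<alpha> (reord M N)"

definition typed :: "('j, 't) opd \<Rightarrow> 't \<Rightarrow> ('l \<Rightarrow> 'j) \<Rightarrow> 'l list \<Rightarrow> 'j \<Rightarrow> bool" where
  "typed T \<alpha> g M j \<longleftrightarrow> \<alpha> \<in> Ops T \<and> Src T \<alpha> = map g M \<and> Tgt T \<alpha> = j"

lemma relab_map: "inj_on e (set M) \<Longrightarrow> reorders M N \<Longrightarrow> relab T \<alpha> (map e M) (map e N) = relab T \<alpha> M N"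
  by (simp add: relab_def reord_map)

lemma typed_arity: "typed T \<alpha> g M j \<Longrightarrow> arity T \<alpha> = length M"
  by (simp add: typed_def arity_def)

lemma typed_map: "typed T \<alpha> g (map e M) j = typed T \<alpha> (\<lambda>l. g (e l)) M j"
  by (simp add: typed_def comp_def)

lemma typed_nth: "\<alpha> \<in> Ops T \<Longrightarrow> typed T \<alpha> ((!) (Src T \<alpha>)) [0..<arity T \<alpha>] (Tgt T \<alpha>)"
  by (simp add: typed_def arity_def map_nth)

lemma map2_map_map: "map2 f (map a M) (map b M) = map (\<lambda>l. f (a l) (b l)) M"
  by (induction M) auto

lemma list_all2_map_map: "list_all2 P (map a M) (map b M) = (\<forall>l\<in>set M. P (a l) (b l))"
  by (induction M) auto

text \<open>The decorating operation at \<open>k\<close> of a composite in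
  \<open>F \<down> j\<close>. Substitution delivers the inputs grouped by their image in
  \<open>L2\<close>; the outer \<open>relab\<close> restores the order of \<open>L1\<close> inside
  the fibre over \<open>k\<close>.\<close>

definition dcmp :: "('i, 's) opd \<Rightarrow> 'l list \<Rightarrow> 'm list \<Rightarrow> ('l \<Rightarrow> 'm) \<Rightarrow> ('m \<Rightarrow> 'n)
    \<Rightarrow> ('n \<Rightarrow> 's) \<Rightarrow> ('m \<Rightarrow> 's) \<Rightarrow> 'n \<Rightarrow> 's" where
  "dcmp S L1 L2 h1 h2 b2 b1 k = relab S (Sub S (b2 k) (map b1 (fib L2 h2 k)))
     (cfib L1 h1 (fib L2 h2 k)) (fib L1 (\<lambda>l. h2 (h1 l)) k)"

context operad
begin

lemma typed_relab:
  assumes "typed T \<alpha> g M j" "reorders M N"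
  shows "typed T (relab T \<alpha> M N) g N j"
proof -
  have "reord M N permutes {..<arity T \<alpha>}"
    using reord_permutes[OF assms(2)] typed_arity[OF assms(1)] by simp
  then show ?thesis
    using assms act_ops act_src act_tgt permute_list_reord[OF assms(2), of g]
    by (simp add: relab_def typed_def)
qed

lemma relab_self:
  "typed T \<alpha> g M j \<Longrightarrow> distinct M \<Longrightarrow> relab T \<alpha> M M = \<alpha>"
  by (simp add: relab_def act_id typed_def)

lemma relab_relab:
  assumes "typed T \<alpha> g M j" "reorders M N" "reorders N K"
  shows "relab T (relab T \<alpha> M N) N K = relab T \<alpha> M K"
proof -
  have "reord M N permutes {..<arity T \<alpha>}" "reord N K permutes {..<arity T \<alpha>}"
    using reord_permutes assms reorders_length[OF assms(2)] typed_arity[OF assms(1)] by metis+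
  then show ?thesis
    using assms by (simp add: relab_def act_act reord_comp typed_def)
qed

lemma typed_one: "j \<in> Col T \<Longrightarrow> g m = j \<Longrightarrow> typed T (One T j) g [m] j"
  by (simp add: typed_def one_ops one_src one_tgt)

lemma typed_col: "typed T \<alpha> g M j \<Longrightarrow> m \<in> set M \<Longrightarrow> g m \<in> Col T"
  using src_col[of \<alpha>] by (auto simp: typed_def)

lemma typed_composable:
  "typed T \<alpha> g M j \<Longrightarrow> (\<And>m. m \<in> set M \<Longrightarrow> typed T (\<beta> m) g' (L m) (g m)) \<Longrightarrow>
    composable T \<alpha> (map \<beta> M)"
  by (auto simp: composable_def typed_def)

lemma typed_sub:
  assumes "typed T \<alpha> g M j" "\<And>m. m \<in> set M \<Longrightarrow> typed T (\<beta> m) g' (L m) (g m)"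
  shows "typed T (Sub T \<alpha> (map \<beta> M)) g' (concat (map L M)) j"
proof -
  have "composable T \<alpha> (map \<beta> M)" by (rule typed_composable[OF assms])
  moreover have "map (Src T) (map \<beta> M) = map (map g') (map L M)"
    using assms(2) by (auto simp: typed_def)
  ultimately have "Src T (Sub T \<alpha> (map \<beta> M)) = map g' (concat (map L M))"
    by (simp only: sub_src map_concat)
  then show ?thesis
    using assms(1) \<open>composable T \<alpha> (map \<beta> M)\<close> by (simp add: typed_def sub_ops sub_tgt)
qed

text \<open>The outer equivariance axiom with its block permutation read on labels: permuting the
  inputs of \<open>\<alpha>\<close> permutes whole blocks. Disjointness of the blocks is what makes
  their concatenation a labelling.\<close>

lemma sub_outer:
  assumes \<alpha>: "typed T \<alpha> g M j" and \<beta>: "\<And>m. m \<in> set M \<Longrightarrow> typed T (\<beta> m) g' (L m) (g m)"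
    and MN: "reorders M N" and dist: "distinct (concat (map L M))"
  shows "Sub T (relab T \<alpha> M N) (map \<beta> N) =
    relab T (Sub T \<alpha> (map \<beta> M)) (concat (map L M)) (concat (map L N))"
proof -
  have perm: "reord M N permutes {..<arity T \<alpha>}"
    using reord_permutes[OF MN] typed_arity[OF \<alpha>] by simp
  have N: "permute_list (reord M N) (map \<beta> M) = map \<beta> N"
    by (rule permute_list_reord[OF MN])
  have ar: "map (arity T) (map \<beta> N) = map (\<lambda>m. length (L m)) N"
    "map (arity T) (map \<beta> M) = map (\<lambda>m. length (L m)) M"
    using MN by (auto simp: typed_arity[OF \<beta>] reorders_def)
  have "block_map (map (arity T) (map \<beta> N)) (map (arity T) (map \<beta> M)) (reord M N) (\<lambda>_. id) =
      reord (concat (map L M)) (concat (map L N))"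
    by (rule block_map_reord[OF MN dist _ ar])
      (use distinct_concat_mapD[OF dist] MN in \<open>auto simp: reorders_def\<close>)
  then show ?thesis
    using sub_act_outer[OF typed_composable[OF \<alpha> \<beta>] perm] by (simp add: relab_def N)
qed

text \<open>The inner equivariance axiom in the same form: the blocks stay in place and each is
  relisted internally.\<close>

lemma sub_inner:
  assumes \<alpha>: "typed T \<alpha> g M j" and \<beta>: "\<And>m. m \<in> set M \<Longrightarrow> typed T (\<beta> m) g' (L m) (g m)"
    and M: "distinct M" and LK: "\<And>m. m \<in> set M \<Longrightarrow> reorders (L m) (K m)"
    and dist: "distinct (concat (map L M))"
  shows "Sub T \<alpha> (map (\<lambda>m. relab T (\<beta> m) (L m) (K m)) M) =
    relab T (Sub T \<alpha> (map \<beta> M)) (concat (map L M)) (concat (map K M))"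
proof -
  let ?\<sigma> = "map (\<lambda>m. reord (L m) (K m)) M"
  have ar: "map (arity T) (map \<beta> M) = map (\<lambda>m. length (K m)) M"
    "map (arity T) (map \<beta> M) = map (\<lambda>m. length (L m)) M"
    by (auto simp: typed_arity[OF \<beta>] reorders_length[OF LK])
  have perm: "list_all2 (\<lambda>\<beta> \<sigma>. \<sigma> permutes {..<arity T \<beta>}) (map \<beta> M) ?\<sigma>"
    by (auto simp: list_all2_map_map typed_arity[OF \<beta>] intro: reord_permutes LK)
  note sub_act_inner[OF typed_composable[OF \<alpha> \<beta>] perm]
  moreover have "block_map (map (arity T) (map \<beta> M)) (map (arity T) (map \<beta> M)) id (\<lambda>k. ?\<sigma> ! k) =
      reord (concat (map L M)) (concat (map K M))"
    by (rule block_map_reord[OF _ dist LK ar]) (use M in auto)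
  ultimately show ?thesis
    by (simp add: relab_def map2_map_map)
qed

lemma sub_sub:
  assumes \<alpha>: "typed T \<alpha> g M j" and \<beta>: "\<And>m. m \<in> set M \<Longrightarrow> typed T (\<beta> m) g' (L m) (g m)"
    and \<gamma>: "\<And>m l. m \<in> set M \<Longrightarrow> l \<in> set (L m) \<Longrightarrow> typed T (\<gamma> l) g'' (K l) (g' l)"
  shows "Sub T (Sub T \<alpha> (map \<beta> M)) (map \<gamma> (concat (map L M))) =
    Sub T \<alpha> (map (\<lambda>m. Sub T (\<beta> m) (map \<gamma> (L m))) M)"
proof -
  have "composable T (\<beta> m) (map \<gamma> (L m))" if "m \<in> set M" for m
    by (rule typed_composable[OF \<beta>[OF that] \<gamma>[OF that]])
  then have comp: "list_all2 (composable T) (map \<beta> M) (map (\<lambda>m. map \<gamma> (L m)) M)"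
    by (simp add: list_all2_map_map)
  from sub_assoc[OF typed_composable[OF \<alpha> \<beta>] comp] show ?thesis
    by (simp add: map2_map_map map_concat comp_def)
qed

lemma sub_one_l: "typed T \<alpha> g M j \<Longrightarrow> Sub T (One T j) [\<alpha>] = \<alpha>"
  using sub_one_left by (auto simp: typed_def)

lemma sub_one_r: "typed T \<alpha> g M j \<Longrightarrow> Sub T \<alpha> (map (\<lambda>m. One T (g m)) M) = \<alpha>"
  using sub_one_right[of \<alpha>] by (auto simp: typed_def comp_def)

lemma typed_dcmp:
  assumes "typed T (b2 k) g2 (fib L2 h2 k) j" "distinct L1" "distinct L2"
    "\<And>l. l \<in> set L1 \<Longrightarrow> h1 l \<in> set L2"
    "\<And>l. l \<in> set L2 \<Longrightarrow> h2 l = k \<Longrightarrow> typed T (b1 l) g1 (fib L1 h1 l) (g2 l)"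
  shows "typed T (dcmp T L1 L2 h1 h2 b2 b1 k) g1 (fib L1 (\<lambda>l. h2 (h1 l)) k) j"
  unfolding dcmp_def
proof (rule typed_relab)
  show "typed T (Sub T (b2 k) (map b1 (fib L2 h2 k))) g1 (cfib L1 h1 (fib L2 h2 k)) j"
    unfolding cfib_def by (rule typed_sub[OF assms(1)]) (use assms in auto)
qed (rule reorders_cfib_fib[OF assms(2-4)])

text \<open>
  Both the associativity of composition in \<open>F \<down> j\<close> and the closure of its morphisms under
  composition are instances of this identity.
\<close>

lemma sub_dcmp:
  assumes \<alpha>: "typed T \<alpha> gV V j" and V: "distinct V"
    and b2: "\<And>k. k \<in> set V \<Longrightarrow> typed T (b2 k) g2 (fib L2 h2 k) (gV k)"
    and b1: "\<And>l. l \<in> set L2 \<Longrightarrow> h2 l \<in> set V \<Longrightarrow> typed T (b1 l) g1 (fib L1 h1 l) (g2 l)"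
    and L: "distinct L1" "distinct L2" and h1: "\<And>l. l \<in> set L1 \<Longrightarrow> h1 l \<in> set L2"
    and W: "reorders (cfib L2 h2 V) W" and K: "reorders (cfib L1 h1 W) K"
  shows "relab T (Sub T \<alpha> (map (dcmp T L1 L2 h1 h2 b2 b1) V)) (cfib L1 (\<lambda>l. h2 (h1 l)) V) K =
    relab T (Sub T (relab T (Sub T \<alpha> (map b2 V)) (cfib L2 h2 V) W) (map b1 W)) (cfib L1 h1 W) K"
proof -
  define \<eta> where "\<eta> = (\<lambda>k. Sub T (b2 k) (map b1 (fib L2 h2 k)))"
  define U where "U = (\<lambda>k. cfib L1 h1 (fib L2 h2 k))"
  let ?C = "cfib L2 h2 V"
  have concat_U: "concat (map U V) = cfib L1 h1 ?C"
    by (simp add: U_def cfib_cfib)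
  have dist: "distinct (cfib L1 h1 ?C)" using V L by simp
  have b1': "typed T (b1 l) g1 (fib L1 h1 l) (g2 l)" if "l \<in> set ?C" for l
    using b1 that by auto
  have \<eta>: "typed T (\<eta> k) g1 (U k) (gV k)" if "k \<in> set V" for k
    unfolding \<eta>_def U_def cfib_def by (rule typed_sub[OF b2[OF that]]) (use b1 that in auto)
  have \<zeta>: "typed T (Sub T \<alpha> (map b2 V)) g2 ?C j"
    unfolding cfib_def by (rule typed_sub[OF \<alpha> b2])
  have U: "reorders (U k) (fib L1 (\<lambda>l. h2 (h1 l)) k)" for k
    unfolding U_def by (rule reorders_cfib_fib[OF L h1])
  have "relab T (Sub T \<alpha> (map (dcmp T L1 L2 h1 h2 b2 b1) V)) (cfib L1 (\<lambda>l. h2 (h1 l)) V) K =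
      relab T (relab T (Sub T \<alpha> (map \<eta> V)) (concat (map U V)) (cfib L1 (\<lambda>l. h2 (h1 l)) V))
        (cfib L1 (\<lambda>l. h2 (h1 l)) V) K"
  proof -
    \<comment> \<open>Inner equivariance moves the reorderings contained in the operations
      \<open>dcmp\<close> out of the substitution, where they fuse with the outer
      \<open>relab\<close>.\<close>
    have "Sub T \<alpha> (map (\<lambda>k. relab T (\<eta> k) (U k) (fib L1 (\<lambda>l. h2 (h1 l)) k)) V) =
        relab T (Sub T \<alpha> (map \<eta> V)) (concat (map U V)) (cfib L1 (\<lambda>l. h2 (h1 l)) V)"
      unfolding cfib_def by (rule sub_inner[OF \<alpha> \<eta> V U]) (use dist concat_U in simp_all)
    then show ?thesis by (simp add: dcmp_def[abs_def] \<eta>_def U_def)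
  qed
  also have "\<dots> = relab T (Sub T \<alpha> (map \<eta> V)) (concat (map U V)) K"
  proof (rule relab_relab)
    show "typed T (Sub T \<alpha> (map \<eta> V)) g1 (concat (map U V)) j"
      by (rule typed_sub[OF \<alpha> \<eta>])
    show "reorders (concat (map U V)) (cfib L1 (\<lambda>l. h2 (h1 l)) V)"
      unfolding concat_U using L V h1 by (auto simp: reorders_def)
    show "reorders (cfib L1 (\<lambda>l. h2 (h1 l)) V) K"
      using K W L V h1 by (auto simp: reorders_def)
  qed
  also have "\<dots> = relab T (Sub T (Sub T \<alpha> (map b2 V)) (map b1 ?C)) (cfib L1 h1 ?C) K"
  proof -
    have "Sub T (Sub T \<alpha> (map b2 V)) (map b1 ?C) = Sub T \<alpha> (map \<eta> V)"
      unfolding cfib_def \<eta>_def by (rule sub_sub[OF \<alpha> b2]) (use b1 in auto)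
    then show ?thesis by (simp add: concat_U)
  qed
  \<comment> \<open>The intermediate order \<open>cfib L1 h1 W\<close> is inserted so that outer
    equivariance applies: it trades a permutation of blocks of \<open>L1\<close> for one of the
    inputs labelled by \<open>L2\<close>.\<close>
  also have "\<dots> = relab T (relab T (Sub T (Sub T \<alpha> (map b2 V)) (map b1 ?C)) (cfib L1 h1 ?C) (cfib L1 h1 W))
      (cfib L1 h1 W) K"
  proof (rule relab_relab[symmetric])
    show "typed T (Sub T (Sub T \<alpha> (map b2 V)) (map b1 ?C)) g1 (cfib L1 h1 ?C) j"
      unfolding cfib_def[of L1] by (rule typed_sub[OF \<zeta> b1'])
    show "reorders (cfib L1 h1 ?C) (cfib L1 h1 W)"
      using W L V by (auto simp: reorders_def)
  qed (rule K)
  also have "relab T (Sub T (Sub T \<alpha> (map b2 V)) (map b1 ?C)) (cfib L1 h1 ?C) (cfib L1 h1 W) =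
      Sub T (relab T (Sub T \<alpha> (map b2 V)) ?C W) (map b1 W)"
    unfolding cfib_def[of L1]
    by (rule sub_outer[OF \<zeta> b1' W, symmetric]) (use dist in \<open>simp_all add: cfib_def[of L1]\<close>)
  finally show ?thesis .
qed

end

section \<open>The 2-monad of an operad\<close>

text \<open>Labels are attached to the inputs of the target: \<open>M\<close> lists them in the order of \<open>\<beta>\<close>, and \<open>N\<close>
  in the order of the source.\<close>

definition larr :: "('j, 't) opd \<Rightarrow> 't \<Rightarrow> 'l list \<Rightarrow> 'l list \<Rightarrow> ('l \<Rightarrow> 'o) \<Rightarrow> ('l \<Rightarrow> 'm) \<Rightarrow> ('l \<Rightarrow> 'o)
    \<Rightarrow> ('t, 'o, 'm) marr" where
  "larr T \<beta> M N x c y = ((relab T \<beta> M N, map x N), (reord M N, map c N), (\<beta>, map y M))"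

definition lhom :: "('j \<Rightarrow> ('o, 'm) cat) \<Rightarrow> ('l \<Rightarrow> 'j) \<Rightarrow> 'l list
    \<Rightarrow> ('l \<Rightarrow> 'o) \<Rightarrow> ('l \<Rightarrow> 'm) \<Rightarrow> ('l \<Rightarrow> 'o) \<Rightarrow> bool" where
  "lhom X g M x c y \<longleftrightarrow> (\<forall>l\<in>set M. in_hom (X (g l)) (c l) (x l) (y l))"

lemma lhomD: "lhom X g M x c y \<Longrightarrow> l \<in> set M \<Longrightarrow> in_hom (X (g l)) (c l) (x l) (y l)"
  by (simp add: lhom_def)

lemma larr_cong:
  assumes "reorders M N" "\<And>l. l \<in> set M \<Longrightarrow> x l = x' l \<and> c l = c' l \<and> y l = y' l"
  shows "larr T \<beta> M N x c y = larr T \<beta> M N x' c' y'"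
  using assms by (auto simp: larr_def reorders_def)

lemma larr_map:
  "inj_on e (set M) \<Longrightarrow> reorders M N \<Longrightarrow>
    larr T \<beta> (map e M) (map e N) x c y = larr T \<beta> M N (\<lambda>l. x (e l)) (\<lambda>l. c (e l)) (\<lambda>l. y (e l))"
  by (simp add: larr_def relab_map reord_map comp_def)

lemma mon_ob_sel:
  "Obj (mon_ob T X j) = {(\<alpha>, xs). \<alpha> \<in> Ops T \<and> Tgt T \<alpha> = j \<and> list_all2 (\<lambda>i x. x \<in> Obj (X i)) (Src T \<alpha>) xs}"
  "Dom (mon_ob T X j) m = fst m" "Cod (mon_ob T X j) m = snd (snd m)"
  by (simp_all add: mon_ob_def cat_of_homs_def split: prod.splits)

lemma mon_ob_Obj: "(\<alpha>, map x M) \<in> Obj (mon_ob T X j) \<longleftrightarrow>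
    \<alpha> \<in> Ops T \<and> Tgt T \<alpha> = j \<and> list_all2 (\<lambda>i x. x \<in> Obj (X i)) (Src T \<alpha>) (map x M)"
  by (simp add: mon_ob_sel)

lemma mon_ob_ObjI:
  "typed T \<alpha> g M j \<Longrightarrow> (\<And>l. l \<in> set M \<Longrightarrow> x l \<in> Obj (X (g l))) \<Longrightarrow> (\<alpha>, map x M) \<in> Obj (mon_ob T X j)"
  by (auto simp: mon_ob_Obj typed_def list_all2_map_map)

lemma mon_ob_ObjE:
  assumes "a \<in> Obj (mon_ob T X j)"
  shows "\<exists>\<alpha> g n x. a = (\<alpha>, map x [0..<n]) \<and> typed T \<alpha> g [0..<n] j \<and> (\<forall>l<n. x l \<in> Obj (X (g l)))"
proof -
  obtain \<alpha> xs where a: "a = (\<alpha>, xs)" by fastforce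
  have *: "\<alpha> \<in> Ops T" "Tgt T \<alpha> = j" "list_all2 (\<lambda>i x. x \<in> Obj (X i)) (Src T \<alpha>) xs"
    using assms by (auto simp: mon_ob_sel a)
  have len: "length xs = arity T \<alpha>" using list_all2_lengthD[OF *(3)] by (simp add: arity_def)
  show ?thesis
  proof (intro exI conjI allI impI)
    show "a = (\<alpha>, map ((!) xs) [0..<arity T \<alpha>])" using a len map_nth[of xs] by simp
    show "typed T \<alpha> ((!) (Src T \<alpha>)) [0..<arity T \<alpha>] j" using typed_nth[OF *(1)] *(2) by simp
    show "xs ! l \<in> Obj (X (Src T \<alpha> ! l))" if "l < arity T \<alpha>" for l
      using list_all2_nthD[OF *(3)] that by (simp add: arity_def)
  qed
qed

context operad
begin

lemma larr_in_hom:
  assumes X: "\<And>j. j \<in> Col T \<Longrightarrow> category (X j)"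
    and \<beta>: "typed T \<beta> g M j" and MN: "reorders M N" and c: "lhom X g M x c y"
  shows "in_hom (mon_ob T X j) (larr T \<beta> M N x c y) (relab T \<beta> M N, map x N) (\<beta>, map y M)"
proof -
  have set: "set N = set M" using MN by (simp add: reorders_def)
  have obj: "x l \<in> Obj (X (g l)) \<and> y l \<in> Obj (X (g l))" if "l \<in> set M" for l
    using category.dom_obj[OF X] category.cod_obj[OF X] lhomD[OF c that] typed_col[OF \<beta> that]
    by (fastforce simp: in_hom_def)
  have \<alpha>: "typed T (relab T \<beta> M N) g N j" by (rule typed_relab[OF \<beta> MN])
  have len: "length N = length M" by (rule reorders_length[OF MN])
  have "in_hom (X (Src T (relab T \<beta> M N) ! k)) (map c N ! k) (map x N ! k) (map y M ! reord M N k)"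
    if "k < length N" for k
  proof -
    have "M ! reord M N k = N ! k" "reord M N k < length M" "N ! k \<in> set M"
      using that MN by (auto simp: nth_reord reord_less reorders_def)
    then show ?thesis using lhomD[OF c, of "N ! k"] \<alpha> that by (simp add: typed_def)
  qed
  then show ?thesis
    using obj set \<alpha> \<beta> len reord_permutes[OF MN]
      mon_ob_ObjI[OF \<alpha>, of x X] mon_ob_ObjI[OF \<beta>, of y X]
    by (auto simp: in_hom_def mon_ob_def cat_of_homs_def larr_def typed_arity relab_def)
qed

text \<open>The permutation of the arrow determines the order \<open>N\<close> by
  \<open>reord_unique\<close>. The functions \<open>x\<close> and \<open>c\<close> are then read off
  the lists at the positions of the labels in \<open>N\<close>.\<close>

lemma larrE:
  assumes m: "in_hom (mon_ob T X j) m a (\<beta>, map y M)" and \<beta>: "typed T \<beta> g M j" and M: "distinct M"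
  shows "\<exists>N x c. m = larr T \<beta> M N x c y \<and> a = (relab T \<beta> M N, map x N) \<and> reorders M N \<and> lhom X g M x c y"
proof -
  obtain \<alpha> xs \<rho> cs where m': "m = ((\<alpha>, xs), (\<rho>, cs), (\<beta>, map y M))" and a: "a = (\<alpha>, xs)"
    using m by (cases m; cases a) (auto simp: in_hom_def mon_ob_sel)
  have 1: "\<rho> permutes {..<length M}" "\<alpha> = Act T \<beta> \<rho>" "length cs = arity T \<alpha>"
    "\<And>k. k < arity T \<alpha> \<Longrightarrow> in_hom (X (Src T \<alpha> ! k)) (cs ! k) (xs ! k) (map y M ! \<rho> k)"
    "length xs = arity T \<alpha>"
    using m typed_arity[OF \<beta>]
    by (auto simp: in_hom_def mon_ob_def cat_of_homs_def m' list_all2_lengthD[symmetric] arity_def)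
  define N where "N = map (\<lambda>k. M ! \<rho> k) [0..<length M]"
  have MN: "reorders M N" and \<rho>: "reord M N = \<rho>"
    unfolding N_def by (rule reord_unique[OF M 1(1)])+
  have \<alpha>: "\<alpha> = relab T \<beta> M N" by (simp add: relab_def \<rho> 1(2))
  then have \<alpha>t: "typed T \<alpha> g N j" using typed_relab[OF \<beta> MN] by simp
  have len: "length N = arity T \<alpha>" "distinct N" "length N = length M"
    using typed_arity[OF \<alpha>t] MN reorders_length[OF MN] by (auto simp: reorders_def)
  define x c where "x = (\<lambda>l. xs ! pos N l)" and "c = (\<lambda>l. cs ! pos N l)"
  have xs: "map x N = xs" "map c N = cs"
    using len 1 by (auto simp: x_def c_def intro!: nth_equalityI)
  show ?thesis
  proof (intro exI conjI)
    show "reorders M N" by (rule MN)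
    show "m = larr T \<beta> M N x c y" by (simp add: larr_def xs \<alpha> \<rho> m')
    show "a = (relab T \<beta> M N, map x N)" by (simp add: a xs \<alpha>)
    show "lhom X g M x c y"
      unfolding lhom_def
    proof
      fix l assume "l \<in> set M"
      then have l: "l \<in> set N" using MN by (simp add: reorders_def)
      let ?k = "pos N l"
      have k: "?k < length N" "N ! ?k = l" using l by auto
      have "M ! \<rho> ?k = l" "\<rho> ?k < length M"
        using nth_reord[OF MN k(1)] reord_less[OF MN k(1)] by (auto simp: \<rho> k)
      then show "in_hom (X (g l)) (c l) (x l) (y l)"
        using 1(4)[of ?k] k len \<alpha>t by (simp add: typed_def x_def c_def)
    qed
  qed
qed

text \<open>In the definition the index of the second list is shifted by the first permutation. Both
  permutations are orders of the same labels, so the shift vanishes and components are composed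
  label by label.\<close>

lemma larr_cmp:
  assumes \<beta>: "typed T \<beta> g M j" and MN: "reorders M N" and NK: "reorders N K"
  shows "Cmp (mon_ob T X j) (larr T \<beta> M N y d z) (larr T (relab T \<beta> M N) N K x c y) =
    larr T \<beta> M K x (\<lambda>l. Cmp (X (g l)) (d l) (c l)) z"
proof -
  have \<alpha>: "typed T (relab T \<beta> M K) g K j"
    by (rule typed_relab[OF \<beta> reorders_trans[OF MN NK]])
  have len: "length K = arity T (relab T \<beta> M K)" using typed_arity[OF \<alpha>] by simp
  have "map (\<lambda>k. Cmp (X (Src T (relab T \<beta> M K) ! k)) (map d N ! reord N K k) (map c K ! k)) [0..<length K] =
      map (\<lambda>l. Cmp (X (g l)) (d l) (c l)) K"
    using \<alpha> NK by (auto simp: typed_def nth_reord reord_less intro!: nth_equalityI)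
  then show ?thesis
    using relab_relab[OF \<beta> MN NK] reord_comp[OF MN NK] len
    by (simp add: mon_ob_def cat_of_homs_def larr_def)
qed

lemma larr_ide:
  assumes "typed T \<beta> g M j" "distinct M"
  shows "Ide (mon_ob T X j) (\<beta>, map y M) = larr T \<beta> M M y (\<lambda>l. Ide (X (g l)) (y l)) y"
  using assms(1) by (simp add: mon_ob_def cat_of_homs_def larr_def relab_self[OF assms] reord_self[OF assms(2)]
      map2_map_map typed_def)

lemma mon_ob_category:
  assumes X: "\<And>j. j \<in> Col T \<Longrightarrow> category (X j)"
  shows "category (mon_ob T X j)"
proof
  show "Dom (mon_ob T X j) m \<in> Obj (mon_ob T X j)" "Cod (mon_ob T X j) m \<in> Obj (mon_ob T X j)"
    if "m \<in> Arr (mon_ob T X j)" for m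
    using that by (auto simp: mon_ob_def cat_of_homs_def)
next
  fix a assume "a \<in> Obj (mon_ob T X j)"
  from mon_ob_ObjE[OF this] obtain \<alpha> g n x where a: "a = (\<alpha>, map x [0..<n])" "typed T \<alpha> g [0..<n] j"
    "\<And>l. l < n \<Longrightarrow> x l \<in> Obj (X (g l))" by blast
  have "lhom X g [0..<n] x (\<lambda>l. Ide (X (g l)) (x l)) x"
    using category.ide_hom[OF X] a typed_col[OF a(2)] by (auto simp: lhom_def)
  from larr_in_hom[OF X a(2) _ this, of "[0..<n]"]
  show "in_hom (mon_ob T X j) (Ide (mon_ob T X j) a) a a"
    by (simp add: a larr_ide[OF a(2)] relab_self[OF a(2)])
next
  fix m a b assume m: "in_hom (mon_ob T X j) m a b"
  then have b: "b \<in> Obj (mon_ob T X j)"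
    by (auto simp: mon_ob_def cat_of_homs_def in_hom_def)
  from mon_ob_ObjE[OF this] obtain \<beta> g n y where b: "b = (\<beta>, map y [0..<n])" "typed T \<beta> g [0..<n] j"
    "\<And>l. l < n \<Longrightarrow> y l \<in> Obj (X (g l))" by blast
  obtain N x c where mm: "m = larr T \<beta> [0..<n] N x c y" "a = (relab T \<beta> [0..<n] N, map x N)"
      "reorders [0..<n] N" "lhom X g [0..<n] x c y"
    using larrE[OF m[unfolded b(1)] b(2) distinct_upt] by blast
  have N: "distinct N" "set N = {0..<n}" using mm(3) by (simp_all add: reorders_def)
  have col: "category (X (g l))" if "l < n" for l
    using X typed_col[OF b(2)] that by simp
  show "Cmp (mon_ob T X j) (Ide (mon_ob T X j) b) m = m"
    unfolding b(1) larr_ide[OF b(2) distinct_upt] mm(1)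
    using larr_cmp[OF b(2) _ mm(3), of X y "\<lambda>l. Ide (X (g l)) (y l)" y x c]
    by (auto simp: relab_self[OF b(2)] intro!: larr_cong[OF mm(3)] category.cmp_ide_left[OF col] lhomD[OF mm(4)])
  show "Cmp (mon_ob T X j) m (Ide (mon_ob T X j) a) = m"
    unfolding mm(2) larr_ide[OF typed_relab[OF b(2) mm(3)] N(1)] mm(1)
    using larr_cmp[OF b(2) mm(3), of N X x c y x "\<lambda>l. Ide (X (g l)) (x l)"] N
    by (auto intro!: larr_cong[OF mm(3)] category.cmp_ide_right[OF col] lhomD[OF mm(4)])
next
  fix m1 m2 a1 a2 a3
  assume m: "in_hom (mon_ob T X j) m1 a1 a2" "in_hom (mon_ob T X j) m2 a2 a3"
  then have "a3 \<in> Obj (mon_ob T X j)"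
    by (auto simp: mon_ob_def cat_of_homs_def in_hom_def)
  from mon_ob_ObjE[OF this] obtain \<beta> g n z where a3: "a3 = (\<beta>, map z [0..<n])" "typed T \<beta> g [0..<n] j"
    by blast
  obtain N y d where m2: "m2 = larr T \<beta> [0..<n] N y d z" "a2 = (relab T \<beta> [0..<n] N, map y N)"
      "reorders [0..<n] N" "lhom X g [0..<n] y d z"
    using larrE[OF m(2)[unfolded a3(1)] a3(2) distinct_upt] by blast
  have N: "distinct N" "set N = {0..<n}" using m2(3) by (simp_all add: reorders_def)
  note \<alpha> = typed_relab[OF a3(2) m2(3)]
  obtain K x c where m1: "m1 = larr T (relab T \<beta> [0..<n] N) N K x c y"
      "a1 = (relab T (relab T \<beta> [0..<n] N) N K, map x K)" "reorders N K" "lhom X g N x c y"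
    using larrE[OF m(1)[unfolded m2(2)] \<alpha> N(1)] by blast
  have col: "category (X (g l))" if "l < n" for l
    using X typed_col[OF a3(2)] that by simp
  have dc: "lhom X g [0..<n] x (\<lambda>l. Cmp (X (g l)) (d l) (c l)) z"
    using m2(4) m1(4) category.cmp_hom[OF col] N by (fastforce simp: lhom_def)
  have K: "reorders [0..<n] K" by (rule reorders_trans[OF m2(3) m1(3)])
  have cmp21: "Cmp (mon_ob T X j) m2 m1 = larr T \<beta> [0..<n] K x (\<lambda>l. Cmp (X (g l)) (d l) (c l)) z"
    unfolding m1(1) m2(1) by (rule larr_cmp[OF a3(2) m2(3) m1(3)])
  show "in_hom (mon_ob T X j) (Cmp (mon_ob T X j) m2 m1) a1 a3"
    using larr_in_hom[OF X a3(2) K dc] m1(2) relab_relab[OF a3(2) m2(3) m1(3)]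
    by (simp add: cmp21 a3(1))
  fix m0 a0 assume m0: "in_hom (mon_ob T X j) m0 a0 a1"
  note \<alpha>' = typed_relab[OF \<alpha> m1(3)]
  have K': "distinct K" "set K = {0..<n}" using K by (simp_all add: reorders_def)
  obtain H w b where m0': "m0 = larr T (relab T (relab T \<beta> [0..<n] N) N K) K H w b x"
      "reorders K H" "lhom X g K w b x"
    using larrE[OF m0[unfolded m1(2)] \<alpha>' K'(1)] by blast
  have eq: "relab T (relab T \<beta> [0..<n] N) N K = relab T \<beta> [0..<n] K"
    by (rule relab_relab[OF a3(2) m2(3) m1(3)])
  have "Cmp (mon_ob T X j) m2 (Cmp (mon_ob T X j) m1 m0) =
      larr T \<beta> [0..<n] H w (\<lambda>l. Cmp (X (g l)) (d l) (Cmp (X (g l)) (c l) (b l))) z"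
    unfolding m0'(1) m1(1) m2(1) larr_cmp[OF \<alpha> m1(3) m0'(2)]
    by (rule larr_cmp[OF a3(2) m2(3) reorders_trans[OF m1(3) m0'(2)]])
  also have "\<dots> = larr T \<beta> [0..<n] H w (\<lambda>l. Cmp (X (g l)) (Cmp (X (g l)) (d l) (c l)) (b l)) z"
  proof (rule larr_cong[OF reorders_trans[OF K m0'(2)]])
    fix l assume "l \<in> set [0..<n]"
    then have "in_hom (X (g l)) (b l) (w l) (x l)" "in_hom (X (g l)) (c l) (x l) (y l)"
      "in_hom (X (g l)) (d l) (y l) (z l)" "l < n"
      using m0'(3) m1(4) m2(4) K' N by (auto simp: lhom_def)
    then show "w l = w l \<and> Cmp (X (g l)) (d l) (Cmp (X (g l)) (c l) (b l)) =
        Cmp (X (g l)) (Cmp (X (g l)) (d l) (c l)) (b l) \<and> z l = z l"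
      using category.cmp_assoc[OF col] by simp
  qed
  also have "\<dots> = Cmp (mon_ob T X j) (Cmp (mon_ob T X j) m2 m1) m0"
    unfolding cmp21 m0'(1) eq by (rule larr_cmp[OF a3(2) K m0'(2), symmetric])
  finally show "Cmp (mon_ob T X j) m2 (Cmp (mon_ob T X j) m1 m0) =
      Cmp (mon_ob T X j) (Cmp (mon_ob T X j) m2 m1) m0" .
qed

section \<open>The structure maps of the 2-monad on labelled objects and arrows\<close>

lemma mon_obj_map_larr:
  "typed T \<alpha> g M j \<Longrightarrow> mon_obj_map T G (\<alpha>, map x M) = (\<alpha>, map (\<lambda>l. FO (G (g l)) (x l)) M)"
  by (simp add: mon_obj_map_def typed_def map2_map_map)

lemma mon_1_obj:
  "typed T \<alpha> g M j \<Longrightarrow> j \<in> Col T \<Longrightarrow> (\<alpha>, map x M) \<in> Obj (mon_ob T X j) \<Longrightarrow>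
    FO (mon_1 T X G j) (\<alpha>, map x M) = (\<alpha>, map (\<lambda>l. FO (G (g l)) (x l)) M)"
  by (simp add: mon_1_def mon_obj_map_larr)

lemma mon_1_larr:
  assumes "typed T \<beta> g M j" "j \<in> Col T" "larr T \<beta> M N x c y \<in> Arr (mon_ob T X j)" "reorders M N"
  shows "FA (mon_1 T X G j) (larr T \<beta> M N x c y) =
    larr T \<beta> M N (\<lambda>l. FO (G (g l)) (x l)) (\<lambda>l. FA (G (g l)) (c l)) (\<lambda>l. FO (G (g l)) (y l))"
proof -
  note \<alpha> = typed_relab[OF assms(1,4)]
  have "Src T (relab T \<beta> M N) = map g N" using \<alpha> by (simp add: typed_def)
  then show ?thesis
    using assms(2,3) mon_obj_map_larr[OF assms(1), of G y] mon_obj_map_larr[OF \<alpha>, of G x]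
    by (simp add: mon_1_def larr_def map2_map_map)
qed

lemma mon_unit_larr:
  "j \<in> Col T \<Longrightarrow> m \<in> Arr (X j) \<Longrightarrow>
    FA (mon_unit T X j) m = larr T (One T j) [l] [l] (\<lambda>_. Dom (X j) m) (\<lambda>_. m) (\<lambda>_. Cod (X j) m)"
  by (simp add: mon_unit_def larr_def relab_def one_ops act_id)

lemma mon_mult_obj_map:
  "mon_mult_obj T (\<alpha>, map (\<lambda>m. (\<beta> m, map x (L m))) M) = (Sub T \<alpha> (map \<beta> M), map x (concat (map L M)))"
  by (simp add: mon_mult_obj_def comp_def map_concat)

text \<open>The permutation produced by the multiplication is a block map, which
  \<open>block_map_reord\<close> turns into a change of order of concatenated labels. The matching
  source operation comes from the two equivariance laws, inner for the \<open>K m\<close> and outer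
  for \<open>N\<close>.\<close>

lemma mon_mult_larr:
  assumes \<alpha>: "typed T \<alpha> g M j" and \<beta>: "\<And>m. m \<in> set M \<Longrightarrow> typed T (\<beta> m) g' (L m) (g m)"
    and MN: "reorders M N" and LK: "\<And>m. m \<in> set M \<Longrightarrow> reorders (L m) (K m)"
    and dist: "distinct (concat (map L M))" and j: "j \<in> Col T"
    and arr: "larr T \<alpha> M N (\<lambda>m. (relab T (\<beta> m) (L m) (K m), map x (K m)))
      (\<lambda>m. larr T (\<beta> m) (L m) (K m) x c y) (\<lambda>m. (\<beta> m, map y (L m))) \<in> Arr (mon_ob T (mon_ob T X) j)"
  shows "FA (mon_mult T X j) (larr T \<alpha> M N (\<lambda>m. (relab T (\<beta> m) (L m) (K m), map x (K m)))
      (\<lambda>m. larr T (\<beta> m) (L m) (K m) x c y) (\<lambda>m. (\<beta> m, map y (L m)))) =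
    larr T (Sub T \<alpha> (map \<beta> M)) (concat (map L M)) (concat (map K N)) x c y"
proof -
  have set: "set N = set M" "distinct M" "distinct N" using MN by (auto simp: reorders_def)
  let ?\<beta>' = "\<lambda>m. relab T (\<beta> m) (L m) (K m)"
  have \<beta>': "typed T (?\<beta>' m) g' (K m) (g m)" if "m \<in> set M" for m
    by (rule typed_relab[OF \<beta>[OF that] LK[OF that]])
  have ar: "map (\<lambda>m. arity T (?\<beta>' m)) N = map (\<lambda>m. length (K m)) N"
    "map (\<lambda>m. arity T (\<beta> m)) M = map (\<lambda>m. length (L m)) M"
    using typed_arity[OF \<beta>] typed_arity[OF \<beta>'] set by auto
  have bm: "block_map (map (\<lambda>m. arity T (?\<beta>' m)) N) (map (\<lambda>m. arity T (\<beta> m)) M) (reord M N)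
      (\<lambda>k. fst (datum_of (map (\<lambda>m. larr T (\<beta> m) (L m) (K m) x c y) N ! k))) =
      reord (concat (map L M)) (concat (map K N))"
    by (rule block_map_reord[OF MN dist LK ar]) (simp_all add: larr_def)
  have distK: "distinct (concat (map K M))"
    using reorders_concat[OF _ dist LK, of M] set by (simp add: reorders_def)
  have "Sub T (relab T \<alpha> M N) (map ?\<beta>' N) = relab T (Sub T \<alpha> (map ?\<beta>' M)) (concat (map K M)) (concat (map K N))"
    by (rule sub_outer[OF \<alpha> \<beta>' MN distK])
  also have "Sub T \<alpha> (map ?\<beta>' M) = relab T (Sub T \<alpha> (map \<beta> M)) (concat (map L M)) (concat (map K M))"
    by (rule sub_inner[OF \<alpha> \<beta> set(2) LK dist])
  also have "relab T \<dots> (concat (map K M)) (concat (map K N)) =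
      relab T (Sub T \<alpha> (map \<beta> M)) (concat (map L M)) (concat (map K N))"
    by (rule relab_relab[OF typed_sub[OF \<alpha> \<beta>]])
      (use reorders_concat[OF _ dist LK, of M] reorders_concat[OF MN distK, of K] set distinct_concat_mapD[OF distK] in auto)
  finally have dom: "Sub T (relab T \<alpha> M N) (map ?\<beta>' N) =
      relab T (Sub T \<alpha> (map \<beta> M)) (concat (map L M)) (concat (map K N))" .
  have "FA (mon_mult T X j) (larr T \<alpha> M N (\<lambda>m. (?\<beta>' m, map x (K m)))
      (\<lambda>m. larr T (\<beta> m) (L m) (K m) x c y) (\<lambda>m. (\<beta> m, map y (L m)))) =
    (mon_mult_obj T (relab T \<alpha> M N, map (\<lambda>m. (?\<beta>' m, map x (K m))) N),
      (block_map (map (\<lambda>m. arity T (?\<beta>' m)) N) (map (\<lambda>m. arity T (\<beta> m)) M) (reord M N)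
        (\<lambda>k. fst (datum_of (map (\<lambda>m. larr T (\<beta> m) (L m) (K m) x c y) N ! k))),
       concat (map (\<lambda>m. map c (K m)) N)),
      mon_mult_obj T (\<alpha>, map (\<lambda>m. (\<beta> m, map y (L m))) M))"
    using arr j by (simp add: mon_mult_def larr_def comp_def)
  also have "\<dots> = larr T (Sub T \<alpha> (map \<beta> M)) (concat (map L M)) (concat (map K N)) x c y"
    unfolding bm mon_mult_obj_map dom by (simp add: larr_def map_concat comp_def)
  finally show ?thesis .
qed

text \<open>Labelling the inputs of an arrow of arrows by pairs makes the labels of the blocks disjoint.\<close>

lemma larr2E:
  assumes m: "m \<in> Arr (mon_ob T (mon_ob T X) j)"
  obtains \<alpha> g M N \<beta> g' and L K :: "nat \<Rightarrow> (nat \<times> nat) list" and x c y where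
    "m = larr T \<alpha> M N (\<lambda>m. (relab T (\<beta> m) (L m) (K m), map x (K m)))
      (\<lambda>m. larr T (\<beta> m) (L m) (K m) x c y) (\<lambda>m. (\<beta> m, map y (L m)))"
    "typed T \<alpha> g M j" "reorders M N" "\<And>m. m \<in> set M \<Longrightarrow> typed T (\<beta> m) g' (L m) (g m)"
    "\<And>m. m \<in> set M \<Longrightarrow> reorders (L m) (K m)" "distinct (concat (map L M))"
    "\<And>m. m \<in> set M \<Longrightarrow> lhom X g' (L m) x c y"
proof -
  let ?XX = "mon_ob T X"
  obtain a b where ab: "in_hom (mon_ob T ?XX j) m a b" "b \<in> Obj (mon_ob T ?XX j)"
    using m by (auto simp: mon_ob_def cat_of_homs_def in_hom_def)
  obtain \<alpha> g n Y where b: "b = (\<alpha>, map Y [0..<n])" "typed T \<alpha> g [0..<n] j"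
    "\<And>m. m < n \<Longrightarrow> Y m \<in> Obj (?XX (g m))"
    using mon_ob_ObjE[OF ab(2)] by blast
  obtain N Z C where mm: "m = larr T \<alpha> [0..<n] N Z C Y" "reorders [0..<n] N" "lhom ?XX g [0..<n] Z C Y"
    using larrE[OF ab(1)[unfolded b(1)] b(2) distinct_upt] by blast
  define \<beta> where "\<beta> m = fst (Y m)" for m
  define L where "L m = map (Pair m) [0..<arity T (\<beta> m)]" for m :: nat
  define g' where "g' = (\<lambda>(m, l). Src T (\<beta> m) ! l)"
  define y where "y = (\<lambda>(m, l). snd (Y m) ! l)"
  have \<beta>: "typed T (\<beta> m) g' (L m) (g m)" and Y: "Y m = (\<beta> m, map y (L m))" if "m < n" for m
  proof -
    obtain \<gamma> ys where Ym: "Y m = (\<gamma>, ys)" by fastforce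
    have "\<gamma> \<in> Ops T" "Tgt T \<gamma> = g m" "length ys = arity T \<gamma>"
      using b(3)[OF that] by (auto simp: mon_ob_sel Ym arity_def dest: list_all2_lengthD)
    then show "typed T (\<beta> m) g' (L m) (g m)" "Y m = (\<beta> m, map y (L m))"
      using map_nth[of ys] map_nth[of "Src T \<gamma>"]
      by (simp_all add: typed_def \<beta>_def Ym L_def g'_def y_def comp_def arity_def)
  qed
  have L: "distinct (L m)" for m by (simp add: L_def distinct_map inj_on_def)
  have "\<exists>K x c. C m = larr T (\<beta> m) (L m) K x c y \<and> Z m = (relab T (\<beta> m) (L m) K, map x K) \<and>
      reorders (L m) K \<and> lhom X g' (L m) x c y" if "m < n" for m
  proof -
    have "in_hom (mon_ob T X (g m)) (C m) (Z m) (\<beta> m, map y (L m))"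
      using lhomD[OF mm(3), of m] Y[OF that] that by simp
    then show ?thesis by (rule larrE[OF _ \<beta>[OF that] L])
  qed
  then obtain K x c where *: "\<And>m. m < n \<Longrightarrow> C m = larr T (\<beta> m) (L m) (K m) (x m) (c m) y \<and>
      Z m = (relab T (\<beta> m) (L m) (K m), map (x m) (K m)) \<and>
      reorders (L m) (K m) \<and> lhom X g' (L m) (x m) (c m) y"
    by metis
  \<comment> \<open>A label carries the index of its block, so the functions chosen separately for
    each block glue to single functions.\<close>
  define x' c' where "x' = (\<lambda>p. x (fst p) p)" and "c' = (\<lambda>p. c (fst p) p)"
  have fst: "fst p = m" if "p \<in> set (L m)" for p m using that by (auto simp: L_def)
  have C: "C m = larr T (\<beta> m) (L m) (K m) x' c' y" "Z m = (relab T (\<beta> m) (L m) (K m), map x' (K m))"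
    "lhom X g' (L m) x' c' y" if "m < n" for m
  proof -
    have re: "reorders (L m) (K m)" using *[OF that] by simp
    then have K: "set (K m) = set (L m)" by (simp add: reorders_def)
    show "C m = larr T (\<beta> m) (L m) (K m) x' c' y"
      using *[OF that] larr_cong[OF re, of "x m" x' "c m" c' y y] fst by (simp add: x'_def c'_def)
    show "Z m = (relab T (\<beta> m) (L m) (K m), map x' (K m))"
      using *[OF that] K fst by (auto simp: x'_def)
    show "lhom X g' (L m) x' c' y"
      using *[OF that] fst by (auto simp: lhom_def x'_def c'_def)
  qed
  show ?thesis
  proof (rule that[of \<alpha> "[0..<n]" N \<beta> L K x' c' y g g'])
    show "m = larr T \<alpha> [0..<n] N (\<lambda>m. (relab T (\<beta> m) (L m) (K m), map x' (K m)))
      (\<lambda>m. larr T (\<beta> m) (L m) (K m) x' c' y) (\<lambda>m. (\<beta> m, map y (L m)))"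
      unfolding mm(1) by (rule larr_cong[OF mm(2)]) (use C Y in auto)
    show "distinct (concat (map L [0..<n]))"
    proof (rule distinct_concat_mapI)
      show "m = k" if "l \<in> set (L m)" "l \<in> set (L k)" for m k l
        using fst[OF that(1)] fst[OF that(2)] by simp
    qed (simp_all add: L)
  qed (use b mm \<beta> * C in auto)
qed

text \<open>The tagging by pairs again, now for an object of \<open>TTX\<close>: \<open>x\<close>
  and \<open>g'\<close> are defined on all tagged labels at once.\<close>

lemma mon_ob2_ObjE:
  assumes a: "a \<in> Obj (mon_ob T (mon_ob T X) j)"
  obtains \<alpha> g M \<beta> g' and L :: "nat \<Rightarrow> (nat \<times> nat) list" and x where
    "a = (\<alpha>, map (\<lambda>m. (\<beta> m, map x (L m))) M)"
    "typed T \<alpha> g M j" "distinct M" "\<And>m. m \<in> set M \<Longrightarrow> typed T (\<beta> m) g' (L m) (g m)"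
    "distinct (concat (map L M))"
    "\<And>m l. m \<in> set M \<Longrightarrow> l \<in> set (L m) \<Longrightarrow> x l \<in> Obj (X (g' l))"
proof -
  obtain \<alpha> g n Y where b: "a = (\<alpha>, map Y [0..<n])" "typed T \<alpha> g [0..<n] j"
    "\<And>m. m < n \<Longrightarrow> Y m \<in> Obj (mon_ob T X (g m))"
    using mon_ob_ObjE[OF a] by blast
  define \<beta> where "\<beta> m = fst (Y m)" for m
  define L where "L m = map (Pair m) [0..<arity T (\<beta> m)]" for m :: nat
  define g' where "g' = (\<lambda>(m, l). Src T (\<beta> m) ! l)"
  define y where "y = (\<lambda>(m, l). snd (Y m) ! l)"
  have \<beta>: "typed T (\<beta> m) g' (L m) (g m)" and Y: "Y m = (\<beta> m, map y (L m))"
    and obj: "\<And>l. l \<in> set (L m) \<Longrightarrow> y l \<in> Obj (X (g' l))" if "m < n" for m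
  proof -
    obtain \<gamma> ys where Ym: "Y m = (\<gamma>, ys)" by fastforce
    have *: "\<gamma> \<in> Ops T" "Tgt T \<gamma> = g m" "length ys = arity T \<gamma>"
      "list_all2 (\<lambda>i x. x \<in> Obj (X i)) (Src T \<gamma>) ys"
      using b(3)[OF that] by (auto simp: mon_ob_sel Ym arity_def dest: list_all2_lengthD)
    then show "typed T (\<beta> m) g' (L m) (g m)" "Y m = (\<beta> m, map y (L m))"
      using map_nth[of ys] map_nth[of "Src T \<gamma>"]
      by (simp_all add: typed_def \<beta>_def Ym L_def g'_def y_def comp_def arity_def)
    show "y l \<in> Obj (X (g' l))" if "l \<in> set (L m)" for l
      using that list_all2_nthD[OF *(4)] by (auto simp: L_def y_def g'_def \<beta>_def Ym arity_def)
  qed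
  show ?thesis
  proof (rule that[of \<alpha> \<beta> y L "[0..<n]" g g'])
    show "distinct (concat (map L [0..<n]))"
      by (rule distinct_concat_mapI) (auto simp: L_def distinct_map inj_on_def)
  qed (use b \<beta> Y obj in auto)
qed

end

section \<open>Strict algebras\<close>

text \<open>The colour at which the structure map is taken is read off the operation, which keeps it
  out of all later formulas.\<close>

definition str_obj :: "('j, 't) opd \<Rightarrow> ('j, 't, 'o, 'm) alg \<Rightarrow> 't \<Rightarrow> 'o list \<Rightarrow> 'o" where
  "str_obj T B \<beta> ys = FO (Str B (Tgt T \<beta>)) (\<beta>, ys)"

definition str_arr :: "('j, 't) opd \<Rightarrow> ('j, 't, 'o, 'm) alg \<Rightarrow> 't \<Rightarrow> 'l list \<Rightarrow> 'l list
    \<Rightarrow> ('l \<Rightarrow> 'o) \<Rightarrow> ('l \<Rightarrow> 'm) \<Rightarrow> ('l \<Rightarrow> 'o) \<Rightarrow> 'm" where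
  "str_arr T B \<beta> M N x c y = FA (Str B (Tgt T \<beta>)) (larr T \<beta> M N x c y)"

text \<open>The symmetry isomorphisms of the algebra: the structure map at an arrow of
  \<open>TB\<close> that does nothing but permute.\<close>

definition str_perm :: "('j, 't) opd \<Rightarrow> ('j, 't, 'o, 'm) alg \<Rightarrow> ('l \<Rightarrow> 'j) \<Rightarrow> 't \<Rightarrow> 'l list \<Rightarrow> 'l list
    \<Rightarrow> ('l \<Rightarrow> 'o) \<Rightarrow> 'm" where
  "str_perm T B g \<beta> M N x = str_arr T B \<beta> M N x (\<lambda>l. Ide (Und B (g l)) (x l)) x"

lemma str_arr_cong:
  assumes "reorders M N" "\<And>l. l \<in> set M \<Longrightarrow> x l = x' l \<and> c l = c' l \<and> y l = y' l"
  shows "str_arr T B \<beta> M N x c y = str_arr T B \<beta> M N x' c' y'"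
  unfolding str_arr_def by (rule arg_cong[OF larr_cong[OF assms(1)]]) (rule assms(2))

lemma str_arr_map:
  "inj_on e (set M) \<Longrightarrow> reorders M N \<Longrightarrow>
    str_arr T B \<beta> (map e M) (map e N) x c y = str_arr T B \<beta> M N (\<lambda>l. x (e l)) (\<lambda>l. c (e l)) (\<lambda>l. y (e l))"
  by (simp add: str_arr_def larr_map)

lemma str_perm_map:
  "inj_on e (set M) \<Longrightarrow> reorders M N \<Longrightarrow>
    str_perm T B g \<beta> (map e M) (map e N) x = str_perm T B (\<lambda>l. g (e l)) \<beta> M N (\<lambda>l. x (e l))"
  by (simp add: str_perm_def str_arr_map)

lemma str_perm_cong:
  assumes "reorders M N" "\<And>l. l \<in> set M \<Longrightarrow> g l = g' l \<and> x l = x' l"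
  shows "str_perm T B g \<beta> M N x = str_perm T B g' \<beta> M N x'"
  unfolding str_perm_def using assms by (intro str_arr_cong) auto

lemma in_homD:
  assumes "in_hom C m x y"
  shows "m \<in> Arr C" "Dom C m = x" "Cod C m = y"
  using assms by (simp_all add: in_hom_def)

context category
begin

lemma in_hom_obj:
  assumes "in_hom C m x y"
  shows "x \<in> Obj C" "y \<in> Obj C"
  using assms dom_obj cod_obj by (auto simp: in_hom_def)

lemma in_hom_self: "m \<in> Arr C \<Longrightarrow> in_hom C m (Dom C m) (Cod C m)"
  by (simp add: in_hom_def)

end

context is_functor
begin

lemma FO_obj: "x \<in> Obj C \<Longrightarrow> FO G x \<in> Obj D"
  using fo_maps by auto

lemma FA_arr: "m \<in> Arr C \<Longrightarrow> FA G m \<in> Arr D"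
  using fa_maps by auto

end

locale strict_alg = operad T for T :: "('j, 't) opd" +
  fixes B :: "('j, 't, 'o, 'm) alg"
  assumes strict: "strict_algebra T B"
begin

lemma Und_category: "j \<in> Col T \<Longrightarrow> category (Und B j)"
  using strict by (simp add: strict_algebra_def)

lemma Str_functor: "j \<in> Col T \<Longrightarrow> is_functor (mon_ob T (Und B) j) (Und B j) (Str B j)"
  using strict by (simp add: strict_algebra_def cell1_def)

lemma mon_category: "category (mon_ob T (Und B) j)"
  by (rule mon_ob_category[OF Und_category])

lemma typed_tgt: "typed T \<beta> g M j \<Longrightarrow> Tgt T \<beta> = j \<and> j \<in> Col T"
  using tgt_col by (auto simp: typed_def)

lemma lhom_obj:
  assumes "lhom (Und B) g M x c y" "typed T \<beta> g M j" "l \<in> set M"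
  shows "x l \<in> Obj (Und B (g l))" "y l \<in> Obj (Und B (g l))"
  using category.in_hom_obj[OF Und_category[OF typed_col[OF assms(2,3)]] lhomD[OF assms(1,3)]] by auto

lemma lhom_ide:
  "typed T \<beta> g M j \<Longrightarrow> (\<And>l. l \<in> set M \<Longrightarrow> x l \<in> Obj (Und B (g l))) \<Longrightarrow>
    lhom (Und B) g M x (\<lambda>l. Ide (Und B (g l)) (x l)) x"
  by (auto simp: lhom_def intro: category.ide_hom[OF Und_category] typed_col)

lemma str_obj_obj:
  assumes "typed T \<beta> g M j" "\<And>l. l \<in> set M \<Longrightarrow> x l \<in> Obj (Und B (g l))"
  shows "str_obj T B \<beta> (map x M) \<in> Obj (Und B j)"
  using is_functor.FO_obj[OF Str_functor mon_ob_ObjI[where X = "Und B" and x = x, OF assms]] typed_tgt[OF assms(1)]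
  by (simp add: str_obj_def)

lemma str_arr_hom:
  assumes "typed T \<beta> g M j" "reorders M N" "lhom (Und B) g M x c y"
  shows "in_hom (Und B j) (str_arr T B \<beta> M N x c y) (str_obj T B (relab T \<beta> M N) (map x N)) (str_obj T B \<beta> (map y M))"
  using is_functor.fa_hom[OF Str_functor larr_in_hom[OF Und_category assms]]
    typed_tgt[OF assms(1)] typed_tgt[OF typed_relab[OF assms(1,2)]]
  by (simp add: str_obj_def str_arr_def)

lemma str_arr_ide:
  assumes "typed T \<beta> g M j" "distinct M" "\<And>l. l \<in> set M \<Longrightarrow> x l \<in> Obj (Und B (g l))"
  shows "str_arr T B \<beta> M M x (\<lambda>l. Ide (Und B (g l)) (x l)) x = Ide (Und B j) (str_obj T B \<beta> (map x M))"
  using is_functor.fa_ide[OF Str_functor mon_ob_ObjI[where X = "Und B" and x = x, OF assms(1,3)]] typed_tgt[OF assms(1)]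
  by (simp add: larr_ide[OF assms(1,2)] str_obj_def str_arr_def)

lemma str_arr_cmp:
  assumes \<beta>: "typed T \<beta> g M j" and MN: "reorders M N" and NK: "reorders N K"
    and d: "lhom (Und B) g M y d z" and c: "lhom (Und B) g M x c y"
  shows "Cmp (Und B j) (str_arr T B \<beta> M N y d z) (str_arr T B (relab T \<beta> M N) N K x c y) =
    str_arr T B \<beta> M K x (\<lambda>l. Cmp (Und B (g l)) (d l) (c l)) z"
proof -
  note \<alpha> = typed_relab[OF \<beta> MN]
  have c': "lhom (Und B) g N x c y" using c MN by (simp add: lhom_def reorders_def)
  show ?thesis
    using is_functor.fa_cmp[OF Str_functor larr_in_hom[OF Und_category \<alpha> NK c'] larr_in_hom[OF Und_category \<beta> MN d]]
      typed_tgt[OF \<beta>] typed_tgt[OF \<alpha>]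
    by (simp add: larr_cmp[OF \<beta> MN NK] str_arr_def)
qed

lemma str_perm_hom:
  assumes "typed T \<beta> g M j" "reorders M N" "\<And>l. l \<in> set M \<Longrightarrow> x l \<in> Obj (Und B (g l))"
  shows "in_hom (Und B j) (str_perm T B g \<beta> M N x) (str_obj T B (relab T \<beta> M N) (map x N)) (str_obj T B \<beta> (map x M))"
  unfolding str_perm_def by (rule str_arr_hom[OF assms(1,2) lhom_ide[OF assms(1,3)]])

text \<open>A symmetry has identity components, so functoriality of the structure map absorbs it.
  Together with the mirror image \<open>str_perm_str_arr\<close> this yields naturality of
  symmetries: both orders of composition equal one \<open>str_arr\<close>.\<close>

lemma str_arr_str_perm:
  assumes \<beta>: "typed T \<beta> g M j" and MN: "reorders M N" and NK: "reorders N K"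
    and d: "lhom (Und B) g M x d z"
  shows "Cmp (Und B j) (str_arr T B \<beta> M N x d z) (str_perm T B g (relab T \<beta> M N) N K x) = str_arr T B \<beta> M K x d z"
  unfolding str_perm_def
  by (subst str_arr_cmp[OF \<beta> MN NK d lhom_ide[OF \<beta> lhom_obj(1)[OF d \<beta>]]])
    (auto intro!: str_arr_cong reorders_trans[OF MN NK]
      category.cmp_ide_right[OF Und_category[OF typed_col[OF \<beta>]]] lhomD[OF d])

lemma str_perm_str_arr:
  assumes \<beta>: "typed T \<beta> g M j" and MN: "reorders M N" and NK: "reorders N K"
    and d: "lhom (Und B) g M x d z"
  shows "Cmp (Und B j) (str_perm T B g \<beta> M N z) (str_arr T B (relab T \<beta> M N) N K x d z) = str_arr T B \<beta> M K x d z"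
  unfolding str_perm_def
  by (subst str_arr_cmp[OF \<beta> MN NK lhom_ide[OF \<beta> lhom_obj(2)[OF d \<beta>]] d])
    (auto intro!: str_arr_cong reorders_trans[OF MN NK]
      category.cmp_ide_left[OF Und_category[OF typed_col[OF \<beta>]]] lhomD[OF d])

lemma str_perm_str_perm:
  assumes \<beta>: "typed T \<beta> g M j" and MN: "reorders M N" and NK: "reorders N K"
    and x: "\<And>l. l \<in> set M \<Longrightarrow> x l \<in> Obj (Und B (g l))"
  shows "Cmp (Und B j) (str_perm T B g \<beta> M N x) (str_perm T B g (relab T \<beta> M N) N K x) = str_perm T B g \<beta> M K x"
  using str_arr_str_perm[OF \<beta> MN NK lhom_ide[OF \<beta> x]] by (simp add: str_perm_def)

lemma str_obj_one: "j \<in> Col T \<Longrightarrow> x \<in> Obj (Und B j) \<Longrightarrow> str_obj T B (One T j) [x] = x"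
proof -
  assume j: "j \<in> Col T" and x: "x \<in> Obj (Und B j)"
  have "comp1 (Col T) (Und B) (Str B) (mon_unit T (Und B)) = id1 (Col T) (Und B)"
    using strict by (simp add: strict_algebra_def)
  from fun_cong[OF this, of j] have "FO (comp_func (Und B j) (Str B j) (mon_unit T (Und B) j)) x = x"
    using j x by (simp add: comp1_def id1_def id_func_def)
  then show ?thesis
    using j x by (simp add: comp_func_def compose_def mon_unit_def str_obj_def one_tgt)
qed

lemma str_arr_one:
  assumes j: "j \<in> Col T" and c: "in_hom (Und B j) (c l) (x l) (y l)"
  shows "str_arr T B (One T j) [l] [l] x c y = c l"
proof -
  have m: "c l \<in> Arr (Und B j)" using c by (simp add: in_hom_def)
  have "comp1 (Col T) (Und B) (Str B) (mon_unit T (Und B)) = id1 (Col T) (Und B)"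
    using strict by (simp add: strict_algebra_def)
  from fun_cong[OF this, of j]
  have "FA (comp_func (Und B j) (Str B j) (mon_unit T (Und B) j)) (c l) = c l"
    using j m by (simp add: comp1_def id1_def id_func_def)
  moreover have "larr T (One T j) [l] [l] (\<lambda>_. Dom (Und B j) (c l)) (\<lambda>_. c l) (\<lambda>_. Cod (Und B j) (c l)) =
      larr T (One T j) [l] [l] x c y"
    by (rule larr_cong) (use c in \<open>auto simp: in_hom_def\<close>)
  ultimately show ?thesis
    using j m mon_unit_larr[where X = "Und B", OF j m, of l] by (simp add: comp_func_def compose_def str_arr_def one_tgt)
qed

lemma mult_law:
  "comp1 (Col T) (mon_ob T (mon_ob T (Und B))) (Str B) (mon_mult T (Und B)) =
   comp1 (Col T) (mon_ob T (mon_ob T (Und B))) (Str B) (mon_1 T (mon_ob T (Und B)) (Str B))"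
  using strict by (simp add: strict_algebra_def)

lemma str_obj_sub:
  assumes \<alpha>: "typed T \<alpha> g M j" and \<beta>: "\<And>m. m \<in> set M \<Longrightarrow> typed T (\<beta> m) g' (L m) (g m)"
    and x: "\<And>m l. m \<in> set M \<Longrightarrow> l \<in> set (L m) \<Longrightarrow> x l \<in> Obj (Und B (g' l))"
  shows "str_obj T B \<alpha> (map (\<lambda>m. str_obj T B (\<beta> m) (map x (L m))) M) =
    str_obj T B (Sub T \<alpha> (map \<beta> M)) (map x (concat (map L M)))"
proof -
  have j: "j \<in> Col T" "Tgt T \<alpha> = j" using typed_tgt[OF \<alpha>] by auto
  have tgt: "Tgt T (Sub T \<alpha> (map \<beta> M)) = j" using typed_sub[OF \<alpha> \<beta>] by (simp add: typed_def)
  let ?z = "(\<alpha>, map (\<lambda>m. (\<beta> m, map x (L m))) M)"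
  have z: "?z \<in> Obj (mon_ob T (mon_ob T (Und B)) j)"
    by (rule mon_ob_ObjI[OF \<alpha>]) (rule mon_ob_ObjI[OF \<beta>], use x in auto)
  have "FO (Str B j) (mon_mult_obj T ?z) = FO (Str B j) (FO (mon_1 T (mon_ob T (Und B)) (Str B) j) ?z)"
    using arg_cong[OF fun_cong[OF mult_law, of j], of "\<lambda>G. FO G ?z"] z j
    by (simp add: comp1_def comp_func_def compose_def mon_mult_def)
  moreover have "map (\<lambda>m. FO (Str B (g m)) (\<beta> m, map x (L m))) M = map (\<lambda>m. str_obj T B (\<beta> m) (map x (L m))) M"
    using \<beta> by (auto simp: str_obj_def typed_def)
  ultimately show ?thesis
    unfolding mon_mult_obj_map mon_1_obj[OF \<alpha> j(1) z] by (simp add: str_obj_def j tgt)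
qed

text \<open>The multiplication law of a strict algebra at a labelled arrow of \<open>TTB\<close>.
  Multiplying first concatenates the labels; the other side applies the structure map inside every
  block and then outside.\<close>

lemma str_arr_sub:
  assumes \<alpha>: "typed T \<alpha> g M j" and \<beta>: "\<And>m. m \<in> set M \<Longrightarrow> typed T (\<beta> m) g' (L m) (g m)"
    and MN: "reorders M N" and LK: "\<And>m. m \<in> set M \<Longrightarrow> reorders (L m) (K m)"
    and dist: "distinct (concat (map L M))"
    and c: "\<And>m. m \<in> set M \<Longrightarrow> lhom (Und B) g' (L m) x c y"
  shows "str_arr T B \<alpha> M N (\<lambda>m. str_obj T B (relab T (\<beta> m) (L m) (K m)) (map x (K m)))
      (\<lambda>m. str_arr T B (\<beta> m) (L m) (K m) x c y) (\<lambda>m. str_obj T B (\<beta> m) (map y (L m))) =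
    str_arr T B (Sub T \<alpha> (map \<beta> M)) (concat (map L M)) (concat (map K N)) x c y"
proof -
  have j: "j \<in> Col T" "Tgt T \<alpha> = j" using typed_tgt[OF \<alpha>] by auto
  have tgt: "Tgt T (Sub T \<alpha> (map \<beta> M)) = j" using typed_sub[OF \<alpha> \<beta>] by (simp add: typed_def)
  let ?m = "larr T \<alpha> M N (\<lambda>m. (relab T (\<beta> m) (L m) (K m), map x (K m)))
      (\<lambda>m. larr T (\<beta> m) (L m) (K m) x c y) (\<lambda>m. (\<beta> m, map y (L m)))"
  have "lhom (mon_ob T (Und B)) g M (\<lambda>m. (relab T (\<beta> m) (L m) (K m), map x (K m)))
      (\<lambda>m. larr T (\<beta> m) (L m) (K m) x c y) (\<lambda>m. (\<beta> m, map y (L m)))"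
    unfolding lhom_def using larr_in_hom[OF Und_category \<beta> LK c] by blast
  from larr_in_hom[OF mon_category \<alpha> MN this]
  have m: "?m \<in> Arr (mon_ob T (mon_ob T (Und B)) j)"
    by (simp add: in_hom_def)
  have "FA (Str B j) (FA (mon_mult T (Und B) j) ?m) =
      FA (Str B j) (FA (mon_1 T (mon_ob T (Und B)) (Str B) j) ?m)"
    using arg_cong[OF fun_cong[OF mult_law, of j], of "\<lambda>G. FA G ?m"] m j
    by (simp add: comp1_def comp_func_def compose_def)
  moreover have "FA (mon_1 T (mon_ob T (Und B)) (Str B) j) ?m =
      larr T \<alpha> M N (\<lambda>m. str_obj T B (relab T (\<beta> m) (L m) (K m)) (map x (K m)))
      (\<lambda>m. str_arr T B (\<beta> m) (L m) (K m) x c y) (\<lambda>m. str_obj T B (\<beta> m) (map y (L m)))"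
    unfolding mon_1_larr[OF \<alpha> j(1) m MN]
    by (rule larr_cong[OF MN]) (use \<beta> typed_relab[OF \<beta> LK] in \<open>auto simp: str_obj_def str_arr_def typed_def\<close>)
  ultimately show ?thesis
    using mon_mult_larr[OF \<alpha> \<beta> MN LK dist j(1) m] by (simp add: str_arr_def j tgt)
qed

text \<open>\<open>str_arr_sub\<close> with identities inside the blocks. A symmetry between
  composite objects thereby becomes a symmetry of their constituents that moves whole
  blocks.\<close>

lemma str_perm_sub:
  assumes \<alpha>: "typed T \<alpha> g M j" and \<beta>: "\<And>m. m \<in> set M \<Longrightarrow> typed T (\<beta> m) g' (L m) (g m)"
    and MN: "reorders M N" and dist: "distinct (concat (map L M))"
    and x: "\<And>m l. m \<in> set M \<Longrightarrow> l \<in> set (L m) \<Longrightarrow> x l \<in> Obj (Und B (g' l))"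
  shows "str_perm T B g \<alpha> M N (\<lambda>m. str_obj T B (\<beta> m) (map x (L m))) =
    str_perm T B g' (Sub T \<alpha> (map \<beta> M)) (concat (map L M)) (concat (map L N)) x"
proof -
  have L: "distinct (L m)" if "m \<in> set M" for m by (rule distinct_concat_mapD[OF dist that])
  have "str_perm T B g \<alpha> M N (\<lambda>m. str_obj T B (\<beta> m) (map x (L m))) =
    str_arr T B \<alpha> M N (\<lambda>m. str_obj T B (relab T (\<beta> m) (L m) (L m)) (map x (L m)))
      (\<lambda>m. str_arr T B (\<beta> m) (L m) (L m) x (\<lambda>l. Ide (Und B (g' l)) (x l)) x) (\<lambda>m. str_obj T B (\<beta> m) (map x (L m)))"
    unfolding str_perm_def
    by (rule str_arr_cong[OF MN]) (simp add: relab_self[OF \<beta> L] str_arr_ide[OF \<beta> L x])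
  also have "\<dots> = str_perm T B g' (Sub T \<alpha> (map \<beta> M)) (concat (map L M)) (concat (map L N)) x"
    unfolding str_perm_def by (rule str_arr_sub[OF \<alpha> \<beta> MN _ dist lhom_ide[OF \<beta> x]]) (use L in auto)
  finally show ?thesis .
qed

lemma str_arr_str_perm_sub:
  assumes \<alpha>: "typed T \<alpha> g M j" and \<beta>: "\<And>m. m \<in> set M \<Longrightarrow> typed T (\<beta> m) g' (L m) (g m)"
    and MN: "reorders M N" and LK: "\<And>m. m \<in> set M \<Longrightarrow> reorders (L m) (K m)"
    and dist: "distinct (concat (map L M))"
    and x: "\<And>m l. m \<in> set M \<Longrightarrow> l \<in> set (L m) \<Longrightarrow> x l \<in> Obj (Und B (g' l))"
  shows "str_arr T B \<alpha> M N (\<lambda>m. str_obj T B (relab T (\<beta> m) (L m) (K m)) (map x (K m)))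
      (\<lambda>m. str_perm T B g' (\<beta> m) (L m) (K m) x) (\<lambda>m. str_obj T B (\<beta> m) (map x (L m))) =
    str_perm T B g' (Sub T \<alpha> (map \<beta> M)) (concat (map L M)) (concat (map K N)) x"
  unfolding str_perm_def by (rule str_arr_sub[OF \<alpha> \<beta> MN LK dist lhom_ide[OF \<beta> x]])

end

text \<open>The bridge between \<open>down\<close>, which speaks of fibres of a function of
  positions, and the labelled description of arrows.\<close>

lemma map_nth_fibre_pos:
  assumes "distinct L2" "q < length L2" "\<And>l. l \<in> set L1 \<Longrightarrow> h l \<in> set L2"
    "\<And>p. p < length L1 \<Longrightarrow> hh p = pos L2 (h (L1 ! p))"
  shows "map ((!) L1) (fibre (length L1) hh q) = fib L1 h (L2 ! q)"
proof -
  have "fibre (length L1) hh q = fib [0..<length L1] (\<lambda>p. pos L2 (h (L1 ! p))) q"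
    unfolding fibre_eq_fib by (rule fib_cong) (use assms(4) in auto)
  then show ?thesis
    using map_nth_fib[of L1 "\<lambda>l. pos L2 (h l)" q] fib_pos[where h = h, OF assms(1-3)] by simp
qed

lemma map_nth_map: "(\<And>p. p \<in> set P \<Longrightarrow> p < length L) \<Longrightarrow> map ((!) (map g L)) P = map g (map ((!) L) P)"
  by auto

lemma cfib_pos_map:
  assumes "set W \<subseteq> set L2" "\<And>l. l \<in> set X \<Longrightarrow> h l \<in> set L2"
  shows "cfib X (\<lambda>l. pos L2 (h l)) (map (pos L2) W) = cfib X h W"
proof -
  have "fib X (\<lambda>l. pos L2 (h l)) (pos L2 w) = fib X h w" if "w \<in> set W" for w
    by (rule fib_cong) (use assms that pos_inj in fastforce)
  then show ?thesis by (simp add: cfib_def cong: map_cong)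
qed

section \<open>The category \<open>F \<down> j\<close>\<close>

text \<open>The source operation of a morphism of \<open>F \<down> j\<close> is determined by its other data.\<close>

definition dsrc :: "('j, 't) opd \<Rightarrow> ('s \<Rightarrow> 't) \<Rightarrow> 'l list \<Rightarrow> 'm list \<Rightarrow> ('l \<Rightarrow> 'm) \<Rightarrow> ('m \<Rightarrow> 's) \<Rightarrow> 't \<Rightarrow> 't" where
  "dsrc T F L1 L2 h b \<alpha> = relab T (Sub T \<alpha> (map (\<lambda>k. F (b k)) L2)) (cfib L1 h L2) L1"

text \<open>An arrow presented by labels. Source and target may use different label types, so that
  one side can be tagged by blocks while the other keeps its labels, or is a singleton labelled by
  \<open>()\<close>.\<close>

definition darr :: "('j, 't) opd \<Rightarrow> ('s \<Rightarrow> 't) \<Rightarrow> 'l list \<Rightarrow> ('l \<Rightarrow> 'i) \<Rightarrow> 'm list \<Rightarrow> ('m \<Rightarrow> 'i)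
    \<Rightarrow> 't \<Rightarrow> ('l \<Rightarrow> 'm) \<Rightarrow> ('m \<Rightarrow> 's) \<Rightarrow> ('i, 's, 't) darr" where
  "darr T F L1 i1 L2 i2 \<alpha> h b =
     ((map i1 L1, dsrc T F L1 L2 h b \<alpha>),
      (\<lambda>p\<in>{..<length L1}. pos L2 (h (L1 ! p)), map b L2),
      (map i2 L2, \<alpha>))"

definition dmor :: "('i, 's) opd \<Rightarrow> 'l list \<Rightarrow> ('l \<Rightarrow> 'i) \<Rightarrow> 'm list \<Rightarrow> ('m \<Rightarrow> 'i)
    \<Rightarrow> ('l \<Rightarrow> 'm) \<Rightarrow> ('m \<Rightarrow> 's) \<Rightarrow> bool" where
  "dmor S L1 i1 L2 i2 h b \<longleftrightarrow> distinct L1 \<and> distinct L2 \<and> (\<forall>l\<in>set L1. h l \<in> set L2) \<and>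
     (\<forall>k\<in>set L2. typed S (b k) i1 (fib L1 h k) (i2 k))"

definition dob :: "('i, 's) opd \<Rightarrow> ('j, 't) opd \<Rightarrow> ('i \<Rightarrow> 'j) \<Rightarrow> 'l list \<Rightarrow> ('l \<Rightarrow> 'i) \<Rightarrow> 't \<Rightarrow> 'j \<Rightarrow> bool" where
  "dob S T f L i \<alpha> j \<longleftrightarrow> distinct L \<and> (\<forall>l\<in>set L. i l \<in> Col S) \<and> typed T \<alpha> (\<lambda>l. f (i l)) L j"

lemma dmorD:
  assumes "dmor S L1 i1 L2 i2 h b"
  shows "distinct L1" "distinct L2" "\<And>l. l \<in> set L1 \<Longrightarrow> h l \<in> set L2"
    "\<And>k. k \<in> set L2 \<Longrightarrow> typed S (b k) i1 (fib L1 h k) (i2 k)" "reorders (cfib L1 h L2) L1"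
  using assms by (auto simp: dmor_def intro: reorders_cfib)

lemma dobD:
  assumes "dob S T f L i \<alpha> j"
  shows "distinct L" "\<And>l. l \<in> set L \<Longrightarrow> i l \<in> Col S" "typed T \<alpha> (\<lambda>l. f (i l)) L j"
  using assms by (auto simp: dob_def)

lemma darr_cong:
  assumes "\<And>l. l \<in> set L1 \<Longrightarrow> i1 l = i1' l \<and> h l = h' l" "\<And>k. k \<in> set L2 \<Longrightarrow> i2 k = i2' k \<and> b k = b' k"
  shows "darr T F L1 i1 L2 i2 \<alpha> h b = darr T F L1 i1' L2 i2' \<alpha> h' b'"
proof -
  have "cfib L1 h L2 = cfib L1 h' L2"
    using assms(1) by (auto simp: cfib_def intro!: arg_cong[of _ _ concat] fib_cong)
  moreover have "map (\<lambda>k. F (b k)) L2 = map (\<lambda>k. F (b' k)) L2"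
    using assms by auto
  ultimately have "dsrc T F L1 L2 h b \<alpha> = dsrc T F L1 L2 h' b' \<alpha>"
    by (simp only: dsrc_def)
  then show ?thesis
    using assms by (auto simp: darr_def restrict_def fun_eq_iff)
qed

text \<open>Serves to tag the sources in a family of arrows; when an arrow is put in labelled form,
  its target labels are prescribed but its source labels are still free.\<close>

lemma darr_map_src:
  assumes e: "inj_on e (set L1)" and re: "reorders (cfib L1 (\<lambda>l. h (e l)) L2) L1"
  shows "darr T F (map e L1) i1 L2 i2 \<alpha> h b = darr T F L1 (\<lambda>l. i1 (e l)) L2 i2 \<alpha> (\<lambda>l. h (e l)) b"
proof -
  have "fib (map e L1) h = (\<lambda>k. map e (fib L1 (\<lambda>l. h (e l)) k))"
    by (rule ext) (simp add: fib_map comp_def)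
  then have cf: "cfib (map e L1) h L2 = map e (cfib L1 (\<lambda>l. h (e l)) L2)"
    by (simp add: cfib_def map_concat comp_def)
  have "inj_on e (set (cfib L1 (\<lambda>l. h (e l)) L2))"
    by (rule inj_on_subset[OF e]) auto
  then show ?thesis
    using relab_map[OF _ re] by (auto simp: darr_def dsrc_def cf restrict_def fun_eq_iff comp_def)
qed

locale opmor = S: operad S + T: operad T + operad_morphism S T f F
  for S :: "('i, 's) opd" and T :: "('j, 't) opd" and f :: "'i \<Rightarrow> 'j" and F :: "'s \<Rightarrow> 't"
begin

lemma F_typed: "typed S \<alpha> g M i \<Longrightarrow> typed T (F \<alpha>) (\<lambda>l. f (g l)) M (f i)"
  using ops_map src_map tgt_map by (auto simp: typed_def comp_def)

lemma F_relab:
  assumes "typed S \<alpha> g M i" "reorders M N"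
  shows "F (relab S \<alpha> M N) = relab T (F \<alpha>) M N"
proof -
  have "reord M N permutes {..<arity S \<alpha>}"
    using reord_permutes[OF assms(2)] typed_arity[OF assms(1)] by simp
  then show ?thesis using assms act_map by (simp add: relab_def typed_def)
qed

lemma F_sub:
  assumes "typed S \<alpha> g M i" "\<And>m. m \<in> set M \<Longrightarrow> typed S (\<beta> m) g' (L m) (g m)"
  shows "F (Sub S \<alpha> (map \<beta> M)) = Sub T (F \<alpha>) (map (\<lambda>m. F (\<beta> m)) M)"
  using sub_map[OF S.typed_composable[where \<beta> = \<beta>, OF assms]] by (simp add: comp_def)

text \<open>Decorations are composed in \<open>S\<close>, while the equation between source and
  target operations lives in \<open>T\<close>; this transports the former to the latter.\<close>

lemma F_dcmp:
  assumes "typed S (b2 k) g2 (fib L2 h2 k) j" "distinct L1" "distinct L2"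
    "\<And>l. l \<in> set L1 \<Longrightarrow> h1 l \<in> set L2"
    "\<And>l. l \<in> set L2 \<Longrightarrow> h2 l = k \<Longrightarrow> typed S (b1 l) g1 (fib L1 h1 l) (g2 l)"
  shows "F (dcmp S L1 L2 h1 h2 b2 b1 k) = dcmp T L1 L2 h1 h2 (\<lambda>k. F (b2 k)) (\<lambda>l. F (b1 l)) k"
proof -
  have b1: "typed S (b1 l) g1 (fib L1 h1 l) (g2 l)" if "l \<in> set (fib L2 h2 k)" for l
    using assms(5) that by simp
  have "typed S (Sub S (b2 k) (map b1 (fib L2 h2 k))) g1 (cfib L1 h1 (fib L2 h2 k)) j"
    unfolding cfib_def by (rule S.typed_sub[OF assms(1) b1])
  moreover have "reorders (cfib L1 h1 (fib L2 h2 k)) (fib L1 (\<lambda>l. h2 (h1 l)) k)"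
    by (rule reorders_cfib_fib[OF assms(2-4)])
  ultimately have "F (relab S (Sub S (b2 k) (map b1 (fib L2 h2 k))) (cfib L1 h1 (fib L2 h2 k))
      (fib L1 (\<lambda>l. h2 (h1 l)) k)) = relab T (F (Sub S (b2 k) (map b1 (fib L2 h2 k))))
      (cfib L1 h1 (fib L2 h2 k)) (fib L1 (\<lambda>l. h2 (h1 l)) k)"
    by (rule F_relab)
  then show ?thesis
    using F_sub[OF assms(1) b1] by (simp add: dcmp_def)
qed

abbreviation "D \<equiv> down S T f F"

lemma dsrc_typed:
  assumes m: "dmor S L1 i1 L2 i2 h b" and o: "dob S T f L2 i2 \<alpha> j"
  shows "typed T (Sub T \<alpha> (map (\<lambda>k. F (b k)) L2)) (\<lambda>l. f (i1 l)) (cfib L1 h L2) j"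
  unfolding cfib_def by (rule T.typed_sub[OF dobD(3)[OF o]]) (rule F_typed[OF dmorD(4)[OF m]])

lemma dsrc_dob:
  assumes m: "dmor S L1 i1 L2 i2 h b" and o: "dob S T f L2 i2 \<alpha> j"
  shows "dob S T f L1 i1 (dsrc T F L1 L2 h b \<alpha>) j"
  unfolding dob_def
proof (intro conjI ballI)
  show "distinct L1" by (rule dmorD[OF m])
  show "i1 l \<in> Col S" if "l \<in> set L1" for l
    using S.typed_col[OF dmorD(4)[OF m dmorD(3)[OF m that]]] that by simp
  show "typed T (dsrc T F L1 L2 h b \<alpha>) (\<lambda>l. f (i1 l)) L1 j"
    unfolding dsrc_def by (rule T.typed_relab[OF dsrc_typed[OF m o] dmorD(5)[OF m]])
qed

lemma D_Obj: "(map i L, \<alpha>) \<in> Obj (D j) \<longleftrightarrow> (\<forall>l\<in>set L. i l \<in> Col S) \<and> typed T \<alpha> (\<lambda>l. f (i l)) L j"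
  by (auto simp: down_def cat_of_homs_def typed_def comp_def)

lemma dob_Obj: "dob S T f L i \<alpha> j \<Longrightarrow> (map i L, \<alpha>) \<in> Obj (D j)"
  by (simp add: D_Obj dob_def)

lemma D_sel: "Dom (D j) m = fst m" "Cod (D j) m = snd (snd m)"
  by (simp_all add: down_def cat_of_homs_def split: prod.splits)

text \<open>The equation required of an arrow holds by the choice of \<open>dsrc\<close>, once the
  bijective part of the indexing function is recognised as the passage from
  \<open>cfib L1 h L2\<close> to \<open>L1\<close>.\<close>

lemma darr_hom:
  assumes m: "dmor S L1 i1 L2 i2 h b" and o: "dob S T f L2 i2 \<alpha> j"
  shows "in_hom (D j) (darr T F L1 i1 L2 i2 \<alpha> h b) (map i1 L1, dsrc T F L1 L2 h b \<alpha>) (map i2 L2, \<alpha>)"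
proof -
  note d = dmorD[OF m]
  let ?hh = "\<lambda>p\<in>{..<length L1}. pos L2 (h (L1 ! p))"
  have "map b L2 ! q \<in> Ops S \<and>
      Src S (map b L2 ! q) = map ((!) (map i1 L1)) (fibre (length L1) ?hh q) \<and>
      Tgt S (map b L2 ! q) = map i2 L2 ! q" if q: "q < length L2" for q
  proof -
    have "map ((!) (map i1 L1)) (fibre (length L1) ?hh q) = map i1 (map ((!) L1) (fibre (length L1) ?hh q))"
      by (rule map_nth_map) (auto simp: fibre_def)
    also have "\<dots> = map i1 (fib L1 h (L2 ! q))"
      using map_nth_fibre_pos[where h = h and hh = ?hh, OF d(2) q d(3)] by simp
    finally show ?thesis using d(4)[of "L2 ! q"] q by (simp add: typed_def)
  qed
  moreover have "bij_part (length L1) ?hh = reord (cfib L1 h L2) L1"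
    by (rule bij_part_pos) (use d in auto)
  moreover have "?hh \<in> {..<length L1} \<rightarrow>\<^sub>E {..<length L2}" using d by auto
  moreover have "(map i1 L1, dsrc T F L1 L2 h b \<alpha>) \<in> Obj (D j)" "(map i2 L2, \<alpha>) \<in> Obj (D j)"
    using dob_Obj[OF o] dob_Obj[OF dsrc_dob[OF m o]] by auto
  ultimately show ?thesis
    by (simp add: in_hom_def down_def cat_of_homs_def darr_def dsrc_def relab_def comp_def)
qed

lemma D_ObjE:
  assumes "a \<in> Obj (D j)"
  shows "\<exists>i n \<alpha>. a = (map i [0..<n], \<alpha>) \<and> dob S T f [0..<n] i \<alpha> j"
proof -
  obtain "is" \<alpha> where a: "a = (is, \<alpha>)" by fastforce
  have "a = (map ((!) is) [0..<length is], \<alpha>)" by (simp add: a map_nth)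
  moreover have "dob S T f [0..<length is] ((!) is) \<alpha> j"
    using assms by (auto simp: dob_def a down_def cat_of_homs_def typed_def map_nth
        intro!: nth_equalityI)
  ultimately show ?thesis by blast
qed

text \<open>Labels of the target are given in advance and those of the source are positions.
  \<open>h\<close> and \<open>b\<close> are the stored function and list transported along the
  positions in \<open>L2\<close>; the source operation has no freedom left, so it must be
  \<open>dsrc\<close>.\<close>

lemma darrE:
  assumes m: "in_hom (D j) m a (map i2 L2, \<alpha>)" and L2: "distinct L2"
  shows "\<exists>n i1 h b. m = darr T F [0..<n] i1 L2 i2 \<alpha> h b \<and>
    a = (map i1 [0..<n], dsrc T F [0..<n] L2 h b \<alpha>) \<and> dmor S [0..<n] i1 L2 i2 h b"
proof -
  obtain is1 \<alpha>1 hh bs where m': "m = ((is1, \<alpha>1), (hh, bs), (map i2 L2, \<alpha>))" and a: "a = (is1, \<alpha>1)"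
    using m by (cases m; cases a) (auto simp: in_hom_def D_sel)
  have 1: "hh \<in> {..<length is1} \<rightarrow>\<^sub>E {..<length L2}" "length bs = length L2"
    "\<And>q. q < length L2 \<Longrightarrow> bs ! q \<in> Ops S \<and> Src S (bs ! q) = map ((!) is1) (fibre (length is1) hh q) \<and>
      Tgt S (bs ! q) = i2 (L2 ! q)"
    "Act T (Sub T \<alpha> (map F bs)) (bij_part (length is1) hh) = \<alpha>1"
    using m by (auto simp: in_hom_def down_def cat_of_homs_def m')
  let ?n = "length is1"
  define h b where "h = (\<lambda>p. L2 ! hh p)" and "b = (\<lambda>k. bs ! pos L2 k)"
  have hh: "hh p < length L2" if "p < ?n" for p using 1(1) that by auto
  have bs: "map b L2 = bs" using 1(2) L2 by (auto simp: b_def intro!: nth_equalityI)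
  have fib: "fibre ?n hh (pos L2 k) = fib [0..<?n] h k" if "k \<in> set L2" for k
    unfolding fibre_eq_fib by (rule fib_cong) (use hh that L2 in \<open>auto simp: h_def\<close>)
  have dm: "dmor S [0..<?n] ((!) is1) L2 i2 h b"
    using 1(3) L2 hh fib by (auto simp: dmor_def typed_def b_def h_def)
  have bp: "bij_part (length [0..<?n]) hh = reord (cfib [0..<?n] h L2) [0..<?n]"
    by (rule bij_part_pos) (use L2 hh in \<open>auto simp: h_def\<close>)
  have \<alpha>1: "\<alpha>1 = dsrc T F [0..<?n] L2 h b \<alpha>"
    using 1(4) bp bs by (auto simp: dsrc_def relab_def simp flip: map_map[unfolded comp_def])
  have "hh = (\<lambda>p\<in>{..<?n}. pos L2 (h ([0..<?n] ! p)))"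
    using 1(1) L2 hh by (auto simp: h_def fun_eq_iff PiE_def extensional_def)
  then have "m = darr T F [0..<?n] ((!) is1) L2 i2 \<alpha> h b"
    by (simp add: darr_def m' bs \<alpha>1[symmetric] map_nth)
  moreover have "a = (map ((!) is1) [0..<?n], dsrc T F [0..<?n] L2 h b \<alpha>)"
    by (simp add: a map_nth \<alpha>1[symmetric])
  ultimately show ?thesis using dm by blast
qed

lemma dcmp_typed:
  assumes m1: "dmor S L1 i1 L2 i2 h1 b1" and m2: "dmor S L2 i2 L3 i3 h2 b2" and k: "k \<in> set L3"
  shows "typed S (dcmp S L1 L2 h1 h2 b2 b1 k) i1 (fib L1 (\<lambda>l. h2 (h1 l)) k) (i3 k)"
  by (rule S.typed_dcmp[where ?g2.0 = i2])
    (use dmorD[OF m1] dmorD[OF m2] k in auto)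

lemma dmor_cmp:
  assumes m1: "dmor S L1 i1 L2 i2 h1 b1" and m2: "dmor S L2 i2 L3 i3 h2 b2"
  shows "dmor S L1 i1 L3 i3 (\<lambda>l. h2 (h1 l)) (dcmp S L1 L2 h1 h2 b2 b1)"
  using dmorD[OF m1] dmorD[OF m2] dcmp_typed[OF m1 m2] by (auto simp: dmor_def)

text \<open>This is \<open>sub_dcmp\<close> in \<open>T\<close>, after \<open>F\<close> has been
  moved inside the composed decorations.\<close>

lemma dsrc_cmp:
  assumes m1: "dmor S L1 i1 L2 i2 h1 b1" and m2: "dmor S L2 i2 L3 i3 h2 b2"
    and o: "dob S T f L3 i3 \<alpha> j"
  shows "dsrc T F L1 L3 (\<lambda>l. h2 (h1 l)) (dcmp S L1 L2 h1 h2 b2 b1) \<alpha> =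
    dsrc T F L1 L2 h1 b1 (dsrc T F L2 L3 h2 b2 \<alpha>)"
proof -
  note d1 = dmorD[OF m1] and d2 = dmorD[OF m2]
  have "map (\<lambda>k. F (dcmp S L1 L2 h1 h2 b2 b1 k)) L3 =
      map (dcmp T L1 L2 h1 h2 (\<lambda>k. F (b2 k)) (\<lambda>l. F (b1 l))) L3"
    using d1 d2 by (auto intro!: F_dcmp[where ?g2.0 = i2])
  then show ?thesis
    unfolding dsrc_def
    by (simp only:) (rule T.sub_dcmp[OF dobD(3)[OF o], where ?g2.0 = "\<lambda>l. f (i2 l)" and ?g1.0 = "\<lambda>l. f (i1 l)"],
        use d1 d2 F_typed[OF d1(4)] F_typed[OF d2(4)] in auto)
qed

text \<open>In \<open>down\<close> each composed decoration is permuted by the bijective part of a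
  restriction of the first indexing function, expressed by positions of positions. On labels that is
  the \<open>relab\<close> contained in \<open>dcmp\<close>.\<close>

lemma darr_cmp:
  assumes m1: "dmor S L1 i1 L2 i2 h1 b1" and m2: "dmor S L2 i2 L3 i3 h2 b2"
    and o: "dob S T f L3 i3 \<alpha> j"
  shows "Cmp (D j) (darr T F L2 i2 L3 i3 \<alpha> h2 b2) (darr T F L1 i1 L2 i2 (dsrc T F L2 L3 h2 b2 \<alpha>) h1 b1) =
    darr T F L1 i1 L3 i3 \<alpha> (\<lambda>l. h2 (h1 l)) (dcmp S L1 L2 h1 h2 b2 b1)"
proof -
  note d1 = dmorD[OF m1] and d2 = dmorD[OF m2]
  define hh1 where "hh1 = (\<lambda>p\<in>{..<length L1}. pos L2 (h1 (L1 ! p)))"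
  define hh2 where "hh2 = (\<lambda>p\<in>{..<length L2}. pos L3 (h2 (L2 ! p)))"
  have hh1: "hh1 p = pos L2 (h1 (L1 ! p))" if "p < length L1" for p using that by (simp add: hh1_def)
  have hh2: "hh2 p = pos L3 (h2 (L2 ! p))" if "p < length L2" for p using that by (simp add: hh2_def)
  let ?h21 = "\<lambda>l. h2 (h1 l)"
  have h21: "hh2 (hh1 p) = pos L3 (?h21 (L1 ! p))" if "p < length L1" for p
    using that d1 by (simp add: hh1 hh2)
  have "compose {..<length L1} hh2 hh1 = (\<lambda>p\<in>{..<length L1}. pos L3 (?h21 (L1 ! p)))"
  proof
    fix p
    show "compose {..<length L1} hh2 hh1 p = (\<lambda>p\<in>{..<length L1}. pos L3 (?h21 (L1 ! p))) p"
      using d1(3)[of "L1 ! p"] by (cases "p < length L1") (simp_all add: compose_def hh1 hh2)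
  qed
  moreover have "(let L = fibre (length L1) (\<lambda>k. hh2 (hh1 k)) q
      in Act S (Sub S (map b2 L3 ! q) (map ((!) (map b1 L2)) (fibre (length L2) hh2 q)))
           (bij_part (length L) (\<lambda>p. hh1 (L ! p)))) = dcmp S L1 L2 h1 h2 b2 b1 (L3 ! q)"
    if q: "q < length L3" for q
  proof -
    let ?k = "L3 ! q"
    define L where "L = fibre (length L1) (\<lambda>k. hh2 (hh1 k)) q"
    define X where "X = fib L1 ?h21 ?k"
    define W where "W = fib L2 h2 ?k"
    define V where "V = fibre (length L2) hh2 q"
    have X: "map ((!) L1) L = X"
      unfolding L_def X_def by (rule map_nth_fibre_pos) (use d1 d2 q h21 in auto)
    have V: "map ((!) L2) V = W"
      unfolding V_def W_def by (rule map_nth_fibre_pos) (use d2 q hh2 in auto)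
    have V_lt: "p < length L2" if "p \<in> set V" for p using that by (auto simp: V_def fibre_def)
    have VW: "V = map (pos L2) W"
      unfolding V[symmetric] using V_lt d2(1) by (auto intro: map_idI[symmetric])
    have "map ((!) (map b1 L2)) V = map b1 W"
      unfolding V[symmetric] by (rule map_nth_map[OF V_lt])
    moreover have "bij_part (length L) (\<lambda>p. hh1 (L ! p)) = reord (cfib L1 h1 W) X"
    proof -
      have "length L = length X" using X by auto
      have L_lt: "p < length L1" if "p \<in> set L" for p using that by (auto simp: L_def fibre_def)
      have "L ! p < length L1" if "p < length X" for p
        by (rule L_lt) (use that \<open>length L = length X\<close> in simp)
      moreover have "L1 ! (L ! p) = X ! p" if "p < length X" for p
        using that unfolding X[symmetric] by simp
      ultimately have "bij_part (length L) (\<lambda>p. hh1 (L ! p)) = bij_part (length X) (\<lambda>p. pos L2 (h1 (X ! p)))"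
        unfolding \<open>length L = length X\<close> by (intro bij_part_cong) (simp add: hh1)
      \<comment> \<open>The restricted codomain \<open>V\<close> is increasing because it is
        filtered from \<open>[0..<length L2]\<close>, but it is in general no initial segment; hence
        the freedom of \<open>V\<close> in \<open>bij_part_list\<close>.\<close>
      also have "\<dots> = reord (cfib X (\<lambda>l. pos L2 (h1 l)) V) X"
      proof (rule bij_part_list)
        show "distinct X" using d1 by (simp add: X_def)
        show "sorted V" unfolding V_def fibre_def by (rule sorted_wrt_filter) (rule sorted_upt)
        show "distinct V" by (simp add: V_def fibre_def)
        show "pos L2 (h1 l) \<in> set V" if "l \<in> set X" for l
          using that d1 by (auto simp: VW X_def W_def)
      qed
      also have "cfib X (\<lambda>l. pos L2 (h1 l)) V = cfib X h1 W"
        unfolding VW by (rule cfib_pos_map) (use d1 in \<open>auto simp: W_def X_def\<close>)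
      \<comment> \<open>A label of \<open>L1\<close> that \<open>h1\<close> sends into
        \<open>W\<close> lies in the fibre \<open>X\<close> already, so restricting the source loses
        nothing.\<close>
      also have "cfib X h1 W = cfib L1 h1 W"
        unfolding cfib_def X_def W_def by (auto intro!: arg_cong[of _ _ concat] fib_fib)
      finally show ?thesis .
    qed
    ultimately show ?thesis
      unfolding Let_def L_def[symmetric] V_def[symmetric] nth_map[OF q] dcmp_def relab_def
        X_def[symmetric] W_def[symmetric] by (simp only:)
  qed
  ultimately show ?thesis
    unfolding darr_def dsrc_cmp[OF m1 m2 o] hh1_def[symmetric] hh2_def[symmetric]
    by (auto simp: down_def cat_of_homs_def intro!: nth_equalityI)
qed

section \<open>Identities and the category laws of \<open>F \<down> j\<close>\<close>

lemma dmor_ide: "dob S T f L i \<alpha> j \<Longrightarrow> dmor S L i L i (\<lambda>l. l) (\<lambda>l. One S (i l))"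
  by (auto simp: dmor_def dob_def fib_id intro: S.typed_one)

lemma dsrc_ide:
  assumes o: "dob S T f L i \<alpha> j"
  shows "dsrc T F L L (\<lambda>l. l) (\<lambda>l. One S (i l)) \<alpha> = \<alpha>"
proof -
  have "map (\<lambda>k. F (One S (i k))) L = map (\<lambda>k. One T (f (i k))) L"
    using dobD[OF o] one_map by auto
  then have "Sub T \<alpha> (map (\<lambda>k. F (One S (i k))) L) = \<alpha>"
    using T.sub_one_r[OF dobD(3)[OF o]] by (simp only:)
  then show ?thesis
    using dobD[OF o] by (simp add: dsrc_def cfib_id T.relab_self[OF dobD(3)[OF o]])
qed

lemma darr_ide:
  assumes o: "dob S T f L i \<alpha> j"
  shows "Ide (D j) (map i L, \<alpha>) = darr T F L i L i \<alpha> (\<lambda>l. l) (\<lambda>l. One S (i l))"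
  using dobD[OF o] by (auto simp: darr_def dsrc_ide[OF o] down_def cat_of_homs_def restrict_def fun_eq_iff)

text \<open>The middle list \<open>L\<close> is allowed to be a reordering of \<open>L2\<close>, so
  that composites with a symmetry are covered along with composites with an identity.\<close>

lemma dcmp_one_left:
  assumes m: "dmor S L1 i1 L2 i2 h b" and k: "k \<in> set L2" and L: "reorders L2 L"
  shows "dcmp S L1 L h (\<lambda>l. l) (\<lambda>l. One S (i2 l)) b k = b k"
proof -
  have "k \<in> set L" "distinct L" using k L by (auto simp: reorders_def)
  then show ?thesis
    using dmorD(1)[OF m] S.sub_one_l[OF dmorD(4)[OF m k]] S.relab_self[OF dmorD(4)[OF m k]]
    by (simp add: dcmp_def fib_id cfib_def)
qed

lemma dcmp_one_right:
  assumes m: "dmor S L1 i1 L2 i2 h b" and k: "k \<in> set L2"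
  shows "dcmp S L1 L1 (\<lambda>l. l) h b (\<lambda>l. One S (i1 l)) k = b k"
  using dmorD(1)[OF m] S.sub_one_r[OF dmorD(4)[OF m k]] S.relab_self[OF dmorD(4)[OF m k]]
  by (simp add: dcmp_def cfib_id subset_iff)

lemma D_category: "category (D j)"
proof
  show "Dom (D j) m \<in> Obj (D j)" "Cod (D j) m \<in> Obj (D j)" if "m \<in> Arr (D j)" for m
    using that by (auto simp: down_def cat_of_homs_def)
next
  fix a assume "a \<in> Obj (D j)"
  from D_ObjE[OF this] obtain i n \<alpha> where a: "a = (map i [0..<n], \<alpha>)" and o: "dob S T f [0..<n] i \<alpha> j"
    by blast
  show "in_hom (D j) (Ide (D j) a) a a"
    using darr_hom[OF dmor_ide[OF o] o] by (simp add: a darr_ide[OF o] dsrc_ide[OF o])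
next
  fix m a b assume m: "in_hom (D j) m a b"
  then have "b \<in> Obj (D j)" by (auto simp: down_def cat_of_homs_def in_hom_def)
  from D_ObjE[OF this] obtain i n \<alpha> where b: "b = (map i [0..<n], \<alpha>)" and o: "dob S T f [0..<n] i \<alpha> j"
    by blast
  obtain n1 i1 h c where m': "m = darr T F [0..<n1] i1 [0..<n] i \<alpha> h c"
    "a = (map i1 [0..<n1], dsrc T F [0..<n1] [0..<n] h c \<alpha>)" and dm: "dmor S [0..<n1] i1 [0..<n] i h c"
    using darrE[OF m[unfolded b] distinct_upt] by blast
  note o1 = dsrc_dob[OF dm o]
  show "Cmp (D j) (Ide (D j) b) m = m"
    unfolding b darr_ide[OF o] m'(1)
    using darr_cmp[OF dm dmor_ide[OF o] o] dcmp_one_left[OF dm]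
    by (simp add: dsrc_ide[OF o]) (rule darr_cong, auto)
  show "Cmp (D j) m (Ide (D j) a) = m"
    unfolding m' darr_ide[OF o1] darr_cmp[OF dmor_ide[OF o1] dm o]
    using dcmp_one_right[OF dm] by (intro darr_cong) auto
next
  fix m1 m2 a1 a2 a3
  assume m: "in_hom (D j) m1 a1 a2" "in_hom (D j) m2 a2 a3"
  then have "a3 \<in> Obj (D j)" by (auto simp: down_def cat_of_homs_def in_hom_def)
  from D_ObjE[OF this] obtain i3 n3 \<alpha> where a3: "a3 = (map i3 [0..<n3], \<alpha>)" and o: "dob S T f [0..<n3] i3 \<alpha> j"
    by blast
  obtain n2 i2 h2 b2 where m2: "m2 = darr T F [0..<n2] i2 [0..<n3] i3 \<alpha> h2 b2"
    "a2 = (map i2 [0..<n2], dsrc T F [0..<n2] [0..<n3] h2 b2 \<alpha>)" and d2: "dmor S [0..<n2] i2 [0..<n3] i3 h2 b2"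
    using darrE[OF m(2)[unfolded a3] distinct_upt] by blast
  note o2 = dsrc_dob[OF d2 o]
  let ?\<alpha>2 = "dsrc T F [0..<n2] [0..<n3] h2 b2 \<alpha>"
  obtain n1 i1 h1 b1 where m1: "m1 = darr T F [0..<n1] i1 [0..<n2] i2 ?\<alpha>2 h1 b1"
    "a1 = (map i1 [0..<n1], dsrc T F [0..<n1] [0..<n2] h1 b1 ?\<alpha>2)" and d1: "dmor S [0..<n1] i1 [0..<n2] i2 h1 b1"
    using darrE[OF m(1)[unfolded m2(2)] distinct_upt] by blast
  note o1 = dsrc_dob[OF d1 o2]
  note c21 = darr_cmp[OF d1 d2 o]
  show "in_hom (D j) (Cmp (D j) m2 m1) a1 a3"
    unfolding m1 m2 a3 c21 using darr_hom[OF dmor_cmp[OF d1 d2] o] by (simp add: dsrc_cmp[OF d1 d2 o])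
  fix m0 a0 assume m0: "in_hom (D j) m0 a0 a1"
  let ?\<alpha>1 = "dsrc T F [0..<n1] [0..<n2] h1 b1 ?\<alpha>2"
  obtain n0 i0 h0 b0 where m0': "m0 = darr T F [0..<n0] i0 [0..<n1] i1 ?\<alpha>1 h0 b0"
    and d0: "dmor S [0..<n0] i0 [0..<n1] i1 h0 b0"
    using darrE[OF m0[unfolded m1(2)] distinct_upt] by blast
  have "Cmp (D j) m2 (Cmp (D j) m1 m0) = darr T F [0..<n0] i0 [0..<n3] i3 \<alpha> (\<lambda>l. h2 (h1 (h0 l)))
      (dcmp S [0..<n0] [0..<n2] (\<lambda>l. h1 (h0 l)) h2 b2 (dcmp S [0..<n0] [0..<n1] h0 h1 b1 b0))"
    unfolding m0' m1(1) m2(1) darr_cmp[OF d0 d1 o2] by (rule darr_cmp[OF dmor_cmp[OF d0 d1] d2 o])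
  also have "\<dots> = darr T F [0..<n0] i0 [0..<n3] i3 \<alpha> (\<lambda>l. h2 (h1 (h0 l)))
      (dcmp S [0..<n0] [0..<n1] h0 (\<lambda>l. h2 (h1 l)) (dcmp S [0..<n1] [0..<n2] h1 h2 b2 b1) b0)"
  proof (rule darr_cong)
    \<comment> \<open>Associativity is checked on one decorating operation at a time, where it is
      \<open>sub_dcmp\<close> in \<open>S\<close> with outer operation \<open>b2 k\<close>.\<close>
    fix k assume k: "k \<in> set [0..<n3]"
    let ?L0 = "[0..<n0]" and ?L1 = "[0..<n1]" and ?L2 = "[0..<n2]"
    note e0 = dmorD[OF d0] and e1 = dmorD[OF d1] and e2 = dmorD[OF d2]
    show "i3 k = i3 k \<and> dcmp S ?L0 ?L2 (\<lambda>l. h1 (h0 l)) h2 b2 (dcmp S ?L0 ?L1 h0 h1 b1 b0) k =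
        dcmp S ?L0 ?L1 h0 (\<lambda>l. h2 (h1 l)) (dcmp S ?L1 ?L2 h1 h2 b2 b1) b0 k"
      unfolding dcmp_def[of S ?L0 ?L2] dcmp_def[of S ?L0 ?L1 h0 "\<lambda>l. h2 (h1 l)"]
        dcmp_def[of S ?L1 ?L2]
      by (intro conjI refl S.sub_dcmp[OF e2(4)[OF k], where ?g2.0 = i1 and ?g1.0 = i0])
        (use e0 e1 e2 in \<open>auto intro: reorders_cfib_fib\<close>)
  qed simp
  also have "\<dots> = Cmp (D j) (Cmp (D j) m2 m1) m0"
    unfolding m0' m1(1) m2(1) c21
    using darr_cmp[OF d0 dmor_cmp[OF d1 d2] o] by (simp add: dsrc_cmp[OF d1 d2 o])
  finally show "Cmp (D j) m2 (Cmp (D j) m1 m0) = Cmp (D j) (Cmp (D j) m2 m1) m0" .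
qed

end

section \<open>The strict algebra \<open>F \<down> (-)\<close>\<close>

text \<open>In disjoint blocks the block containing a label is unique, so choosing one recovers its
  index. Used where labels need not carry a tag from which the block could be read.\<close>

lemma disjoint_choice:
  assumes "\<And>p p' l. p \<in> P \<Longrightarrow> p' \<in> P \<Longrightarrow> l \<in> L p \<Longrightarrow> l \<in> L p' \<Longrightarrow> p = p'"
  shows "\<exists>b'. \<forall>p\<in>P. \<forall>l\<in>L p. b' l = b p l"
proof (intro exI ballI)
  fix p l assume *: "p \<in> P" "l \<in> L p"
  then have "(SOME p'. p' \<in> P \<and> l \<in> L p') = p"
    using assms by (intro some_equality) auto
  then show "(\<lambda>l. b (SOME p'. p' \<in> P \<and> l \<in> L p') l) l = b p l" by simp
qed

context opmor
begin

text \<open>Each label is paired with the index of its object, which makes the blocks disjoint and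
  lets one function \<open>i\<close> describe the whole family.\<close>

lemma family_objE:
  fixes P :: "'p set"
  assumes "\<And>p. p \<in> P \<Longrightarrow> y p \<in> Obj (D (g p))"
  shows "\<exists>(L :: 'p \<Rightarrow> ('p \<times> nat) list) i \<alpha>. \<forall>p\<in>P. y p = (map i (L p), \<alpha> p) \<and> dob S T f (L p) i (\<alpha> p) (g p) \<and>
    (\<forall>l\<in>set (L p). fst l = p)"
proof -
  have "\<exists>i n \<alpha>. y p = (map i [0..<n], \<alpha>) \<and> dob S T f [0..<n] i \<alpha> (g p)" if "p \<in> P" for p
    by (rule D_ObjE[OF assms[OF that]])
  then obtain i n \<alpha> where *: "\<And>p. p \<in> P \<Longrightarrow> y p = (map (i p) [0..<n p], \<alpha> p) \<and>
      dob S T f [0..<n p] (i p) (\<alpha> p) (g p)"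
    by metis
  let ?L = "\<lambda>p. map (Pair p) [0..<n p]" and ?i = "\<lambda>(p, l). i p l"
  have main: "y p = (map ?i (?L p), \<alpha> p) \<and> dob S T f (?L p) ?i (\<alpha> p) (g p) \<and> (\<forall>l\<in>set (?L p). fst l = p)"
    if "p \<in> P" for p
    using *[OF that] by (auto simp: dob_def typed_def distinct_map inj_on_def comp_def)
  show ?thesis by (intro exI[of _ ?L] exI[of _ ?i] exI[of _ \<alpha>] ballI) (rule main)
qed

text \<open>Source data are glued by tags. The decorations are indexed by the prescribed target
  labels, known only to be disjoint, and are glued by \<open>disjoint_choice\<close>.\<close>

lemma family_arrE:
  fixes P :: "'p list"
  assumes c: "lhom D g P x c (\<lambda>p. (map i2 (L2 p), \<alpha> p))"
    and L2: "\<And>p. p \<in> set P \<Longrightarrow> distinct (L2 p)"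
    and disj: "\<And>p p' l. p \<in> set P \<Longrightarrow> p' \<in> set P \<Longrightarrow> l \<in> set (L2 p) \<Longrightarrow> l \<in> set (L2 p') \<Longrightarrow> p = p'"
  shows "\<exists>(L1 :: 'p \<Rightarrow> ('p \<times> nat) list) i1 h b. \<forall>p\<in>set P. c p = darr T F (L1 p) i1 (L2 p) i2 (\<alpha> p) h b \<and>
    x p = (map i1 (L1 p), dsrc T F (L1 p) (L2 p) h b (\<alpha> p)) \<and> dmor S (L1 p) i1 (L2 p) i2 h b \<and>
    (\<forall>l\<in>set (L1 p). fst l = p)"
proof -
  have "\<exists>n i1 h b. c p = darr T F [0..<n] i1 (L2 p) i2 (\<alpha> p) h b \<and>
    x p = (map i1 [0..<n], dsrc T F [0..<n] (L2 p) h b (\<alpha> p)) \<and> dmor S [0..<n] i1 (L2 p) i2 h b"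
    if "p \<in> set P" for p
    by (rule darrE[OF lhomD[OF c that] L2[OF that]])
  then obtain n i1 h b where *: "\<And>p. p \<in> set P \<Longrightarrow>
    c p = darr T F [0..<n p] (i1 p) (L2 p) i2 (\<alpha> p) (h p) (b p) \<and>
    x p = (map (i1 p) [0..<n p], dsrc T F [0..<n p] (L2 p) (h p) (b p) (\<alpha> p)) \<and>
    dmor S [0..<n p] (i1 p) (L2 p) i2 (h p) (b p)"
    by metis
  obtain b' where b': "\<forall>p\<in>set P. \<forall>l\<in>set (L2 p). b' l = b p l"
    using disjoint_choice[of "set P" "\<lambda>p. set (L2 p)" b] disj by blast
  let ?L = "\<lambda>p. map (Pair p) [0..<n p]" and ?i = "\<lambda>(p, l). i1 p l" and ?h = "\<lambda>(p, l). h p l"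
  have main: "c p = darr T F (?L p) ?i (L2 p) i2 (\<alpha> p) ?h b' \<and>
    x p = (map ?i (?L p), dsrc T F (?L p) (L2 p) ?h b' (\<alpha> p)) \<and> dmor S (?L p) ?i (L2 p) i2 ?h b' \<and>
    (\<forall>l\<in>set (?L p). fst l = p)" if p: "p \<in> set P" for p
  proof -
    note d = *[OF p, THEN conjunct2, THEN conjunct2]
    have "darr T F (?L p) ?i (L2 p) i2 (\<alpha> p) ?h b' =
        darr T F [0..<n p] (\<lambda>l. ?i (p, l)) (L2 p) i2 (\<alpha> p) (\<lambda>l. ?h (p, l)) b'"
      by (rule darr_map_src) (use dmorD(5)[OF d] in \<open>auto simp: inj_on_def\<close>)
    also have "\<dots> = darr T F [0..<n p] (i1 p) (L2 p) i2 (\<alpha> p) (h p) (b p)"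
      by (rule darr_cong) (use b' p in auto)
    finally have eq: "darr T F (?L p) ?i (L2 p) i2 (\<alpha> p) ?h b' = c p" using *[OF p] by simp
    moreover have "x p = (map ?i (?L p), dsrc T F (?L p) (L2 p) ?h b' (\<alpha> p))"
      using arg_cong[OF eq, of fst] *[OF p] by (simp add: darr_def)
    moreover have "dmor S (?L p) ?i (L2 p) i2 ?h b'"
      using dmorD[OF d] b' p
      by (auto simp: dmor_def distinct_map inj_on_def fib_map comp_def typed_def)
    ultimately show ?thesis by auto
  qed
  show ?thesis by (intro exI[of _ ?L] exI[of _ ?i] exI[of _ ?h] exI[of _ b'] ballI) (rule main)
qed

text \<open>Because \<open>h\<close> respects blocks and the target blocks are disjoint, each fibre
  of the concatenation lies in one block, whatever the order \<open>N\<close> of the source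
  blocks.\<close>

lemma dmor_concat:
  assumes MN: "reorders M N" and m: "\<And>m. m \<in> set M \<Longrightarrow> dmor S (L1 m) i1 (L2 m) i2 h b"
    and L1: "distinct (concat (map L1 M))" and L2: "distinct (concat (map L2 M))"
  shows "dmor S (concat (map L1 N)) i1 (concat (map L2 M)) i2 h b"
    and "\<And>m k. m \<in> set M \<Longrightarrow> k \<in> set (L2 m) \<Longrightarrow> fib (concat (map L1 N)) h k = fib (L1 m) h k"
proof -
  have N: "set N = set M" "distinct N" "distinct M" using MN by (auto simp: reorders_def)
  show fib: "fib (concat (map L1 N)) h k = fib (L1 m) h k" if "m \<in> set M" "k \<in> set (L2 m)" for m k
    using fib_concat_map[of N m L1 h k] distinct_concat_map_eq[OF L2 N(3)] dmorD(3)[OF m] that N by metis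
  have "reorders (concat (map L1 M)) (concat (map L1 N))"
    by (rule reorders_concat[OF MN L1]) (simp add: distinct_concat_mapD[OF L1])
  then show "dmor S (concat (map L1 N)) i1 (concat (map L2 M)) i2 h b"
    using L2 dmorD(3)[OF m] dmorD(4)[OF m] N fib by (auto simp: dmor_def reorders_def)
qed

lemma dob_concat:
  assumes \<gamma>: "typed T \<gamma> g M j" and o: "\<And>m. m \<in> set M \<Longrightarrow> dob S T f (L m) i (\<alpha> m) (g m)"
    and L: "distinct (concat (map L M))"
  shows "dob S T f (concat (map L M)) i (Sub T \<gamma> (map \<alpha> M)) j"
  using L dobD(2)[OF o] T.typed_sub[OF \<gamma> dobD(3)[OF o]] by (auto simp: dob_def)

text \<open>Associativity gathers the decorations of each block, inner equivariance accounts for the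
  reordering within blocks and outer equivariance for the order \<open>N\<close>. This makes the
  action of \<open>F \<down> (-)\<close> on arrows well typed.\<close>

lemma dsrc_concat:
  assumes \<gamma>: "typed T \<gamma> g M j" and MN: "reorders M N"
    and m: "\<And>m. m \<in> set M \<Longrightarrow> dmor S (L1 m) i1 (L2 m) i2 h b"
    and o: "\<And>m. m \<in> set M \<Longrightarrow> dob S T f (L2 m) i2 (\<alpha> m) (g m)"
    and L1: "distinct (concat (map L1 M))" and L2: "distinct (concat (map L2 M))"
  shows "dsrc T F (concat (map L1 N)) (concat (map L2 M)) h b (Sub T \<gamma> (map \<alpha> M)) =
    Sub T (relab T \<gamma> M N) (map (\<lambda>m. dsrc T F (L1 m) (L2 m) h b (\<alpha> m)) N)"
proof -
  have N: "set N = set M" "distinct N" "distinct M" using MN by (auto simp: reorders_def)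
  let ?C = "\<lambda>m. cfib (L1 m) h (L2 m)"
  let ?\<beta> = "\<lambda>m. Sub T (\<alpha> m) (map (\<lambda>k. F (b k)) (L2 m))"
  have \<beta>: "typed T (?\<beta> m) (\<lambda>l. f (i1 l)) (?C m) (g m)" if "m \<in> set M" for m
    by (rule dsrc_typed[OF m[OF that] o[OF that]])
  have re: "reorders (?C m) (L1 m)" if "m \<in> set M" for m by (rule dmorD(5)[OF m[OF that]])
  have re1: "reorders (concat (map L1 M)) (concat (map ?C M))"
    using N by (intro reorders_concat[OF _ L1] reorders_sym[OF re]) simp_all
  have re2: "reorders (concat (map L1 M)) (concat (map L1 N))"
    by (rule reorders_concat[OF MN L1]) (simp add: distinct_concat_mapD[OF L1])
  have C: "cfib (concat (map L1 N)) h (concat (map L2 M)) = concat (map ?C M)"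
    by (rule cfib_concat_map) (use N L2 dmorD(3)[OF m] in auto)
  have "Sub T (Sub T \<gamma> (map \<alpha> M)) (map (\<lambda>k. F (b k)) (concat (map L2 M))) = Sub T \<gamma> (map ?\<beta> M)"
  proof (rule T.sub_sub[OF \<gamma> dobD(3)[OF o]])
    \<comment> \<open>\<open>sub_sub\<close> expects the input labels of an inner operation as a
      function of \<open>l\<close> alone, so some block containing \<open>l\<close> is
      chosen.\<close>
    show "typed T (F (b l)) (\<lambda>l. f (i1 l)) (fib (L1 (SOME m. m \<in> set M \<and> l \<in> set (L2 m))) h l) (f (i2 l))"
      if "m \<in> set M" "l \<in> set (L2 m)" for m l
      using someI[of "\<lambda>m. m \<in> set M \<and> l \<in> set (L2 m)" m] that
      by (intro F_typed dmorD(4)[OF m]) auto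
  qed
  then have "dsrc T F (concat (map L1 N)) (concat (map L2 M)) h b (Sub T \<gamma> (map \<alpha> M)) =
      relab T (Sub T \<gamma> (map ?\<beta> M)) (concat (map ?C M)) (concat (map L1 N))"
    by (simp add: dsrc_def C)
  also have "\<dots> = relab T (relab T (Sub T \<gamma> (map ?\<beta> M)) (concat (map ?C M)) (concat (map L1 M)))
      (concat (map L1 M)) (concat (map L1 N))"
    by (rule T.relab_relab[OF T.typed_sub[OF \<gamma> \<beta>] reorders_sym[OF re1] re2, symmetric])
  also have "relab T (Sub T \<gamma> (map ?\<beta> M)) (concat (map ?C M)) (concat (map L1 M)) =
      Sub T \<gamma> (map (\<lambda>m. dsrc T F (L1 m) (L2 m) h b (\<alpha> m)) M)"
    unfolding dsrc_def
    by (rule T.sub_inner[OF \<gamma> \<beta> N(3) re, symmetric]) (use re1 in \<open>auto simp: reorders_def\<close>)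
  also have "relab T \<dots> (concat (map L1 M)) (concat (map L1 N)) =
      Sub T (relab T \<gamma> M N) (map (\<lambda>m. dsrc T F (L1 m) (L2 m) h b (\<alpha> m)) N)"
    by (rule T.sub_outer[OF \<gamma> dobD(3)[OF dsrc_dob[OF m o]] MN L1, symmetric])
  finally show ?thesis .
qed

abbreviation "A \<equiv> down_alg S T f F"

lemma Und_A: "Und A = D"
  by (simp add: down_alg_def)

text \<open>All members of the family share one label map \<open>h\<close>, so the ordinal sum of
  their indexing functions is again \<open>h\<close>, read at positions of the
  concatenations.\<close>

lemma down_op_arr_darr:
  assumes \<gamma>: "typed T \<gamma> g N j" and N: "distinct N"
    and m: "\<And>m. m \<in> set N \<Longrightarrow> dmor S (L1 m) i1 (L2 m) i2 h b"
    and o: "\<And>m. m \<in> set N \<Longrightarrow> dob S T f (L2 m) i2 (\<alpha> m) (g m)"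
    and L1: "distinct (concat (map L1 N))" and L2: "distinct (concat (map L2 N))"
  shows "down_op_arr T \<gamma> (map (\<lambda>m. darr T F (L1 m) i1 (L2 m) i2 (\<alpha> m) h b) N) =
    darr T F (concat (map L1 N)) i1 (concat (map L2 N)) i2 (Sub T \<gamma> (map \<alpha> N)) h b"
proof -
  let ?gs = "map (\<lambda>m. darr T F (L1 m) i1 (L2 m) i2 (\<alpha> m) h b) N"
  let ?hh = "\<lambda>k. fst (datum_of (?gs ! k))"
  have ms: "map (\<lambda>g. length (fst (dom_of g))) ?gs = map length (map L1 N)"
    "map (\<lambda>g. length (fst (cod_of g))) ?gs = map length (map L2 N)"
    by (simp_all add: darr_def)
  have bm: "block_map (map length (map L1 N)) (map length (map L2 N)) id ?hh p =
      pos (concat (map L2 N)) (h (concat (map L1 N) ! p))" if "p < length (concat (map L1 N))" for p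
  proof (rule block_map_pos[OF L2 _ that])
    fix k l assume k: "k < length (map L1 N)" and l: "l < length (map L1 N ! k)"
    then have "h (L1 (N ! k) ! l) \<in> set (L2 (N ! k))"
      using dmorD(3)[OF m] by simp
    then show "id k < length (map L2 N) \<and> ?hh k l < length (map L2 N ! id k) \<and>
        map L2 N ! id k ! ?hh k l = h (map L1 N ! k ! l)"
      using k l by (simp add: darr_def)
  qed
  have "sum_list (map length (map L1 N)) = length (concat (map L1 N))"
    by (simp add: length_concat)
  then have restr: "restrict (block_map (map length (map L1 N)) (map length (map L2 N)) id ?hh)
      {..<sum_list (map length (map L1 N))} =
      (\<lambda>p\<in>{..<length (concat (map L1 N))}. pos (concat (map L2 N)) (h (concat (map L1 N) ! p)))"
    using bm by (auto simp: restrict_def fun_eq_iff)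
  have dom: "down_op_obj T \<gamma> (map dom_of ?gs) = (map i1 (concat (map L1 N)),
      dsrc T F (concat (map L1 N)) (concat (map L2 N)) h b (Sub T \<gamma> (map \<alpha> N)))"
    using dsrc_concat[OF \<gamma> _ m o L1 L2, of N] N T.relab_self[OF \<gamma> N]
    by (simp add: down_op_obj_def darr_def map_concat comp_def)
  have cod: "down_op_obj T \<gamma> (map cod_of ?gs) = (map i2 (concat (map L2 N)), Sub T \<gamma> (map \<alpha> N))"
    by (simp add: down_op_obj_def darr_def map_concat comp_def)
  have bs: "concat (map (\<lambda>g. snd (datum_of g)) ?gs) = map b (concat (map L2 N))"
    by (simp add: darr_def map_concat comp_def)
  show ?thesis
    unfolding down_op_arr_def Let_def ms restr dom cod bs by (simp only: darr_def)
qed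

text \<open>A block permutation carries every label to itself; hence a symmetry is the identity on
  labels between two orders of the same concatenation.\<close>

lemma down_sym_darr:
  assumes \<gamma>: "typed T \<gamma> g M j" and MN: "reorders M N"
    and o: "\<And>m. m \<in> set M \<Longrightarrow> dob S T f (L m) i (\<alpha> m) (g m)"
    and L: "distinct (concat (map L M))"
  shows "down_sym S T \<gamma> (reord M N) (map (\<lambda>m. (map i (L m), \<alpha> m)) M) =
      darr T F (concat (map L N)) i (concat (map L M)) i (Sub T \<gamma> (map \<alpha> M)) (\<lambda>l. l) (\<lambda>l. One S (i l))"
    and "dsrc T F (concat (map L N)) (concat (map L M)) (\<lambda>l. l) (\<lambda>l. One S (i l)) (Sub T \<gamma> (map \<alpha> M)) =
      Sub T (relab T \<gamma> M N) (map \<alpha> N)"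
proof -
  have N: "set N = set M" "distinct N" "distinct M" using MN by (auto simp: reorders_def)
  note co = dob_concat[OF \<gamma> o L]
  have re: "reorders (concat (map L M)) (concat (map L N))"
    by (rule reorders_concat[OF MN L]) (simp add: distinct_concat_mapD[OF L])
  let ?M = "concat (map L M)" and ?N = "concat (map L N)"
  have "map (\<lambda>k. F (One S (i k))) ?M = map (\<lambda>k. One T (f (i k))) ?M"
    using dobD(2)[OF co] one_map by auto
  then have "Sub T (Sub T \<gamma> (map \<alpha> M)) (map (\<lambda>k. F (One S (i k))) ?M) = Sub T \<gamma> (map \<alpha> M)"
    using T.sub_one_r[OF dobD(3)[OF co]] by (simp only:)
  moreover have "cfib ?N (\<lambda>l. l) ?M = ?M"
    by (rule cfib_id) (use re in \<open>auto simp: reorders_def\<close>)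
  ultimately show src: "dsrc T F ?N ?M (\<lambda>l. l) (\<lambda>l. One S (i l)) (Sub T \<gamma> (map \<alpha> M)) =
      Sub T (relab T \<gamma> M N) (map \<alpha> N)"
    using T.sub_outer[OF \<gamma> dobD(3)[OF o] MN L] by (simp add: dsrc_def)
  have ns: "map (\<lambda>x. length (fst x)) (map (\<lambda>m. (map i (L m), \<alpha> m)) M) = map (\<lambda>m. length (L m)) M"
    by simp
  have ms: "permute_list (reord M N) (map (\<lambda>m. length (L m)) M) = map (\<lambda>m. length (L m)) N"
    "permute_list (reord M N) (map (\<lambda>m. (map i (L m), \<alpha> m)) M) = map (\<lambda>m. (map i (L m), \<alpha> m)) N"
    by (rule permute_list_reord[OF MN])+
  have bm: "block_map (map (\<lambda>m. length (L m)) N) (map (\<lambda>m. length (L m)) M) (reord M N) (\<lambda>_. id) = reord ?M ?N"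
  proof (rule block_map_reord[OF MN L])
    fix k assume "k < length N"
    then have "N ! k \<in> set M" using N nth_mem by blast
    then show "id = reord (L (N ! k)) (L (N ! k))" using distinct_concat_mapD[OF L] by simp
  qed (use distinct_concat_mapD[OF L] in simp_all)
  have len: "sum_list (map (\<lambda>m. length (L m)) N) = length ?N" by (simp add: length_concat comp_def)
  have "restrict (reord ?M ?N) {..<length ?N} = (\<lambda>p\<in>{..<length ?N}. pos ?M (?N ! p))"
    by (auto simp: restrict_def fun_eq_iff reord_def)
  then show "down_sym S T \<gamma> (reord M N) (map (\<lambda>m. (map i (L m), \<alpha> m)) M) =
      darr T F ?N i ?M i (Sub T \<gamma> (map \<alpha> M)) (\<lambda>l. l) (\<lambda>l. One S (i l))"
    unfolding down_sym_def Let_def ns ms bm len darr_def src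
    by (simp add: down_op_obj_def relab_def[symmetric] map_concat comp_def)
qed

lemma dmor_reorder:
  "reorders L N \<Longrightarrow> (\<And>l. l \<in> set L \<Longrightarrow> i l \<in> Col S) \<Longrightarrow> dmor S N i L i (\<lambda>l. l) (\<lambda>l. One S (i l))"
  by (auto simp: dmor_def reorders_def fib_id intro!: S.typed_one)

lemma A_obj:
  assumes "typed T \<gamma> g M j" "\<And>m. m \<in> set M \<Longrightarrow> dob S T f (L m) i (\<alpha> m) (g m)"
  shows "str_obj T A \<gamma> (map (\<lambda>m. (map i (L m), \<alpha> m)) M) = (map i (concat (map L M)), Sub T \<gamma> (map \<alpha> M))"
proof -
  have "(\<gamma>, map (\<lambda>m. (map i (L m), \<alpha> m)) M) \<in> Obj (mon_ob T D j)"
    by (rule mon_ob_ObjI[OF assms(1)]) (rule dob_Obj[OF assms(2)])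
  moreover have "j \<in> Col T" using assms(1) T.tgt_col by (auto simp: typed_def)
  ultimately show ?thesis
    using assms(1)
    by (simp add: str_obj_def down_alg_def down_op_obj_def typed_def map_concat comp_def)
qed

lemma A_lhom:
  assumes "\<And>m. m \<in> set M \<Longrightarrow> dmor S (L1 m) i1 (L2 m) i2 h b"
    "\<And>m. m \<in> set M \<Longrightarrow> dob S T f (L2 m) i2 (\<alpha> m) (g m)"
  shows "lhom D g M (\<lambda>m. (map i1 (L1 m), dsrc T F (L1 m) (L2 m) h b (\<alpha> m)))
      (\<lambda>m. darr T F (L1 m) i1 (L2 m) i2 (\<alpha> m) h b) (\<lambda>m. (map i2 (L2 m), \<alpha> m))"
  unfolding lhom_def using darr_hom assms by blast

text \<open>On labels, the action of \<open>F \<down> (-)\<close> is concatenation. The symmetry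
  contributes units and the identity label map, so it leaves \<open>h\<close> and \<open>b\<close>
  alone and is visible only in the order \<open>N\<close> of the source blocks.\<close>

lemma A_arr:
  assumes \<gamma>: "typed T \<gamma> g M j" and MN: "reorders M N"
    and m: "\<And>m. m \<in> set M \<Longrightarrow> dmor S (L1 m) i1 (L2 m) i2 h b"
    and o: "\<And>m. m \<in> set M \<Longrightarrow> dob S T f (L2 m) i2 (\<alpha> m) (g m)"
    and L1: "distinct (concat (map L1 M))" and L2: "distinct (concat (map L2 M))"
  shows "str_arr T A \<gamma> M N (\<lambda>m. (map i1 (L1 m), dsrc T F (L1 m) (L2 m) h b (\<alpha> m)))
      (\<lambda>m. darr T F (L1 m) i1 (L2 m) i2 (\<alpha> m) h b) (\<lambda>m. (map i2 (L2 m), \<alpha> m)) =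
    darr T F (concat (map L1 N)) i1 (concat (map L2 M)) i2 (Sub T \<gamma> (map \<alpha> M)) h b"
proof -
  have N: "set N = set M" "distinct N" "distinct M" using MN by (auto simp: reorders_def)
  note \<gamma>' = T.typed_relab[OF \<gamma> MN]
  have re1: "reorders (concat (map L1 M)) (concat (map L1 N))"
    by (rule reorders_concat[OF MN L1]) (simp add: distinct_concat_mapD[OF L1])
  have re2: "reorders (concat (map L2 M)) (concat (map L2 N))"
    by (rule reorders_concat[OF MN L2]) (simp add: distinct_concat_mapD[OF L2])
  have NL: "distinct (concat (map L1 N))" "distinct (concat (map L2 N))"
    using re1 re2 by (auto simp: reorders_def)
  let ?m = "larr T \<gamma> M N (\<lambda>m. (map i1 (L1 m), dsrc T F (L1 m) (L2 m) h b (\<alpha> m)))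
      (\<lambda>m. darr T F (L1 m) i1 (L2 m) i2 (\<alpha> m) h b) (\<lambda>m. (map i2 (L2 m), \<alpha> m))"
  have arr: "?m \<in> Arr (mon_ob T D j)"
    using T.larr_in_hom[OF D_category \<gamma> MN A_lhom[OF m o]] by (simp add: in_hom_def)
  have j: "Tgt T \<gamma> = j" "j \<in> Col T" using \<gamma> T.tgt_col by (auto simp: typed_def)
  have "str_arr T A \<gamma> M N (\<lambda>m. (map i1 (L1 m), dsrc T F (L1 m) (L2 m) h b (\<alpha> m)))
      (\<lambda>m. darr T F (L1 m) i1 (L2 m) i2 (\<alpha> m) h b) (\<lambda>m. (map i2 (L2 m), \<alpha> m)) =
    Cmp (D j) (down_sym S T \<gamma> (reord M N) (map (\<lambda>m. (map i2 (L2 m), \<alpha> m)) M))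
      (down_op_arr T (relab T \<gamma> M N) (map (\<lambda>m. darr T F (L1 m) i1 (L2 m) i2 (\<alpha> m) h b) N))"
    using arr j by (simp add: str_arr_def down_alg_def larr_def relab_def)
  also have "\<dots> = Cmp (D j) (darr T F (concat (map L2 N)) i2 (concat (map L2 M)) i2 (Sub T \<gamma> (map \<alpha> M))
        (\<lambda>l. l) (\<lambda>l. One S (i2 l)))
      (darr T F (concat (map L1 N)) i1 (concat (map L2 N)) i2
        (dsrc T F (concat (map L2 N)) (concat (map L2 M)) (\<lambda>l. l) (\<lambda>l. One S (i2 l)) (Sub T \<gamma> (map \<alpha> M))) h b)"
    using down_sym_darr[OF \<gamma> MN o L2] down_op_arr_darr[OF \<gamma>' N(2) _ _ NL] m o N by simp
  also have "\<dots> = darr T F (concat (map L1 N)) i1 (concat (map L2 M)) i2 (Sub T \<gamma> (map \<alpha> M)) h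
      (dcmp S (concat (map L1 N)) (concat (map L2 N)) h (\<lambda>l. l) (\<lambda>l. One S (i2 l)) b)"
  proof (rule darr_cmp)
    show "dmor S (concat (map L1 N)) i1 (concat (map L2 N)) i2 h b"
      by (rule dmor_concat(1)) (use N m NL in auto)
    show "dmor S (concat (map L2 N)) i2 (concat (map L2 M)) i2 (\<lambda>l. l) (\<lambda>l. One S (i2 l))"
      by (rule dmor_reorder[OF re2]) (use dobD(2)[OF o] in auto)
    show "dob S T f (concat (map L2 M)) i2 (Sub T \<gamma> (map \<alpha> M)) j"
      by (rule dob_concat[OF \<gamma> o L2])
  qed
  also have "\<dots> = darr T F (concat (map L1 N)) i1 (concat (map L2 M)) i2 (Sub T \<gamma> (map \<alpha> M)) h b"
    using dcmp_one_left[OF dmor_concat(1)[OF MN m L1 L2] _ re2] by (intro darr_cong) auto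
  finally show ?thesis .
qed

lemma disjoint_fst:
  assumes "distinct M" "\<And>m. m \<in> set M \<Longrightarrow> distinct (L m)" "\<And>m l. m \<in> set M \<Longrightarrow> l \<in> set (L m) \<Longrightarrow> fst l = m"
  shows "distinct (concat (map L M))"
proof (rule distinct_concat_mapI[OF assms(1,2)])
  show "m = n" if "m \<in> set M" "n \<in> set M" "l \<in> set (L m)" "l \<in> set (L n)" for m n l
    using assms(3)[OF that(1,3)] assms(3)[OF that(2,4)] by simp
qed

lemma mon_D_objE:
  assumes "a \<in> Obj (mon_ob T D j)"
  shows "\<exists>\<gamma> g n (L :: nat \<Rightarrow> (nat \<times> nat) list) i \<alpha>. a = (\<gamma>, map (\<lambda>m. (map i (L m), \<alpha> m)) [0..<n]) \<and>
    typed T \<gamma> g [0..<n] j \<and> (\<forall>m<n. dob S T f (L m) i (\<alpha> m) (g m)) \<and> distinct (concat (map L [0..<n]))"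
proof -
  obtain \<gamma> g n y where a: "a = (\<gamma>, map y [0..<n])" "typed T \<gamma> g [0..<n] j" "\<forall>m<n. y m \<in> Obj (D (g m))"
    using mon_ob_ObjE[OF assms] by blast
  obtain L :: "nat \<Rightarrow> (nat \<times> nat) list" and i \<alpha> where *: "\<forall>p\<in>{0..<n}. y p = (map i (L p), \<alpha> p) \<and>
      dob S T f (L p) i (\<alpha> p) (g p) \<and> (\<forall>l\<in>set (L p). fst l = p)"
    using family_objE[of "{0..<n}" y g] a(3) by auto
  have "distinct (concat (map L [0..<n]))"
    by (rule disjoint_fst) (use * in \<open>auto simp: dob_def\<close>)
  moreover have "a = (\<gamma>, map (\<lambda>m. (map i (L m), \<alpha> m)) [0..<n])"
    using * a(1) by auto
  ultimately show ?thesis using a(2) * by (intro exI[of _ \<gamma>] exI) auto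
qed

lemma mon_D_arrE:
  fixes M :: "'p list"
  assumes m: "in_hom (mon_ob T D j) m a (\<gamma>, map (\<lambda>m. (map i2 (L2 m), \<alpha> m)) M)" and \<gamma>: "typed T \<gamma> g M j"
    and M: "distinct M" and L2: "distinct (concat (map L2 M))"
  shows "\<exists>N (L1 :: 'p \<Rightarrow> ('p \<times> nat) list) i1 h b.
    m = larr T \<gamma> M N (\<lambda>m. (map i1 (L1 m), dsrc T F (L1 m) (L2 m) h b (\<alpha> m)))
      (\<lambda>m. darr T F (L1 m) i1 (L2 m) i2 (\<alpha> m) h b) (\<lambda>m. (map i2 (L2 m), \<alpha> m)) \<and>
    a = (relab T \<gamma> M N, map (\<lambda>m. (map i1 (L1 m), dsrc T F (L1 m) (L2 m) h b (\<alpha> m))) N) \<and>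
    reorders M N \<and> (\<forall>m\<in>set M. dmor S (L1 m) i1 (L2 m) i2 h b) \<and> distinct (concat (map L1 M)) \<and>
    (\<forall>m\<in>set M. \<forall>l\<in>set (L1 m). fst l = m)"
proof -
  obtain N x c where mm: "m = larr T \<gamma> M N x c (\<lambda>m. (map i2 (L2 m), \<alpha> m))"
    "a = (relab T \<gamma> M N, map x N)" "reorders M N" "lhom D g M x c (\<lambda>m. (map i2 (L2 m), \<alpha> m))"
    using T.larrE[OF m \<gamma> M] by blast
  have "\<exists>(L1 :: 'p \<Rightarrow> ('p \<times> nat) list) i1 h b. \<forall>p\<in>set M. c p = darr T F (L1 p) i1 (L2 p) i2 (\<alpha> p) h b \<and>
    x p = (map i1 (L1 p), dsrc T F (L1 p) (L2 p) h b (\<alpha> p)) \<and> dmor S (L1 p) i1 (L2 p) i2 h b \<and>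
    (\<forall>l\<in>set (L1 p). fst l = p)"
    by (rule family_arrE[OF mm(4)])
      (use distinct_concat_mapD[OF L2] distinct_concat_map_eq[OF L2 M] in blast)+
  then obtain L1 :: "'p \<Rightarrow> ('p \<times> nat) list" and i1 h b where *: "\<forall>p\<in>set M. c p = darr T F (L1 p) i1 (L2 p) i2 (\<alpha> p) h b \<and>
    x p = (map i1 (L1 p), dsrc T F (L1 p) (L2 p) h b (\<alpha> p)) \<and> dmor S (L1 p) i1 (L2 p) i2 h b \<and>
    (\<forall>l\<in>set (L1 p). fst l = p)"
    by blast
  have "m = larr T \<gamma> M N (\<lambda>m. (map i1 (L1 m), dsrc T F (L1 m) (L2 m) h b (\<alpha> m)))
      (\<lambda>m. darr T F (L1 m) i1 (L2 m) i2 (\<alpha> m) h b) (\<lambda>m. (map i2 (L2 m), \<alpha> m))"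
    unfolding mm(1) by (rule larr_cong[OF mm(3)]) (use * in auto)
  moreover have "a = (relab T \<gamma> M N, map (\<lambda>m. (map i1 (L1 m), dsrc T F (L1 m) (L2 m) h b (\<alpha> m))) N)"
    using * mm(2,3) by (auto simp: reorders_def)
  moreover have "distinct (concat (map L1 M))"
    by (rule disjoint_fst[OF M]) (use * in \<open>auto simp: dmor_def\<close>)
  ultimately show ?thesis
    using mm(3) * by (intro exI[of _ N] exI[of _ L1] exI[of _ i1] exI[of _ h] exI[of _ b] conjI) blast+
qed

section \<open>Functoriality of the action on \<open>F \<down> (-)\<close>\<close>

lemma A_functor:
  assumes j: "j \<in> Col T"
  shows "is_functor (mon_ob T D j) (D j) (Str A j)"
proof -
  let ?M = "mon_ob T D j"
  interpret M: category ?M by (rule T.mon_ob_category[OF D_category])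
  interpret Dj: category "D j" by (rule D_category)
  have Str: "FO (Str A j) (\<gamma>, ys) = str_obj T A \<gamma> ys" "FA (Str A j) (larr T \<gamma> M N x c y) = str_arr T A \<gamma> M N x c y"
    if "typed T \<gamma> g M' j" for \<gamma> ys N x c y and g :: "'l \<Rightarrow> 'j" and M' and M :: "'k list"
    using that by (auto simp: str_obj_def str_arr_def typed_def)
  have hom: "in_hom (D j) (FA (Str A j) m) (FO (Str A j) a) (FO (Str A j) b)" if m: "in_hom ?M m a b" for m a b
  proof -
    obtain \<gamma> g n and L2 :: "nat \<Rightarrow> (nat \<times> nat) list" and i2 \<alpha> where
      b: "b = (\<gamma>, map (\<lambda>m. (map i2 (L2 m), \<alpha> m)) [0..<n])" and \<gamma>: "typed T \<gamma> g [0..<n] j"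
      and o: "\<forall>m<n. dob S T f (L2 m) i2 (\<alpha> m) (g m)" and L2: "distinct (concat (map L2 [0..<n]))"
      using mon_D_objE[OF M.in_hom_obj(2)[OF m]] by blast
    let ?M = "[0..<n]"
    obtain N and L1 :: "nat \<Rightarrow> (nat \<times> nat) list" and i1 h c where mm: "m = larr T \<gamma> ?M N (\<lambda>m. (map i1 (L1 m), dsrc T F (L1 m) (L2 m) h c (\<alpha> m)))
      (\<lambda>m. darr T F (L1 m) i1 (L2 m) i2 (\<alpha> m) h c) (\<lambda>m. (map i2 (L2 m), \<alpha> m))"
      "a = (relab T \<gamma> ?M N, map (\<lambda>m. (map i1 (L1 m), dsrc T F (L1 m) (L2 m) h c (\<alpha> m))) N)"
      "reorders ?M N" "\<forall>m\<in>set ?M. dmor S (L1 m) i1 (L2 m) i2 h c" "distinct (concat (map L1 ?M))"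
      using mon_D_arrE[OF m[unfolded b] \<gamma> distinct_upt L2] by blast
    note dm = mm(4)[rule_format]
    have o': "dob S T f (L2 m) i2 (\<alpha> m) (g m)" if "m \<in> set ?M" for m using o that by simp
    have N: "set N = set ?M" using mm(3) by (simp add: reorders_def)
    have o1: "dob S T f (L1 m) i1 (dsrc T F (L1 m) (L2 m) h c (\<alpha> m)) (g m)" if "m \<in> set N" for m
      by (rule dsrc_dob[OF dm o']) (use that N in simp_all)
    note \<gamma>' = T.typed_relab[OF \<gamma> mm(3)]
    have "FA (Str A j) m = darr T F (concat (map L1 N)) i1 (concat (map L2 ?M)) i2 (Sub T \<gamma> (map \<alpha> ?M)) h c"
      unfolding mm(1) Str[OF \<gamma>] by (rule A_arr[OF \<gamma> mm(3) dm o' mm(5) L2])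
    then show ?thesis
      unfolding mm(2) b Str[OF \<gamma>] Str[OF \<gamma>']
      using darr_hom[OF dmor_concat(1)[OF mm(3) dm mm(5) L2] dob_concat[OF \<gamma> o' L2]]
        dsrc_concat[OF \<gamma> mm(3) dm o' mm(5) L2] A_obj[OF \<gamma> o'] A_obj[OF \<gamma>' o1]
      by simp
  qed
  show ?thesis
  proof
    fix m a b assume "in_hom ?M m a b"
    then show "in_hom (D j) (FA (Str A j) m) (FO (Str A j) a) (FO (Str A j) b)" by (rule hom)
  next
    have ext: "FO (Str A j) \<in> extensional (Obj ?M)" "FA (Str A j) \<in> extensional (Arr ?M)"
      using j by (auto simp: down_alg_def)
    have "FO (Str A j) a \<in> Obj (D j)" if "a \<in> Obj ?M" for a
      using hom[OF M.ide_hom[OF that]] Dj.in_hom_obj by blast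
    then show "FO (Str A j) \<in> Obj ?M \<rightarrow>\<^sub>E Obj (D j)" using ext by (auto simp: PiE_def)
    have "FA (Str A j) m \<in> Arr (D j)" if "m \<in> Arr ?M" for m
      using hom[OF M.in_hom_self[OF that]] by (simp add: in_hom_def)
    then show "FA (Str A j) \<in> Arr ?M \<rightarrow>\<^sub>E Arr (D j)" using ext by (auto simp: PiE_def)
  next
    fix a assume "a \<in> Obj ?M"
    then obtain \<gamma> g n and L :: "nat \<Rightarrow> (nat \<times> nat) list" and i \<alpha> where
      a: "a = (\<gamma>, map (\<lambda>m. (map i (L m), \<alpha> m)) [0..<n])" and \<gamma>: "typed T \<gamma> g [0..<n] j"
      and o: "\<forall>m<n. dob S T f (L m) i (\<alpha> m) (g m)" and L: "distinct (concat (map L [0..<n]))"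
      using mon_D_objE by blast
    let ?M = "[0..<n]" and ?one = "\<lambda>l. One S (i l)"
    have o': "dob S T f (L m) i (\<alpha> m) (g m)" if "m \<in> set ?M" for m using o that by simp
    have re: "reorders ?M ?M" by simp
    have "Ide (mon_ob T D j) a = larr T \<gamma> ?M ?M (\<lambda>m. (map i (L m), dsrc T F (L m) (L m) (\<lambda>l. l) ?one (\<alpha> m)))
        (\<lambda>m. darr T F (L m) i (L m) i (\<alpha> m) (\<lambda>l. l) ?one) (\<lambda>m. (map i (L m), \<alpha> m))"
      unfolding a T.larr_ide[OF \<gamma> distinct_upt]
      by (rule larr_cong[OF re]) (use darr_ide[OF o'] dsrc_ide[OF o'] in auto)
    then have "FA (Str A j) (Ide (mon_ob T D j) a) =
        darr T F (concat (map L ?M)) i (concat (map L ?M)) i (Sub T \<gamma> (map \<alpha> ?M)) (\<lambda>l. l) ?one"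
      using A_arr[OF \<gamma> re dmor_ide[OF o'] o' L L] by (simp add: Str[OF \<gamma>])
    moreover have "FO (Str A j) a = (map i (concat (map L ?M)), Sub T \<gamma> (map \<alpha> ?M))"
      unfolding a Str[OF \<gamma>] by (rule A_obj[OF \<gamma> o'])
    ultimately show "FA (Str A j) (Ide (mon_ob T D j) a) = Ide (D j) (FO (Str A j) a)"
      using darr_ide[OF dob_concat[OF \<gamma> o' L]] by (simp only:)
  next
    fix m1 m2 a1 a2 a3
    assume m: "in_hom ?M m1 a1 a2" "in_hom ?M m2 a2 a3"
    obtain \<gamma> g n and L3 :: "nat \<Rightarrow> (nat \<times> nat) list" and i3 \<alpha> where
      a3: "a3 = (\<gamma>, map (\<lambda>m. (map i3 (L3 m), \<alpha> m)) [0..<n])" and \<gamma>: "typed T \<gamma> g [0..<n] j"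
      and o: "\<forall>m<n. dob S T f (L3 m) i3 (\<alpha> m) (g m)" and L3: "distinct (concat (map L3 [0..<n]))"
      using mon_D_objE[OF M.in_hom_obj(2)[OF m(2)]] by blast
    let ?M = "[0..<n]"
    obtain N and L2 :: "nat \<Rightarrow> (nat \<times> nat) list" and i2 h2 b2 where m2: "m2 = larr T \<gamma> ?M N (\<lambda>m. (map i2 (L2 m), dsrc T F (L2 m) (L3 m) h2 b2 (\<alpha> m)))
      (\<lambda>m. darr T F (L2 m) i2 (L3 m) i3 (\<alpha> m) h2 b2) (\<lambda>m. (map i3 (L3 m), \<alpha> m))"
      "a2 = (relab T \<gamma> ?M N, map (\<lambda>m. (map i2 (L2 m), dsrc T F (L2 m) (L3 m) h2 b2 (\<alpha> m))) N)"
      "reorders ?M N" "\<forall>m\<in>set ?M. dmor S (L2 m) i2 (L3 m) i3 h2 b2" "distinct (concat (map L2 ?M))"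
      "\<forall>m\<in>set ?M. \<forall>l\<in>set (L2 m). fst l = m"
      using mon_D_arrE[OF m(2)[unfolded a3] \<gamma> distinct_upt L3] by blast
    let ?\<alpha>2 = "\<lambda>m. dsrc T F (L2 m) (L3 m) h2 b2 (\<alpha> m)"
    note d2 = m2(4)[rule_format]
    have o3: "dob S T f (L3 m) i3 (\<alpha> m) (g m)" if "m \<in> set ?M" for m using o that by simp
    have N: "set N = set ?M" "distinct N" using m2(3) by (auto simp: reorders_def)
    have o2: "dob S T f (L2 m) i2 (?\<alpha>2 m) (g m)" if "m \<in> set N" for m
      by (rule dsrc_dob[OF d2 o3]) (use that N in simp_all)
    note \<gamma>' = T.typed_relab[OF \<gamma> m2(3)]
    have re2: "reorders (concat (map L2 ?M)) (concat (map L2 N))"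
      by (rule reorders_concat[OF m2(3,5)]) (simp add: distinct_concat_mapD[OF m2(5)])
    then have L2N: "distinct (concat (map L2 N))" by (simp add: reorders_def)
    obtain K and L1 :: "nat \<Rightarrow> (nat \<times> nat) list" and i1 h1 b1 where m1: "m1 = larr T (relab T \<gamma> ?M N) N K
        (\<lambda>m. (map i1 (L1 m), dsrc T F (L1 m) (L2 m) h1 b1 (?\<alpha>2 m)))
        (\<lambda>m. darr T F (L1 m) i1 (L2 m) i2 (?\<alpha>2 m) h1 b1) (\<lambda>m. (map i2 (L2 m), ?\<alpha>2 m))"
      "reorders N K" "\<forall>m\<in>set N. dmor S (L1 m) i1 (L2 m) i2 h1 b1" "distinct (concat (map L1 N))"
      using mon_D_arrE[OF m(1)[unfolded m2(2)] \<gamma>' N(2) L2N] by blast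
    note d1 = m1(3)[rule_format]
    have NK: "set K = set N" using m1(2) by (simp add: reorders_def)
    have re1: "reorders (concat (map L1 N)) (concat (map L1 ?M))"
      by (rule reorders_concat[OF reorders_sym[OF m2(3)] m1(4)]) (simp add: distinct_concat_mapD[OF m1(4)])
    then have L1M: "distinct (concat (map L1 ?M))" by (simp add: reorders_def)
    note c1 = dmor_concat[OF m1(2) d1 m1(4) L2N] and c2 = dmor_concat[OF m2(3) d2 m2(5) L3]
    have src: "dsrc T F (concat (map L2 N)) (concat (map L3 ?M)) h2 b2 (Sub T \<gamma> (map \<alpha> ?M)) =
        Sub T (relab T \<gamma> ?M N) (map ?\<alpha>2 N)"
      by (rule dsrc_concat[OF \<gamma> m2(3) d2 o3 m2(5) L3])
    let ?b = "dcmp S (concat (map L1 K)) (concat (map L2 N)) h1 h2 b2 b1"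
    \<comment> \<open>Composition of decorations is local: the fibres entering \<open>dcmp\<close>
      are the same in a block as in the concatenation. So the single function \<open>?b\<close>
      decorates the composites in all blocks.\<close>
    have loc: "dcmp S (L1 m) (L2 m) h1 h2 b2 b1 k = ?b k" if "m \<in> set ?M" "k \<in> set (L3 m)" for m k
    proof -
      have f2: "fib (concat (map L2 N)) h2 k = fib (L2 m) h2 k" using c2(2) that by simp
      have f1: "fib (concat (map L1 K)) h1 l = fib (L1 m) h1 l" if "l \<in> set (L2 m)" for l
        using c1(2) that \<open>m \<in> set ?M\<close> N by simp
      have f21: "fib (concat (map L1 K)) (\<lambda>l. h2 (h1 l)) k = fib (L1 m) (\<lambda>l. h2 (h1 l)) k"
      proof (rule fib_concat_map)
        show "distinct K" using m1(2) by (simp add: reorders_def)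
        show "m \<in> set K" using that NK N by simp
        fix m' l assume "m' \<in> set K" "l \<in> set (L1 m')" "h2 (h1 l) = k"
        then show "m' = m"
          using distinct_concat_map_eq[OF L3 distinct_upt, of m' m k] dmorD(3)[OF d1, of m' l]
            dmorD(3)[OF d2, of m' "h1 l"] that NK N by simp
      qed
      have "cfib (concat (map L1 K)) h1 (fib (L2 m) h2 k) = cfib (L1 m) h1 (fib (L2 m) h2 k)"
        unfolding cfib_def using f1 by (auto intro!: arg_cong[of _ _ concat])
      then show ?thesis by (simp add: dcmp_def f2 f21)
    qed
    have dmc: "dmor S (L1 m) i1 (L3 m) i3 (\<lambda>l. h2 (h1 l)) ?b" if "m \<in> set ?M" for m
      using dmor_cmp[OF d1 d2, of m] loc that N by (auto simp: dmor_def)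
    have cmp: "Cmp (mon_ob T D j) m2 m1 = larr T \<gamma> ?M K
        (\<lambda>m. (map i1 (L1 m), dsrc T F (L1 m) (L3 m) (\<lambda>l. h2 (h1 l)) ?b (\<alpha> m)))
        (\<lambda>m. darr T F (L1 m) i1 (L3 m) i3 (\<alpha> m) (\<lambda>l. h2 (h1 l)) ?b) (\<lambda>m. (map i3 (L3 m), \<alpha> m))"
      unfolding m1(1) m2(1) T.larr_cmp[OF \<gamma> m2(3) m1(2)]
    proof (rule larr_cong[OF reorders_trans[OF m2(3) m1(2)]])
      fix m assume m: "m \<in> set ?M"
      then have mN: "m \<in> set N" using N by simp
      have eq: "darr T F (L1 m) i1 (L3 m) i3 (\<alpha> m) (\<lambda>l. h2 (h1 l)) (dcmp S (L1 m) (L2 m) h1 h2 b2 b1) =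
          darr T F (L1 m) i1 (L3 m) i3 (\<alpha> m) (\<lambda>l. h2 (h1 l)) ?b"
        by (rule darr_cong) (use loc[OF m] in auto)
      have "dsrc T F (L1 m) (L3 m) (\<lambda>l. h2 (h1 l)) ?b (\<alpha> m) = dsrc T F (L1 m) (L2 m) h1 b1 (?\<alpha>2 m)"
        using arg_cong[OF eq, of "\<lambda>a. snd (fst a)"] dsrc_cmp[OF d1[OF mN] d2[OF m] o3[OF m]]
        by (simp add: darr_def)
      then show "(map i1 (L1 m), dsrc T F (L1 m) (L2 m) h1 b1 (?\<alpha>2 m)) =
          (map i1 (L1 m), dsrc T F (L1 m) (L3 m) (\<lambda>l. h2 (h1 l)) ?b (\<alpha> m)) \<and>
        Cmp (D (g m)) (darr T F (L2 m) i2 (L3 m) i3 (\<alpha> m) h2 b2) (darr T F (L1 m) i1 (L2 m) i2 (?\<alpha>2 m) h1 b1) =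
          darr T F (L1 m) i1 (L3 m) i3 (\<alpha> m) (\<lambda>l. h2 (h1 l)) ?b \<and>
        (map i3 (L3 m), \<alpha> m) = (map i3 (L3 m), \<alpha> m)"
        using darr_cmp[OF d1[OF mN] d2[OF m] o3[OF m]] eq by simp
    qed
    have "FA (Str A j) (Cmp (mon_ob T D j) m2 m1) = darr T F (concat (map L1 K)) i1 (concat (map L3 ?M)) i3
        (Sub T \<gamma> (map \<alpha> ?M)) (\<lambda>l. h2 (h1 l)) ?b"
      unfolding cmp Str[OF \<gamma>]
      by (rule A_arr[OF \<gamma> reorders_trans[OF m2(3) m1(2)] dmc o3 L1M L3])
    also have "\<dots> = Cmp (D j) (FA (Str A j) m2) (FA (Str A j) m1)"
    proof -
      have "FA (Str A j) m2 = darr T F (concat (map L2 N)) i2 (concat (map L3 ?M)) i3 (Sub T \<gamma> (map \<alpha> ?M)) h2 b2"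
        unfolding m2(1) Str[OF \<gamma>] by (rule A_arr[OF \<gamma> m2(3) d2 o3 m2(5) L3])
      moreover have "FA (Str A j) m1 = darr T F (concat (map L1 K)) i1 (concat (map L2 N)) i2
          (Sub T (relab T \<gamma> ?M N) (map ?\<alpha>2 N)) h1 b1"
        unfolding m1(1) Str[OF \<gamma>'] by (rule A_arr[OF \<gamma>' m1(2) d1 o2 m1(4) L2N])
      ultimately show ?thesis
        using darr_cmp[OF c1(1) c2(1) dob_concat[OF \<gamma> o3 L3]] by (simp add: src)
    qed
    finally show "FA (Str A j) (Cmp (mon_ob T D j) m2 m1) = Cmp (D j) (FA (Str A j) m2) (FA (Str A j) m1)" .
  qed
qed

section \<open>The unit and multiplication laws of \<open>F \<down> (-)\<close>\<close>

lemma A_unit_obj: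
  assumes j: "j \<in> Col T" and x: "x \<in> Obj (D j)"
  shows "str_obj T A (One T j) [x] = x"
proof -
  obtain i n \<alpha> where xx: "x = (map i [0..<n], \<alpha>)" and o: "dob S T f [0..<n] i \<alpha> j"
    using D_ObjE[OF x] by blast
  have "typed T (One T j) (\<lambda>_. j) [()] j" by (simp add: T.typed_one j)
  from A_obj[OF this, of "\<lambda>_. [0..<n]" i "\<lambda>_. \<alpha>"] o T.sub_one_l[OF dobD(3)[OF o]] show ?thesis
    by (simp add: xx)
qed

lemma A_unit_arr:
  assumes j: "j \<in> Col T" and m: "m \<in> Arr (D j)"
  shows "str_arr T A (One T j) [()] [()] (\<lambda>_. Dom (D j) m) (\<lambda>_. m) (\<lambda>_. Cod (D j) m) = m"
proof -
  interpret Dj: category "D j" by (rule D_category)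
  note hom = Dj.in_hom_self[OF m]
  obtain i n \<alpha> where b: "Cod (D j) m = (map i [0..<n], \<alpha>)" and o: "dob S T f [0..<n] i \<alpha> j"
    using D_ObjE[OF Dj.cod_obj[OF m]] by blast
  obtain n1 i1 h b where mm: "m = darr T F [0..<n1] i1 [0..<n] i \<alpha> h b"
    "Dom (D j) m = (map i1 [0..<n1], dsrc T F [0..<n1] [0..<n] h b \<alpha>)" and dm: "dmor S [0..<n1] i1 [0..<n] i h b"
    using darrE[OF hom[unfolded b] distinct_upt] by blast
  have one: "typed T (One T j) (\<lambda>_. j) [()] j" by (simp add: T.typed_one j)
  have "str_arr T A (One T j) [()] [()] (\<lambda>m. (map i1 [0..<n1], dsrc T F [0..<n1] [0..<n] h b \<alpha>))
      (\<lambda>m. darr T F [0..<n1] i1 [0..<n] i \<alpha> h b) (\<lambda>m. (map i [0..<n], \<alpha>)) =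
    darr T F (concat (map (\<lambda>_. [0..<n1]) [()])) i1 (concat (map (\<lambda>_. [0..<n]) [()])) i (Sub T (One T j) (map (\<lambda>_. \<alpha>) [()])) h b"
    by (rule A_arr[OF one]) (use dm o in auto)
  then show ?thesis
    using T.sub_one_l[OF dobD(3)[OF o]] by (simp add: b mm(2)) (simp add: mm(1)[symmetric])
qed

lemma A_mult_obj:
  assumes j: "j \<in> Col T" and a: "a \<in> Obj (mon_ob T (mon_ob T D) j)"
  shows "FO (Str A j) (FO (mon_mult T D j) a) = FO (Str A j) (FO (mon_1 T (mon_ob T D) (Str A) j) a)"
proof (rule T.mon_ob2_ObjE[OF a])
  fix \<alpha> g M \<beta> g' x and L :: "nat \<Rightarrow> (nat \<times> nat) list"
  assume aa: "a = (\<alpha>, map (\<lambda>m. (\<beta> m, map x (L m))) M)"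
    and \<alpha>: "typed T \<alpha> g M j" and M: "distinct M" and \<beta>: "\<And>m. m \<in> set M \<Longrightarrow> typed T (\<beta> m) g' (L m) (g m)"
    and L: "distinct (concat (map L M))"
    and x: "\<And>m l. m \<in> set M \<Longrightarrow> l \<in> set (L m) \<Longrightarrow> x l \<in> Obj (D (g' l))"
  let ?P = "concat (map L M)"
  have "\<exists>(L' :: nat \<times> nat \<Rightarrow> ((nat \<times> nat) \<times> nat) list) i \<gamma>. \<forall>p\<in>set ?P. x p = (map i (L' p), \<gamma> p) \<and>
      dob S T f (L' p) i (\<gamma> p) (g' p) \<and> (\<forall>l\<in>set (L' p). fst l = p)"
    by (rule family_objE) (use x in auto)
  then obtain L' :: "nat \<times> nat \<Rightarrow> ((nat \<times> nat) \<times> nat) list" and i \<gamma> where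
    *: "\<forall>p\<in>set ?P. x p = (map i (L' p), \<gamma> p) \<and> dob S T f (L' p) i (\<gamma> p) (g' p) \<and> (\<forall>l\<in>set (L' p). fst l = p)"
    by blast
  have o: "dob S T f (L' p) i (\<gamma> p) (g' p)" if "p \<in> set ?P" for p using * that by blast
  have om: "dob S T f (L' p) i (\<gamma> p) (g' p)" if "m \<in> set M" "p \<in> set (L m)" for m p
    by (rule o) (use that in auto)
  have L': "distinct (concat (map L' ?P))"
    by (rule disjoint_fst[OF L]) (use * in \<open>auto simp: dob_def\<close>)
  have split: "concat (map L' ?P) = concat (map (\<lambda>m. concat (map L' (L m))) M)"
    by (induction M) auto
  have L'm: "distinct (concat (map L' (L m)))" if "m \<in> set M" for m
    using distinct_concat_mapD[of "\<lambda>m. concat (map L' (L m))" M m] L' that split by simp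
  have ss: "Sub T (Sub T \<alpha> (map \<beta> M)) (map \<gamma> (concat (map L M))) =
      Sub T \<alpha> (map (\<lambda>m. Sub T (\<beta> m) (map \<gamma> (L m))) M)"
    by (rule T.sub_sub[OF \<alpha> \<beta>]) (assumption, rule dobD(3)[OF om])
  have xm: "map x (L m) = map (\<lambda>p. (map i (L' p), \<gamma> p)) (L m)" if "m \<in> set M" for m
    using * that by auto
  have "map x ?P = map (\<lambda>p. (map i (L' p), \<gamma> p)) ?P" using * by auto
  then have "FO (Str A j) (FO (mon_mult T D j) a) =
      str_obj T A (Sub T \<alpha> (map \<beta> M)) (map (\<lambda>p. (map i (L' p), \<gamma> p)) ?P)"
    using a j T.typed_sub[OF \<alpha> \<beta>] unfolding aa
    by (simp add: mon_mult_def T.mon_mult_obj_map str_obj_def typed_def del: map_eq_conv)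
  also have "\<dots> = (map i (concat (map L' ?P)), Sub T (Sub T \<alpha> (map \<beta> M)) (map \<gamma> ?P))"
    by (rule A_obj[OF T.typed_sub[OF \<alpha> \<beta>] o])
  also have "\<dots> = (map i (concat (map (\<lambda>m. concat (map L' (L m))) M)),
      Sub T \<alpha> (map (\<lambda>m. Sub T (\<beta> m) (map \<gamma> (L m))) M))"
    unfolding split ss ..
  also have "\<dots> = str_obj T A \<alpha> (map (\<lambda>m. (map i (concat (map L' (L m))), Sub T (\<beta> m) (map \<gamma> (L m)))) M)"
    by (rule A_obj[OF \<alpha> dob_concat[OF \<beta> om L'm], symmetric])
  also have "map (\<lambda>m. (map i (concat (map L' (L m))), Sub T (\<beta> m) (map \<gamma> (L m)))) M =
      map (\<lambda>m. FO (Str A (g m)) (\<beta> m, map x (L m))) M"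
  proof (rule map_cong[OF refl])
    fix m assume m: "m \<in> set M"
    have "str_obj T A (\<beta> m) (map (\<lambda>p. (map i (L' p), \<gamma> p)) (L m)) =
        (map i (concat (map L' (L m))), Sub T (\<beta> m) (map \<gamma> (L m)))"
      by (rule A_obj[OF \<beta>[OF m] om[OF m]])
    then show "(map i (concat (map L' (L m))), Sub T (\<beta> m) (map \<gamma> (L m))) = FO (Str A (g m)) (\<beta> m, map x (L m))"
      unfolding xm[OF m] using \<beta>[OF m] by (simp add: str_obj_def typed_def)
  qed
  also have "str_obj T A \<alpha> \<dots> = FO (Str A j) (FO (mon_1 T (mon_ob T D) (Str A) j) a)"
    using \<alpha> unfolding aa T.mon_1_obj[OF \<alpha> j a[unfolded aa]] by (simp add: str_obj_def typed_def)
  finally show ?thesis .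
qed

text \<open>By \<open>A_arr\<close> both sides are one labelled arrow over the same iterated
  concatenation. Multiplying first concatenates over pairs \<open>p\<close>; acting twice
  concatenates inside each \<open>m\<close> and then over \<open>m\<close>. The target operations
  agree by associativity of substitution.\<close>

lemma A_mult_arr:
  assumes j: "j \<in> Col T" and a: "a \<in> Arr (mon_ob T (mon_ob T D) j)"
  shows "FA (Str A j) (FA (mon_mult T D j) a) = FA (Str A j) (FA (mon_1 T (mon_ob T D) (Str A) j) a)"
proof (rule T.larr2E[OF a])
  fix \<alpha> g M N \<beta> g' x c y and L K :: "nat \<Rightarrow> (nat \<times> nat) list"
  assume aa: "a = larr T \<alpha> M N (\<lambda>m. (relab T (\<beta> m) (L m) (K m), map x (K m)))
      (\<lambda>m. larr T (\<beta> m) (L m) (K m) x c y) (\<lambda>m. (\<beta> m, map y (L m)))"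
    and \<alpha>: "typed T \<alpha> g M j" and MN: "reorders M N" and \<beta>: "\<And>m. m \<in> set M \<Longrightarrow> typed T (\<beta> m) g' (L m) (g m)"
    and LK: "\<And>m. m \<in> set M \<Longrightarrow> reorders (L m) (K m)" and L: "distinct (concat (map L M))"
    and c: "\<And>m. m \<in> set M \<Longrightarrow> lhom D g' (L m) x c y"
  let ?P = "concat (map L M)" and ?Q = "concat (map K N)"
  have PQ: "reorders ?P ?Q" by (rule reorders_concat[OF MN L LK])
  have N: "set N = set M" "distinct M" using MN by (auto simp: reorders_def)
  have c': "lhom D g' ?P x c y" using c by (auto simp: lhom_def)
  have y: "y p \<in> Obj (D (g' p))" if "p \<in> set ?P" for p
    using category.in_hom_obj[OF D_category lhomD[OF c' that]] by simp
  have "\<exists>(L2 :: nat \<times> nat \<Rightarrow> ((nat \<times> nat) \<times> nat) list) i2 \<gamma>. \<forall>p\<in>set ?P. y p = (map i2 (L2 p), \<gamma> p) \<and>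
      dob S T f (L2 p) i2 (\<gamma> p) (g' p) \<and> (\<forall>l\<in>set (L2 p). fst l = p)"
    by (rule family_objE) (use y in auto)
  then obtain L2 :: "nat \<times> nat \<Rightarrow> ((nat \<times> nat) \<times> nat) list" and i2 \<gamma> where
    *: "\<forall>p\<in>set ?P. y p = (map i2 (L2 p), \<gamma> p) \<and> dob S T f (L2 p) i2 (\<gamma> p) (g' p) \<and> (\<forall>l\<in>set (L2 p). fst l = p)"
    by blast
  have o: "dob S T f (L2 p) i2 (\<gamma> p) (g' p)" if "p \<in> set ?P" for p using * that by blast
  have om: "dob S T f (L2 p) i2 (\<gamma> p) (g' p)" if "m \<in> set M" "p \<in> set (L m)" for m p
    by (rule o) (use that in auto)
  have L2: "distinct (concat (map L2 ?P))"
    by (rule disjoint_fst[OF L]) (use * in \<open>auto simp: dob_def\<close>)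
  have c2: "lhom D g' ?P x c (\<lambda>p. (map i2 (L2 p), \<gamma> p))" using c' * by (auto simp: lhom_def)
  have "\<exists>(L1 :: nat \<times> nat \<Rightarrow> ((nat \<times> nat) \<times> nat) list) i1 h b. \<forall>p\<in>set ?P.
    c p = darr T F (L1 p) i1 (L2 p) i2 (\<gamma> p) h b \<and>
    x p = (map i1 (L1 p), dsrc T F (L1 p) (L2 p) h b (\<gamma> p)) \<and> dmor S (L1 p) i1 (L2 p) i2 h b \<and>
    (\<forall>l\<in>set (L1 p). fst l = p)"
    by (rule family_arrE[OF c2]) (use distinct_concat_mapD[OF L2] distinct_concat_map_eq[OF L2 L] in blast)+
  then obtain L1 :: "nat \<times> nat \<Rightarrow> ((nat \<times> nat) \<times> nat) list" and i1 h b where **: "\<forall>p\<in>set ?P.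
    c p = darr T F (L1 p) i1 (L2 p) i2 (\<gamma> p) h b \<and>
    x p = (map i1 (L1 p), dsrc T F (L1 p) (L2 p) h b (\<gamma> p)) \<and> dmor S (L1 p) i1 (L2 p) i2 h b \<and>
    (\<forall>l\<in>set (L1 p). fst l = p)"
    by blast
  have d: "dmor S (L1 p) i1 (L2 p) i2 h b" if "p \<in> set ?P" for p using ** that by blast
  have dm: "dmor S (L1 p) i1 (L2 p) i2 h b" if "m \<in> set M" "p \<in> set (L m)" for m p
    by (rule d) (use that in auto)
  have L1: "distinct (concat (map L1 ?P))"
    by (rule disjoint_fst[OF L]) (use ** in \<open>auto simp: dmor_def\<close>)
  let ?x = "\<lambda>p. (map i1 (L1 p), dsrc T F (L1 p) (L2 p) h b (\<gamma> p))"
    and ?c = "\<lambda>p. darr T F (L1 p) i1 (L2 p) i2 (\<gamma> p) h b" and ?y = "\<lambda>p. (map i2 (L2 p), \<gamma> p)"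
  have split: "concat (map Z (concat (map X Y))) = concat (map (\<lambda>m. concat (map Z (X m))) Y)" for Z X Y
    by (induction Y) auto
  let ?L1 = "\<lambda>m. concat (map L1 (K m))" and ?L2 = "\<lambda>m. concat (map L2 (L m))"
  let ?L1' = "\<lambda>m. concat (map L1 (L m))"
  have L2': "distinct (concat (map ?L2 M))" using L2 unfolding split .
  have L1': "distinct (concat (map ?L1' M))" using L1 unfolding split .
  have L2m: "distinct (?L2 m)" if "m \<in> set M" for m by (rule distinct_concat_mapD[OF L2' that])
  have L1m': "distinct (?L1' m)" if "m \<in> set M" for m by (rule distinct_concat_mapD[OF L1' that])
  have re: "reorders (?L1' m) (?L1 m)" if "m \<in> set M" for m
    by (rule reorders_concat[OF LK[OF that] L1m'[OF that]])
      (use dmorD(1)[OF dm[OF that]] in simp)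
  have "reorders (concat (map ?L1' M)) (concat (map ?L1 M))"
    by (rule reorders_concat[OF _ L1' re]) (use N in simp_all)
  then have L1M: "distinct (concat (map ?L1 M))" by (simp add: reorders_def)
  have dcm: "dmor S (?L1 m) i1 (?L2 m) i2 h b" if "m \<in> set M" for m
    by (rule dmor_concat(1)[OF LK[OF that] dm[OF that] L1m'[OF that] L2m[OF that]])
  have ocm: "dob S T f (?L2 m) i2 (Sub T (\<beta> m) (map \<gamma> (L m))) (g m)" if "m \<in> set M" for m
    by (rule dob_concat[OF \<beta>[OF that] om[OF that] L2m[OF that]])
  have ss: "Sub T (Sub T \<alpha> (map \<beta> M)) (map \<gamma> (concat (map L M))) =
      Sub T \<alpha> (map (\<lambda>m. Sub T (\<beta> m) (map \<gamma> (L m))) M)"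
    by (rule T.sub_sub[OF \<alpha> \<beta>]) (assumption, rule dobD(3)[OF om])
  note tsub = T.typed_sub[OF \<alpha> \<beta>]
  have "FA (Str A j) (FA (mon_mult T D j) a) = str_arr T A (Sub T \<alpha> (map \<beta> M)) ?P ?Q x c y"
  proof -
    have "FA (mon_mult T D j) a = larr T (Sub T \<alpha> (map \<beta> M)) ?P ?Q x c y"
      unfolding aa by (rule T.mon_mult_larr[OF \<alpha> \<beta> MN LK L j a[unfolded aa]])
    then show ?thesis using tsub by (simp add: str_arr_def typed_def)
  qed
  also have "\<dots> = str_arr T A (Sub T \<alpha> (map \<beta> M)) ?P ?Q ?x ?c ?y"
    by (rule str_arr_cong[OF PQ]) (use * ** in auto)
  also have "\<dots> = darr T F (concat (map L1 ?Q)) i1 (concat (map L2 ?P)) i2 (Sub T (Sub T \<alpha> (map \<beta> M)) (map \<gamma> ?P)) h b"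
    by (rule A_arr[OF tsub PQ d o L1 L2])
  also have "\<dots> = darr T F (concat (map ?L1 N)) i1 (concat (map ?L2 M)) i2
      (Sub T \<alpha> (map (\<lambda>m. Sub T (\<beta> m) (map \<gamma> (L m))) M)) h b"
    unfolding split ss ..
  also have "\<dots> = str_arr T A \<alpha> M N (\<lambda>m. (map i1 (?L1 m), dsrc T F (?L1 m) (?L2 m) h b (Sub T (\<beta> m) (map \<gamma> (L m)))))
      (\<lambda>m. darr T F (?L1 m) i1 (?L2 m) i2 (Sub T (\<beta> m) (map \<gamma> (L m))) h b)
      (\<lambda>m. (map i2 (?L2 m), Sub T (\<beta> m) (map \<gamma> (L m))))"
    by (rule A_arr[OF \<alpha> MN dcm ocm L1M L2', symmetric])
  also have "\<dots> = str_arr T A \<alpha> M N (\<lambda>m. FO (Str A (g m)) (relab T (\<beta> m) (L m) (K m), map x (K m)))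
      (\<lambda>m. FA (Str A (g m)) (larr T (\<beta> m) (L m) (K m) x c y)) (\<lambda>m. FO (Str A (g m)) (\<beta> m, map y (L m)))"
  proof (rule str_arr_cong[OF MN], intro conjI)
    fix m assume m: "m \<in> set M"
    have \<beta>m: "Tgt T (\<beta> m) = g m" "Tgt T (relab T (\<beta> m) (L m) (K m)) = g m"
      using \<beta>[OF m] T.typed_relab[OF \<beta>[OF m] LK[OF m]] by (auto simp: typed_def)
    have LKs: "set (K m) = set (L m)" using LK[OF m] by (simp add: reorders_def)
    have xK: "map x (K m) = map ?x (K m)" using ** m LKs by auto
    have yL: "map y (L m) = map ?y (L m)" using * m by auto
    have cL: "larr T (\<beta> m) (L m) (K m) x c y = larr T (\<beta> m) (L m) (K m) ?x ?c ?y"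
      by (rule larr_cong[OF LK[OF m]]) (use * ** m in auto)
    have "str_arr T A (\<beta> m) (L m) (K m) ?x ?c ?y = darr T F (?L1 m) i1 (?L2 m) i2 (Sub T (\<beta> m) (map \<gamma> (L m))) h b"
      by (rule A_arr[OF \<beta>[OF m] LK[OF m] dm[OF m] om[OF m] L1m'[OF m] L2m[OF m]])
    then show "darr T F (?L1 m) i1 (?L2 m) i2 (Sub T (\<beta> m) (map \<gamma> (L m))) h b =
        FA (Str A (g m)) (larr T (\<beta> m) (L m) (K m) x c y)"
      unfolding cL by (simp add: str_arr_def \<beta>m)
    have "str_obj T A (\<beta> m) (map ?y (L m)) = (map i2 (?L2 m), Sub T (\<beta> m) (map \<gamma> (L m)))"
      by (rule A_obj[OF \<beta>[OF m] om[OF m]])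
    then show "(map i2 (?L2 m), Sub T (\<beta> m) (map \<gamma> (L m))) = FO (Str A (g m)) (\<beta> m, map y (L m))"
      unfolding yL by (simp add: str_obj_def \<beta>m)
    have "str_obj T A (relab T (\<beta> m) (L m) (K m)) (map ?x (K m)) =
        (map i1 (?L1 m), Sub T (relab T (\<beta> m) (L m) (K m)) (map (\<lambda>p. dsrc T F (L1 p) (L2 p) h b (\<gamma> p)) (K m)))"
      by (rule A_obj[OF T.typed_relab[OF \<beta>[OF m] LK[OF m]]])
        (rule dsrc_dob[OF dm[OF m] om[OF m]], use LKs in simp_all)
    also have "Sub T (relab T (\<beta> m) (L m) (K m)) (map (\<lambda>p. dsrc T F (L1 p) (L2 p) h b (\<gamma> p)) (K m)) =
        dsrc T F (?L1 m) (?L2 m) h b (Sub T (\<beta> m) (map \<gamma> (L m)))"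
      by (rule dsrc_concat[OF \<beta>[OF m] LK[OF m] dm[OF m] om[OF m] L1m'[OF m] L2m[OF m], symmetric])
    finally show "(map i1 (?L1 m), dsrc T F (?L1 m) (?L2 m) h b (Sub T (\<beta> m) (map \<gamma> (L m)))) =
        FO (Str A (g m)) (relab T (\<beta> m) (L m) (K m), map x (K m))"
      unfolding xK by (simp add: str_obj_def \<beta>m)
  qed
  also have "\<dots> = FA (Str A j) (FA (mon_1 T (mon_ob T D) (Str A) j) a)"
  proof -
    have "FA (mon_1 T (mon_ob T D) (Str A) j) a =
        larr T \<alpha> M N (\<lambda>m. FO (Str A (g m)) (relab T (\<beta> m) (L m) (K m), map x (K m)))
      (\<lambda>m. FA (Str A (g m)) (larr T (\<beta> m) (L m) (K m) x c y)) (\<lambda>m. FO (Str A (g m)) (\<beta> m, map y (L m)))"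
      unfolding aa by (rule T.mon_1_larr[OF \<alpha> j a[unfolded aa] MN])
    then show ?thesis using \<alpha> by (simp add: str_arr_def typed_def)
  qed
  finally show ?thesis .
qed

lemma A_strict: "strict_algebra T A"
  unfolding strict_algebra_def Und_A
proof (intro conjI ballI)
  show "category (D j)" for j by (rule D_category)
  show "cell1 (Col T) (mon_ob T D) D (Str A)"
    using A_functor by (simp add: cell1_def) (simp add: down_alg_def)
  show "comp1 (Col T) D (Str A) (mon_unit T D) = id1 (Col T) D"
  proof
    fix j
    show "comp1 (Col T) D (Str A) (mon_unit T D) j = id1 (Col T) D j"
    proof (cases "j \<in> Col T")
      case j: True
      have "compose (Obj (D j)) (FO (Str A j)) (FO (mon_unit T D j)) = (\<lambda>x\<in>Obj (D j). x)"
        using A_unit_obj[OF j] j by (auto simp: compose_def restrict_def fun_eq_iff mon_unit_def str_obj_def T.one_tgt)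
      moreover have "compose (Arr (D j)) (FA (Str A j)) (FA (mon_unit T D j)) = (\<lambda>x\<in>Arr (D j). x)"
        using A_unit_arr[OF j] T.mon_unit_larr[where X = D, OF j, of _ "()"] j
        by (auto simp: compose_def restrict_def fun_eq_iff str_arr_def T.one_tgt)
      ultimately show ?thesis using j by (simp add: comp1_def id1_def comp_func_def id_func_def)
    qed (simp add: comp1_def id1_def)
  qed
  show "comp1 (Col T) (mon_ob T (mon_ob T D)) (Str A) (mon_mult T D) =
      comp1 (Col T) (mon_ob T (mon_ob T D)) (Str A) (mon_1 T (mon_ob T D) (Str A))"
  proof
    fix j
    show "comp1 (Col T) (mon_ob T (mon_ob T D)) (Str A) (mon_mult T D) j =
      comp1 (Col T) (mon_ob T (mon_ob T D)) (Str A) (mon_1 T (mon_ob T D) (Str A)) j"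
      using A_mult_obj[of j] A_mult_arr[of j]
      by (cases "j \<in> Col T") (auto simp: comp1_def comp_func_def compose_def restrict_def fun_eq_iff)
  qed
qed

end

section \<open>Lax morphisms from the terminal algebra\<close>

definition lax_ob :: "('i, 's, unit, unit, 'p, 'q) lax \<Rightarrow> 'i \<Rightarrow> 'p" where
  "lax_ob X i = FO (fst X i) ()"

text \<open>Over the terminal algebra a pair \<open>(\<alpha>, xs)\<close> contains no more than
  \<open>\<alpha>\<close>, so a coherence 2-cell is a function of operations.\<close>

definition lax_coh :: "('i, 's) opd \<Rightarrow> ('i, 's, unit, unit, 'p, 'q) lax \<Rightarrow> 's \<Rightarrow> 'q" where
  "lax_coh S X \<alpha> = snd X (Tgt S \<alpha>) (\<alpha>, replicate (arity S \<alpha>) ())"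

text \<open>A functor out of the terminal category sends its arrow to an identity, so objects and
  coherence arrows are the whole data of such a lax morphism.\<close>

definition mklax :: "('i, 's) opd \<Rightarrow> ('i \<Rightarrow> 'j) \<Rightarrow> ('j, 't, 'p, 'q) alg \<Rightarrow> ('i \<Rightarrow> 'p) \<Rightarrow> ('s \<Rightarrow> 'q)
    \<Rightarrow> ('i, 's, unit, unit, 'p, 'q) lax" where
  "mklax S f B x c =
     ((\<lambda>i\<in>Col S. \<lparr> FO = (\<lambda>_. x i), FA = (\<lambda>_. Ide (Und B (f i)) (x i)) \<rparr>),
      (\<lambda>i\<in>Col S. \<lambda>(\<alpha>, _)\<in>Obj (mon_ob S (\<lambda>_. terminal_cat) i). c \<alpha>))"

lemma terminal_category: "category terminal_cat"
  by unfold_locales (auto simp: terminal_cat_def in_hom_def)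

lemma terminal_sel [simp]: "Obj terminal_cat = UNIV" "Arr terminal_cat = UNIV" "in_hom terminal_cat m x y"
  by (auto simp: terminal_cat_def in_hom_def)

lemma Und_terminal [simp]: "Und (terminal_alg S) = (\<lambda>_. terminal_cat)"
  by (simp add: terminal_alg_def)

lemma unit_list: "(us :: unit list) = replicate (length us) ()"
  by (induction us) auto

lemma map_unit: "map h M = replicate (length M) ()"
  by (induction M) auto

lemma pull_apply [simp]: "i \<in> I \<Longrightarrow> pull I f Y i = Y (f i)"
  by (simp add: pull_def)

lemma Fbar_Und: "Und (Fbar S f F B) = pull (Col S) f (Und B)"
  by (simp add: Fbar_def)

context operad
begin

lemma mon_2_larr:
  assumes \<alpha>: "typed T \<alpha> g M j" and M: "distinct M" and j: "j \<in> Col T"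
    and obj: "(\<alpha>, map y M) \<in> Obj (mon_ob T X j)"
  shows "mon_2 T X G G' \<phi> j (\<alpha>, map y M) =
    larr T \<alpha> M M (\<lambda>m. FO (G (g m)) (y m)) (\<lambda>m. \<phi> (g m) (y m)) (\<lambda>m. FO (G' (g m)) (y m))"
proof -
  have src: "Src T \<alpha> = map g M" using \<alpha> by (simp add: typed_def)
  have "mon_2 T X G G' \<phi> j (\<alpha>, map y M) =
      (mon_obj_map T G (\<alpha>, map y M), (id, map2 \<phi> (map g M) (map y M)), mon_obj_map T G' (\<alpha>, map y M))"
    using obj j by (simp add: mon_2_def src)
  then show ?thesis
    unfolding mon_obj_map_larr[OF \<alpha>] map2_map_map larr_def
    using relab_self[OF \<alpha> M] M by simp
qed

lemma terminal_mon_obj: "typed T \<alpha> g M j \<Longrightarrow> (\<alpha>, replicate (length M) ()) \<in> Obj (mon_ob T (\<lambda>_. terminal_cat) j)"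
  using mon_ob_ObjI[of T \<alpha> g M j "\<lambda>_. ()" "\<lambda>_. terminal_cat"] by (simp add: map_unit)

end

locale opmor_alg = opmor S T f F + B: strict_alg T B
  for S :: "('i, 's) opd" and T :: "('j, 't) opd" and f :: "'i \<Rightarrow> 'j" and F :: "'s \<Rightarrow> 't"
    and B :: "('j, 't, 'o, 'm) alg"
begin

abbreviation "FB \<equiv> Fbar S f F B"
abbreviation "one \<equiv> terminal_alg S"

lemma typed_tgt_f: "typed S \<alpha> g M i \<Longrightarrow> Tgt S \<alpha> = i \<and> i \<in> Col S \<and> f i \<in> Col T"
  using S.tgt_col col_map by (auto simp: typed_def)

lemma lhom_pull:
  assumes "typed S \<alpha> g M i"
  shows "lhom (pull (Col S) f Y) g M x c y = lhom Y (\<lambda>m. f (g m)) M x c y"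
  by (simp add: lhom_def S.typed_col[OF assms])

lemma FB_str_obj:
  assumes \<alpha>: "typed S \<alpha> g M i" and x: "\<And>l. l \<in> set M \<Longrightarrow> x l \<in> Obj (Und B (f (g l)))"
  shows "str_obj S FB \<alpha> (map x M) = str_obj T B (F \<alpha>) (map x M)"
proof -
  have "(\<alpha>, map x M) \<in> Obj (mon_ob S (pull (Col S) f (Und B)) i)"
    by (rule mon_ob_ObjI[OF \<alpha>]) (use S.typed_col[OF \<alpha>] x in simp)
  then show ?thesis
    using typed_tgt_f[OF \<alpha>] F_typed[OF \<alpha>]
    by (simp add: str_obj_def Fbar_def comp1_def comp_func_def compose_def Fl_def typed_def)
qed

lemma FB_str_arr:
  assumes \<beta>: "typed S \<beta> g M i" and MN: "reorders M N" and c: "lhom (Und B) (\<lambda>m. f (g m)) M x c y"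
  shows "str_arr S FB \<beta> M N x c y = str_arr T B (F \<beta>) M N x c y"
proof -
  have pc: "category (pull (Col S) f (Und B) i)" if "i \<in> Col S" for i
    using B.Und_category col_map that by simp
  have "lhom (pull (Col S) f (Und B)) g M x c y" using c unfolding lhom_pull[OF \<beta>] .
  from S.larr_in_hom[OF pc \<beta> MN this]
  have "larr S \<beta> M N x c y \<in> Arr (mon_ob S (pull (Col S) f (Und B)) i)" by (simp add: in_hom_def)
  then show ?thesis
    using typed_tgt_f[OF \<beta>] F_typed[OF \<beta>] F_relab[OF \<beta> MN]
    by (simp add: str_arr_def Fbar_def comp1_def comp_func_def compose_def Fl_def typed_def larr_def)
qed

context
  fixes g :: "'i \<Rightarrow> (unit, unit, 'o, 'm) func"
  assumes g_fun: "\<And>i. i \<in> Col S \<Longrightarrow> is_functor terminal_cat (Und B (f i)) (g i)"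
begin

lemma g_obj: "i \<in> Col S \<Longrightarrow> FO (g i) () \<in> Obj (Und B (f i))"
  using is_functor.FO_obj[OF g_fun, of i "()"] by simp

lemma g_ide: "i \<in> Col S \<Longrightarrow> FA (g i) () = Ide (Und B (f i)) (FO (g i) ())"
  using is_functor.fa_ide[OF g_fun, of i "()"] by (simp add: terminal_cat_def)

lemma lax_dom_obj:
  assumes \<alpha>: "typed S \<alpha> h M i"
  shows "FO (lax_dom S one FB g i) (\<alpha>, replicate (length M) ()) = str_obj T B (F \<alpha>) (map (\<lambda>m. FO (g (h m)) ()) M)"
proof -
  note i = typed_tgt_f[OF \<alpha>]
  have "FO (mon_1 S (\<lambda>_. terminal_cat) g i) (\<alpha>, map (\<lambda>_. ()) M) = (\<alpha>, map (\<lambda>m. FO (g (h m)) ()) M)"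
    by (rule S.mon_1_obj[OF \<alpha>]) (use i S.terminal_mon_obj[OF \<alpha>] in \<open>simp_all add: map_unit\<close>)
  then have "FO (lax_dom S one FB g i) (\<alpha>, replicate (length M) ()) = str_obj S FB \<alpha> (map (\<lambda>m. FO (g (h m)) ()) M)"
    using i S.terminal_mon_obj[OF \<alpha>]
    by (simp add: lax_dom_def comp1_def comp_func_def compose_def str_obj_def map_unit)
  also have "\<dots> = str_obj T B (F \<alpha>) (map (\<lambda>m. FO (g (h m)) ()) M)"
    by (rule FB_str_obj[OF \<alpha>]) (use g_obj S.typed_col[OF \<alpha>] in simp)
  finally show ?thesis .
qed

text \<open>An arrow of the free \<open>S\<close>-algebra on \<open>1\<close> is only a permutation,
  and the 1-cell fills in identities; what results is a symmetry of \<open>B\<close>.\<close>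

lemma lax_dom_arr:
  assumes \<beta>: "typed S \<beta> h M i" and MN: "reorders M N"
  shows "FA (lax_dom S one FB g i) (larr S \<beta> M N (\<lambda>_. ()) (\<lambda>_. ()) (\<lambda>_. ())) =
    str_perm T B (\<lambda>m. f (h m)) (F \<beta>) M N (\<lambda>m. FO (g (h m)) ())"
proof -
  note i = typed_tgt_f[OF \<beta>]
  let ?m = "larr S \<beta> M N (\<lambda>_. ()) (\<lambda>_. ()) (\<lambda>_. ())" and ?x = "\<lambda>m. FO (g (h m)) ()"
  have m: "?m \<in> Arr (mon_ob S (\<lambda>_. terminal_cat) i)"
    using S.larr_in_hom[OF terminal_category \<beta> MN] by (simp add: in_hom_def[of "mon_ob S (\<lambda>_. terminal_cat) i"] lhom_def)
  have "FA (mon_1 S (\<lambda>_. terminal_cat) g i) ?m = larr S \<beta> M N ?x (\<lambda>m. FA (g (h m)) ()) ?x"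
    by (rule S.mon_1_larr[OF \<beta> _ m MN]) (use i in simp)
  also have "\<dots> = larr S \<beta> M N ?x (\<lambda>m. Ide (Und B (f (h m))) (?x m)) ?x"
    by (rule larr_cong[OF MN]) (use g_ide S.typed_col[OF \<beta>] in simp)
  finally have "FA (lax_dom S one FB g i) ?m = str_arr S FB \<beta> M N ?x (\<lambda>m. Ide (Und B (f (h m))) (?x m)) ?x"
    using i m by (simp add: lax_dom_def comp1_def comp_func_def compose_def str_arr_def)
  also have "\<dots> = str_perm T B (\<lambda>m. f (h m)) (F \<beta>) M N ?x"
    unfolding str_perm_def by (rule FB_str_arr[OF \<beta> MN B.lhom_ide[OF F_typed[OF \<beta>]]]) (use g_obj S.typed_col[OF \<beta>] in simp)
  finally show ?thesis .
qed

lemma lax_cod_obj: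
  "typed S \<alpha> h M i \<Longrightarrow> FO (lax_cod S one g i) (\<alpha>, replicate (length M) ()) = FO (g i) ()"
  using typed_tgt_f[of \<alpha> h M i] S.terminal_mon_obj[of \<alpha> h M i]
  by (simp add: lax_cod_def comp1_def comp_func_def compose_def terminal_alg_def)

lemma lax_cod_arr:
  assumes "i \<in> Col S" "m \<in> Arr (mon_ob S (\<lambda>_. terminal_cat) i)"
  shows "FA (lax_cod S one g i) m = Ide (Und B (f i)) (FO (g i) ())"
  using assms g_ide by (simp add: lax_cod_def comp1_def comp_func_def compose_def terminal_alg_def)

end

lemma terminal_mon_objE:
  assumes "a \<in> Obj (mon_ob S (\<lambda>_. terminal_cat) i)"
  shows "a = (fst a, replicate (arity S (fst a)) ()) \<and> fst a \<in> Ops S \<and> Tgt S (fst a) = i"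
proof -
  obtain \<alpha> us where a: "a = (\<alpha>, us)" by fastforce
  have "\<alpha> \<in> Ops S" "Tgt S \<alpha> = i" "length us = arity S \<alpha>"
    using assms by (auto simp: mon_ob_sel a arity_def dest: list_all2_lengthD)
  then show ?thesis using unit_list[of us] by (simp add: a)
qed

lemma lax_coh_typed: "typed S \<alpha> g M i \<Longrightarrow> lax_coh S X \<alpha> = snd X i (\<alpha>, replicate (length M) ())"
  using typed_arity[of S \<alpha> g M i] by (simp add: lax_coh_def typed_def)

lemma lhom_one: "lhom (\<lambda>_. terminal_cat) g M x c y"
  by (simp add: lhom_def)

section \<open>The laws satisfied by a lax morphism from the terminal algebra\<close>

context
  fixes X :: "('i, 's, unit, unit, 'o, 'm) lax"
  assumes lax: "lax_morphism S one FB X"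
begin

lemma lax_unfold:
  shows "cell1 (Col S) (\<lambda>_. terminal_cat) (pull (Col S) f (Und B)) (fst X)"
    "cell2 (Col S) (mon_ob S (\<lambda>_. terminal_cat)) (pull (Col S) f (Und B))
      (lax_dom S one FB (fst X)) (lax_cod S one (fst X)) (snd X)"
    "rwhisker (Col S) (\<lambda>_. terminal_cat) (snd X) (mon_unit S (\<lambda>_. terminal_cat)) =
      id2 (Col S) (\<lambda>_. terminal_cat) (pull (Col S) f (Und B)) (fst X)"
    "rwhisker (Col S) (mon_ob S (mon_ob S (\<lambda>_. terminal_cat))) (snd X) (mon_mult S (\<lambda>_. terminal_cat)) =
     vcomp (Col S) (mon_ob S (mon_ob S (\<lambda>_. terminal_cat))) (pull (Col S) f (Und B))
       (rwhisker (Col S) (mon_ob S (mon_ob S (\<lambda>_. terminal_cat))) (snd X) (mon_1 S (mon_ob S (\<lambda>_. terminal_cat)) (Str one)))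
       (lwhisker (Col S) (mon_ob S (mon_ob S (\<lambda>_. terminal_cat))) (Str FB)
          (mon_2 S (mon_ob S (\<lambda>_. terminal_cat)) (lax_dom S one FB (fst X)) (lax_cod S one (fst X)) (snd X)))"
  using lax by (auto simp: lax_morphism_def Fbar_Und split: prod.splits)

lemma lax_functor: "i \<in> Col S \<Longrightarrow> is_functor terminal_cat (Und B (f i)) (fst X i)"
  using lax_unfold(1) by (auto simp: cell1_def)

lemma lax_ob_obj: "i \<in> Col S \<Longrightarrow> lax_ob X i \<in> Obj (Und B (f i))"
  unfolding lax_ob_def by (rule g_obj[OF lax_functor])

lemma lax_ob_obj_typed:
  assumes "typed S \<alpha> g M i" "m \<in> set M"
  shows "lax_ob X (g m) \<in> Obj (Und B (f (g m)))"
  by (rule lax_ob_obj[OF S.typed_col[OF assms]])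

lemma lax_coh_hom:
  assumes \<alpha>: "typed S \<alpha> g M i"
  shows "in_hom (Und B (f i)) (lax_coh S X \<alpha>) (str_obj T B (F \<alpha>) (map (\<lambda>m. lax_ob X (g m)) M)) (lax_ob X i)"
  using lax_unfold(2) lax_dom_obj[OF lax_functor \<alpha>] lax_cod_obj[OF lax_functor \<alpha>] S.terminal_mon_obj[OF \<alpha>] typed_tgt_f[OF \<alpha>]
  by (fastforce simp: cell2_def is_nat_trans_def lax_coh_typed[OF \<alpha>] lax_ob_def)

lemma lax_coh_one:
  assumes i: "i \<in> Col S"
  shows "lax_coh S X (One S i) = Ide (Und B (f i)) (lax_ob X i)"
  using fun_cong[OF fun_cong[OF lax_unfold(3), of i], of "()"] i S.one_src[OF i] S.one_tgt[OF i]
  by (simp add: rwhisker_def id2_def mon_unit_def lax_coh_def lax_ob_def arity_def)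

text \<open>Naturality of the coherence 2-cell at an arrow that only permutes; the codomain functor
  turns this arrow into an identity.\<close>

lemma lax_coh_relab:
  assumes \<alpha>: "typed S \<alpha> g M i" and MN: "reorders M N"
  shows "lax_coh S X (relab S \<alpha> M N) =
    Cmp (Und B (f i)) (lax_coh S X \<alpha>) (str_perm T B (\<lambda>m. f (g m)) (F \<alpha>) M N (\<lambda>m. lax_ob X (g m)))"
proof -
  note i = typed_tgt_f[OF \<alpha>]
  interpret Bi: category "Und B (f i)" using B.Und_category i by blast
  note \<alpha>' = S.typed_relab[OF \<alpha> MN]
  let ?m = "larr S \<alpha> M N (\<lambda>_. ()) (\<lambda>_. ()) (\<lambda>_. ())"
  have m: "in_hom (mon_ob S (\<lambda>_. terminal_cat) i) ?m (relab S \<alpha> M N, replicate (length N) ()) (\<alpha>, replicate (length M) ())"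
    using S.larr_in_hom[OF terminal_category \<alpha> MN lhom_one] by (simp add: map_unit)
  have "\<And>m x y. in_hom (mon_ob S (\<lambda>_. terminal_cat) i) m x y \<Longrightarrow>
      Cmp (Und B (f i)) (snd X i y) (FA (lax_dom S one FB (fst X) i) m) =
      Cmp (Und B (f i)) (FA (lax_cod S one (fst X) i) m) (snd X i x)"
    using lax_unfold(2) i by (auto simp: cell2_def is_nat_trans_def)
  from this[OF m]
  have "Cmp (Und B (f i)) (lax_coh S X \<alpha>) (str_perm T B (\<lambda>m. f (g m)) (F \<alpha>) M N (\<lambda>m. lax_ob X (g m))) =
      Cmp (Und B (f i)) (Ide (Und B (f i)) (lax_ob X i)) (lax_coh S X (relab S \<alpha> M N))"
    using lax_dom_arr[OF lax_functor \<alpha> MN] lax_cod_arr[OF lax_functor, of i ?m] m i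
    by (simp add: lax_coh_typed[OF \<alpha>] lax_coh_typed[OF \<alpha>'] lax_ob_def in_hom_def[of "mon_ob S (\<lambda>_. terminal_cat) i"])
  then show ?thesis using Bi.cmp_ide_left[OF lax_coh_hom[OF \<alpha>']] by simp
qed

text \<open>The multiplication axiom of a lax morphism at an operation whose inputs are filled by
  operations. Its second factor is the structure map of \<open>B\<close> applied to the inner
  coherence arrows.\<close>

lemma lax_coh_sub:
  assumes \<alpha>: "typed S \<alpha> g M i" and M: "distinct M" and \<beta>: "\<And>m. m \<in> set M \<Longrightarrow> typed S (\<beta> m) g' (L m) (g m)"
  shows "lax_coh S X (Sub S \<alpha> (map \<beta> M)) =
    Cmp (Und B (f i)) (lax_coh S X \<alpha>) (str_arr T B (F \<alpha>) M M
      (\<lambda>m. str_obj T B (F (\<beta> m)) (map (\<lambda>l. lax_ob X (g' l)) (L m))) (\<lambda>m. lax_coh S X (\<beta> m)) (\<lambda>m. lax_ob X (g m)))"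
proof -
  note i = typed_tgt_f[OF \<alpha>]
  let ?E = "\<lambda>_ :: 'i. terminal_cat"
  let ?y = "\<lambda>m. (\<beta> m, replicate (length (L m)) ())"
  let ?z = "(\<alpha>, map ?y M)"
  have z: "?z \<in> Obj (mon_ob S (mon_ob S ?E) i)"
    by (rule mon_ob_ObjI[OF \<alpha>]) (use S.terminal_mon_obj[OF \<beta>] in simp)
  have z': "mon_mult_obj S ?z = (Sub S \<alpha> (map \<beta> M), replicate (length (concat (map L M))) ())"
    using S.mon_mult_obj_map[of \<alpha> \<beta> "\<lambda>_. ()" L M] by (simp only: map_unit)
  have one: "FO (mon_1 S (mon_ob S ?E) (Str one) i) ?z = (\<alpha>, replicate (length M) ())"
    using S.mon_1_obj[OF \<alpha> _ z, of "Str one"] i by (simp add: map_unit)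
  have "snd X i (mon_mult_obj S ?z) = Cmp (Und B (f i)) (snd X i (\<alpha>, replicate (length M) ()))
      (FA (Str FB i) (mon_2 S (mon_ob S ?E) (lax_dom S one FB (fst X)) (lax_cod S one (fst X)) (snd X) i ?z))"
    using fun_cong[OF fun_cong[OF lax_unfold(4), of i], of ?z] z i one
    by (simp add: rwhisker_def vcomp_def lwhisker_def mon_mult_def)
  moreover have "mon_2 S (mon_ob S ?E) (lax_dom S one FB (fst X)) (lax_cod S one (fst X)) (snd X) i ?z =
      larr S \<alpha> M M (\<lambda>m. FO (lax_dom S one FB (fst X) (g m)) (?y m)) (\<lambda>m. snd X (g m) (?y m))
        (\<lambda>m. FO (lax_cod S one (fst X) (g m)) (?y m))"
    by (rule S.mon_2_larr[OF \<alpha> M _ z]) (use i in simp)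
  moreover have "\<dots> = larr S \<alpha> M M
      (\<lambda>m. str_obj T B (F (\<beta> m)) (map (\<lambda>l. lax_ob X (g' l)) (L m))) (\<lambda>m. lax_coh S X (\<beta> m)) (\<lambda>m. lax_ob X (g m))"
    by (rule larr_cong)
      (use M lax_dom_obj[OF lax_functor \<beta>] lax_cod_obj[OF lax_functor \<beta>] lax_coh_typed[OF \<beta>, of _ X, symmetric] in \<open>simp_all add: lax_ob_def\<close>)
  moreover have "lhom (Und B) (\<lambda>m. f (g m)) M (\<lambda>m. str_obj T B (F (\<beta> m)) (map (\<lambda>l. lax_ob X (g' l)) (L m)))
      (\<lambda>m. lax_coh S X (\<beta> m)) (\<lambda>m. lax_ob X (g m))"
    using lax_coh_hom[OF \<beta>] by (simp add: lhom_def)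
  ultimately show ?thesis
    using FB_str_arr[OF \<alpha>, of M] M i
    by (simp add: z' lax_coh_typed[OF \<alpha>] lax_coh_typed[OF S.typed_sub[OF \<alpha> \<beta>]] str_arr_def[of S])
qed

lemma lax_eq_mklax: "X = mklax S f B (lax_ob X) (lax_coh S X)"
proof (rule prod_eqI)
  show "fst X = fst (mklax S f B (lax_ob X) (lax_coh S X))"
  proof
    fix i show "fst X i = fst (mklax S f B (lax_ob X) (lax_coh S X)) i"
    proof (cases "i \<in> Col S")
      case True
      have "FO (fst X i) = (\<lambda>_. lax_ob X i)" "FA (fst X i) = (\<lambda>_. Ide (Und B (f i)) (lax_ob X i))"
        using g_ide[OF lax_functor True] by (auto simp: lax_ob_def)
      then show ?thesis using True by (simp add: mklax_def)
    next
      case False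
      then show ?thesis using lax_unfold(1) by (simp add: cell1_def mklax_def extensional_def)
    qed
  qed
  show "snd X = snd (mklax S f B (lax_ob X) (lax_coh S X))"
  proof (intro ext)
    fix i a show "snd X i a = snd (mklax S f B (lax_ob X) (lax_coh S X)) i a"
    proof (cases "i \<in> Col S")
      case True
      show ?thesis
      proof (cases "a \<in> Obj (mon_ob S (\<lambda>_. terminal_cat) i)")
        case a: True
        obtain \<alpha> us where aa: "a = (\<alpha>, us)" by fastforce
        show ?thesis using terminal_mon_objE[OF a] a True by (simp add: mklax_def lax_coh_def aa)
      next
        case a: False
        have "snd X i \<in> extensional (Obj (mon_ob S (\<lambda>_. terminal_cat) i))"
          using lax_unfold(2) True by (simp add: cell2_def is_nat_trans_def)
        then show ?thesis using a True by (cases a) (simp add: mklax_def extensional_def)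
      qed
    next
      case False
      then show ?thesis using lax_unfold(2) by (simp add: cell2_def mklax_def extensional_def)
    qed
  qed
qed

end

section \<open>Building a lax morphism from objects and coherence arrows\<close>

lemma lax_ob_mklax: "i \<in> Col S \<Longrightarrow> lax_ob (mklax S f B x c) i = x i"
  by (simp add: lax_ob_def mklax_def)

lemma lax_coh_mklax:
  assumes "\<alpha> \<in> Ops S"
  shows "lax_coh S (mklax S f B x c) \<alpha> = c \<alpha>"
  using S.terminal_mon_obj[OF typed_nth[OF assms]] S.tgt_col[OF assms] by (simp add: lax_coh_def mklax_def)

lemma mklax_cong:
  assumes "\<And>i. i \<in> Col S \<Longrightarrow> x i = x' i" "\<And>\<alpha>. \<alpha> \<in> Ops S \<Longrightarrow> c \<alpha> = c' \<alpha>"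
  shows "mklax S f B x c = mklax S f B x' c'"
  using assms by (auto simp: mklax_def restrict_def fun_eq_iff mon_ob_sel split: prod.splits)

text \<open>Converse to the laws above: typing, unit, permutation and substitution laws suffice. A
  hypothesis cannot be polymorphic in the label type, so labels are fixed to \<open>nat\<close> for
  outer operations and to pairs for inner ones, as produced by \<open>typed_nth\<close> and
  \<open>mon_ob2_ObjE\<close>.\<close>

lemma mklax_lax:
  assumes x: "\<And>i. i \<in> Col S \<Longrightarrow> x i \<in> Obj (Und B (f i))"
    and hom: "\<And>\<alpha> g M i. typed S \<alpha> g (M :: nat list) i \<Longrightarrow>
      in_hom (Und B (f i)) (c \<alpha>) (str_obj T B (F \<alpha>) (map (\<lambda>m. x (g m)) M)) (x i)"
    and one: "\<And>i. i \<in> Col S \<Longrightarrow> c (One S i) = Ide (Und B (f i)) (x i)"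
    and rel: "\<And>\<alpha> g M N i. typed S \<alpha> g (M :: nat list) i \<Longrightarrow> reorders M N \<Longrightarrow>
      c (relab S \<alpha> M N) = Cmp (Und B (f i)) (c \<alpha>) (str_perm T B (\<lambda>m. f (g m)) (F \<alpha>) M N (\<lambda>m. x (g m)))"
    and sub: "\<And>\<alpha> g M i \<beta> g' L. typed S \<alpha> g M i \<Longrightarrow> distinct M \<Longrightarrow>
      (\<And>m. m \<in> set M \<Longrightarrow> typed S (\<beta> m) g' (L m) (g m)) \<Longrightarrow>
      distinct (concat (map (L :: nat \<Rightarrow> (nat \<times> nat) list) M)) \<Longrightarrow>
      c (Sub S \<alpha> (map \<beta> M)) = Cmp (Und B (f i)) (c \<alpha>) (str_arr T B (F \<alpha>) M M
      (\<lambda>m. str_obj T B (F (\<beta> m)) (map (\<lambda>l. x (g' l)) (L m))) (\<lambda>m. c (\<beta> m)) (\<lambda>m. x (g m)))"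
  shows "lax_morphism S one FB (mklax S f B x c)"
proof -
  let ?E = "\<lambda>_ :: 'i. terminal_cat"
  define g where "g = fst (mklax S f B x c)"
  define gc where "gc = snd (mklax S f B x c)"
  have gi: "g i = \<lparr> FO = (\<lambda>_. x i), FA = (\<lambda>_. Ide (Und B (f i)) (x i)) \<rparr>" if "i \<in> Col S" for i
    using that by (simp add: g_def mklax_def)
  have gci: "gc i (\<alpha>, replicate (length M) ()) = c \<alpha>" if "typed S \<alpha> h M i" for i \<alpha> h and M :: "'l list"
    using S.terminal_mon_obj[OF that] typed_tgt_f[OF that] by (simp add: gc_def mklax_def)
  have g_fun: "is_functor terminal_cat (Und B (f i)) (g i)" if i: "i \<in> Col S" for i
  proof -
    interpret Bi: category "Und B (f i)" using B.Und_category col_map[OF i] by blast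
    interpret E: category terminal_cat by (rule terminal_category)
    show ?thesis
      using Bi.ide_hom[OF x[OF i]] x[OF i] Bi.cmp_ide_left[OF Bi.ide_hom[OF x[OF i]]]
      by unfold_locales (auto simp: gi[OF i] in_hom_def[of "Und B (f i)"] extensional_def)
  qed
  have xg: "FO (g i) () = x i" if "i \<in> Col S" for i using gi[OF that] by simp
  have xgm: "FO (g (h m)) () = x (h m)" if "typed S \<alpha> h M i" "m \<in> set M" for \<alpha> h i m and M :: "'l list"
    by (rule xg[OF S.typed_col[OF that]])
  have xm: "map (\<lambda>m. FO (g (h m)) ()) M = map (\<lambda>m. x (h m)) M" if "typed S \<alpha> h M i" for \<alpha> h i and M :: "'l list"
    using xgm[OF that] by simp
  have xm2: "map (\<lambda>m. FO (g (h m)) ()) M = map (\<lambda>m. x (h m)) M" if "typed S \<alpha> h M i" for \<alpha> h i and M :: "(nat \<times> nat) list"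
    using xg S.typed_col[OF that] by simp
  have 1: "cell1 (Col S) ?E (pull (Col S) f (Und B)) g"
    using g_fun by (simp add: cell1_def) (simp add: g_def mklax_def)
  have nat: "is_nat_trans (mon_ob S ?E i) (Und B (f i)) (lax_dom S one FB g i) (lax_cod S one g i) (gc i)"
    if i: "i \<in> Col S" for i
    unfolding is_nat_trans_def
  proof (intro conjI ballI allI impI)
    show "gc i \<in> extensional (Obj (mon_ob S ?E i))"
      using i by (simp add: gc_def mklax_def)
    fix a assume a: "a \<in> Obj (mon_ob S ?E i)"
    let ?\<alpha> = "fst a" and ?M = "[0..<arity S (fst a)]"
    have aa: "a = (?\<alpha>, replicate (length ?M) ())" "?\<alpha> \<in> Ops S" "Tgt S ?\<alpha> = i"
      using terminal_mon_objE[OF a] by auto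
    have t: "typed S ?\<alpha> ((!) (Src S ?\<alpha>)) ?M i" using typed_nth[OF aa(2)] aa(3) by simp
    have "FO (lax_dom S one FB g i) a = str_obj T B (F ?\<alpha>) (map (\<lambda>m. x (Src S ?\<alpha> ! m)) ?M)"
      by (subst aa(1)) (subst lax_dom_obj[OF g_fun t], simp_all only: xm[OF t])
    moreover have "FO (lax_cod S one g i) a = x i"
      by (subst aa(1)) (subst lax_cod_obj[OF g_fun t], simp_all only: xg[OF i])
    moreover have "gc i a = c ?\<alpha>" by (subst aa(1)) (rule gci[OF t])
    ultimately show "in_hom (Und B (f i)) (gc i a) (FO (lax_dom S one FB g i) a) (FO (lax_cod S one g i) a)"
      using hom[OF t] by simp
  next
    fix m a b assume m: "in_hom (mon_ob S ?E i) m a b"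
    have b: "b \<in> Obj (mon_ob S ?E i)"
      by (rule category.in_hom_obj(2)[OF S.mon_ob_category[OF terminal_category] m])
    let ?\<beta> = "fst b" and ?M = "[0..<arity S (fst b)]"
    have bb: "b = (?\<beta>, replicate (length ?M) ())" "?\<beta> \<in> Ops S" "Tgt S ?\<beta> = i"
      using terminal_mon_objE[OF b] by auto
    have t: "typed S ?\<beta> ((!) (Src S ?\<beta>)) ?M i" using typed_nth[OF bb(2)] bb(3) by simp
    have m': "in_hom (mon_ob S ?E i) m a (?\<beta>, map (\<lambda>_. ()) ?M)" using m bb(1) by (simp add: map_unit)
    obtain N xx cc where mm: "m = larr S ?\<beta> ?M N xx cc (\<lambda>_. ())" "a = (relab S ?\<beta> ?M N, map xx N)" "reorders ?M N"
      using S.larrE[OF m' t distinct_upt] by blast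
    have mm': "m = larr S ?\<beta> ?M N (\<lambda>_. ()) (\<lambda>_. ()) (\<lambda>_. ())" proof -
      have "xx = (\<lambda>_. ())" "cc = (\<lambda>_. ())" by (simp_all add: fun_eq_iff)
      then show ?thesis using mm(1) by simp
    qed
    have aa: "a = (relab S ?\<beta> ?M N, replicate (length N) ())" by (simp add: mm(2) map_unit)
    note t' = S.typed_relab[OF t mm(3)]
    interpret Bi: category "Und B (f i)" using B.Und_category col_map[OF i] by blast
    have "Cmp (Und B (f i)) (gc i b) (FA (lax_dom S one FB g i) m) =
        Cmp (Und B (f i)) (c ?\<beta>) (str_perm T B (\<lambda>m. f (Src S ?\<beta> ! m)) (F ?\<beta>) ?M N (\<lambda>m. FO (g (Src S ?\<beta> ! m)) ()))"
    proof -
      have "FA (lax_dom S one FB g i) m =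
          str_perm T B (\<lambda>m. f (Src S ?\<beta> ! m)) (F ?\<beta>) ?M N (\<lambda>m. FO (g (Src S ?\<beta> ! m)) ())"
        unfolding mm' by (rule lax_dom_arr[OF g_fun t mm(3)])
      moreover have "gc i b = c ?\<beta>" by (subst bb(1)) (rule gci[OF t])
      ultimately show ?thesis by (simp only:)
    qed
    also have "str_perm T B (\<lambda>m. f (Src S ?\<beta> ! m)) (F ?\<beta>) ?M N (\<lambda>m. FO (g (Src S ?\<beta> ! m)) ()) =
        str_perm T B (\<lambda>m. f (Src S ?\<beta> ! m)) (F ?\<beta>) ?M N (\<lambda>m. x (Src S ?\<beta> ! m))"
      by (rule str_perm_cong[OF mm(3)]) (use xgm[OF t] in simp)
    also have "Cmp (Und B (f i)) (c ?\<beta>) \<dots> = c (relab S ?\<beta> ?M N)"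
      by (rule rel[OF t mm(3), symmetric])
    also have "\<dots> = Cmp (Und B (f i)) (FA (lax_cod S one g i) m) (gc i a)"
      using lax_cod_arr[OF g_fun i, of m] m Bi.cmp_ide_left[OF hom[OF t']] gci[OF t'] xg[OF i]
      by (simp add: aa in_hom_def[of "mon_ob S ?E i"])
    finally show "Cmp (Und B (f i)) (gc i b) (FA (lax_dom S one FB g i) m) =
        Cmp (Und B (f i)) (FA (lax_cod S one g i) m) (gc i a)" .
  qed
  have 2: "cell2 (Col S) (mon_ob S ?E) (pull (Col S) f (Und B)) (lax_dom S one FB g) (lax_cod S one g) gc"
    using nat by (simp add: cell2_def) (simp add: gc_def mklax_def)
  have 3: "rwhisker (Col S) ?E gc (mon_unit S ?E) = id2 (Col S) ?E (pull (Col S) f (Und B)) g"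
  proof (intro ext)
    fix i a show "rwhisker (Col S) ?E gc (mon_unit S ?E) i a = id2 (Col S) ?E (pull (Col S) f (Und B)) g i a"
    proof (cases "i \<in> Col S")
      case True
      have "typed S (One S i) (\<lambda>_. i) [0 :: nat] i" by (simp add: S.typed_one True)
      then show ?thesis using gci[of "One S i" "\<lambda>_. i" "[0 :: nat]" i] one[OF True] xg[OF True] True
        by (simp add: rwhisker_def id2_def mon_unit_def)
    qed (simp add: rwhisker_def id2_def)
  qed
  have 4: "rwhisker (Col S) (mon_ob S (mon_ob S ?E)) gc (mon_mult S ?E) =
     vcomp (Col S) (mon_ob S (mon_ob S ?E)) (pull (Col S) f (Und B))
       (rwhisker (Col S) (mon_ob S (mon_ob S ?E)) gc (mon_1 S (mon_ob S ?E) (Str one)))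
       (lwhisker (Col S) (mon_ob S (mon_ob S ?E)) (Str FB)
          (mon_2 S (mon_ob S ?E) (lax_dom S one FB g) (lax_cod S one g) gc))" (is "?lhs = ?rhs")
  proof (intro ext)
    fix i a show "?lhs i a = ?rhs i a"
    proof (cases "i \<in> Col S \<and> a \<in> Obj (mon_ob S (mon_ob S ?E) i)")
      case True
      then have i: "i \<in> Col S" and a: "a \<in> Obj (mon_ob S (mon_ob S ?E) i)" by auto
      show ?thesis
      proof (rule S.mon_ob2_ObjE[OF a])
        fix \<alpha> h M \<beta> h' us and L :: "nat \<Rightarrow> (nat \<times> nat) list"
        assume aa: "a = (\<alpha>, map (\<lambda>m. (\<beta> m, map us (L m))) M)" and \<alpha>: "typed S \<alpha> h M i" and M: "distinct M"
          and \<beta>: "\<And>m. m \<in> set M \<Longrightarrow> typed S (\<beta> m) h' (L m) (h m)" and L: "distinct (concat (map L M))"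
        let ?y = "\<lambda>m. (\<beta> m, replicate (length (L m)) ())"
        have az: "a = (\<alpha>, map ?y M)" by (simp add: aa map_unit)
        have z': "mon_mult_obj S a = (Sub S \<alpha> (map \<beta> M), replicate (length (concat (map L M))) ())"
          using S.mon_mult_obj_map[of \<alpha> \<beta> us L M] by (simp only: map_unit aa)
        have one: "FO (mon_1 S (mon_ob S ?E) (Str one) i) a = (\<alpha>, replicate (length M) ())"
          using S.mon_1_obj[OF \<alpha> i a[unfolded aa], of "Str one"] by (simp add: map_unit aa)
        have h: "lhom (Und B) (\<lambda>m. f (h m)) M (\<lambda>m. str_obj T B (F (\<beta> m)) (map (\<lambda>l. x (h' l)) (L m)))
          (\<lambda>m. c (\<beta> m)) (\<lambda>m. x (h m))"
          unfolding lhom_def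
        proof
          fix m assume m: "m \<in> set M"
          \<comment> \<open>The hypothesis \<open>hom\<close> speaks of labels in
            \<open>nat\<close>, so the pairs labelling the block are replaced by their
            positions.\<close>
          have "typed S (\<beta> m) (\<lambda>k. h' (L m ! k)) [0..<length (L m)] (h m)"
            using \<beta>[OF m] typed_map[of S "\<beta> m" h' "(!) (L m)" "[0..<length (L m)]" "h m"] by (simp add: map_nth)
          moreover have "map (\<lambda>k. x (h' (L m ! k))) [0..<length (L m)] = map (\<lambda>l. x (h' l)) (L m)"
            by (rule nth_equalityI) simp_all
          ultimately show "in_hom (Und B (f (h m))) (c (\<beta> m)) (str_obj T B (F (\<beta> m)) (map (\<lambda>l. x (h' l)) (L m))) (x (h m))"
            using hom by fastforce
        qed
        have "mon_2 S (mon_ob S ?E) (lax_dom S one FB g) (lax_cod S one g) gc i a =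
            larr S \<alpha> M M (\<lambda>m. FO (lax_dom S one FB g (h m)) (?y m)) (\<lambda>m. gc (h m) (?y m))
              (\<lambda>m. FO (lax_cod S one g (h m)) (?y m))"
          unfolding az by (rule S.mon_2_larr[OF \<alpha> M i a[unfolded az]])
        also have "\<dots> = larr S \<alpha> M M
            (\<lambda>m. str_obj T B (F (\<beta> m)) (map (\<lambda>l. x (h' l)) (L m))) (\<lambda>m. c (\<beta> m)) (\<lambda>m. x (h m))"
        proof (rule larr_cong[OF iffD2[OF reorders_refl M]], intro conjI)
          fix m assume m: "m \<in> set M"
          show "FO (lax_dom S one FB g (h m)) (?y m) = str_obj T B (F (\<beta> m)) (map (\<lambda>l. x (h' l)) (L m))"
            using lax_dom_obj[OF g_fun \<beta>[OF m]] xm2[OF \<beta>[OF m]] by simp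
          have t: "typed S (\<beta> m) (\<lambda>k. h' (L m ! k)) [0..<length (L m)] (h m)"
            using \<beta>[OF m] typed_map[of S "\<beta> m" h' "(!) (L m)" "[0..<length (L m)]" "h m"] by (simp add: map_nth)
          show "gc (h m) (?y m) = c (\<beta> m)" using gci[OF t] by simp
          show "FO (lax_cod S one g (h m)) (?y m) = x (h m)"
            using lax_cod_obj[OF g_fun \<beta>[OF m]] xg S.typed_col[OF \<alpha> m] by simp
        qed
        finally have m2: "FA (Str FB i) (mon_2 S (mon_ob S ?E) (lax_dom S one FB g) (lax_cod S one g) gc i a) =
            str_arr T B (F \<alpha>) M M (\<lambda>m. str_obj T B (F (\<beta> m)) (map (\<lambda>l. x (h' l)) (L m))) (\<lambda>m. c (\<beta> m)) (\<lambda>m. x (h m))"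
          using FB_str_arr[OF \<alpha> _ h] M typed_tgt_f[OF \<alpha>] by (simp add: str_arr_def[of S])
        have tsub: "Sub S \<alpha> (map \<beta> M) \<in> Ops S" "Tgt S (Sub S \<alpha> (map \<beta> M)) = i"
          "arity S (Sub S \<alpha> (map \<beta> M)) = length (concat (map L M))"
          using S.typed_sub[OF \<alpha> \<beta>] typed_arity[OF S.typed_sub[OF \<alpha> \<beta>]] by (auto simp: typed_def)
        have "gc i (mon_mult_obj S a) = c (Sub S \<alpha> (map \<beta> M))"
          unfolding z' using gci[OF typed_nth[OF tsub(1)]] tsub by simp
        also have "\<dots> = Cmp (Und B (f i)) (gc i (\<alpha>, replicate (length M) ()))
            (FA (Str FB i) (mon_2 S (mon_ob S ?E) (lax_dom S one FB g) (lax_cod S one g) gc i a))"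
          unfolding m2 gci[OF \<alpha>] by (rule sub[OF \<alpha> M \<beta> L])
        finally show ?thesis
          using i a by (simp add: rwhisker_def vcomp_def lwhisker_def one mon_mult_def)
      qed
    next
      case False
      then show ?thesis by (auto simp: rwhisker_def vcomp_def)
    qed
  qed
  have "lax_morphism S one FB (g, gc)"
    using 1 2 3 4 by (simp add: lax_morphism_def Fbar_Und)
  then show ?thesis by (simp add: g_def gc_def)
qed

end

section \<open>The lax morphism \<open>u\<^sub>F\<close> and the extension of lax morphisms along it\<close>

text \<open>
  The value of the extension at a labelled morphism of \<open>F \<down> j\<close>: first permute the inputs along
  the bijective part of the indexing function, then apply the coherence data of the lax
  morphism to the decorating operations.
\<close>

definition ext_arr :: "('j, 't) opd \<Rightarrow> ('j, 't, 'o, 'm) alg \<Rightarrow> ('i \<Rightarrow> 'j) \<Rightarrow> ('s \<Rightarrow> 't) \<Rightarrow> ('i \<Rightarrow> 'o) \<Rightarrow> ('s \<Rightarrow> 'm)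
    \<Rightarrow> 'k list \<Rightarrow> ('k \<Rightarrow> 'i) \<Rightarrow> 'l list \<Rightarrow> ('l \<Rightarrow> 'i) \<Rightarrow> 't \<Rightarrow> ('k \<Rightarrow> 'l) \<Rightarrow> ('l \<Rightarrow> 's) \<Rightarrow> 'm" where
  "ext_arr T B f F x c L1 i1 L2 i2 \<alpha> h b = Cmp (Und B (Tgt T \<alpha>))
     (str_arr T B \<alpha> L2 L2 (\<lambda>k. str_obj T B (F (b k)) (map (\<lambda>l. x (i1 l)) (fib L1 h k))) (\<lambda>k. c (b k)) (\<lambda>k. x (i2 k)))
     (str_perm T B (\<lambda>l. f (i1 l)) (Sub T \<alpha> (map (\<lambda>k. F (b k)) L2)) (cfib L1 h L2) L1 (\<lambda>l. x (i1 l)))"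

definition ext_FO :: "('j, 't) opd \<Rightarrow> ('j, 't, 'o, 'm) alg \<Rightarrow> ('i \<Rightarrow> 'o) \<Rightarrow> ('i, 't) dobj \<Rightarrow> 'o" where
  "ext_FO T B x = (\<lambda>(is, \<alpha>). str_obj T B \<alpha> (map x is))"

text \<open>An arrow of \<open>F \<down> j\<close> comes without labels; its positions serve as
  labels here, and \<open>ext_FA_darr\<close> shows that any other choice gives the same
  value.\<close>

definition ext_FA :: "('j, 't) opd \<Rightarrow> ('j, 't, 'o, 'm) alg \<Rightarrow> ('i \<Rightarrow> 'j) \<Rightarrow> ('s \<Rightarrow> 't) \<Rightarrow> ('i \<Rightarrow> 'o) \<Rightarrow> ('s \<Rightarrow> 'm)
    \<Rightarrow> ('i, 's, 't) darr \<Rightarrow> 'm" where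
  "ext_FA T B f F x c = (\<lambda>((is1, _), (h, bs), (is2, \<alpha>)).
     ext_arr T B f F x c [0..<length is1] ((!) is1) [0..<length is2] ((!) is2) \<alpha> h ((!) bs))"

text \<open>Rebracketing for the composite of two extended arrows: the inner pair, coherence
  \<open>a1\<close> before permutation \<open>p2\<close>, is exchanged for a permutation
  \<open>q\<close> before coherence \<open>r\<close>.\<close>

lemma (in category) cmp_exchange:
  assumes "in_hom C p1 w0 w1" "in_hom C a1 w1 w2" "in_hom C p2 w2 w3" "in_hom C a2 w3 w4"
    "in_hom C q w1 w5" "in_hom C r w5 w3" "Cmp C p2 a1 = Cmp C r q"
  shows "Cmp C (Cmp C a2 p2) (Cmp C a1 p1) = Cmp C (Cmp C a2 r) (Cmp C q p1)"
proof -
  have "Cmp C (Cmp C a2 p2) (Cmp C a1 p1) = Cmp C a2 (Cmp C p2 (Cmp C a1 p1))"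
    using cmp_assoc[OF cmp_hom[OF assms(1,2)] assms(3,4)] by simp
  also have "Cmp C p2 (Cmp C a1 p1) = Cmp C (Cmp C r q) p1"
    using cmp_assoc[OF assms(1-3)] assms(7) by simp
  also have "\<dots> = Cmp C r (Cmp C q p1)"
    using cmp_assoc[OF assms(1,5,6)] by simp
  also have "Cmp C a2 \<dots> = Cmp C (Cmp C a2 r) (Cmp C q p1)"
    using cmp_assoc[OF cmp_hom[OF assms(1,5)] assms(6,4)] .
  finally show ?thesis .
qed

lemma map_singletons: "concat (map (\<lambda>l. [l]) L) = L"
  by (induction L) auto

section \<open>The coherence arrows of \<open>u\<^sub>F\<close> and the factorisation of arrows of
  \<open>F \<down> j\<close>\<close>

context opmor
begin

abbreviation "ux \<equiv> \<lambda>i. ([i], One T (f i)) :: ('i, 't) dobj"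

text \<open>The coherence arrow of \<open>u\<^sub>F\<close> at an operation. Its indexing function
  is the constant 0 because positions count from 0.\<close>

definition uc :: "'s \<Rightarrow> ('i, 's, 't) darr" where
  "uc \<alpha> = ((Src S \<alpha>, F \<alpha>), (\<lambda>k\<in>{..<arity S \<alpha>}. 0, [\<alpha>]), ([Tgt S \<alpha>], One T (f (Tgt S \<alpha>))))"

lemma dob_one: "i k \<in> Col S \<Longrightarrow> dob S T f [k] i (One T (f (i k))) (f (i k))"
  by (simp add: dob_def T.typed_one col_map)

lemma cfib_single: "cfib L h [k] = fib L h k"
  by (simp add: cfib_def)

lemma uc_dmor:
  "typed S (b k) i1 (fib L h k) (i2 k) \<Longrightarrow> distinct L \<Longrightarrow> dmor S (fib L h k) i1 [k] i2 h b"
  by (simp add: dmor_def fib_fib)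

text \<open>The part of an arrow over one target label \<open>k\<close> is the coherence arrow of
  its decoration. Keeping the labels, \<open>h\<close> and \<open>b\<close> of the surrounding arrow
  allows \<open>A_arr\<close> to reassemble these parts.\<close>

lemma uc_darr:
  assumes b: "typed S (b k) i1 (fib L h k) (i2 k)" and L: "distinct L"
  shows "uc (b k) = darr T F (fib L h k) i1 [k] i2 (One T (f (i2 k))) h b"
    and "dsrc T F (fib L h k) [k] h b (One T (f (i2 k))) = F (b k)"
proof -
  note t = F_typed[OF b]
  have ff: "fib (fib L h k) h k = fib L h k" by (rule fib_fib)
  show src: "dsrc T F (fib L h k) [k] h b (One T (f (i2 k))) = F (b k)"
    using T.sub_one_l[OF t] T.relab_self[OF t] L by (simp add: dsrc_def cfib_single ff)
  have "(\<lambda>p\<in>{..<length (fib L h k)}. pos [k] (h (fib L h k ! p))) = (\<lambda>p\<in>{..<length (fib L h k)}. 0)"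
  proof (rule restrict_ext)
    fix p assume "p \<in> {..<length (fib L h k)}"
    then have "fib L h k ! p \<in> set (fib L h k)" by (intro nth_mem) simp
    then show "pos [k] (h (fib L h k ! p)) = 0" by (intro pos_eqI) simp_all
  qed
  then show "uc (b k) = darr T F (fib L h k) i1 [k] i2 (One T (f (i2 k))) h b"
    using b typed_arity[OF b] by (simp add: uc_def darr_def src typed_def)
qed

text \<open>Substituting unit operations into \<open>\<alpha>\<close> changes nothing, so the
  objects \<open>(i, 1)\<close> generate all objects of \<open>F \<down> j\<close> under the
  action.\<close>

lemma A_units:
  assumes \<alpha>: "typed T \<alpha> (\<lambda>l. f (i l)) L j" and i: "\<And>l. l \<in> set L \<Longrightarrow> i l \<in> Col S"
  shows "str_obj T A \<alpha> (map (\<lambda>l. ux (i l)) L) = (map i L, \<alpha>)"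
proof -
  have "str_obj T A \<alpha> (map (\<lambda>l. (map i [l], One T (f (i l)))) L) =
      (map i (concat (map (\<lambda>l. [l]) L)), Sub T \<alpha> (map (\<lambda>l. One T (f (i l))) L))"
    by (rule A_obj[OF \<alpha>]) (rule dob_one[where i = i, OF i])
  then show ?thesis using T.sub_one_r[OF \<alpha>] by (simp add: map_singletons)
qed

text \<open>The monotone half of the factorisation: acting by \<open>\<alpha>\<close> on the
  coherence arrows keeps \<open>h\<close> and \<open>b\<close>, and lists the source already grouped
  along the target.\<close>

lemma A_uc:
  assumes m: "dmor S L1 i1 L2 i2 h b" and o: "dob S T f L2 i2 \<alpha> j"
  shows "str_arr T A \<alpha> L2 L2 (\<lambda>k. str_obj T A (F (b k)) (map (\<lambda>l. ux (i1 l)) (fib L1 h k))) (\<lambda>k. uc (b k)) (\<lambda>k. ux (i2 k)) =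
    darr T F (cfib L1 h L2) i1 L2 i2 \<alpha> h b"
proof -
  note d = dmorD[OF m] and e = dobD[OF o]
  have "str_arr T A \<alpha> L2 L2 (\<lambda>k. str_obj T A (F (b k)) (map (\<lambda>l. ux (i1 l)) (fib L1 h k))) (\<lambda>k. uc (b k)) (\<lambda>k. ux (i2 k)) =
      str_arr T A \<alpha> L2 L2 (\<lambda>k. (map i1 (fib L1 h k), dsrc T F (fib L1 h k) [k] h b (One T (f (i2 k)))))
      (\<lambda>k. darr T F (fib L1 h k) i1 [k] i2 (One T (f (i2 k))) h b) (\<lambda>k. (map i2 [k], One T (f (i2 k))))"
  proof (rule str_arr_cong[OF iffD2[OF reorders_refl d(2)]], intro conjI)
    fix k assume k: "k \<in> set L2"
    have "i1 l \<in> Col S" if "l \<in> set (fib L1 h k)" for l by (rule S.typed_col[OF d(4)[OF k] that])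
    from A_units[OF F_typed[OF d(4)[OF k]] this]
    show "str_obj T A (F (b k)) (map (\<lambda>l. ux (i1 l)) (fib L1 h k)) =
        (map i1 (fib L1 h k), dsrc T F (fib L1 h k) [k] h b (One T (f (i2 k))))"
      by (simp add: uc_darr(2)[where b = b and ?i1.0 = i1 and ?i2.0 = i2 and h = h, OF d(4)[OF k] d(1)])
    show "uc (b k) = darr T F (fib L1 h k) i1 [k] i2 (One T (f (i2 k))) h b"
      by (rule uc_darr(1)[where b = b and ?i1.0 = i1 and ?i2.0 = i2 and h = h, OF d(4)[OF k] d(1)])
  qed simp
  also have "\<dots> = darr T F (concat (map (fib L1 h) L2)) i1 (concat (map (\<lambda>k. [k]) L2)) i2
      (Sub T \<alpha> (map (\<lambda>k. One T (f (i2 k))) L2)) h b"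
  proof (rule A_arr[OF e(3)])
    show "dmor S (fib L1 h k) i1 [k] i2 h b" "dob S T f [k] i2 (One T (f (i2 k))) (f (i2 k))" if "k \<in> set L2" for k
      using uc_dmor[where b = b and ?i1.0 = i1 and ?i2.0 = i2 and h = h, OF d(4)[OF that] d(1)] dob_one[where i = i2, OF e(2)[OF that]] .
    show "distinct (concat (map (fib L1 h) L2))" using distinct_cfib[OF d(1,2)] by (simp add: cfib_def)
  qed (use d in \<open>simp_all add: map_singletons\<close>)
  finally show ?thesis using T.sub_one_r[OF e(3)] by (simp add: map_singletons cfib_def)
qed

text \<open>The bijective half of the factorisation. Every block is a singleton, so permuting blocks
  is permuting labels, and the units substituted into \<open>\<alpha>\<close> disappear.\<close>

lemma A_str_perm:
  assumes o: "dob S T f M i \<alpha> j" and MN: "reorders M N"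
  shows "str_perm T A (\<lambda>l. f (i l)) \<alpha> M N (\<lambda>l. ux (i l)) = darr T F N i M i \<alpha> (\<lambda>l. l) (\<lambda>l. One S (i l))"
proof -
  note e = dobD[OF o]
  have o1: "dob S T f [m] i (One T (f (i m))) (f (i m))" if "m \<in> set M" for m
    by (rule dob_one[of i m, OF e(2)[OF that]])
  have "str_perm T A (\<lambda>l. f (i l)) \<alpha> M N (\<lambda>l. ux (i l)) =
      str_arr T A \<alpha> M N (\<lambda>m. (map i [m], dsrc T F [m] [m] (\<lambda>l. l) (\<lambda>l. One S (i l)) (One T (f (i m)))))
      (\<lambda>m. darr T F [m] i [m] i (One T (f (i m))) (\<lambda>l. l) (\<lambda>l. One S (i l))) (\<lambda>m. (map i [m], One T (f (i m))))"
    unfolding str_perm_def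
  proof (rule str_arr_cong[OF MN], intro conjI)
    fix m assume m: "m \<in> set M"
    show "ux (i m) = (map i [m], dsrc T F [m] [m] (\<lambda>l. l) (\<lambda>l. One S (i l)) (One T (f (i m))))"
      using dsrc_ide[OF o1[OF m]] by simp
    show "Ide (Und A (f (i m))) (ux (i m)) = darr T F [m] i [m] i (One T (f (i m))) (\<lambda>l. l) (\<lambda>l. One S (i l))"
      using darr_ide[OF o1[OF m]] by (simp add: Und_A)
  qed simp
  also have "\<dots> = darr T F (concat (map (\<lambda>m. [m]) N)) i (concat (map (\<lambda>m. [m]) M)) i
      (Sub T \<alpha> (map (\<lambda>m. One T (f (i m))) M)) (\<lambda>l. l) (\<lambda>l. One S (i l))"
    by (rule A_arr[OF e(3) MN dmor_ide[OF o1] o1]) (use e(1) in \<open>auto simp: map_singletons\<close>)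
  finally show ?thesis using T.sub_one_r[OF e(3)] by (simp add: map_singletons)
qed

lemma typed_dob: "typed S \<alpha> g M i \<Longrightarrow> distinct M \<Longrightarrow> dob S T f M g (F \<alpha>) (f i)"
  using F_typed S.typed_col by (fastforce simp: dob_def)

text \<open>Labelling the only target position by \<open>()\<close> makes the indexing function
  constant, with all of \<open>M\<close> as its single fibre.\<close>

lemma uc_darr_unit:
  assumes \<alpha>: "typed S \<alpha> g M i" and M: "distinct M"
  shows "uc \<alpha> = darr T F M g [()] (\<lambda>_. i) (One T (f i)) (\<lambda>_. ()) (\<lambda>_. \<alpha>)"
    and "dsrc T F M [()] (\<lambda>_. ()) (\<lambda>_. \<alpha>) (One T (f i)) = F \<alpha>"
    and "dmor S M g [()] (\<lambda>_. i) (\<lambda>_. ()) (\<lambda>_. \<alpha>)"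
proof -
  have fb: "fib M (\<lambda>_. ()) () = M" by (simp add: fib_def)
  have t: "typed S \<alpha> g (fib M (\<lambda>_. ()) ()) i" using \<alpha> fb by simp
  show "uc \<alpha> = darr T F M g [()] (\<lambda>_. i) (One T (f i)) (\<lambda>_. ()) (\<lambda>_. \<alpha>)"
    "dsrc T F M [()] (\<lambda>_. ()) (\<lambda>_. \<alpha>) (One T (f i)) = F \<alpha>"
    using uc_darr[of "\<lambda>_. \<alpha>" "()" g M "\<lambda>_. ()" "\<lambda>_. i"] t M fb by simp_all
  show "dmor S M g [()] (\<lambda>_. i) (\<lambda>_. ()) (\<lambda>_. \<alpha>)"
    using t M by (simp add: dmor_def)
qed

lemma dob_unit: "i \<in> Col S \<Longrightarrow> dob S T f [()] (\<lambda>_. i) (One T (f i)) (f i)"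
  using dob_one[of "\<lambda>_. i" "()"] by simp

lemma uc_hom:
  assumes \<alpha>: "typed S \<alpha> g M i"
  shows "in_hom (D (f i)) (uc \<alpha>) (str_obj T A (F \<alpha>) (map (\<lambda>m. ux (g m)) M)) (ux i)"
proof -
  let ?N = "[0..<length M]" and ?g = "\<lambda>k. g (M ! k)"
  have map: "map (\<lambda>k. y (M ! k)) ?N = map y M" for y :: "_ \<Rightarrow> 'z" by (rule nth_equalityI) simp_all
  have t: "typed S \<alpha> ?g ?N i" using \<alpha> map[of g] by (simp add: typed_def)
  have i: "i \<in> Col S" using \<alpha> S.tgt_col by (auto simp: typed_def)
  have "in_hom (D (f i)) (uc \<alpha>) (map ?g ?N, F \<alpha>) (ux i)"
    using darr_hom[OF uc_darr_unit(3)[OF t distinct_upt] dob_unit[OF i]] uc_darr_unit(1,2)[OF t distinct_upt] by simp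
  moreover have "str_obj T A (F \<alpha>) (map (\<lambda>m. ux (g m)) M) = (map g M, F \<alpha>)"
    by (rule A_units[OF F_typed[OF \<alpha>] S.typed_col[OF \<alpha>]])
  ultimately show ?thesis using map[of g] by simp
qed

lemma uc_one: "i \<in> Col S \<Longrightarrow> uc (One S i) = Ide (D (f i)) (ux i)"
proof -
  assume i: "i \<in> Col S"
  have t: "typed S (One S i) (\<lambda>_. i) [()] i" by (simp add: S.typed_one i)
  have "Ide (D (f i)) (map (\<lambda>_. i) [()], One T (f i)) =
      darr T F [()] (\<lambda>_. i) [()] (\<lambda>_. i) (One T (f i)) (\<lambda>l. l) (\<lambda>l. One S i)"
    by (rule darr_ide[OF dob_unit[OF i]])
  moreover have "darr T F [()] (\<lambda>_. i) [()] (\<lambda>_. i) (One T (f i)) (\<lambda>l. l) (\<lambda>l. One S i) =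
      darr T F [()] (\<lambda>_. i) [()] (\<lambda>_. i) (One T (f i)) (\<lambda>_. ()) (\<lambda>_. One S i)"
    by (rule darr_cong) simp_all
  ultimately show ?thesis using uc_darr_unit(1)[OF t] by simp
qed

text \<open>Composing with a symmetry leaves the single decoration \<open>\<alpha>\<close>; its
  inputs, grouped in the order \<open>M\<close>, are then relisted in the order \<open>N\<close> by
  the \<open>relab\<close> of \<open>dcmp\<close>.\<close>

lemma uc_relab:
  assumes \<alpha>: "typed S \<alpha> g M i" and MN: "reorders M N"
  shows "uc (relab S \<alpha> M N) = Cmp (D (f i)) (uc \<alpha>) (str_perm T A (\<lambda>m. f (g m)) (F \<alpha>) M N (\<lambda>m. ux (g m)))"
proof -
  have M: "distinct M" "distinct N" "set M = set N" using MN by (auto simp: reorders_def)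
  have i: "i \<in> Col S" using \<alpha> S.tgt_col by (auto simp: typed_def)
  note o = typed_dob[OF \<alpha> M(1)]
  note u = uc_darr_unit[OF \<alpha> M(1)] and u' = uc_darr_unit[OF S.typed_relab[OF \<alpha> MN] M(2)]
  have dm: "dmor S N g M g (\<lambda>l. l) (\<lambda>l. One S (g l))"
    by (rule dmor_reorder[OF MN S.typed_col[OF \<alpha>]])
  have "Cmp (D (f i)) (uc \<alpha>) (str_perm T A (\<lambda>m. f (g m)) (F \<alpha>) M N (\<lambda>m. ux (g m))) =
      darr T F N g [()] (\<lambda>_. i) (One T (f i)) (\<lambda>_. ()) (dcmp S N M (\<lambda>l. l) (\<lambda>_. ()) (\<lambda>_. \<alpha>) (\<lambda>l. One S (g l)))"
    using darr_cmp[OF dm u(3) dob_unit[OF i]] A_str_perm[OF o MN] by (simp add: u(1,2))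
  also have "\<dots> = darr T F N g [()] (\<lambda>_. i) (One T (f i)) (\<lambda>_. ()) (\<lambda>_. relab S \<alpha> M N)"
  proof (rule darr_cong)
    fix k :: unit assume "k \<in> set [()]"
    have fb': "fib M (\<lambda>_. ()) k = M" "fib N (\<lambda>_. ()) k = N" by (simp_all add: fib_def)
    have cf: "cfib N (\<lambda>l. l) M = M" by (rule cfib_id) (use M in simp_all)
    show "i = i \<and> dcmp S N M (\<lambda>l. l) (\<lambda>_. ()) (\<lambda>_. \<alpha>) (\<lambda>l. One S (g l)) k = relab S \<alpha> M N"
      by (simp only: dcmp_def fb' cf S.sub_one_r[OF \<alpha>])
  qed simp
  finally show ?thesis using u'(1) by simp
qed

lemma uc_sub:
  assumes \<alpha>: "typed S \<alpha> g M i" and M: "distinct M" and \<beta>: "\<And>m. m \<in> set M \<Longrightarrow> typed S (\<beta> m) g' (L m) (g m)"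
    and L: "distinct (concat (map L M))"
  shows "uc (Sub S \<alpha> (map \<beta> M)) = Cmp (D (f i)) (uc \<alpha>) (str_arr T A (F \<alpha>) M M
      (\<lambda>m. str_obj T A (F (\<beta> m)) (map (\<lambda>l. ux (g' l)) (L m))) (\<lambda>m. uc (\<beta> m)) (\<lambda>m. ux (g m)))"
proof -
  let ?L = "concat (map L M)"
  have i: "i \<in> Col S" using \<alpha> S.tgt_col by (auto simp: typed_def)
  \<comment> \<open>\<open>h\<close> sends a label to its block. Its fibres are the blocks, so
    substitution in \<open>S\<close> becomes composition of the arrow \<open>(h, \<beta>)\<close>
    with the coherence arrow of \<open>\<alpha>\<close>.\<close>
  obtain h where h: "\<forall>m\<in>set M. \<forall>l\<in>set (L m). h l = m"
    using disjoint_choice[of "set M" "\<lambda>m. set (L m)" "\<lambda>m _. m"] distinct_concat_map_eq[OF L M] by blast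
  have fib: "fib ?L h m = L m" if "m \<in> set M" for m
  proof -
    have "fib ?L h m = fib (L m) h m" by (rule fib_concat_map[OF M that]) (use h in auto)
    then show ?thesis using h that by (simp add: fib_def)
  qed
  have dm: "dmor S ?L g' M g h \<beta>" using L M h \<beta> fib by (auto simp: dmor_def)
  have cf: "cfib ?L h M = ?L" unfolding cfib_def using fib by (auto intro!: arg_cong[of _ _ concat])
  note o = typed_dob[OF \<alpha> M]
  note u = uc_darr_unit[OF \<alpha> M] and u' = uc_darr_unit[OF S.typed_sub[OF \<alpha> \<beta>] L]
  have "str_arr T A (F \<alpha>) M M (\<lambda>m. str_obj T A (F (\<beta> m)) (map (\<lambda>l. ux (g' l)) (L m))) (\<lambda>m. uc (\<beta> m)) (\<lambda>m. ux (g m)) =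
      str_arr T A (F \<alpha>) M M (\<lambda>m. str_obj T A (F (\<beta> m)) (map (\<lambda>l. ux (g' l)) (fib ?L h m))) (\<lambda>m. uc (\<beta> m)) (\<lambda>m. ux (g m))"
    by (rule str_arr_cong) (use M fib in simp_all)
  also have "\<dots> = darr T F ?L g' M g (F \<alpha>) h \<beta>"
    using A_uc[OF dm o] by (simp only: cf)
  finally have "Cmp (D (f i)) (uc \<alpha>) (str_arr T A (F \<alpha>) M M
      (\<lambda>m. str_obj T A (F (\<beta> m)) (map (\<lambda>l. ux (g' l)) (L m))) (\<lambda>m. uc (\<beta> m)) (\<lambda>m. ux (g m))) =
    darr T F ?L g' [()] (\<lambda>_. i) (One T (f i)) (\<lambda>_. ()) (dcmp S ?L M h (\<lambda>_. ()) (\<lambda>_. \<alpha>) \<beta>)"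
    using darr_cmp[OF dm u(3) dob_unit[OF i]] by (simp add: u(1,2))
  also have "\<dots> = darr T F ?L g' [()] (\<lambda>_. i) (One T (f i)) (\<lambda>_. ()) (\<lambda>_. Sub S \<alpha> (map \<beta> M))"
  proof (rule darr_cong)
    fix k :: unit assume "k \<in> set [()]"
    have fb': "fib M (\<lambda>_. ()) k = M" "fib ?L (\<lambda>_. ()) k = ?L" by (simp_all add: fib_def)
    show "i = i \<and> dcmp S ?L M h (\<lambda>_. ()) (\<lambda>_. \<alpha>) \<beta> k = Sub S \<alpha> (map \<beta> M)"
      using S.relab_self[OF S.typed_sub[OF \<alpha> \<beta>] L] by (simp only: dcmp_def fb' cf)
  qed simp
  finally show ?thesis using u'(1) by simp
qed

lemma A_alg: "opmor_alg S T f F A"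
  by unfold_locales (rule A_strict)

lemma u_lax_eq: "u_lax S T f F = mklax S f A ux uc"
  unfolding u_lax_def mklax_def Und_A Und_terminal
  by (auto simp: restrict_def fun_eq_iff uc_def mon_ob_sel)

lemma u_lax_lax: "lax_morphism S (terminal_alg S) (Fbar S f F A) (u_lax S T f F)"
  unfolding u_lax_eq
proof (rule opmor_alg.mklax_lax[OF A_alg])
  show "ux i \<in> Obj (Und A (f i))" if "i \<in> Col S" for i
    using dob_Obj[OF dob_unit[OF that]] by (simp add: Und_A)
qed (simp_all add: Und_A uc_hom uc_one uc_relab uc_sub)

text \<open>Extending \<open>u\<^sub>F\<close> along itself gives the identity, because every arrow
  is its bijective half followed by its monotone half. The other two claims type the halves, so that
  a functor can be applied to each.\<close>

lemma ext_arr_A: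
  assumes m: "dmor S L1 i1 L2 i2 h b" and o: "dob S T f L2 i2 \<alpha> j"
  shows "ext_arr T A f F ux uc L1 i1 L2 i2 \<alpha> h b = darr T F L1 i1 L2 i2 \<alpha> h b"
    and "in_hom (D j) (str_arr T A \<alpha> L2 L2 (\<lambda>k. str_obj T A (F (b k)) (map (\<lambda>l. ux (i1 l)) (fib L1 h k))) (\<lambda>k. uc (b k)) (\<lambda>k. ux (i2 k)))
      (map i1 (cfib L1 h L2), Sub T \<alpha> (map (\<lambda>k. F (b k)) L2)) (map i2 L2, \<alpha>)"
    and "\<exists>a. in_hom (D j) (str_perm T A (\<lambda>l. f (i1 l)) (Sub T \<alpha> (map (\<lambda>k. F (b k)) L2)) (cfib L1 h L2) L1 (\<lambda>l. ux (i1 l)))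
      a (map i1 (cfib L1 h L2), Sub T \<alpha> (map (\<lambda>k. F (b k)) L2))"
proof -
  note d = dmorD[OF m] and e = dobD[OF o]
  let ?C = "cfib L1 h L2" and ?\<beta> = "Sub T \<alpha> (map (\<lambda>k. F (b k)) L2)"
  have C: "distinct ?C" "set ?C = set L1" using d(5) by (auto simp: reorders_def)
  have col: "i1 l \<in> Col S" if "l \<in> set L1" for l
    using S.typed_col[OF d(4)[OF d(3)[OF that]]] that by simp
  have fib: "fib ?C h k = fib L1 h k" if "k \<in> set L2" for k
  proof -
    have "fib ?C h k = fib (fib L1 h k) h k"
      unfolding cfib_def by (rule fib_concat_map[OF d(2) that]) simp
    then show ?thesis by (simp add: fib_fib)
  qed
  have "map (fib ?C h) L2 = map (fib L1 h) L2" using fib by simp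
  \<comment> \<open>The list \<open>?C\<close> is already grouped, so grouping it again changes
    nothing and the monotone half involves no permutation.\<close>
  then have cf: "cfib ?C h L2 = ?C" by (simp only: cfib_def)
  have m': "dmor S ?C i1 L2 i2 h b" using d C fib by (auto simp: dmor_def)
  have o': "dob S T f ?C i1 ?\<beta> j" using dsrc_typed[OF m o] C col by (simp add: dob_def)
  have dm: "dmor S L1 i1 ?C i1 (\<lambda>l. l) (\<lambda>l. One S (i1 l))"
    by (rule dmor_reorder[OF d(5)]) (use C col in auto)
  have src: "dsrc T F ?C L2 h b \<alpha> = ?\<beta>"
    using T.relab_self[OF dsrc_typed[OF m o] C(1)] by (simp add: dsrc_def cf)
  show "in_hom (D j) (str_arr T A \<alpha> L2 L2 (\<lambda>k. str_obj T A (F (b k)) (map (\<lambda>l. ux (i1 l)) (fib L1 h k))) (\<lambda>k. uc (b k)) (\<lambda>k. ux (i2 k)))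
      (map i1 ?C, ?\<beta>) (map i2 L2, \<alpha>)"
    using darr_hom[OF m' o] A_uc[OF m o] src by simp
  show "\<exists>a. in_hom (D j) (str_perm T A (\<lambda>l. f (i1 l)) ?\<beta> ?C L1 (\<lambda>l. ux (i1 l))) a (map i1 ?C, ?\<beta>)"
    using darr_hom[OF dm o'] A_str_perm[OF o' d(5)] by auto
  have "ext_arr T A f F ux uc L1 i1 L2 i2 \<alpha> h b =
      Cmp (D j) (darr T F ?C i1 L2 i2 \<alpha> h b) (darr T F L1 i1 ?C i1 ?\<beta> (\<lambda>l. l) (\<lambda>l. One S (i1 l)))"
    using A_uc[OF m o] A_str_perm[OF o' d(5)] e(3) by (simp add: ext_arr_def Und_A typed_def)
  also have "\<dots> = darr T F L1 i1 L2 i2 \<alpha> h (dcmp S L1 ?C (\<lambda>l. l) h b (\<lambda>l. One S (i1 l)))"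
    using darr_cmp[OF dm m' o] by (simp add: src)
  also have "\<dots> = darr T F L1 i1 L2 i2 \<alpha> h b"
  proof (rule darr_cong)
    fix k assume k: "k \<in> set L2"
    show "i2 k = i2 k \<and> dcmp S L1 ?C (\<lambda>l. l) h b (\<lambda>l. One S (i1 l)) k = b k"
      using S.sub_one_r[OF d(4)[OF k]] S.relab_self[OF d(4)[OF k]] d(1)
      by (simp add: dcmp_def fib[OF k] cfib_id subset_iff)
  qed simp
  finally show "ext_arr T A f F ux uc L1 i1 L2 i2 \<alpha> h b = darr T F L1 i1 L2 i2 \<alpha> h b" .
qed

end

lemma map_nth_comp: "map (\<lambda>k. y (L ! k)) [0..<length L] = map y L"
  by (rule nth_equalityI) simp_all

lemma cfib_idx:
  assumes L2: "distinct L2" and h: "\<And>l. l \<in> set L1 \<Longrightarrow> h l \<in> set L2"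
    and hh: "\<And>p. p < length L1 \<Longrightarrow> hh p = pos L2 (h (L1 ! p))"
  shows "map ((!) L1) (cfib [0..<length L1] hh [0..<length L2]) = cfib L1 h L2"
proof -
  have "map ((!) L1) (fib [0..<length L1] hh q) = fib L1 h (L2 ! q)" if "q < length L2" for q
    using map_nth_fibre_pos[where h = h, OF L2 that h hh] by (simp add: fibre_eq_fib)
  then have "map ((!) L1) (cfib [0..<length L1] hh [0..<length L2]) =
      concat (map (\<lambda>q. fib L1 h (L2 ! q)) [0..<length L2])"
    by (auto simp: cfib_def map_concat intro!: arg_cong[of _ _ concat])
  then show ?thesis by (simp only: map_nth_comp cfib_def)
qed

context opmor_alg
begin

text \<open>Replacing positions by distinct labels is an injective renaming, under which
  \<open>str_arr\<close> and \<open>str_perm\<close> are invariant.\<close>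

lemma ext_FA_darr:
  assumes m: "dmor S L1 i1 L2 i2 h b"
  shows "ext_FA T B f F x c (darr T F L1 i1 L2 i2 \<alpha> h b) = ext_arr T B f F x c L1 i1 L2 i2 \<alpha> h b"
proof -
  note d = dmorD[OF m]
  let ?hh = "\<lambda>p\<in>{..<length L1}. pos L2 (h (L1 ! p))"
  let ?M1 = "[0..<length L1]" and ?M2 = "[0..<length L2]"
  have nth: "map ((!) L1) ?M1 = L1" "map ((!) L2) ?M2 = L2" by (simp_all add: map_nth)
  have inj: "inj_on ((!) L1) {..<length L1}" "inj_on ((!) L2) {..<length L2}"
    using d by (auto simp: inj_on_def nth_eq_iff_index_eq)
  have cf: "map ((!) L1) (cfib ?M1 ?hh ?M2) = cfib L1 h L2"
    by (rule cfib_idx[OF d(2,3)]) simp_all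
  have fibs: "map ((!) L1) (fib ?M1 ?hh q) = fib L1 h (L2 ! q)" if "q < length L2" for q
    using map_nth_fibre_pos[where h = h and hh = ?hh, OF d(2) that d(3)] by (simp add: fibre_eq_fib)
  have fl: "p < length L1" if "p \<in> set (fib ?M1 ?hh q)" for p q using that by simp
  have sAeq: "str_arr T B \<alpha> ?M2 ?M2 (\<lambda>k. str_obj T B (F (map b L2 ! k)) (map (\<lambda>l. x (map i1 L1 ! l)) (fib ?M1 ?hh k)))
        (\<lambda>k. c (map b L2 ! k)) (\<lambda>k. x (map i2 L2 ! k)) =
      str_arr T B \<alpha> L2 L2 (\<lambda>k. str_obj T B (F (b k)) (map (\<lambda>l. x (i1 l)) (fib L1 h k))) (\<lambda>k. c (b k)) (\<lambda>k. x (i2 k))"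
  proof -
    have "str_arr T B \<alpha> (map ((!) L2) ?M2) (map ((!) L2) ?M2) (\<lambda>k. str_obj T B (F (b k)) (map (\<lambda>l. x (i1 l)) (fib L1 h k))) (\<lambda>k. c (b k)) (\<lambda>k. x (i2 k)) =
      str_arr T B \<alpha> ?M2 ?M2 (\<lambda>k. str_obj T B (F (b (L2 ! k))) (map (\<lambda>l. x (i1 l)) (fib L1 h (L2 ! k)))) (\<lambda>k. c (b (L2 ! k))) (\<lambda>k. x (i2 (L2 ! k)))"
      by (rule str_arr_map) (use inj in \<open>simp_all add: atLeast0LessThan\<close>)
    also have "\<dots> = str_arr T B \<alpha> ?M2 ?M2 (\<lambda>k. str_obj T B (F (map b L2 ! k)) (map (\<lambda>l. x (map i1 L1 ! l)) (fib ?M1 ?hh k)))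
        (\<lambda>k. c (map b L2 ! k)) (\<lambda>k. x (map i2 L2 ! k))"
    proof (rule str_arr_cong[OF iffD2[OF reorders_refl distinct_upt]], intro conjI)
      fix k assume "k \<in> set ?M2"
      then have k: "k < length L2" by simp
      have "map (\<lambda>l. x (map i1 L1 ! l)) (fib ?M1 ?hh k) = map (\<lambda>l. x (i1 l)) (map ((!) L1) (fib ?M1 ?hh k))"
        using fl by auto
      then show "str_obj T B (F (b (L2 ! k))) (map (\<lambda>l. x (i1 l)) (fib L1 h (L2 ! k))) =
          str_obj T B (F (map b L2 ! k)) (map (\<lambda>l. x (map i1 L1 ! l)) (fib ?M1 ?hh k))"
        unfolding fibs[OF k] using k by simp
    qed simp_all
    finally show ?thesis unfolding nth by simp
  qed
  have re: "reorders (cfib ?M1 ?hh ?M2) ?M1"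
    by (rule reorders_cfib) (use d in auto)
  have sPeq: "str_perm T B (\<lambda>l. f (map i1 L1 ! l)) \<beta> (cfib ?M1 ?hh ?M2) ?M1 (\<lambda>l. x (map i1 L1 ! l)) =
      str_perm T B (\<lambda>l. f (i1 l)) \<beta> (cfib L1 h L2) L1 (\<lambda>l. x (i1 l))" for \<beta>
  proof -
    have "str_perm T B (\<lambda>l. f (i1 l)) \<beta> (map ((!) L1) (cfib ?M1 ?hh ?M2)) (map ((!) L1) ?M1) (\<lambda>l. x (i1 l)) =
        str_perm T B (\<lambda>l. f (i1 (L1 ! l))) \<beta> (cfib ?M1 ?hh ?M2) ?M1 (\<lambda>l. x (i1 (L1 ! l)))"
      by (rule str_perm_map) (use inj re in \<open>auto simp: reorders_def atLeast0LessThan intro: inj_on_subset\<close>)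
    also have "\<dots> = str_perm T B (\<lambda>l. f (map i1 L1 ! l)) \<beta> (cfib ?M1 ?hh ?M2) ?M1 (\<lambda>l. x (map i1 L1 ! l))"
      by (rule str_perm_cong[OF re]) simp
    finally show ?thesis unfolding nth cf by simp
  qed
  have "map (\<lambda>k. F (map b L2 ! k)) ?M2 = map (\<lambda>k. F (b k)) L2"
    by (rule nth_equalityI) simp_all
  then show ?thesis
    using sAeq sPeq by (simp only: ext_FA_def darr_def prod.case ext_arr_def length_map)
qed

end

context opmor_alg
begin

section \<open>The extension of a lax morphism: functoriality and compatibility with
  concatenation\<close>

context
  fixes X :: "('i, 's, unit, unit, 'o, 'm) lax"
  assumes lax: "lax_morphism S one FB X"
begin

abbreviation "x \<equiv> lax_ob X"
abbreviation "c \<equiv> lax_coh S X"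
abbreviation "ext_X \<equiv> ext_arr T B f F x c"

lemma x_obj: "typed S \<alpha> g M i \<Longrightarrow> l \<in> set M \<Longrightarrow> x (g l) \<in> Obj (Und B (f (g l)))"
  by (rule lax_ob_obj_typed[OF lax])

lemma dob_x_obj: "dob S T f L i \<alpha> j \<Longrightarrow> l \<in> set L \<Longrightarrow> x (i l) \<in> Obj (Und B (f (i l)))"
  by (rule lax_ob_obj[OF lax]) (rule dobD(2))

lemma dmor_x_obj:
  assumes "dmor S L1 i1 L2 i2 h b" "l \<in> set L1"
  shows "x (i1 l) \<in> Obj (Und B (f (i1 l)))"
  using x_obj[OF dmorD(4)[OF assms(1) dmorD(3)[OF assms]]] assms(2) by simp

lemma c_lhom:
  assumes "dmor S L1 i1 L2 i2 h b"
  shows "lhom (Und B) (\<lambda>k. f (i2 k)) L2 (\<lambda>k. str_obj T B (F (b k)) (map (\<lambda>l. x (i1 l)) (fib L1 h k)))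
    (\<lambda>k. c (b k)) (\<lambda>k. x (i2 k))"
  unfolding lhom_def using lax_coh_hom[OF lax dmorD(4)[OF assms]] by simp

text \<open>The object between the two steps of the formula: the coherence step sees it as an
  iterated value of the structure map, the permutation step as a value at the substituted
  operation.\<close>

lemma ext_X_sub_obj:
  assumes m: "dmor S L1 i1 L2 i2 h b" and o: "dob S T f L2 i2 \<alpha> j"
  shows "str_obj T B \<alpha> (map (\<lambda>k. str_obj T B (F (b k)) (map (\<lambda>l. x (i1 l)) (fib L1 h k))) L2) =
    str_obj T B (Sub T \<alpha> (map (\<lambda>k. F (b k)) L2)) (map (\<lambda>l. x (i1 l)) (cfib L1 h L2))"
  unfolding cfib_def
  by (rule B.str_obj_sub[OF dobD(3)[OF o] F_typed[OF dmorD(4)[OF m]]]) (use dmor_x_obj[OF m] in auto)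

lemma ext_X_parts:
  assumes m: "dmor S L1 i1 L2 i2 h b" and o: "dob S T f L2 i2 \<alpha> j"
  shows "in_hom (Und B j) (str_arr T B \<alpha> L2 L2 (\<lambda>k. str_obj T B (F (b k)) (map (\<lambda>l. x (i1 l)) (fib L1 h k))) (\<lambda>k. c (b k)) (\<lambda>k. x (i2 k)))
      (str_obj T B (Sub T \<alpha> (map (\<lambda>k. F (b k)) L2)) (map (\<lambda>l. x (i1 l)) (cfib L1 h L2)))
      (str_obj T B \<alpha> (map (\<lambda>k. x (i2 k)) L2))"
    and "in_hom (Und B j) (str_perm T B (\<lambda>l. f (i1 l)) (Sub T \<alpha> (map (\<lambda>k. F (b k)) L2)) (cfib L1 h L2) L1 (\<lambda>l. x (i1 l)))
      (str_obj T B (dsrc T F L1 L2 h b \<alpha>) (map (\<lambda>l. x (i1 l)) L1))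
      (str_obj T B (Sub T \<alpha> (map (\<lambda>k. F (b k)) L2)) (map (\<lambda>l. x (i1 l)) (cfib L1 h L2)))"
proof -
  note d = dmorD[OF m] and e = dobD[OF o]
  show "in_hom (Und B j) (str_arr T B \<alpha> L2 L2 (\<lambda>k. str_obj T B (F (b k)) (map (\<lambda>l. x (i1 l)) (fib L1 h k))) (\<lambda>k. c (b k)) (\<lambda>k. x (i2 k)))
      (str_obj T B (Sub T \<alpha> (map (\<lambda>k. F (b k)) L2)) (map (\<lambda>l. x (i1 l)) (cfib L1 h L2)))
      (str_obj T B \<alpha> (map (\<lambda>k. x (i2 k)) L2))"
    using B.str_arr_hom[OF e(3) _ c_lhom[OF m], of L2] d(2) ext_X_sub_obj[OF m o] T.relab_self[OF e(3) d(2)] by simp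
  show "in_hom (Und B j) (str_perm T B (\<lambda>l. f (i1 l)) (Sub T \<alpha> (map (\<lambda>k. F (b k)) L2)) (cfib L1 h L2) L1 (\<lambda>l. x (i1 l)))
      (str_obj T B (dsrc T F L1 L2 h b \<alpha>) (map (\<lambda>l. x (i1 l)) L1))
      (str_obj T B (Sub T \<alpha> (map (\<lambda>k. F (b k)) L2)) (map (\<lambda>l. x (i1 l)) (cfib L1 h L2)))"
    unfolding dsrc_def by (rule B.str_perm_hom[OF dsrc_typed[OF m o] d(5)]) (use dmor_x_obj[OF m] in auto)
qed

lemma ext_X_eq:
  assumes "dob S T f L2 i2 \<alpha> j"
  shows "ext_X L1 i1 L2 i2 \<alpha> h b = Cmp (Und B j)
     (str_arr T B \<alpha> L2 L2 (\<lambda>k. str_obj T B (F (b k)) (map (\<lambda>l. x (i1 l)) (fib L1 h k))) (\<lambda>k. c (b k)) (\<lambda>k. x (i2 k)))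
     (str_perm T B (\<lambda>l. f (i1 l)) (Sub T \<alpha> (map (\<lambda>k. F (b k)) L2)) (cfib L1 h L2) L1 (\<lambda>l. x (i1 l)))"
  using dobD(3)[OF assms] by (simp add: ext_arr_def typed_def)

lemma dob_category:
  assumes "dob S T f L i \<alpha> j"
  shows "category (Und B j)"
  by (rule B.Und_category) (use B.typed_tgt[OF dobD(3)[OF assms]] in simp)

lemma ext_X_hom:
  assumes m: "dmor S L1 i1 L2 i2 h b" and o: "dob S T f L2 i2 \<alpha> j"
  shows "in_hom (Und B j) (ext_X L1 i1 L2 i2 \<alpha> h b)
    (str_obj T B (dsrc T F L1 L2 h b \<alpha>) (map (\<lambda>l. x (i1 l)) L1)) (str_obj T B \<alpha> (map (\<lambda>k. x (i2 k)) L2))"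
  unfolding ext_X_eq[OF o] by (rule category.cmp_hom[OF dob_category[OF o] ext_X_parts(2,1)[OF m o]])

text \<open>At unit decorations \<open>c\<close> gives identities, and the structure map at a unit
  operation returns its argument, so both steps are identities of the same object.\<close>

lemma ext_X_ide:
  assumes o: "dob S T f L i \<alpha> j"
  shows "ext_X L i L i \<alpha> (\<lambda>l. l) (\<lambda>l. One S (i l)) = Ide (Und B j) (str_obj T B \<alpha> (map (\<lambda>l. x (i l)) L))"
proof -
  note e = dobD[OF o]
  have xo: "x (i l) \<in> Obj (Und B (f (i l)))" if "l \<in> set L" for l by (rule dob_x_obj[OF o that])
  have "str_arr T B \<alpha> L L (\<lambda>k. str_obj T B (F (One S (i k))) (map (\<lambda>l. x (i l)) (fib L (\<lambda>l. l) k))) (\<lambda>k. c (One S (i k))) (\<lambda>k. x (i k)) =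
      str_arr T B \<alpha> L L (\<lambda>k. x (i k)) (\<lambda>k. Ide (Und B (f (i k))) (x (i k))) (\<lambda>k. x (i k))"
    by (rule str_arr_cong[OF iffD2[OF reorders_refl e(1)]])
      (use e lax_coh_one[OF lax] xo in \<open>simp add: fib_id one_map B.str_obj_one col_map\<close>)
  also have "\<dots> = Ide (Und B j) (str_obj T B \<alpha> (map (\<lambda>l. x (i l)) L))"
    by (rule B.str_arr_ide[OF e(3,1) xo])
  finally have 1: "str_arr T B \<alpha> L L (\<lambda>k. str_obj T B (F (One S (i k))) (map (\<lambda>l. x (i l)) (fib L (\<lambda>l. l) k))) (\<lambda>k. c (One S (i k))) (\<lambda>k. x (i k)) =
      Ide (Und B j) (str_obj T B \<alpha> (map (\<lambda>l. x (i l)) L))" .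
  have "map (\<lambda>k. F (One S (i k))) L = map (\<lambda>k. One T (f (i k))) L"
    using e one_map by auto
  then have "Sub T \<alpha> (map (\<lambda>k. F (One S (i k))) L) = \<alpha>"
    using T.sub_one_r[OF e(3)] by (simp only:)
  then have 2: "str_perm T B (\<lambda>l. f (i l)) (Sub T \<alpha> (map (\<lambda>k. F (One S (i k))) L)) (cfib L (\<lambda>l. l) L) L (\<lambda>l. x (i l)) =
      Ide (Und B j) (str_obj T B \<alpha> (map (\<lambda>l. x (i l)) L))"
    using B.str_arr_ide[OF e(3,1) xo] e(1) by (simp add: str_perm_def cfib_id)
  have "str_obj T B \<alpha> (map (\<lambda>l. x (i l)) L) \<in> Obj (Und B j)" by (rule B.str_obj_obj[OF e(3) xo])
  then show ?thesis
    unfolding ext_X_eq[OF o] 1 2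
    using category.cmp_ide_left[OF dob_category[OF o] category.ide_hom[OF dob_category[OF o]]] by blast
qed

lemma ext_X_cmp:
  assumes m1: "dmor S L1 i1 L2 i2 h1 b1" and m2: "dmor S L2 i2 L3 i3 h2 b2"
    and o: "dob S T f L3 i3 \<alpha> j"
  shows "Cmp (Und B j) (ext_X L2 i2 L3 i3 \<alpha> h2 b2) (ext_X L1 i1 L2 i2 (dsrc T F L2 L3 h2 b2 \<alpha>) h1 b1) =
    ext_X L1 i1 L3 i3 \<alpha> (\<lambda>l. h2 (h1 l)) (dcmp S L1 L2 h1 h2 b2 b1)"
proof -
  interpret Bj: category "Und B j" by (rule dob_category[OF o])
  note d1 = dmorD[OF m1] and d2 = dmorD[OF m2] and e = dobD[OF o]
  let ?C = "cfib L2 h2 L3" and ?\<zeta> = "Sub T \<alpha> (map (\<lambda>k. F (b2 k)) L3)" and ?\<alpha>2 = "dsrc T F L2 L3 h2 b2 \<alpha>"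
  let ?x1 = "\<lambda>l. x (i1 l)" and ?x2 = "\<lambda>l. x (i2 l)" and ?x3 = "\<lambda>l. x (i3 l)"
  let ?o1 = "\<lambda>l. str_obj T B (F (b1 l)) (map ?x1 (fib L1 h1 l))"
  let ?o2 = "\<lambda>k. str_obj T B (F (b2 k)) (map ?x2 (fib L2 h2 k))"
  let ?g1 = "\<lambda>l. f (i1 l)" and ?g2 = "\<lambda>l. f (i2 l)" and ?g3 = "\<lambda>l. f (i3 l)"
  let ?U = "\<lambda>k. cfib L1 h1 (fib L2 h2 k)" and ?W = "\<lambda>k. fib L1 (\<lambda>l. h2 (h1 l)) k"
  let ?\<eta> = "\<lambda>k. Sub S (b2 k) (map b1 (fib L2 h2 k))"
  let ?b = "dcmp S L1 L2 h1 h2 b2 b1"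
  let ?K = "cfib L1 h1 ?C" and ?\<theta> = "Sub T ?\<zeta> (map (\<lambda>l. F (b1 l)) ?C)"
  note \<zeta> = dsrc_typed[OF m2 o]
  have C: "distinct ?C" "set ?C = set L2" using d2(5) by (auto simp: reorders_def)
  have re_C: "reorders ?C L2" by (rule d2(5))
  have \<alpha>2: "?\<alpha>2 = relab T ?\<zeta> ?C L2" by (simp add: dsrc_def)
  note o2 = dsrc_dob[OF m2 o]
  have x1o: "?x1 l \<in> Obj (Und B (?g1 l))" if "l \<in> set L1" for l by (rule dmor_x_obj[OF m1 that])
  have tb1: "typed T (F (b1 l)) ?g1 (fib L1 h1 l) (?g2 l)" if "l \<in> set L2" for l by (rule F_typed[OF d1(4)[OF that]])
  have tb2: "typed T (F (b2 k)) ?g2 (fib L2 h2 k) (?g3 k)" if "k \<in> set L3" for k by (rule F_typed[OF d2(4)[OF that]])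
  have lh1: "lhom (Und B) ?g2 L ?o1 (\<lambda>l. c (b1 l)) ?x2" if "set L \<subseteq> set L2" for L
    using c_lhom[OF m1] that by (auto simp: lhom_def)
  have o1o: "?o1 l \<in> Obj (Und B (?g2 l))" if "l \<in> set L2" for l
    by (rule B.lhom_obj(1)[OF lh1[OF order_refl] dobD(3)[OF o2] that])
  let ?P1 = "str_perm T B ?g1 (Sub T ?\<alpha>2 (map (\<lambda>k. F (b1 k)) L2)) (cfib L1 h1 L2) L1 ?x1"
  let ?A1 = "str_arr T B ?\<alpha>2 L2 L2 ?o1 (\<lambda>l. c (b1 l)) ?x2"
  let ?P2 = "str_perm T B ?g2 ?\<zeta> ?C L2 ?x2"
  let ?A2 = "str_arr T B \<alpha> L3 L3 ?o2 (\<lambda>k. c (b2 k)) ?x3"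
  \<comment> \<open>The exchanged middle pair: \<open>?Q\<close> permutes the inputs labelled by
    \<open>L2\<close> before \<open>?R\<close> applies the coherence arrows of \<open>b1\<close>,
    whereas \<open>?A1\<close> and \<open>?P2\<close> do so in the opposite order.\<close>
  let ?Q = "str_perm T B ?g2 ?\<zeta> ?C L2 ?o1" and ?R = "str_arr T B ?\<zeta> ?C ?C ?o1 (\<lambda>l. c (b1 l)) ?x2"
  have relC: "relab T ?\<zeta> ?C ?C = ?\<zeta>" by (rule T.relab_self[OF \<zeta> C(1)])
  have PA: "Cmp (Und B j) ?P2 ?A1 = str_arr T B ?\<zeta> ?C L2 ?o1 (\<lambda>l. c (b1 l)) ?x2"
    unfolding \<alpha>2 by (rule B.str_perm_str_arr[OF \<zeta> re_C _ lh1]) (use C d1(2) in auto)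
  have RQ: "Cmp (Und B j) ?R ?Q = str_arr T B ?\<zeta> ?C L2 ?o1 (\<lambda>l. c (b1 l)) ?x2"
    using B.str_arr_str_perm[OF \<zeta> _ re_C lh1] C by (simp add: relC)
  have homR: "in_hom (Und B j) ?R (str_obj T B ?\<zeta> (map ?o1 ?C)) (str_obj T B ?\<zeta> (map ?x2 ?C))"
    using B.str_arr_hom[OF \<zeta> _ lh1, of ?C] C by (simp add: relC)
  have homQ: "in_hom (Und B j) ?Q (str_obj T B ?\<alpha>2 (map ?o1 L2)) (str_obj T B ?\<zeta> (map ?o1 ?C))"
    unfolding \<alpha>2 by (rule B.str_perm_hom[OF \<zeta> re_C]) (use o1o C in auto)
  have src1: "str_obj T B ?\<alpha>2 (map ?o1 L2) =
      str_obj T B (Sub T ?\<alpha>2 (map (\<lambda>k. F (b1 k)) L2)) (map ?x1 (cfib L1 h1 L2))"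
    by (rule ext_X_sub_obj[OF m1 o2])
  have "Cmp (Und B j) (ext_X L2 i2 L3 i3 \<alpha> h2 b2) (ext_X L1 i1 L2 i2 ?\<alpha>2 h1 b1) =
      Cmp (Und B j) (Cmp (Und B j) ?A2 ?P2) (Cmp (Und B j) ?A1 ?P1)"
    unfolding ext_X_eq[OF o] ext_X_eq[OF o2] ..
  also have "\<dots> = Cmp (Und B j) (Cmp (Und B j) ?A2 ?R) (Cmp (Und B j) ?Q ?P1)"
    by (rule Bj.cmp_exchange[OF ext_X_parts(2)[OF m1 o2] ext_X_parts(1)[OF m1 o2] ext_X_parts(2)[OF m2 o] ext_X_parts(1)[OF m2 o]
        homQ[unfolded src1] homR trans[OF PA RQ[symmetric]]])
  also have "Cmp (Und B j) ?Q ?P1 = str_perm T B ?g1 ?\<theta> ?K L1 ?x1"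
  proof -
    have disK: "distinct (concat (map (fib L1 h1) ?C))"
      using distinct_cfib[OF d1(1) C(1), of h1] by (simp add: cfib_def[of L1])
    \<comment> \<open>Each object permuted by \<open>?Q\<close> is itself a value of the structure
      map, so \<open>?Q\<close> moves blocks of labels of \<open>L1\<close> and fuses with
      \<open>?P1\<close>.\<close>
    have "?Q = str_perm T B ?g1 ?\<theta> ?K (cfib L1 h1 L2) ?x1"
      unfolding cfib_def[of L1] by (rule B.str_perm_sub[OF \<zeta> tb1 re_C disK]) (use C x1o in auto)
    moreover have "Sub T ?\<alpha>2 (map (\<lambda>k. F (b1 k)) L2) = relab T ?\<theta> ?K (cfib L1 h1 L2)"
      unfolding \<alpha>2 cfib_def[of L1] by (rule T.sub_outer[OF \<zeta> tb1 re_C disK]) (use C in auto)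
    moreover have "typed T ?\<theta> ?g1 ?K j"
      unfolding cfib_def[of L1] by (rule T.typed_sub[OF \<zeta> tb1]) (use C in auto)
    moreover have "reorders ?K (cfib L1 h1 L2)" "reorders (cfib L1 h1 L2) L1"
      using C d1 by (auto simp: reorders_def)
    ultimately show ?thesis using B.str_perm_str_perm[of ?\<theta> ?g1 ?K j "cfib L1 h1 L2" L1 ?x1] x1o C by auto
  qed
  also have "Cmp (Und B j) ?A2 ?R = str_arr T B \<alpha> L3 L3 (\<lambda>k. str_obj T B (F (?\<eta> k)) (map ?x1 (?U k))) (\<lambda>k. c (?\<eta> k)) ?x3"
  proof -
    have rel: "relab T (F (b2 k)) (fib L2 h2 k) (fib L2 h2 k) = F (b2 k)" if "k \<in> set L3" for k
      by (rule T.relab_self[OF tb2[OF that]]) (use d1 in simp)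
    let ?E = "\<lambda>k. str_arr T B (F (b2 k)) (fib L2 h2 k) (fib L2 h2 k) ?o1 (\<lambda>l. c (b1 l)) ?x2"
    let ?mid = "\<lambda>k. str_obj T B (relab T (F (b2 k)) (fib L2 h2 k) (fib L2 h2 k)) (map ?o1 (fib L2 h2 k))"
    \<comment> \<open>The multiplication law splits \<open>?R\<close> into blocks over
      \<open>L3\<close>. Inside a block the coherence of \<open>b2 k\<close> meets that of the
      \<open>b1 l\<close>, and the substitution law merges them into
      \<open>c (?\<eta> k)\<close>.\<close>
    have "?R = str_arr T B \<alpha> L3 L3 ?mid ?E ?o2"
      unfolding cfib_def[of L2]
      by (rule B.str_arr_sub[OF e(3) tb2 _ _ _ lh1, symmetric])
        (use d1 d2 C(1) in \<open>auto simp: cfib_def[of L2]\<close>)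
    moreover have "lhom (Und B) ?g3 L3 ?mid ?E ?o2"
      unfolding lhom_def
    proof
      fix k assume "k \<in> set L3"
      then show "in_hom (Und B (?g3 k)) (?E k) (?mid k) (?o2 k)"
        by (intro B.str_arr_hom[OF tb2] lh1) (use d1 in auto)
    qed
    ultimately have "Cmp (Und B j) ?A2 ?R = str_arr T B \<alpha> L3 L3 ?mid (\<lambda>k. Cmp (Und B (?g3 k)) (c (b2 k)) (?E k)) ?x3"
      using B.str_arr_cmp[OF e(3) _ _ c_lhom[OF m2], of L3 L3] T.relab_self[OF e(3,1)] e(1) by simp
    also have "\<dots> = str_arr T B \<alpha> L3 L3 (\<lambda>k. str_obj T B (F (?\<eta> k)) (map ?x1 (?U k))) (\<lambda>k. c (?\<eta> k)) ?x3"
    proof (rule str_arr_cong[OF iffD2[OF reorders_refl e(1)]], intro conjI)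
      fix k assume k: "k \<in> set L3"
      have b1k: "typed S (b1 l) i1 (fib L1 h1 l) (i2 l)" if "l \<in> set (fib L2 h2 k)" for l
        using d1(4) that by simp
      show "Cmp (Und B (?g3 k)) (c (b2 k)) (?E k) = c (?\<eta> k)"
        by (rule lax_coh_sub[OF lax d2(4)[OF k] _ b1k, symmetric]) (use d1 in simp)
      have "str_obj T B (F (b2 k)) (map ?o1 (fib L2 h2 k)) =
          str_obj T B (Sub T (F (b2 k)) (map (\<lambda>l. F (b1 l)) (fib L2 h2 k))) (map ?x1 (?U k))"
        unfolding cfib_def by (rule B.str_obj_sub[OF tb2[OF k] tb1]) (use x1o in auto)
      then show "?mid k = str_obj T B (F (?\<eta> k)) (map ?x1 (?U k))"
        using F_sub[OF d2(4)[OF k] b1k] rel[OF k] by simp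
    qed simp
    finally show ?thesis .
  qed
  finally have lhs: "Cmp (Und B j) (ext_X L2 i2 L3 i3 \<alpha> h2 b2) (ext_X L1 i1 L2 i2 ?\<alpha>2 h1 b1) =
      Cmp (Und B j) (str_arr T B \<alpha> L3 L3 (\<lambda>k. str_obj T B (F (?\<eta> k)) (map ?x1 (?U k))) (\<lambda>k. c (?\<eta> k)) ?x3) (str_perm T B ?g1 ?\<theta> ?K L1 ?x1)" .
  let ?h = "\<lambda>l. h2 (h1 l)"
  have \<eta>: "typed S (?\<eta> k) i1 (?U k) (i3 k)" if "k \<in> set L3" for k
    unfolding cfib_def by (rule S.typed_sub[OF d2(4)[OF that] d1(4)]) simp
  have UW: "reorders (?U k) (?W k)" for k by (rule reorders_cfib_fib[OF d1(1,2,3)])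
  have K: "concat (map ?U L3) = ?K" "concat (map ?W L3) = cfib L1 ?h L3"
    by (simp add: cfib_cfib) (simp add: cfib_def)
  have Kd: "distinct ?K" using d1 C by simp
  have \<theta>: "?\<theta> = Sub T \<alpha> (map (\<lambda>k. F (?\<eta> k)) L3)"
  proof -
    have "?\<theta> = Sub T \<alpha> (map (\<lambda>k. Sub T (F (b2 k)) (map (\<lambda>l. F (b1 l)) (fib L2 h2 k))) L3)"
      unfolding cfib_def by (rule T.sub_sub[OF e(3) tb2 tb1]) auto
    also have "map (\<lambda>k. Sub T (F (b2 k)) (map (\<lambda>l. F (b1 l)) (fib L2 h2 k))) L3 = map (\<lambda>k. F (?\<eta> k)) L3"
      using F_sub[OF d2(4) d1(4)] by auto
    finally show ?thesis .
  qed
  have F\<eta>: "typed T (F (?\<eta> k)) ?g1 (?U k) (?g3 k)" if "k \<in> set L3" for k by (rule F_typed[OF \<eta>[OF that]])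
  \<comment> \<open>The other side of the claim is now brought to the same form. Its decorations
    \<open>?b k\<close> differ from \<open>?\<eta> k\<close> by the reordering from
    \<open>?U k\<close> to \<open>?W k\<close>, whose symmetry \<open>?S k\<close> the permutation
    law of \<open>c\<close> splits off.\<close>
  have Fb: "F (?b k) = relab T (F (?\<eta> k)) (?U k) (?W k)" if "k \<in> set L3" for k
    unfolding dcmp_def by (rule F_relab[OF \<eta>[OF that] UW])
  let ?o\<eta> = "\<lambda>k. str_obj T B (F (?\<eta> k)) (map ?x1 (?U k))"
  let ?ob = "\<lambda>k. str_obj T B (F (?b k)) (map ?x1 (?W k))"
  let ?S = "\<lambda>k. str_perm T B ?g1 (F (?\<eta> k)) (?U k) (?W k) ?x1"
  let ?A = "str_arr T B \<alpha> L3 L3 ?ob (\<lambda>k. c (?b k)) ?x3"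
  let ?A\<eta> = "str_arr T B \<alpha> L3 L3 ?o\<eta> (\<lambda>k. c (?\<eta> k)) ?x3"
  let ?AS = "str_arr T B \<alpha> L3 L3 ?ob ?S ?o\<eta>"
  let ?P = "str_perm T B ?g1 (Sub T \<alpha> (map (\<lambda>k. F (?b k)) L3)) (cfib L1 ?h L3) L1 ?x1"
  have lh\<eta>: "lhom (Und B) ?g3 L3 ?o\<eta> (\<lambda>k. c (?\<eta> k)) ?x3"
    unfolding lhom_def using lax_coh_hom[OF lax \<eta>] by simp
  have lhS: "lhom (Und B) ?g3 L3 ?ob ?S ?o\<eta>"
    unfolding lhom_def
  proof
    fix k assume k: "k \<in> set L3"
    show "in_hom (Und B (?g3 k)) (?S k) (?ob k) (?o\<eta> k)"
      unfolding Fb[OF k] by (rule B.str_perm_hom[OF F\<eta>[OF k] UW]) (use x1o in auto)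
  qed
  have "?A = str_arr T B \<alpha> L3 L3 ?ob (\<lambda>k. Cmp (Und B (?g3 k)) (c (?\<eta> k)) (?S k)) ?x3"
    by (rule str_arr_cong[OF iffD2[OF reorders_refl e(1)]]) (use lax_coh_relab[OF lax \<eta> UW] in \<open>simp add: dcmp_def\<close>)
  also have "\<dots> = Cmp (Und B j) ?A\<eta> ?AS"
    using B.str_arr_cmp[OF e(3) _ _ lh\<eta> lhS, of L3 L3] T.relab_self[OF e(3,1)] e(1) by simp
  finally have A: "?A = Cmp (Und B j) ?A\<eta> ?AS" .
  \<comment> \<open>The symmetries inside the blocks over \<open>L3\<close> assemble to one symmetry
    of the concatenation, which then fuses with \<open>?P\<close>.\<close>
  have AS: "?AS = str_perm T B ?g1 ?\<theta> ?K (cfib L1 ?h L3) ?x1"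
  proof -
    have "?AS = str_arr T B \<alpha> L3 L3 (\<lambda>k. str_obj T B (relab T (F (?\<eta> k)) (?U k) (?W k)) (map ?x1 (?W k))) ?S ?o\<eta>"
      by (rule str_arr_cong[OF iffD2[OF reorders_refl e(1)]]) (simp add: Fb)
    also have "\<dots> = str_perm T B ?g1 (Sub T \<alpha> (map (\<lambda>k. F (?\<eta> k)) L3)) (concat (map ?U L3)) (concat (map ?W L3)) ?x1"
      by (rule B.str_arr_str_perm_sub[OF e(3) F\<eta> _ UW]) (use e(1) K(1) Kd x1o in auto)
    finally show ?thesis unfolding \<theta> K .
  qed
  have \<theta>t: "typed T ?\<theta> ?g1 ?K j"
    unfolding cfib_def[of L1] by (rule T.typed_sub[OF \<zeta> tb1]) (use C in auto)
  have Sb: "Sub T \<alpha> (map (\<lambda>k. F (?b k)) L3) = relab T ?\<theta> ?K (cfib L1 ?h L3)"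
  proof -
    have "map (\<lambda>k. F (?b k)) L3 = map (\<lambda>k. relab T (F (?\<eta> k)) (?U k) (?W k)) L3" using Fb by auto
    then show ?thesis
      using T.sub_inner[OF e(3) F\<eta> e(1) UW] Kd by (simp only: K \<theta>)
  qed
  have re: "reorders ?K (cfib L1 ?h L3)" "reorders (cfib L1 ?h L3) L1" "reorders ?K L1"
    using C d1 d2 by (auto simp: reorders_def)
  have ASP: "Cmp (Und B j) ?AS ?P = str_perm T B ?g1 ?\<theta> ?K L1 ?x1"
    unfolding AS Sb by (rule B.str_perm_str_perm[OF \<theta>t re(1,2)]) (use x1o in auto)
  note m = dmor_cmp[OF m1 m2]
  have "ext_X L1 i1 L3 i3 \<alpha> ?h ?b = Cmp (Und B j) ?A ?P"
    by (rule ext_X_eq[OF o])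
  also have "\<dots> = Cmp (Und B j) ?A\<eta> (Cmp (Und B j) ?AS ?P)"
  proof -
    have relL: "relab T \<alpha> L3 L3 = \<alpha>" by (rule T.relab_self[OF e(3,1)])
    have 1: "in_hom (Und B j) ?A\<eta> (str_obj T B \<alpha> (map ?o\<eta> L3)) (str_obj T B \<alpha> (map ?x3 L3))"
      using B.str_arr_hom[OF e(3) _ lh\<eta>, of L3] e(1) by (simp add: relL)
    have 2: "in_hom (Und B j) ?AS (str_obj T B \<alpha> (map ?ob L3)) (str_obj T B \<alpha> (map ?o\<eta> L3))"
      using B.str_arr_hom[OF e(3) _ lhS, of L3] e(1) by (simp add: relL)
    have 3: "in_hom (Und B j) ?P (str_obj T B (dsrc T F L1 L3 ?h ?b \<alpha>) (map ?x1 L1)) (str_obj T B \<alpha> (map ?ob L3))"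
      unfolding ext_X_sub_obj[OF m o] by (rule ext_X_parts(2)[OF m o])
    show ?thesis unfolding A using Bj.cmp_assoc[OF 3 2 1] by simp
  qed
  finally show ?thesis unfolding lhs ASP by (rule sym)
qed

text \<open>Strictness of the extension on arrows: the grouping of a concatenation can be done block
  by block, so the multiplication law of \<open>B\<close> distributes both steps of the formula over
  the blocks.\<close>

lemma ext_X_concat:
  assumes \<gamma>: "typed T \<gamma> g M j" and MN: "reorders M N"
    and m: "\<And>m. m \<in> set M \<Longrightarrow> dmor S (L1 m) i1 (L2 m) i2 h b"
    and o: "\<And>m. m \<in> set M \<Longrightarrow> dob S T f (L2 m) i2 (\<alpha> m) (g m)"
    and L1: "distinct (concat (map L1 M))" and L2: "distinct (concat (map L2 M))"
  shows "ext_X (concat (map L1 N)) i1 (concat (map L2 M)) i2 (Sub T \<gamma> (map \<alpha> M)) h b =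
    str_arr T B \<gamma> M N (\<lambda>m. str_obj T B (dsrc T F (L1 m) (L2 m) h b (\<alpha> m)) (map (\<lambda>l. x (i1 l)) (L1 m)))
      (\<lambda>m. ext_X (L1 m) i1 (L2 m) i2 (\<alpha> m) h b) (\<lambda>m. str_obj T B (\<alpha> m) (map (\<lambda>k. x (i2 k)) (L2 m)))"
proof -
  have N: "set N = set M" "distinct N" "distinct M" using MN by (auto simp: reorders_def)
  let ?L1 = "concat (map L1 N)" and ?L2 = "concat (map L2 M)"
  let ?x1 = "\<lambda>l. x (i1 l)" and ?x2 = "\<lambda>l. x (i2 l)" and ?g1 = "\<lambda>l. f (i1 l)"
  let ?C = "\<lambda>m. cfib (L1 m) h (L2 m)" and ?\<beta> = "\<lambda>m. Sub T (\<alpha> m) (map (\<lambda>k. F (b k)) (L2 m))"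
  have co: "dob S T f ?L2 i2 (Sub T \<gamma> (map \<alpha> M)) j" by (rule dob_concat[OF \<gamma> o L2])
  have cc: "dmor S ?L1 i1 ?L2 i2 h b" by (rule dmor_concat(1)[OF MN m L1 L2])
  have fb1: "fib ?L1 h k = fib (L1 m) h k" if "m \<in> set M" "k \<in> set (L2 m)" for m k
    by (rule dmor_concat(2)[OF MN m L1 L2]) (use that in auto)
  let ?o = "\<lambda>k. str_obj T B (F (b k)) (map ?x1 (fib ?L1 h k))"
  have x1o: "?x1 l \<in> Obj (Und B (?g1 l))" if "m \<in> set M" "l \<in> set (L1 m)" for m l
    by (rule dmor_x_obj[OF m[OF that(1)] that(2)])
  let ?A = "\<lambda>m. str_arr T B (\<alpha> m) (L2 m) (L2 m) (\<lambda>k. str_obj T B (F (b k)) (map ?x1 (fib (L1 m) h k))) (\<lambda>k. c (b k)) ?x2"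
  let ?A' = "\<lambda>m. str_arr T B (\<alpha> m) (L2 m) (L2 m) ?o (\<lambda>k. c (b k)) ?x2"
  let ?P = "\<lambda>m. str_perm T B ?g1 (?\<beta> m) (?C m) (L1 m) ?x1"
  let ?s = "\<lambda>m. str_obj T B (dsrc T F (L1 m) (L2 m) h b (\<alpha> m)) (map ?x1 (L1 m))"
  let ?t = "\<lambda>m. str_obj T B (\<alpha> m) (map ?x2 (L2 m))"
  let ?m = "\<lambda>m. str_obj T B (?\<beta> m) (map ?x1 (?C m))"
  have lhA: "lhom (Und B) g M ?m ?A ?t" and lhP: "lhom (Und B) g M ?s ?P ?m"
    unfolding lhom_def using ext_X_parts[OF m o] by blast+
  have "str_arr T B \<gamma> M N ?s (\<lambda>m. ext_X (L1 m) i1 (L2 m) i2 (\<alpha> m) h b) ?t =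
      str_arr T B \<gamma> M N ?s (\<lambda>m. Cmp (Und B (g m)) (?A m) (?P m)) ?t"
    by (rule str_arr_cong[OF MN]) (use ext_X_eq[OF o] in simp)
  also have "\<dots> = Cmp (Und B j) (str_arr T B \<gamma> M M ?m ?A ?t) (str_arr T B \<gamma> M N ?s ?P ?m)"
    using B.str_arr_cmp[OF \<gamma> _ MN lhA lhP] N T.relab_self[OF \<gamma> N(3)] by simp
  also have "str_arr T B \<gamma> M M ?m ?A ?t = str_arr T B (Sub T \<gamma> (map \<alpha> M)) ?L2 ?L2 ?o (\<lambda>k. c (b k)) ?x2"
  proof -
    have "str_arr T B \<gamma> M M ?m ?A ?t = str_arr T B \<gamma> M M
        (\<lambda>m. str_obj T B (relab T (\<alpha> m) (L2 m) (L2 m)) (map ?o (L2 m))) ?A' ?t"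
    proof (rule str_arr_cong[OF iffD2[OF reorders_refl N(3)]], intro conjI)
      fix m' assume m': "m' \<in> set M"
      have fb: "fib (L1 m') h k = fib ?L1 h k" if "k \<in> set (L2 m')" for k using fb1[OF m' that] by simp
      show "?A m' = ?A' m'"
        by (rule str_arr_cong) (use dmorD(2)[OF m[OF m']] fb in simp_all)
      have "map (\<lambda>k. str_obj T B (F (b k)) (map ?x1 (fib (L1 m') h k))) (L2 m') = map ?o (L2 m')"
        using fb by simp
      then show "?m m' = str_obj T B (relab T (\<alpha> m') (L2 m') (L2 m')) (map ?o (L2 m'))"
        using ext_X_sub_obj[OF m[OF m'] o[OF m']] T.relab_self[OF dobD(3)[OF o[OF m']] dobD(1)[OF o[OF m']]] by (simp only:)
    qed simp
    also have "\<dots> = str_arr T B (Sub T \<gamma> (map \<alpha> M)) ?L2 ?L2 ?o (\<lambda>k. c (b k)) ?x2"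
    proof (rule B.str_arr_sub[OF \<gamma> dobD(3)[OF o] _ _ L2])
      fix m' assume m': "m' \<in> set M"
      show "reorders (L2 m') (L2 m')" using dmorD(2)[OF m[OF m']] by simp
      show "lhom (Und B) (\<lambda>l. f (i2 l)) (L2 m') ?o (\<lambda>k. c (b k)) ?x2"
        using c_lhom[OF m[OF m']] fb1[OF m'] by (simp add: lhom_def)
    qed (use N in simp_all)
    finally show ?thesis .
  qed
  also have "str_arr T B \<gamma> M N ?s ?P ?m = str_perm T B ?g1 (Sub T \<gamma> (map ?\<beta> M)) (concat (map ?C M)) ?L1 ?x1"
  proof -
    have "distinct (cfib ?L1 h ?L2)" using dmorD(1,2)[OF cc] by simp
    moreover have "cfib ?L1 h ?L2 = concat (map ?C M)"
      by (rule cfib_concat_map) (use N L2 dmorD(3)[OF m] in auto)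
    ultimately have "distinct (concat (map ?C M))" by simp
    then have "str_arr T B \<gamma> M N (\<lambda>m. str_obj T B (relab T (?\<beta> m) (?C m) (L1 m)) (map ?x1 (L1 m))) ?P ?m =
        str_perm T B ?g1 (Sub T \<gamma> (map ?\<beta> M)) (concat (map ?C M)) ?L1 ?x1"
      by (intro B.str_arr_str_perm_sub[OF \<gamma> dsrc_typed[OF m o] MN dmorD(5)[OF m]]) (use x1o in auto)
    then show ?thesis by (simp only: dsrc_def)
  qed
  also have "concat (map ?C M) = cfib ?L1 h ?L2"
    by (rule cfib_concat_map[symmetric]) (use N L2 dmorD(3)[OF m] in auto)
  also have "Sub T \<gamma> (map ?\<beta> M) = Sub T (Sub T \<gamma> (map \<alpha> M)) (map (\<lambda>k. F (b k)) ?L2)"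
  proof (rule T.sub_sub[OF \<gamma> dobD(3)[OF o], symmetric])
    show "typed T (F (b l)) ?g1 (fib ?L1 h l) (f (i2 l))" if "m \<in> set M" "l \<in> set (L2 m)" for m l
      using F_typed[OF dmorD(4)[OF cc]] that by auto
  qed
  finally show ?thesis unfolding ext_X_eq[OF co] by (rule sym)
qed

text \<open>A single fibre needs no permutation, and the structure map at a unit operation returns
  its argument; only \<open>c \<alpha>\<close> remains. This is why restriction recovers the given
  lax morphism.\<close>

lemma ext_X_uc:
  assumes \<alpha>: "typed S \<alpha> g M i" and M: "distinct M"
  shows "ext_X M g [()] (\<lambda>_. i) (One T (f i)) (\<lambda>_. ()) (\<lambda>_. \<alpha>) = c \<alpha>"
proof -
  have i: "i \<in> Col S" "f i \<in> Col T" using typed_tgt_f[OF \<alpha>] by auto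
  have fb: "fib M (\<lambda>_. ()) () = M" by (simp add: fib_def)
  have hom: "in_hom (Und B (f i)) (c \<alpha>) (str_obj T B (F \<alpha>) (map (\<lambda>m. x (g m)) M)) (x i)"
    by (rule lax_coh_hom[OF lax \<alpha>])
  have "str_arr T B (One T (f i)) [()] [()] (\<lambda>k. str_obj T B (F \<alpha>) (map (\<lambda>l. x (g l)) (fib M (\<lambda>_. ()) k))) (\<lambda>k. c \<alpha>) (\<lambda>k. x i) = c \<alpha>"
    by (rule B.str_arr_one[OF i(2)]) (use hom fb in simp)
  moreover have "str_perm T B (\<lambda>l. f (g l)) (Sub T (One T (f i)) (map (\<lambda>k. F \<alpha>) [()])) (cfib M (\<lambda>_. ()) [()]) M (\<lambda>l. x (g l)) =
      Ide (Und B (f i)) (str_obj T B (F \<alpha>) (map (\<lambda>m. x (g m)) M))"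
    using B.str_arr_ide[OF F_typed[OF \<alpha>] M x_obj[OF \<alpha>]] T.sub_one_l[OF F_typed[OF \<alpha>]]
    by (simp add: str_perm_def cfib_single fb)
  ultimately show ?thesis
    unfolding ext_X_eq[OF dob_unit[OF i(1)]]
    using category.cmp_ide_right[OF B.Und_category[OF i(2)] hom] by simp
qed

end

end

section \<open>Strict morphisms and their 2-cells\<close>

lemma comp_functor:
  assumes "is_functor C D G" "is_functor D E H"
  shows "is_functor C E (comp_func C H G)"
proof -
  interpret G: is_functor C D G by fact
  interpret H: is_functor D E H by fact
  show ?thesis
  proof
    show "FO (comp_func C H G) \<in> Obj C \<rightarrow>\<^sub>E Obj E" "FA (comp_func C H G) \<in> Arr C \<rightarrow>\<^sub>E Arr E"
      using G.FO_obj H.FO_obj G.FA_arr H.FA_arr by (auto simp: comp_func_def compose_def)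
    fix m x y assume m: "in_hom C m x y"
    then have mem: "m \<in> Arr C" "x \<in> Obj C" "y \<in> Obj C"
      using G.A.in_hom_obj by (auto simp: in_hom_def)
    show "in_hom E (FA (comp_func C H G) m) (FO (comp_func C H G) x) (FO (comp_func C H G) y)"
      using H.fa_hom[OF G.fa_hom[OF m]] mem by (simp add: comp_func_def compose_def)
    fix m' z assume m': "in_hom C m' y z"
    have "m' \<in> Arr C" "Cmp C m' m \<in> Arr C"
      using m' G.A.cmp_hom[OF m m'] by (auto simp: in_hom_def)
    then show "FA (comp_func C H G) (Cmp C m' m) = Cmp E (FA (comp_func C H G) m') (FA (comp_func C H G) m)"
      using H.fa_cmp[OF G.fa_hom[OF m] G.fa_hom[OF m']] G.fa_cmp[OF m m'] mem
      by (simp add: comp_func_def compose_def)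
  next
    fix x assume x: "x \<in> Obj C"
    have "Ide C x \<in> Arr C" using G.A.ide_hom[OF x] by (simp add: in_hom_def)
    then show "FA (comp_func C H G) (Ide C x) = Ide E (FO (comp_func C H G) x)"
      using x G.fa_ide[OF x] H.fa_ide[OF G.FO_obj[OF x]] by (simp add: comp_func_def compose_def)
  qed
qed

lemma nat_ide:
  assumes "is_functor C D G"
  shows "is_nat_trans C D G G (\<lambda>x\<in>Obj C. Ide D (FO G x))"
proof -
  interpret G: is_functor C D G by fact
  show ?thesis
    unfolding is_nat_trans_def
  proof (intro conjI ballI allI impI)
    fix m x y assume m: "in_hom C m x y"
    show "Cmp D ((\<lambda>x\<in>Obj C. Ide D (FO G x)) y) (FA G m) = Cmp D (FA G m) ((\<lambda>x\<in>Obj C. Ide D (FO G x)) x)"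
      using G.B.cmp_ide_left[OF G.fa_hom[OF m]] G.B.cmp_ide_right[OF G.fa_hom[OF m]] G.A.in_hom_obj[OF m]
      by simp
  qed (simp_all add: G.B.ide_hom G.FO_obj)
qed

lemma nat_vcomp:
  assumes "is_functor C D G" "is_functor C D G'" "is_functor C D G''"
    and \<phi>: "is_nat_trans C D G G' \<phi>" and \<psi>: "is_nat_trans C D G' G'' \<psi>"
  shows "is_nat_trans C D G G'' (\<lambda>x\<in>Obj C. Cmp D (\<psi> x) (\<phi> x))"
proof -
  interpret G: is_functor C D G by fact
  interpret G': is_functor C D G' by fact
  interpret G'': is_functor C D G'' by fact
  have h: "in_hom D (\<phi> x) (FO G x) (FO G' x)" "in_hom D (\<psi> x) (FO G' x) (FO G'' x)" if "x \<in> Obj C" for x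
    using \<phi> \<psi> that by (auto simp: is_nat_trans_def)
  show ?thesis
    unfolding is_nat_trans_def
  proof (intro conjI ballI allI impI)
    fix m x y assume m: "in_hom C m x y"
    note x = G.A.in_hom_obj[OF m]
    have "Cmp D (Cmp D (\<psi> y) (\<phi> y)) (FA G m) = Cmp D (\<psi> y) (Cmp D (\<phi> y) (FA G m))"
      using G.B.cmp_assoc[OF G.fa_hom[OF m] h(1)[OF x(2)] h(2)[OF x(2)]] by simp
    also have "Cmp D (\<phi> y) (FA G m) = Cmp D (FA G' m) (\<phi> x)"
      using \<phi> m by (simp add: is_nat_trans_def)
    also have "Cmp D (\<psi> y) \<dots> = Cmp D (Cmp D (\<psi> y) (FA G' m)) (\<phi> x)"
      by (rule G.B.cmp_assoc[OF h(1)[OF x(1)] G'.fa_hom[OF m] h(2)[OF x(2)]])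
    also have "Cmp D (\<psi> y) (FA G' m) = Cmp D (FA G'' m) (\<psi> x)"
      using \<psi> m by (simp add: is_nat_trans_def)
    also have "Cmp D \<dots> (\<phi> x) = Cmp D (FA G'' m) (Cmp D (\<psi> x) (\<phi> x))"
      using G.B.cmp_assoc[OF h(1)[OF x(1)] h(2)[OF x(1)] G''.fa_hom[OF m]] by simp
    finally show "Cmp D ((\<lambda>x\<in>Obj C. Cmp D (\<psi> x) (\<phi> x)) y) (FA G m) =
        Cmp D (FA G'' m) ((\<lambda>x\<in>Obj C. Cmp D (\<psi> x) (\<phi> x)) x)"
      using x by simp
  qed (use G.B.cmp_hom[OF h] in simp_all)
qed

context
  fixes J :: "'j set" and X :: "'j \<Rightarrow> ('o, 'm) cat" and Y :: "'j \<Rightarrow> ('p, 'q) cat"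
begin

lemma cell2_in_hom:
  "cell2 J X Y g g' \<phi> \<Longrightarrow> j \<in> J \<Longrightarrow> x \<in> Obj (X j) \<Longrightarrow> in_hom (Y j) (\<phi> j x) (FO (g j) x) (FO (g' j) x)"
  by (simp add: cell2_def is_nat_trans_def)

text \<open>Two levels of extensionality give two default values: outside \<open>J\<close> the whole
  family member is \<open>undefined\<close>, hence \<open>undefined x\<close> at \<open>x\<close>;
  inside \<open>J\<close> it is a function that is \<open>undefined\<close> off the objects.\<close>

lemma cell2_ext: "cell2 J X Y g g' \<phi> \<Longrightarrow> j \<notin> J \<or> x \<notin> Obj (X j) \<Longrightarrow> \<phi> j x = (if j \<in> J then undefined else undefined x)"
  by (auto simp: cell2_def is_nat_trans_def extensional_def)

lemma cell2_id2:
  assumes "cell1 J X Y g"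
  shows "cell2 J X Y g g (id2 J X Y g)"
  using assms nat_ide by (auto simp: cell2_def cell1_def id2_def)

lemma cell2_vcomp:
  assumes "cell1 J X Y g" "cell1 J X Y g'" "cell1 J X Y g''" "cell2 J X Y g g' \<phi>" "cell2 J X Y g' g'' \<psi>"
  shows "cell2 J X Y g g'' (vcomp J X Y \<psi> \<phi>)"
  unfolding cell2_def
proof (intro conjI ballI)
  fix j assume j: "j \<in> J"
  have "is_nat_trans (X j) (Y j) (g j) (g'' j) (\<lambda>x\<in>Obj (X j). Cmp (Y j) (\<psi> j x) (\<phi> j x))"
    by (rule nat_vcomp[where G' = "g' j"]) (use assms j in \<open>auto simp: cell1_def cell2_def\<close>)
  then show "is_nat_trans (X j) (Y j) (g j) (g'' j) (vcomp J X Y \<psi> \<phi> j)"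
    using j by (simp add: vcomp_def)
qed (simp add: vcomp_def)

context
  assumes Y: "\<And>j. j \<in> J \<Longrightarrow> category (Y j)"
begin

lemma vcomp_id_left:
  assumes "cell2 J X Y g g' \<phi>"
  shows "vcomp J X Y (id2 J X Y g') \<phi> = \<phi>"
proof (intro ext)
  fix j x show "vcomp J X Y (id2 J X Y g') \<phi> j x = \<phi> j x"
    using cell2_ext[OF assms, of j x] category.cmp_ide_left[OF Y cell2_in_hom[OF assms, of j x]]
    by (cases "j \<in> J"; cases "x \<in> Obj (X j)") (auto simp: vcomp_def id2_def)
qed

lemma vcomp_id_right:
  assumes "cell2 J X Y g g' \<phi>"
  shows "vcomp J X Y \<phi> (id2 J X Y g) = \<phi>"
proof (intro ext)
  fix j x show "vcomp J X Y \<phi> (id2 J X Y g) j x = \<phi> j x"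
    using cell2_ext[OF assms, of j x] category.cmp_ide_right[OF Y cell2_in_hom[OF assms, of j x]]
    by (cases "j \<in> J"; cases "x \<in> Obj (X j)") (auto simp: vcomp_def id2_def)
qed

lemma vcomp_assoc:
  assumes "cell2 J X Y g0 g1 \<phi>" "cell2 J X Y g1 g2 \<psi>" "cell2 J X Y g2 g3 \<chi>"
  shows "vcomp J X Y \<chi> (vcomp J X Y \<psi> \<phi>) = vcomp J X Y (vcomp J X Y \<chi> \<psi>) \<phi>"
proof (intro ext)
  fix j x show "vcomp J X Y \<chi> (vcomp J X Y \<psi> \<phi>) j x = vcomp J X Y (vcomp J X Y \<chi> \<psi>) \<phi> j x"
    using category.cmp_assoc[OF Y cell2_in_hom[OF assms(1), of j x] cell2_in_hom[OF assms(2), of j x] cell2_in_hom[OF assms(3), of j x]]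
    by (cases "j \<in> J"; cases "x \<in> Obj (X j)") (auto simp: vcomp_def)
qed

end

end

lemma cat_of_homs_category:
  assumes "\<And>x. x \<in> X \<Longrightarrow> e x \<in> H x x"
    "\<And>x y z d d'. x \<in> X \<Longrightarrow> y \<in> X \<Longrightarrow> z \<in> X \<Longrightarrow> d \<in> H x y \<Longrightarrow> d' \<in> H y z \<Longrightarrow> k x y z d' d \<in> H x z"
    "\<And>x y d. x \<in> X \<Longrightarrow> y \<in> X \<Longrightarrow> d \<in> H x y \<Longrightarrow> k x y y (e y) d = d"
    "\<And>x y d. x \<in> X \<Longrightarrow> y \<in> X \<Longrightarrow> d \<in> H x y \<Longrightarrow> k x x y d (e x) = d"
    "\<And>x y z w d d' d''. x \<in> X \<Longrightarrow> y \<in> X \<Longrightarrow> z \<in> X \<Longrightarrow> w \<in> X \<Longrightarrow> d \<in> H x y \<Longrightarrow> d' \<in> H y z \<Longrightarrow> d'' \<in> H z w \<Longrightarrow>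
      k x z w d'' (k x y z d' d) = k x y w (k y z w d'' d') d"
  shows "category (cat_of_homs X H e k)"
  by unfold_locales (use assms in \<open>auto simp: cat_of_homs_def in_hom_def\<close>)

lemma bij_iso_of_categories:
  assumes G: "is_functor C D G" and bO: "bij_betw (FO G) (Obj C) (Obj D)" and bA: "bij_betw (FA G) (Arr C) (Arr D)"
  shows "iso_of_categories C D G"
proof -
  interpret G: is_functor C D G by fact
  define H where "H = \<lparr> FO = (\<lambda>y\<in>Obj D. inv_into (Obj C) (FO G) y), FA = (\<lambda>m\<in>Arr D. inv_into (Arr C) (FA G) m) \<rparr>"
  have HO: "FO H y \<in> Obj C" "FO G (FO H y) = y" if "y \<in> Obj D" for y
    using that bO by (auto simp: H_def bij_betw_def inv_into_into f_inv_into_f)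
  have HA: "FA H m \<in> Arr C" "FA G (FA H m) = m" if "m \<in> Arr D" for m
    using that bA by (auto simp: H_def bij_betw_def inv_into_into f_inv_into_f)
  have HGO: "FO H (FO G x) = x" if "x \<in> Obj C" for x
    using that bO G.FO_obj by (auto simp: H_def bij_betw_def)
  have HGA: "FA H (FA G m) = m" if "m \<in> Arr C" for m
    using that bA G.FA_arr by (auto simp: H_def bij_betw_def)
  have hom: "in_hom C (FA H m) (FO H x) (FO H y)" if m: "in_hom D m x y" for m x y
  proof -
    have mD: "m \<in> Arr D" using m by (simp add: in_hom_def)
    let ?m = "FA H m"
    have h: "in_hom C ?m (Dom C ?m) (Cod C ?m)" by (rule G.A.in_hom_self[OF HA(1)[OF mD]])
    \<comment> \<open>Injectivity on objects recovers the ends of the inverse image of an arrow from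
      the ends of the arrow.\<close>
    have "FO G (Dom C ?m) = x" "FO G (Cod C ?m) = y"
      using G.fa_hom[OF h] m HA(2)[OF mD] by (auto simp: in_hom_def)
    then have "Dom C ?m = FO H x" "Cod C ?m = FO H y"
      using HGO G.A.in_hom_obj[OF h] by auto
    then show ?thesis using h by simp
  qed
  have "is_functor D C H"
  proof
    show "FO H \<in> Obj D \<rightarrow>\<^sub>E Obj C" "FA H \<in> Arr D \<rightarrow>\<^sub>E Arr C"
      using HO(1) HA(1) by (auto simp: PiE_def H_def)
    fix m x y assume m: "in_hom D m x y"
    show "in_hom C (FA H m) (FO H x) (FO H y)" by (rule hom[OF m])
    fix m' z assume m': "in_hom D m' y z"
    have "m \<in> Arr D" "m' \<in> Arr D" using m m' by (auto simp: in_hom_def)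
    then have "Cmp D m' m = FA G (Cmp C (FA H m') (FA H m))"
      using G.fa_cmp[OF hom[OF m] hom[OF m']] HA(2) by simp
    moreover have "Cmp C (FA H m') (FA H m) \<in> Arr C"
      using G.A.cmp_hom[OF hom[OF m] hom[OF m']] by (simp add: in_hom_def)
    ultimately show "FA H (Cmp D m' m) = Cmp C (FA H m') (FA H m)" using HGA by simp
  next
    fix x assume x: "x \<in> Obj D"
    have "Ide D x = FA G (Ide C (FO H x))" using G.fa_ide[OF HO(1)[OF x]] HO(2)[OF x] by simp
    moreover have "Ide C (FO H x) \<in> Arr C" using G.A.ide_hom[OF HO(1)[OF x]] by (simp add: in_hom_def)
    ultimately show "FA H (Ide D x) = Ide C (FO H x)" using HGA by simp
  qed
  moreover have "comp_func C H G = id_func C" "comp_func D G H = id_func D"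
    using HGO HGA HO HA by (auto simp: comp_func_def id_func_def compose_def restrict_def fun_eq_iff)
  ultimately show ?thesis using G by (auto simp: iso_of_categories_def)
qed

section \<open>Strict morphisms as 1-cells with a property, and their 2-cells\<close>

locale strict_alg2 = C: strict_alg T C + B: strict_alg T B
  for T :: "('j, 't) opd" and C :: "('j, 't, 'p, 'q) alg" and B :: "('j, 't, 'o, 'm) alg"
begin

abbreviation "MC \<equiv> mon_ob T (Und C)"
abbreviation "idl g \<equiv> id2 (Col T) MC (Und B) (lax_cod T C g)"

definition strict_1cell :: "('j \<Rightarrow> ('p, 'q, 'o, 'm) func) \<Rightarrow> bool" where
  "strict_1cell g \<longleftrightarrow> cell1 (Col T) (Und C) (Und B) g \<and> lax_dom T C B g = lax_cod T C g"

lemma strict_1cell_functor: "strict_1cell g \<Longrightarrow> j \<in> Col T \<Longrightarrow> is_functor (Und C j) (Und B j) (g j)"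
  by (simp add: strict_1cell_def cell1_def)

lemma MC_ObjI:
  assumes "typed T \<alpha> h M j" "\<And>m. m \<in> set M \<Longrightarrow> y m \<in> Obj (Und C (h m))"
  shows "(\<alpha>, map y M) \<in> Obj (MC j)"
  by (rule mon_ob_ObjI[OF assms(1)]) (rule assms(2))

lemma cod_obj:
  assumes "typed T \<alpha> h M j" "(\<alpha>, map y M) \<in> Obj (MC j)"
  shows "FO (lax_cod T C g j) (\<alpha>, map y M) = FO (g j) (str_obj T C \<alpha> (map y M))"
  using assms C.typed_tgt[OF assms(1)] by (simp add: lax_cod_def comp1_def comp_func_def compose_def str_obj_def)

lemma dom_obj:
  assumes "typed T \<alpha> h M j" "(\<alpha>, map y M) \<in> Obj (MC j)"
  shows "FO (lax_dom T C B g j) (\<alpha>, map y M) = str_obj T B \<alpha> (map (\<lambda>m. FO (g (h m)) (y m)) M)"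
  using assms C.typed_tgt[OF assms(1)] C.mon_1_obj[OF assms(1) _ assms(2), of g]
  by (simp add: lax_dom_def comp1_def comp_func_def compose_def str_obj_def)

lemma larr_MC:
  assumes "typed T \<beta> h M j" "reorders M N" "lhom (Und C) h M x c y"
  shows "larr T \<beta> M N x c y \<in> Arr (MC j)"
  using C.larr_in_hom[OF C.Und_category assms] by (simp add: in_hom_def)

lemma cod_arr:
  assumes "typed T \<beta> h M j" "reorders M N" "lhom (Und C) h M x c y"
  shows "FA (lax_cod T C g j) (larr T \<beta> M N x c y) = FA (g j) (str_arr T C \<beta> M N x c y)"
  using larr_MC[OF assms] C.typed_tgt[OF assms(1)]
  by (simp add: lax_cod_def comp1_def comp_func_def compose_def str_arr_def)

lemma dom_arr:
  assumes "typed T \<beta> h M j" "reorders M N" "lhom (Und C) h M x c y"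
  shows "FA (lax_dom T C B g j) (larr T \<beta> M N x c y) =
    str_arr T B \<beta> M N (\<lambda>m. FO (g (h m)) (x m)) (\<lambda>m. FA (g (h m)) (c m)) (\<lambda>m. FO (g (h m)) (y m))"
  using larr_MC[OF assms] C.typed_tgt[OF assms(1)] C.mon_1_larr[OF assms(1) _ larr_MC[OF assms] assms(2), of g]
  by (simp add: lax_dom_def comp1_def comp_func_def compose_def str_arr_def)

lemma strict_1cell_obj:
  assumes "strict_1cell g" "typed T \<alpha> h M j" "\<And>m. m \<in> set M \<Longrightarrow> y m \<in> Obj (Und C (h m))"
  shows "FO (g j) (str_obj T C \<alpha> (map y M)) = str_obj T B \<alpha> (map (\<lambda>m. FO (g (h m)) (y m)) M)"
proof -
  have "(\<alpha>, map y M) \<in> Obj (MC j)" by (rule MC_ObjI[OF assms(2,3)])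
  then show ?thesis using cod_obj[OF assms(2), of y g] dom_obj[OF assms(2), of y g] assms(1) by (simp add: strict_1cell_def)
qed

lemma strict_1cell_arr:
  assumes "strict_1cell g" "typed T \<beta> h M j" "reorders M N" "lhom (Und C) h M x c y"
  shows "FA (g j) (str_arr T C \<beta> M N x c y) =
    str_arr T B \<beta> M N (\<lambda>m. FO (g (h m)) (x m)) (\<lambda>m. FA (g (h m)) (c m)) (\<lambda>m. FO (g (h m)) (y m))"
  using cod_arr[OF assms(2-4), of g] dom_arr[OF assms(2-4), of g] assms(1) by (simp add: strict_1cell_def)

lemma strict_1cellI:
  assumes "cell1 (Col T) (Und C) (Und B) g"
    and "\<And>j a. j \<in> Col T \<Longrightarrow> a \<in> Obj (MC j) \<Longrightarrow> FO (lax_dom T C B g j) a = FO (lax_cod T C g j) a"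
    and "\<And>j m. j \<in> Col T \<Longrightarrow> m \<in> Arr (MC j) \<Longrightarrow> FA (lax_dom T C B g j) m = FA (lax_cod T C g j) m"
  shows "strict_1cell g"
  unfolding strict_1cell_def
proof (intro conjI assms(1) ext)
  fix j show "lax_dom T C B g j = lax_cod T C g j"
  proof (cases "j \<in> Col T")
    case True
    have "FO (lax_dom T C B g j) = FO (lax_cod T C g j)"
    proof
      fix a show "FO (lax_dom T C B g j) a = FO (lax_cod T C g j) a"
        using assms(2)[OF True, of a] True
        by (cases "a \<in> Obj (MC j)") (simp_all add: lax_dom_def lax_cod_def comp1_def comp_func_def compose_def)
    qed
    moreover have "FA (lax_dom T C B g j) = FA (lax_cod T C g j)"
    proof
      fix a show "FA (lax_dom T C B g j) a = FA (lax_cod T C g j) a"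
        using assms(3)[OF True, of a] True
        by (cases "a \<in> Arr (MC j)") (simp_all add: lax_dom_def lax_cod_def comp1_def comp_func_def compose_def)
    qed
    ultimately show ?thesis by simp
  qed (simp add: lax_dom_def lax_cod_def comp1_def)
qed

lemma cod_cell1:
  assumes "cell1 (Col T) (Und C) (Und B) g"
  shows "cell1 (Col T) MC (Und B) (lax_cod T C g)"
  using assms comp_functor[OF C.Str_functor] by (auto simp: cell1_def lax_cod_def comp1_def)

text \<open>With an identity as coherence 2-cell, both lax axioms compare identities. The objects
  they belong to agree by the unit and multiplication laws of \<open>C\<close> and because
  \<open>g\<close> preserves the structure.\<close>

lemma strict_1cell_lax:
  assumes g: "strict_1cell g"
  shows "lax_morphism T C B (g, idl g)"
proof -
  have cell1: "cell1 (Col T) (Und C) (Und B) g" and eq: "lax_dom T C B g = lax_cod T C g"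
    using g by (auto simp: strict_1cell_def)
  have 2: "cell2 (Col T) MC (Und B) (lax_dom T C B g) (lax_cod T C g) (idl g)"
    unfolding eq by (rule cell2_id2[OF cod_cell1[OF cell1]])
  have 3: "rwhisker (Col T) (Und C) (idl g) (mon_unit T (Und C)) = id2 (Col T) (Und C) (Und B) g"
  proof (intro ext)
    fix j a
    show "rwhisker (Col T) (Und C) (idl g) (mon_unit T (Und C)) j a = id2 (Col T) (Und C) (Und B) g j a"
    proof (cases "j \<in> Col T \<and> a \<in> Obj (Und C j)")
      case True
      then have j: "j \<in> Col T" and a: "a \<in> Obj (Und C j)" by auto
      have t: "typed T (One T j) (\<lambda>_. j) [()] j" by (simp add: C.typed_one j)
      have obj: "(One T j, map (\<lambda>_. a) [()]) \<in> Obj (MC j)" by (rule MC_ObjI[OF t]) (simp add: a)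
      show ?thesis using cod_obj[OF t obj, of g] C.str_obj_one[OF j a] j a obj
        by (simp add: rwhisker_def id2_def mon_unit_def)
    next
      case False
      then show ?thesis by (auto simp: rwhisker_def id2_def)
    qed
  qed
  have 4: "rwhisker (Col T) (mon_ob T MC) (idl g) (mon_mult T (Und C)) =
     vcomp (Col T) (mon_ob T MC) (Und B)
       (rwhisker (Col T) (mon_ob T MC) (idl g) (mon_1 T MC (Str C)))
       (lwhisker (Col T) (mon_ob T MC) (Str B) (mon_2 T MC (lax_dom T C B g) (lax_cod T C g) (idl g)))"
    (is "?lhs = ?rhs")
  proof (intro ext)
    fix j a show "?lhs j a = ?rhs j a"
    proof (cases "j \<in> Col T \<and> a \<in> Obj (mon_ob T MC j)")
      case True
      then have j: "j \<in> Col T" and a: "a \<in> Obj (mon_ob T MC j)" by auto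
      interpret Bj: category "Und B j" by (rule B.Und_category[OF j])
      show ?thesis
      proof (rule C.mon_ob2_ObjE[OF a])
        fix \<alpha> h M \<beta> h' x and L :: "nat \<Rightarrow> (nat \<times> nat) list"
        assume aa: "a = (\<alpha>, map (\<lambda>m. (\<beta> m, map x (L m))) M)" and \<alpha>: "typed T \<alpha> h M j" and M: "distinct M"
          and \<beta>: "\<And>m. m \<in> set M \<Longrightarrow> typed T (\<beta> m) h' (L m) (h m)" and L: "distinct (concat (map L M))"
          and x: "\<And>m l. m \<in> set M \<Longrightarrow> l \<in> set (L m) \<Longrightarrow> x l \<in> Obj (Und C (h' l))"
        let ?s = "\<lambda>m. str_obj T C (\<beta> m) (map x (L m))"
        let ?W = "FO (g j) (str_obj T C \<alpha> (map ?s M))"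
        have so: "?s m \<in> Obj (Und C (h m))" if "m \<in> set M" for m by (rule C.str_obj_obj[OF \<beta>[OF that] x[OF that]])
        have om: "(\<beta> m, map x (L m)) \<in> Obj (MC (h m))" if "m \<in> set M" for m by (rule MC_ObjI[OF \<beta>[OF that] x[OF that]])
        have os: "(\<alpha>, map ?s M) \<in> Obj (MC j)" by (rule MC_ObjI[OF \<alpha> so])
        have tsub: "typed T (Sub T \<alpha> (map \<beta> M)) h' (concat (map L M)) j" by (rule C.typed_sub[OF \<alpha> \<beta>])
        have osub: "(Sub T \<alpha> (map \<beta> M), map x (concat (map L M))) \<in> Obj (MC j)"
          by (rule MC_ObjI[OF tsub]) (use x in auto)
        have W: "?W \<in> Obj (Und B j)"
          by (rule is_functor.FO_obj[OF strict_1cell_functor[OF g j] C.str_obj_obj[OF \<alpha> so]])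
        have "?lhs j a = Ide (Und B j) (FO (lax_cod T C g j) (Sub T \<alpha> (map \<beta> M), map x (concat (map L M))))"
          using j a osub by (simp add: rwhisker_def mon_mult_def id2_def aa C.mon_mult_obj_map)
        also have "\<dots> = Ide (Und B j) ?W"
          unfolding cod_obj[OF tsub osub] using C.str_obj_sub[OF \<alpha> \<beta> x] by simp
        finally have lhs: "?lhs j a = Ide (Und B j) ?W" .
        have m1: "FO (mon_1 T MC (Str C) j) a = (\<alpha>, map ?s M)"
        proof -
          have "FO (mon_1 T MC (Str C) j) a = (\<alpha>, map (\<lambda>m. FO (Str C (h m)) (\<beta> m, map x (L m))) M)"
            unfolding aa by (rule C.mon_1_obj[OF \<alpha> j a[unfolded aa]])
          also have "map (\<lambda>m. FO (Str C (h m)) (\<beta> m, map x (L m))) M = map ?s M"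
            using \<beta> by (auto simp: str_obj_def typed_def)
          finally show ?thesis .
        qed
        have "mon_2 T MC (lax_dom T C B g) (lax_cod T C g) (idl g) j a =
            larr T \<alpha> M M (\<lambda>m. FO (lax_dom T C B g (h m)) (\<beta> m, map x (L m))) (\<lambda>m. idl g (h m) (\<beta> m, map x (L m)))
              (\<lambda>m. FO (lax_cod T C g (h m)) (\<beta> m, map x (L m)))"
          unfolding aa by (rule C.mon_2_larr[OF \<alpha> M j a[unfolded aa]])
        also have "\<dots> = larr T \<alpha> M M (\<lambda>m. FO (g (h m)) (?s m)) (\<lambda>m. Ide (Und B (h m)) (FO (g (h m)) (?s m))) (\<lambda>m. FO (g (h m)) (?s m))"
        proof (rule larr_cong[OF iffD2[OF reorders_refl M]], intro conjI)
          fix m assume m: "m \<in> set M"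
          have hm: "h m \<in> Col T" by (rule C.typed_col[OF \<alpha> m])
          have e: "FO (lax_cod T C g (h m)) (\<beta> m, map x (L m)) = FO (g (h m)) (?s m)"
            by (rule cod_obj[OF \<beta>[OF m] om[OF m]])
          show "FO (lax_dom T C B g (h m)) (\<beta> m, map x (L m)) = FO (g (h m)) (?s m)" unfolding eq e ..
          show "FO (lax_cod T C g (h m)) (\<beta> m, map x (L m)) = FO (g (h m)) (?s m)" by (rule e)
          show "idl g (h m) (\<beta> m, map x (L m)) = Ide (Und B (h m)) (FO (g (h m)) (?s m))"
            using om[OF m] hm e by (simp add: id2_def)
        qed
        finally have "FA (Str B j) (mon_2 T MC (lax_dom T C B g) (lax_cod T C g) (idl g) j a) =
            str_arr T B \<alpha> M M (\<lambda>m. FO (g (h m)) (?s m)) (\<lambda>m. Ide (Und B (h m)) (FO (g (h m)) (?s m))) (\<lambda>m. FO (g (h m)) (?s m))"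
          using C.typed_tgt[OF \<alpha>] by (simp add: str_arr_def)
        also have "\<dots> = Ide (Und B j) (str_obj T B \<alpha> (map (\<lambda>m. FO (g (h m)) (?s m)) M))"
          by (rule B.str_arr_ide[OF \<alpha> M is_functor.FO_obj[OF strict_1cell_functor[OF g C.typed_col[OF \<alpha>]] so]])
        also have "str_obj T B \<alpha> (map (\<lambda>m. FO (g (h m)) (?s m)) M) = ?W"
          by (rule strict_1cell_obj[OF g \<alpha> so, symmetric])
        finally have m2: "FA (Str B j) (mon_2 T MC (lax_dom T C B g) (lax_cod T C g) (idl g) j a) = Ide (Und B j) ?W" .
        have "?rhs j a = Cmp (Und B j) (Ide (Und B j) ?W) (Ide (Und B j) ?W)"
        proof -
          have "idl g j (\<alpha>, map ?s M) = Ide (Und B j) ?W"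
            using j os cod_obj[OF \<alpha> os, of g] by (simp add: id2_def)
          then show ?thesis using j a by (simp add: vcomp_def rwhisker_def lwhisker_def m1 m2)
        qed
        then show ?thesis using lhs Bj.cmp_ide_left[OF Bj.ide_hom[OF W]] by simp
      qed
    next
      case False
      then show ?thesis by (auto simp: rwhisker_def vcomp_def)
    qed
  qed
  show ?thesis using cell1 2 3 4 by (simp add: lax_morphism_def)
qed

text \<open>The coherence 2-cell of a strict morphism is forced and satisfies the lax axioms
  automatically, so a strict morphism is a 1-cell with a property.\<close>

lemma strict_iff: "strict_morphism T C B G \<longleftrightarrow> strict_1cell (fst G) \<and> G = (fst G, idl (fst G))"
  using strict_1cell_lax by (cases G) (auto simp: strict_morphism_def strict_1cell_def lax_morphism_def)

lemma mon_2_str_arr: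
  assumes \<alpha>: "typed T \<alpha> h M j" and M: "distinct M" and y: "\<And>m. m \<in> set M \<Longrightarrow> y m \<in> Obj (Und C (h m))"
  shows "FA (Str B j) (mon_2 T (Und C) g g' \<phi> j (\<alpha>, map y M)) =
    str_arr T B \<alpha> M M (\<lambda>m. FO (g (h m)) (y m)) (\<lambda>m. \<phi> (h m) (y m)) (\<lambda>m. FO (g' (h m)) (y m))"
proof -
  have "mon_2 T (Und C) g g' \<phi> j (\<alpha>, map y M) =
      larr T \<alpha> M M (\<lambda>m. FO (g (h m)) (y m)) (\<lambda>m. \<phi> (h m) (y m)) (\<lambda>m. FO (g' (h m)) (y m))"
    by (rule C.mon_2_larr[OF \<alpha> M _ MC_ObjI[OF \<alpha> y]]) (use C.typed_tgt[OF \<alpha>] in simp)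
  then show ?thesis using C.typed_tgt[OF \<alpha>] by (simp add: str_arr_def)
qed

lemma cell2_lhom:
  assumes "cell2 (Col T) (Und C) (Und B) g g' \<phi>" "typed T \<alpha> h M j" "\<And>m. m \<in> set M \<Longrightarrow> y m \<in> Obj (Und C (h m))"
  shows "lhom (Und B) h M (\<lambda>m. FO (g (h m)) (y m)) (\<lambda>m. \<phi> (h m) (y m)) (\<lambda>m. FO (g' (h m)) (y m))"
  unfolding lhom_def using cell2_in_hom[OF assms(1)] C.typed_col[OF assms(2)] assms(3) by simp

lemma strict_2cell_eval:
  assumes g: "strict_1cell g" and g': "strict_1cell g'" and \<phi>: "cell2 (Col T) (Und C) (Und B) g g' \<phi>"
    and j: "j \<in> Col T" and a: "a \<in> Obj (MC j)"
  shows "vcomp (Col T) MC (Und B) (idl g') (lwhisker (Col T) MC (Str B) (mon_2 T (Und C) g g' \<phi>)) j a =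
      FA (Str B j) (mon_2 T (Und C) g g' \<phi> j a)"
    and "vcomp (Col T) MC (Und B) (rwhisker (Col T) MC \<phi> (Str C)) (idl g) j a = \<phi> j (FO (Str C j) a)"
proof -
  interpret Bj: category "Und B j" by (rule B.Und_category[OF j])
  obtain \<alpha> h n y where aa: "a = (\<alpha>, map y [0..<n])" and \<alpha>: "typed T \<alpha> h [0..<n] j"
    and y: "\<forall>l<n. y l \<in> Obj (Und C (h l))"
    using mon_ob_ObjE[OF a] by blast
  let ?M = "[0..<n]"
  have y': "y m \<in> Obj (Und C (h m))" if "m \<in> set ?M" for m using y that by simp
  have str: "FO (Str C j) a = str_obj T C \<alpha> (map y ?M)" using C.typed_tgt[OF \<alpha>] by (simp add: str_obj_def aa)
  have "in_hom (Und B j) (FA (Str B j) (mon_2 T (Und C) g g' \<phi> j a))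
      (str_obj T B \<alpha> (map (\<lambda>m. FO (g (h m)) (y m)) ?M)) (str_obj T B \<alpha> (map (\<lambda>m. FO (g' (h m)) (y m)) ?M))"
    unfolding aa using mon_2_str_arr[OF \<alpha> distinct_upt y', of g g' \<phi>] B.str_arr_hom[OF \<alpha> _ cell2_lhom[OF \<phi> \<alpha> y'], of ?M]
      C.relab_self[OF \<alpha> distinct_upt] by simp
  moreover have "FO (lax_cod T C g' j) a = str_obj T B \<alpha> (map (\<lambda>m. FO (g' (h m)) (y m)) ?M)"
    using cod_obj[OF \<alpha> a[unfolded aa], of g'] strict_1cell_obj[OF g' \<alpha> y'] by (simp add: aa)
  ultimately show "vcomp (Col T) MC (Und B) (idl g') (lwhisker (Col T) MC (Str B) (mon_2 T (Und C) g g' \<phi>)) j a =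
      FA (Str B j) (mon_2 T (Und C) g g' \<phi> j a)"
    using j a Bj.cmp_ide_left by (simp add: vcomp_def lwhisker_def id2_def)
  have "in_hom (Und B j) (\<phi> j (FO (Str C j) a)) (FO (g j) (FO (Str C j) a)) (FO (g' j) (FO (Str C j) a))"
    by (rule cell2_in_hom[OF \<phi> j]) (unfold str, rule C.str_obj_obj[OF \<alpha> y'])
  moreover have "FO (lax_cod T C g j) a = FO (g j) (FO (Str C j) a)"
    using cod_obj[OF \<alpha> a[unfolded aa], of g] by (simp add: aa str[unfolded aa])
  ultimately show "vcomp (Col T) MC (Und B) (rwhisker (Col T) MC \<phi> (Str C)) (idl g) j a = \<phi> j (FO (Str C j) a)"
    using j a Bj.cmp_ide_right by (simp add: vcomp_def rwhisker_def id2_def)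
qed

text \<open>The coherence 2-cells cancel from both composites. What remains of the 2-cell condition
  is that the component at a value of the structure map is the structure map applied to
  components.\<close>

lemma strict_2cell_iff:
  assumes g: "strict_1cell g" and g': "strict_1cell g'"
  shows "lax_2cell T C B (g, idl g) (g', idl g') \<phi> \<longleftrightarrow> cell2 (Col T) (Und C) (Und B) g g' \<phi> \<and>
    (\<forall>j\<in>Col T. \<forall>a\<in>Obj (MC j). FA (Str B j) (mon_2 T (Und C) g g' \<phi> j a) = \<phi> j (FO (Str C j) a))"
proof (cases "cell2 (Col T) (Und C) (Und B) g g' \<phi>")
  case True
  let ?l = "vcomp (Col T) MC (Und B) (idl g') (lwhisker (Col T) MC (Str B) (mon_2 T (Und C) g g' \<phi>))"
    and ?r = "vcomp (Col T) MC (Und B) (rwhisker (Col T) MC \<phi> (Str C)) (idl g)"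
  have "?l j a = ?r j a" if "\<not> (j \<in> Col T \<and> a \<in> Obj (MC j))" for j a
    using that by (auto simp: vcomp_def)
  then have "?l = ?r \<longleftrightarrow> (\<forall>j\<in>Col T. \<forall>a\<in>Obj (MC j). ?l j a = ?r j a)"
    by (intro iffI ballI, simp) (intro ext, blast)
  then show ?thesis using True strict_2cell_eval[OF g g' True] by (simp add: lax_2cell_def)
qed (simp add: lax_2cell_def)

lemma strict_2cell_law:
  assumes "strict_1cell g" "strict_1cell g'" "lax_2cell T C B (g, idl g) (g', idl g') \<phi>" "typed T \<alpha> h M j" "distinct M"
    "\<And>m. m \<in> set M \<Longrightarrow> y m \<in> Obj (Und C (h m))"
  shows "str_arr T B \<alpha> M M (\<lambda>m. FO (g (h m)) (y m)) (\<lambda>m. \<phi> (h m) (y m)) (\<lambda>m. FO (g' (h m)) (y m)) = \<phi> j (str_obj T C \<alpha> (map y M))"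
proof -
  have "(\<alpha>, map y M) \<in> Obj (MC j)" by (rule MC_ObjI[OF assms(4,6)])
  then show ?thesis
    using assms(3) mon_2_str_arr[OF assms(4-6), of g g' \<phi>] C.typed_tgt[OF assms(4)]
    by (simp add: strict_2cell_iff[OF assms(1,2)] str_obj_def)
qed

lemma strict_2cell_id:
  assumes g: "strict_1cell g"
  shows "lax_2cell T C B (g, idl g) (g, idl g) (id2 (Col T) (Und C) (Und B) g)"
  unfolding strict_2cell_iff[OF g g]
proof (intro conjI ballI)
  show "cell2 (Col T) (Und C) (Und B) g g (id2 (Col T) (Und C) (Und B) g)"
    using g by (intro cell2_id2) (simp add: strict_1cell_def)
  fix j a assume j: "j \<in> Col T" and a: "a \<in> Obj (MC j)"
  obtain \<alpha> h n y where aa: "a = (\<alpha>, map y [0..<n])" and \<alpha>: "typed T \<alpha> h [0..<n] j"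
    and y: "\<forall>l<n. y l \<in> Obj (Und C (h l))"
    using mon_ob_ObjE[OF a] by blast
  let ?M = "[0..<n]" and ?id = "id2 (Col T) (Und C) (Und B) g"
  have y': "y m \<in> Obj (Und C (h m))" if "m \<in> set ?M" for m using y that by simp
  have "FA (Str B j) (mon_2 T (Und C) g g ?id j a) =
      str_arr T B \<alpha> ?M ?M (\<lambda>m. FO (g (h m)) (y m)) (\<lambda>m. ?id (h m) (y m)) (\<lambda>m. FO (g (h m)) (y m))"
    unfolding aa by (rule mon_2_str_arr[OF \<alpha> distinct_upt y'])
  also have "\<dots> = str_arr T B \<alpha> ?M ?M (\<lambda>m. FO (g (h m)) (y m)) (\<lambda>m. Ide (Und B (h m)) (FO (g (h m)) (y m))) (\<lambda>m. FO (g (h m)) (y m))"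
    by (rule str_arr_cong[OF iffD2[OF reorders_refl distinct_upt]]) (use y' C.typed_col[OF \<alpha>] in \<open>simp add: id2_def\<close>)
  also have "\<dots> = Ide (Und B j) (str_obj T B \<alpha> (map (\<lambda>m. FO (g (h m)) (y m)) ?M))"
    by (rule B.str_arr_ide[OF \<alpha> distinct_upt is_functor.FO_obj[OF strict_1cell_functor[OF g C.typed_col[OF \<alpha>]] y']])
  also have "str_obj T B \<alpha> (map (\<lambda>m. FO (g (h m)) (y m)) ?M) = FO (g j) (str_obj T C \<alpha> (map y ?M))"
    by (rule strict_1cell_obj[OF g \<alpha> y', symmetric])
  also have "Ide (Und B j) \<dots> = ?id j (FO (Str C j) a)"
    using C.typed_tgt[OF \<alpha>] C.str_obj_obj[OF \<alpha> y'] j by (simp add: id2_def aa str_obj_def)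
  finally show "FA (Str B j) (mon_2 T (Und C) g g ?id j a) = ?id j (FO (Str C j) a)" .
qed

lemma strict_2cell_vcomp:
  assumes g: "strict_1cell g" "strict_1cell g'" "strict_1cell g''"
    and \<phi>: "lax_2cell T C B (g, idl g) (g', idl g') \<phi>" and \<psi>: "lax_2cell T C B (g', idl g') (g'', idl g'') \<psi>"
  shows "lax_2cell T C B (g, idl g) (g'', idl g'') (vcomp (Col T) (Und C) (Und B) \<psi> \<phi>)"
  unfolding strict_2cell_iff[OF g(1,3)]
proof (intro conjI ballI)
  have c: "cell2 (Col T) (Und C) (Und B) g g' \<phi>" "cell2 (Col T) (Und C) (Und B) g' g'' \<psi>"
    using \<phi> \<psi> by (auto simp: lax_2cell_def)
  show "cell2 (Col T) (Und C) (Und B) g g'' (vcomp (Col T) (Und C) (Und B) \<psi> \<phi>)"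
    by (rule cell2_vcomp[OF _ _ _ c]) (use g in \<open>auto simp: strict_1cell_def\<close>)
  fix j a assume j: "j \<in> Col T" and a: "a \<in> Obj (MC j)"
  obtain \<alpha> h n y where aa: "a = (\<alpha>, map y [0..<n])" and \<alpha>: "typed T \<alpha> h [0..<n] j"
    and y: "\<forall>l<n. y l \<in> Obj (Und C (h l))"
    using mon_ob_ObjE[OF a] by blast
  let ?M = "[0..<n]" and ?v = "vcomp (Col T) (Und C) (Und B) \<psi> \<phi>"
  have y': "y m \<in> Obj (Und C (h m))" if "m \<in> set ?M" for m using y that by simp
  have "FA (Str B j) (mon_2 T (Und C) g g'' ?v j a) =
      str_arr T B \<alpha> ?M ?M (\<lambda>m. FO (g (h m)) (y m)) (\<lambda>m. ?v (h m) (y m)) (\<lambda>m. FO (g'' (h m)) (y m))"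
    unfolding aa by (rule mon_2_str_arr[OF \<alpha> distinct_upt y'])
  also have "\<dots> = str_arr T B \<alpha> ?M ?M (\<lambda>m. FO (g (h m)) (y m)) (\<lambda>m. Cmp (Und B (h m)) (\<psi> (h m) (y m)) (\<phi> (h m) (y m))) (\<lambda>m. FO (g'' (h m)) (y m))"
    by (rule str_arr_cong[OF iffD2[OF reorders_refl distinct_upt]]) (use y' C.typed_col[OF \<alpha>] in \<open>simp add: vcomp_def\<close>)
  also have "\<dots> = Cmp (Und B j)
      (str_arr T B \<alpha> ?M ?M (\<lambda>m. FO (g' (h m)) (y m)) (\<lambda>m. \<psi> (h m) (y m)) (\<lambda>m. FO (g'' (h m)) (y m)))
      (str_arr T B \<alpha> ?M ?M (\<lambda>m. FO (g (h m)) (y m)) (\<lambda>m. \<phi> (h m) (y m)) (\<lambda>m. FO (g' (h m)) (y m)))"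
    using B.str_arr_cmp[OF \<alpha> _ _ cell2_lhom[OF c(2) \<alpha> y'] cell2_lhom[OF c(1) \<alpha> y'], of ?M ?M] C.relab_self[OF \<alpha> distinct_upt]
    by simp
  also have "\<dots> = Cmp (Und B j) (\<psi> j (str_obj T C \<alpha> (map y ?M))) (\<phi> j (str_obj T C \<alpha> (map y ?M)))"
    using strict_2cell_law[OF g(1,2) \<phi> \<alpha> distinct_upt y'] strict_2cell_law[OF g(2,3) \<psi> \<alpha> distinct_upt y'] by simp
  also have "\<dots> = ?v j (FO (Str C j) a)"
    using C.typed_tgt[OF \<alpha>] C.str_obj_obj[OF \<alpha> y'] j by (simp add: vcomp_def aa str_obj_def)
  finally show "FA (Str B j) (mon_2 T (Und C) g g'' ?v j a) = ?v j (FO (Str C j) a)" .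
qed

lemma Alg_s_category: "category (Alg_s T C B)"
  unfolding Alg_s_def
proof (rule cat_of_homs_category, unfold mem_Collect_eq)
  fix G assume "strict_morphism T C B G"
  then show "lax_2cell T C B G G (id2 (Col T) (Und C) (Und B) (fst G))"
    using strict_2cell_id[of "fst G"] by (simp add: strict_iff)
next
  fix G G' G'' \<phi> \<psi>
  assume "strict_morphism T C B G" "strict_morphism T C B G'" "strict_morphism T C B G''"
    "lax_2cell T C B G G' \<phi>" "lax_2cell T C B G' G'' \<psi>"
  then show "lax_2cell T C B G G'' (vcomp (Col T) (Und C) (Und B) \<psi> \<phi>)"
    using strict_2cell_vcomp[of "fst G" "fst G'" "fst G''" \<phi> \<psi>] by (simp add: strict_iff)
next
  fix G G' \<phi> assume "lax_2cell T C B G G' \<phi>"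
  then have c: "cell2 (Col T) (Und C) (Und B) (fst G) (fst G') \<phi>" by (auto simp: lax_2cell_def split: prod.splits)
  show "vcomp (Col T) (Und C) (Und B) (id2 (Col T) (Und C) (Und B) (fst G')) \<phi> = \<phi>"
    "vcomp (Col T) (Und C) (Und B) \<phi> (id2 (Col T) (Und C) (Und B) (fst G)) = \<phi>"
    by (rule vcomp_id_left[OF B.Und_category c], assumption, rule vcomp_id_right[OF B.Und_category c])
next
  fix G0 G1 G2 G3 \<phi> \<psi> \<chi>
  assume "lax_2cell T C B G0 G1 \<phi>" "lax_2cell T C B G1 G2 \<psi>" "lax_2cell T C B G2 G3 \<chi>"
  then have c: "cell2 (Col T) (Und C) (Und B) (fst G0) (fst G1) \<phi>" "cell2 (Col T) (Und C) (Und B) (fst G1) (fst G2) \<psi>"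
    "cell2 (Col T) (Und C) (Und B) (fst G2) (fst G3) \<chi>"
    by (auto simp: lax_2cell_def split: prod.splits)
  show "vcomp (Col T) (Und C) (Und B) \<chi> (vcomp (Col T) (Und C) (Und B) \<psi> \<phi>) =
      vcomp (Col T) (Und C) (Und B) (vcomp (Col T) (Und C) (Und B) \<chi> \<psi>) \<phi>"
    by (rule vcomp_assoc[OF B.Und_category c])
qed

end

lemma func_eqI: "FO G = FO H \<Longrightarrow> FA G = FA H \<Longrightarrow> (G :: ('o, 'm, 'p, 'q) func) = H"
  by simp

section \<open>Extension and restriction are mutually inverse\<close>

context opmor_alg
begin

interpretation AB: strict_alg2 T A B
  by unfold_locales (rule A_strict)

abbreviation "Alax \<equiv> lax_morphism S one FB"

definition Ext :: "('i, 's, unit, unit, 'o, 'm) lax \<Rightarrow> 'j \<Rightarrow> (('i, 't) dobj, ('i, 's, 't) darr, 'o, 'm) func" where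
  "Ext X = (\<lambda>j\<in>Col T. \<lparr> FO = (\<lambda>a\<in>Obj (D j). ext_FO T B (lax_ob X) a),
     FA = (\<lambda>m\<in>Arr (D j). ext_FA T B f F (lax_ob X) (lax_coh S X) m) \<rparr>)"

lemma dob_Col: "dob S T f L i \<alpha> j \<Longrightarrow> j \<in> Col T"
  using T.tgt_col by (auto simp: dob_def typed_def)

lemma Ext_obj:
  assumes "dob S T f L i \<alpha> j"
  shows "FO (Ext X j) (map i L, \<alpha>) = str_obj T B \<alpha> (map (\<lambda>l. lax_ob X (i l)) L)"
  using dob_Obj[OF assms] dob_Col[OF assms] by (simp add: Ext_def ext_FO_def comp_def)

lemma Ext_arr:
  assumes "dmor S L1 i1 L2 i2 h b" "dob S T f L2 i2 \<alpha> j"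
  shows "FA (Ext X j) (darr T F L1 i1 L2 i2 \<alpha> h b) = ext_arr T B f F (lax_ob X) (lax_coh S X) L1 i1 L2 i2 \<alpha> h b"
  using darr_hom[OF assms] dob_Col[OF assms(2)] ext_FA_darr[OF assms(1)] by (simp add: Ext_def in_hom_def)

lemma Ext_functor:
  assumes X: "Alax X" and j: "j \<in> Col T"
  shows "is_functor (D j) (Und B j) (Ext X j)"
proof -
  interpret Dj: category "D j" by (rule D_category)
  interpret Bj: category "Und B j" by (rule B.Und_category[OF j])
  have hom: "in_hom (Und B j) (FA (Ext X j) m) (FO (Ext X j) a) (FO (Ext X j) b)" if m: "in_hom (D j) m a b" for m a b
  proof -
    obtain i n \<alpha> where b: "b = (map i [0..<n], \<alpha>)" and o: "dob S T f [0..<n] i \<alpha> j"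
      using D_ObjE[OF Dj.in_hom_obj(2)[OF m]] by blast
    obtain n1 i1 h e where m': "m = darr T F [0..<n1] i1 [0..<n] i \<alpha> h e"
      "a = (map i1 [0..<n1], dsrc T F [0..<n1] [0..<n] h e \<alpha>)" and dm: "dmor S [0..<n1] i1 [0..<n] i h e"
      using darrE[OF m[unfolded b] distinct_upt] by blast
    show ?thesis
      unfolding m' b Ext_arr[OF dm o] Ext_obj[OF o] Ext_obj[OF dsrc_dob[OF dm o]] by (rule ext_X_hom[OF X dm o])
  qed
  show ?thesis
  proof
    have ext: "FO (Ext X j) \<in> extensional (Obj (D j))" "FA (Ext X j) \<in> extensional (Arr (D j))"
      using j by (auto simp: Ext_def)
    show "FO (Ext X j) \<in> Obj (D j) \<rightarrow>\<^sub>E Obj (Und B j)"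
      using ext(1) Bj.in_hom_obj(1)[OF hom[OF Dj.ide_hom]] by (auto simp: PiE_def)
    show "FA (Ext X j) \<in> Arr (D j) \<rightarrow>\<^sub>E Arr (Und B j)"
      using ext(2) in_homD(1)[OF hom[OF Dj.in_hom_self]] by (auto simp: PiE_def)
    fix m a b assume "in_hom (D j) m a b"
    then show "in_hom (Und B j) (FA (Ext X j) m) (FO (Ext X j) a) (FO (Ext X j) b)" by (rule hom)
  next
    fix a assume "a \<in> Obj (D j)"
    from D_ObjE[OF this] obtain i n \<alpha> where a: "a = (map i [0..<n], \<alpha>)" and o: "dob S T f [0..<n] i \<alpha> j"
      by blast
    show "FA (Ext X j) (Ide (D j) a) = Ide (Und B j) (FO (Ext X j) a)"
      unfolding a darr_ide[OF o] Ext_arr[OF dmor_ide[OF o] o] Ext_obj[OF o] by (rule ext_X_ide[OF X o])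
  next
    fix m1 m2 a1 a2 a3
    assume m: "in_hom (D j) m1 a1 a2" "in_hom (D j) m2 a2 a3"
    obtain i3 n3 \<alpha> where a3: "a3 = (map i3 [0..<n3], \<alpha>)" and o: "dob S T f [0..<n3] i3 \<alpha> j"
      using D_ObjE[OF Dj.in_hom_obj(2)[OF m(2)]] by blast
    obtain n2 i2 h2 b2 where m2: "m2 = darr T F [0..<n2] i2 [0..<n3] i3 \<alpha> h2 b2"
      "a2 = (map i2 [0..<n2], dsrc T F [0..<n2] [0..<n3] h2 b2 \<alpha>)" and d2: "dmor S [0..<n2] i2 [0..<n3] i3 h2 b2"
      using darrE[OF m(2)[unfolded a3] distinct_upt] by blast
    obtain n1 i1 h1 b1 where m1: "m1 = darr T F [0..<n1] i1 [0..<n2] i2 (dsrc T F [0..<n2] [0..<n3] h2 b2 \<alpha>) h1 b1"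
      and d1: "dmor S [0..<n1] i1 [0..<n2] i2 h1 b1"
      using darrE[OF m(1)[unfolded m2(2)] distinct_upt] by blast
    show "FA (Ext X j) (Cmp (D j) m2 m1) = Cmp (Und B j) (FA (Ext X j) m2) (FA (Ext X j) m1)"
      unfolding m1 m2 darr_cmp[OF d1 d2 o] Ext_arr[OF dmor_cmp[OF d1 d2] o] Ext_arr[OF d2 o] Ext_arr[OF d1 dsrc_dob[OF d2 o]]
      by (rule ext_X_cmp[OF X d1 d2 o, symmetric])
  qed
qed

text \<open>The action on \<open>F \<down> (-)\<close> concatenates labels. On objects the claim is
  therefore the multiplication law of \<open>B\<close>, and on arrows it is
  \<open>ext_X_concat\<close>.\<close>

lemma Ext_strict_1cell:
  assumes X: "Alax X"
  shows "AB.strict_1cell (Ext X)"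
proof (rule AB.strict_1cellI)
  show "cell1 (Col T) (Und A) (Und B) (Ext X)"
    using Ext_functor[OF X] by (simp add: cell1_def Und_A) (simp add: Ext_def)
  fix j a assume j: "j \<in> Col T" and a: "a \<in> Obj (mon_ob T (Und A) j)"
  obtain \<gamma> g n and L :: "nat \<Rightarrow> (nat \<times> nat) list" and i \<alpha> where
    aa: "a = (\<gamma>, map (\<lambda>m. (map i (L m), \<alpha> m)) [0..<n])" and \<gamma>: "typed T \<gamma> g [0..<n] j"
    and o': "\<forall>m<n. dob S T f (L m) i (\<alpha> m) (g m)" and L: "distinct (concat (map L [0..<n]))"
    using mon_D_objE[OF a[unfolded Und_A]] by blast
  let ?M = "[0..<n]"
  have o: "dob S T f (L m) i (\<alpha> m) (g m)" if "m \<in> set ?M" for m using o' that by simp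
  have "FO (lax_dom T A B (Ext X) j) a = str_obj T B \<gamma> (map (\<lambda>m. FO (Ext X (g m)) (map i (L m), \<alpha> m)) ?M)"
    unfolding aa by (rule AB.dom_obj[OF \<gamma> a[unfolded aa]])
  also have "map (\<lambda>m. FO (Ext X (g m)) (map i (L m), \<alpha> m)) ?M = map (\<lambda>m. str_obj T B (\<alpha> m) (map (\<lambda>l. lax_ob X (i l)) (L m))) ?M"
    using Ext_obj[OF o] by simp
  also have "str_obj T B \<gamma> \<dots> = str_obj T B (Sub T \<gamma> (map \<alpha> ?M)) (map (\<lambda>l. lax_ob X (i l)) (concat (map L ?M)))"
    by (rule B.str_obj_sub[OF \<gamma> dobD(3)[OF o] dob_x_obj[OF X o]])
  also have "\<dots> = FO (Ext X j) (map i (concat (map L ?M)), Sub T \<gamma> (map \<alpha> ?M))"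
    by (rule Ext_obj[OF dob_concat[OF \<gamma> o L], symmetric])
  also have "(map i (concat (map L ?M)), Sub T \<gamma> (map \<alpha> ?M)) = str_obj T A \<gamma> (map (\<lambda>m. (map i (L m), \<alpha> m)) ?M)"
    by (rule A_obj[OF \<gamma> o, symmetric])
  also have "FO (Ext X j) \<dots> = FO (lax_cod T A (Ext X) j) a"
    unfolding aa by (rule AB.cod_obj[OF \<gamma> a[unfolded aa], symmetric])
  finally show "FO (lax_dom T A B (Ext X) j) a = FO (lax_cod T A (Ext X) j) a" .
next
  fix j m assume j: "j \<in> Col T" and m: "m \<in> Arr (mon_ob T (Und A) j)"
  interpret M: category "mon_ob T D j" by (rule T.mon_ob_category[OF D_category])
  note mh = M.in_hom_self[OF m[unfolded Und_A]]
  obtain \<gamma> g n and L2 :: "nat \<Rightarrow> (nat \<times> nat) list" and i2 \<alpha> where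
    b: "Cod (mon_ob T D j) m = (\<gamma>, map (\<lambda>m. (map i2 (L2 m), \<alpha> m)) [0..<n])" and \<gamma>: "typed T \<gamma> g [0..<n] j"
    and o': "\<forall>m<n. dob S T f (L2 m) i2 (\<alpha> m) (g m)" and L2: "distinct (concat (map L2 [0..<n]))"
    using mon_D_objE[OF M.in_hom_obj(2)[OF mh]] by blast
  let ?M = "[0..<n]"
  obtain N and L1 :: "nat \<Rightarrow> (nat \<times> nat) list" and i1 h e where
    mm: "m = larr T \<gamma> ?M N (\<lambda>m. (map i1 (L1 m), dsrc T F (L1 m) (L2 m) h e (\<alpha> m)))
      (\<lambda>m. darr T F (L1 m) i1 (L2 m) i2 (\<alpha> m) h e) (\<lambda>m. (map i2 (L2 m), \<alpha> m))"
    and MN: "reorders ?M N" and d': "\<forall>m\<in>set ?M. dmor S (L1 m) i1 (L2 m) i2 h e"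
    and L1: "distinct (concat (map L1 ?M))"
    using mon_D_arrE[OF mh[unfolded b] \<gamma> distinct_upt L2] by blast
  have o: "dob S T f (L2 m) i2 (\<alpha> m) (g m)" if "m \<in> set ?M" for m using o' that by simp
  have d: "dmor S (L1 m) i1 (L2 m) i2 h e" if "m \<in> set ?M" for m using d' that by blast
  have lh': "lhom (Und A) g ?M (\<lambda>m. (map i1 (L1 m), dsrc T F (L1 m) (L2 m) h e (\<alpha> m)))
      (\<lambda>m. darr T F (L1 m) i1 (L2 m) i2 (\<alpha> m) h e) (\<lambda>m. (map i2 (L2 m), \<alpha> m))"
    unfolding Und_A by (rule A_lhom[OF d o])
  have "FA (lax_dom T A B (Ext X) j) m = str_arr T B \<gamma> ?M N
      (\<lambda>m. FO (Ext X (g m)) (map i1 (L1 m), dsrc T F (L1 m) (L2 m) h e (\<alpha> m)))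
      (\<lambda>m. FA (Ext X (g m)) (darr T F (L1 m) i1 (L2 m) i2 (\<alpha> m) h e)) (\<lambda>m. FO (Ext X (g m)) (map i2 (L2 m), \<alpha> m))"
    unfolding mm by (rule AB.dom_arr[OF \<gamma> MN lh'])
  also have "\<dots> = str_arr T B \<gamma> ?M N
      (\<lambda>m. str_obj T B (dsrc T F (L1 m) (L2 m) h e (\<alpha> m)) (map (\<lambda>l. lax_ob X (i1 l)) (L1 m)))
      (\<lambda>m. ext_arr T B f F (lax_ob X) (lax_coh S X) (L1 m) i1 (L2 m) i2 (\<alpha> m) h e) (\<lambda>m. str_obj T B (\<alpha> m) (map (\<lambda>k. lax_ob X (i2 k)) (L2 m)))"
    by (rule str_arr_cong[OF MN], intro conjI Ext_obj[OF o] Ext_obj[OF dsrc_dob[OF d o]] Ext_arr[OF d o])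
  also have "\<dots> = ext_arr T B f F (lax_ob X) (lax_coh S X) (concat (map L1 N)) i1 (concat (map L2 ?M)) i2 (Sub T \<gamma> (map \<alpha> ?M)) h e"
    by (rule ext_X_concat[OF X \<gamma> MN d o L1 L2, symmetric])
  also have "\<dots> = FA (Ext X j) (darr T F (concat (map L1 N)) i1 (concat (map L2 ?M)) i2 (Sub T \<gamma> (map \<alpha> ?M)) h e)"
    by (rule Ext_arr[OF dmor_concat(1)[OF MN d L1 L2] dob_concat[OF \<gamma> o L2], symmetric])
  also have "darr T F (concat (map L1 N)) i1 (concat (map L2 ?M)) i2 (Sub T \<gamma> (map \<alpha> ?M)) h e =
      str_arr T A \<gamma> ?M N (\<lambda>m. (map i1 (L1 m), dsrc T F (L1 m) (L2 m) h e (\<alpha> m)))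
      (\<lambda>m. darr T F (L1 m) i1 (L2 m) i2 (\<alpha> m) h e) (\<lambda>m. (map i2 (L2 m), \<alpha> m))"
    by (rule A_arr[OF \<gamma> MN d o L1 L2, symmetric])
  also have "FA (Ext X j) \<dots> = FA (lax_cod T A (Ext X) j) m"
    unfolding mm by (rule AB.cod_arr[OF \<gamma> MN lh', symmetric])
  finally show "FA (lax_dom T A B (Ext X) j) m = FA (lax_cod T A (Ext X) j) m" .
qed

text \<open>Precomposition with \<open>u\<^sub>F\<close> in explicit form, evaluating
  \<open>g\<close> at the objects \<open>(i, 1)\<close> and at the coherence arrows;
  \<open>precomp_obj\<close> identifies it with the composite of lax morphisms.\<close>

definition restr_u :: "('j \<Rightarrow> (('i, 't) dobj, ('i, 's, 't) darr, 'o, 'm) func) \<Rightarrow> ('i, 's, unit, unit, 'o, 'm) lax" where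
  "restr_u g = mklax S f B (\<lambda>i. FO (g (f i)) (ux i)) (\<lambda>\<alpha>. FA (g (f (Tgt S \<alpha>))) (uc \<alpha>))"

lemma lax_ob_restr_u: "i \<in> Col S \<Longrightarrow> lax_ob (restr_u g) i = FO (g (f i)) (ux i)"
  by (simp add: restr_u_def lax_ob_mklax)

lemma lax_coh_restr_u: "typed S \<alpha> h M i \<Longrightarrow> lax_coh S (restr_u g) \<alpha> = FA (g (f i)) (uc \<alpha>)"
  by (simp add: restr_u_def lax_coh_mklax typed_def)

section \<open>Restriction of a strict morphism along \<open>u\<^sub>F\<close>\<close>

context
  fixes g :: "'j \<Rightarrow> (('i, 't) dobj, ('i, 's, 't) darr, 'o, 'm) func"
  assumes strict_1cell: "AB.strict_1cell g"
begin

abbreviation "gx \<equiv> \<lambda>i. FO (g (f i)) (ux i)"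
abbreviation "gc \<equiv> \<lambda>\<alpha>. FA (g (f (Tgt S \<alpha>))) (uc \<alpha>)"

lemma g_functor: "j \<in> Col T \<Longrightarrow> is_functor (D j) (Und B j) (g j)"
  using AB.strict_1cell_functor[OF strict_1cell] by (simp add: Und_A)

lemma ux_obj: "i \<in> Col S \<Longrightarrow> ux i \<in> Obj (Und A (f i))"
  using dob_Obj[OF dob_unit] by (simp add: Und_A)

lemma g_units:
  assumes \<alpha>: "typed T \<alpha> (\<lambda>l. f (i l)) L j" and i: "\<And>l. l \<in> set L \<Longrightarrow> i l \<in> Col S"
  shows "FO (g j) (str_obj T A \<alpha> (map (\<lambda>l. ux (i l)) L)) = str_obj T B \<alpha> (map (\<lambda>l. gx (i l)) L)"
  by (rule AB.strict_1cell_obj[OF strict_1cell \<alpha> ux_obj[OF i]])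

lemma restr_u_obj_eq:
  assumes o: "dob S T f L i \<alpha> j"
  shows "FO (g j) (map i L, \<alpha>) = str_obj T B \<alpha> (map (\<lambda>l. gx (i l)) L)"
  using g_units[OF dobD(3,2)[OF o]] A_units[OF dobD(3,2)[OF o]] by simp

lemma g_str_perm:
  assumes \<alpha>: "typed T \<alpha> (\<lambda>l. f (i l)) M j" and MN: "reorders M N" and i: "\<And>l. l \<in> set M \<Longrightarrow> i l \<in> Col S"
  shows "FA (g j) (str_perm T A (\<lambda>l. f (i l)) \<alpha> M N (\<lambda>l. ux (i l))) = str_perm T B (\<lambda>l. f (i l)) \<alpha> M N (\<lambda>l. gx (i l))"
proof -
  have lh: "lhom (Und A) (\<lambda>l. f (i l)) M (\<lambda>l. ux (i l)) (\<lambda>l. Ide (Und A (f (i l))) (ux (i l))) (\<lambda>l. ux (i l))"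
    unfolding lhom_def Und_A using category.ide_hom[OF D_category] ux_obj[OF i] by (simp add: Und_A)
  show ?thesis
    unfolding str_perm_def AB.strict_1cell_arr[OF strict_1cell \<alpha> MN lh]
    by (rule str_arr_cong[OF MN])
      (use is_functor.fa_ide[OF g_functor[OF col_map]] ux_obj[OF i] i in \<open>simp add: Und_A\<close>)
qed

lemma uc_lhom:
  assumes "dmor S L1 i1 L2 i2 h b"
  shows "lhom (Und A) (\<lambda>k. f (i2 k)) L2 (\<lambda>k. str_obj T A (F (b k)) (map (\<lambda>l. ux (i1 l)) (fib L1 h k)))
    (\<lambda>k. uc (b k)) (\<lambda>k. ux (i2 k))"
  unfolding lhom_def Und_A using uc_hom[OF dmorD(4)[OF assms]] by simp

text \<open>A strict \<open>g\<close> preserves composition and the algebra structure, so it carries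
  the laws of the coherence arrows \<open>uc\<close> to those demanded by
  \<open>mklax_lax\<close>.\<close>

lemma restr_u_lax: "Alax (restr_u g)"
  unfolding restr_u_def
proof (rule mklax_lax)
  fix i assume i: "i \<in> Col S"
  interpret G: is_functor "D (f i)" "Und B (f i)" "g (f i)" by (rule g_functor[OF col_map[OF i]])
  show "gx i \<in> Obj (Und B (f i))" using G.FO_obj ux_obj[OF i] by (simp add: Und_A)
  show "gc (One S i) = Ide (Und B (f i)) (gx i)"
    using G.fa_ide ux_obj[OF i] uc_one[OF i] S.one_tgt[OF i] by (simp add: Und_A)
next
  fix \<alpha> h i and M :: "nat list" assume \<alpha>: "typed S \<alpha> h M i"
  have i: "i \<in> Col S" "Tgt S \<alpha> = i" using typed_tgt_f[OF \<alpha>] by auto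
  interpret G: is_functor "D (f i)" "Und B (f i)" "g (f i)" by (rule g_functor[OF col_map[OF i(1)]])
  show "in_hom (Und B (f i)) (gc \<alpha>) (str_obj T B (F \<alpha>) (map (\<lambda>m. gx (h m)) M)) (gx i)"
    using G.fa_hom[OF uc_hom[OF \<alpha>]] g_units[OF F_typed[OF \<alpha>] S.typed_col[OF \<alpha>]] i(2) by simp
  fix N assume MN: "reorders M N"
  note \<alpha>' = S.typed_relab[OF \<alpha> MN]
  have Ai: "\<And>l. l \<in> set M \<Longrightarrow> ux (h l) \<in> Obj (Und A (f (h l)))" using ux_obj S.typed_col[OF \<alpha>] by simp
  have P: "in_hom (D (f i)) (str_perm T A (\<lambda>m. f (h m)) (F \<alpha>) M N (\<lambda>m. ux (h m)))
      (str_obj T A (relab T (F \<alpha>) M N) (map (\<lambda>m. ux (h m)) N)) (str_obj T A (F \<alpha>) (map (\<lambda>m. ux (h m)) M))"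
    using AB.C.str_perm_hom[OF F_typed[OF \<alpha>] MN Ai] by (simp add: Und_A)
  have "gc (relab S \<alpha> M N) = FA (g (f i)) (uc (relab S \<alpha> M N))" using \<alpha>' by (simp add: typed_def)
  also have "\<dots> = Cmp (Und B (f i)) (FA (g (f i)) (uc \<alpha>)) (FA (g (f i)) (str_perm T A (\<lambda>m. f (h m)) (F \<alpha>) M N (\<lambda>m. ux (h m))))"
    unfolding uc_relab[OF \<alpha> MN] by (rule G.fa_cmp[OF P uc_hom[OF \<alpha>]])
  also have "\<dots> = Cmp (Und B (f i)) (gc \<alpha>) (str_perm T B (\<lambda>m. f (h m)) (F \<alpha>) M N (\<lambda>m. gx (h m)))"
    using g_str_perm[OF F_typed[OF \<alpha>] MN S.typed_col[OF \<alpha>]] i(2) by simp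
  finally show "gc (relab S \<alpha> M N) = Cmp (Und B (f i)) (gc \<alpha>) (str_perm T B (\<lambda>m. f (h m)) (F \<alpha>) M N (\<lambda>m. gx (h m)))" .
next
  fix \<alpha> h i \<beta> h' and M :: "nat list" and L :: "nat \<Rightarrow> (nat \<times> nat) list"
  assume \<alpha>: "typed S \<alpha> h M i" and M: "distinct M" and \<beta>: "\<And>m. m \<in> set M \<Longrightarrow> typed S (\<beta> m) h' (L m) (h m)"
    and L: "distinct (concat (map L M))"
  have i: "i \<in> Col S" "Tgt S \<alpha> = i" using typed_tgt_f[OF \<alpha>] by auto
  interpret G: is_functor "D (f i)" "Und B (f i)" "g (f i)" by (rule g_functor[OF col_map[OF i(1)]])
  have re: "reorders M M" using M by simp
  let ?o = "\<lambda>m. str_obj T A (F (\<beta> m)) (map (\<lambda>l. ux (h' l)) (L m))"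
  have lh: "lhom (Und A) (\<lambda>m. f (h m)) M ?o (\<lambda>m. uc (\<beta> m)) (\<lambda>m. ux (h m))"
    unfolding lhom_def Und_A using uc_hom[OF \<beta>] by simp
  let ?s = "str_arr T A (F \<alpha>) M M ?o (\<lambda>m. uc (\<beta> m)) (\<lambda>m. ux (h m))"
  have hom: "in_hom (D (f i)) ?s (str_obj T A (relab T (F \<alpha>) M M) (map ?o M)) (str_obj T A (F \<alpha>) (map (\<lambda>m. ux (h m)) M))"
    using AB.C.str_arr_hom[OF F_typed[OF \<alpha>] re lh] by (simp add: Und_A)
  have "gc (Sub S \<alpha> (map \<beta> M)) = FA (g (f i)) (uc (Sub S \<alpha> (map \<beta> M)))"
    using S.typed_sub[OF \<alpha> \<beta>] by (simp add: typed_def)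
  also have "\<dots> = Cmp (Und B (f i)) (FA (g (f i)) (uc \<alpha>)) (FA (g (f i)) ?s)"
  proof -
    have "uc (Sub S \<alpha> (map \<beta> M)) = Cmp (D (f i)) (uc \<alpha>) ?s" by (rule uc_sub[OF \<alpha> M \<beta> L])
    then show ?thesis using G.fa_cmp[OF hom uc_hom[OF \<alpha>]] by (simp only:)
  qed
  also have "FA (g (f i)) ?s = str_arr T B (F \<alpha>) M M (\<lambda>m. FO (g (f (h m))) (?o m)) (\<lambda>m. FA (g (f (h m))) (uc (\<beta> m))) (\<lambda>m. gx (h m))"
    by (rule AB.strict_1cell_arr[OF strict_1cell F_typed[OF \<alpha>] re lh])
  also have "\<dots> = str_arr T B (F \<alpha>) M M (\<lambda>m. str_obj T B (F (\<beta> m)) (map (\<lambda>l. gx (h' l)) (L m))) (\<lambda>m. gc (\<beta> m)) (\<lambda>m. gx (h m))"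
  proof (rule str_arr_cong[OF re], intro conjI)
    fix m assume m: "m \<in> set M"
    show "FO (g (f (h m))) (?o m) = str_obj T B (F (\<beta> m)) (map (\<lambda>l. gx (h' l)) (L m))"
      by (rule g_units[OF F_typed[OF \<beta>[OF m]] S.typed_col[OF \<beta>[OF m]]])
    show "FA (g (f (h m))) (uc (\<beta> m)) = gc (\<beta> m)" using \<beta>[OF m] by (simp add: typed_def)
  qed simp
  finally show "gc (Sub S \<alpha> (map \<beta> M)) = Cmp (Und B (f i)) (gc \<alpha>) (str_arr T B (F \<alpha>) M M
      (\<lambda>m. str_obj T B (F (\<beta> m)) (map (\<lambda>l. gx (h' l)) (L m))) (\<lambda>m. gc (\<beta> m)) (\<lambda>m. gx (h m)))"
    using i(2) by simp
qed

text \<open>Uniqueness of the extension on arrows: \<open>ext_arr_A\<close> factors the arrow into a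
  symmetry and a value of the action at coherence arrows, and \<open>g\<close> preserves both
  factors.\<close>

lemma g_darr:
  assumes m: "dmor S L1 i1 L2 i2 h b" and o: "dob S T f L2 i2 \<alpha> j"
  shows "FA (g j) (darr T F L1 i1 L2 i2 \<alpha> h b) = ext_arr T B f F (lax_ob (restr_u g)) (lax_coh S (restr_u g)) L1 i1 L2 i2 \<alpha> h b"
proof -
  note d = dmorD[OF m] and e = dobD[OF o]
  interpret G: is_functor "D j" "Und B j" "g j" by (rule g_functor[OF dob_Col[OF o]])
  have re: "reorders L2 L2" using d(2) by simp
  let ?C = "cfib L1 h L2" and ?\<beta> = "Sub T \<alpha> (map (\<lambda>k. F (b k)) L2)"
  let ?s = "str_arr T A \<alpha> L2 L2 (\<lambda>k. str_obj T A (F (b k)) (map (\<lambda>l. ux (i1 l)) (fib L1 h k))) (\<lambda>k. uc (b k)) (\<lambda>k. ux (i2 k))"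
  let ?p = "str_perm T A (\<lambda>l. f (i1 l)) ?\<beta> ?C L1 (\<lambda>l. ux (i1 l))"
  obtain a where p: "in_hom (D j) ?p a (map i1 ?C, ?\<beta>)" using ext_arr_A(3)[OF m o] by blast
  have tgt: "Tgt T \<alpha> = j" using e(3) by (simp add: typed_def)
  have col: "i1 l \<in> Col S" if "l \<in> set ?C" for l
    using S.typed_col[OF d(4)[OF d(3)]] that by auto
  have "darr T F L1 i1 L2 i2 \<alpha> h b = Cmp (D j) ?s ?p"
    using ext_arr_A(1)[OF m o] by (simp add: ext_arr_def tgt Und_A)
  then have "FA (g j) (darr T F L1 i1 L2 i2 \<alpha> h b) = Cmp (Und B j) (FA (g j) ?s) (FA (g j) ?p)"
    using G.fa_cmp[OF p ext_arr_A(2)[OF m o]] by simp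
  also have "FA (g j) ?p = str_perm T B (\<lambda>l. f (i1 l)) ?\<beta> ?C L1 (\<lambda>l. gx (i1 l))"
    by (rule g_str_perm[OF dsrc_typed[OF m o] d(5) col])
  also have "\<dots> = str_perm T B (\<lambda>l. f (i1 l)) ?\<beta> ?C L1 (\<lambda>l. lax_ob (restr_u g) (i1 l))"
    by (rule str_perm_cong[OF d(5)]) (use lax_ob_restr_u[OF col] in simp)
  also have "FA (g j) ?s = str_arr T B \<alpha> L2 L2
      (\<lambda>k. FO (g (f (i2 k))) (str_obj T A (F (b k)) (map (\<lambda>l. ux (i1 l)) (fib L1 h k))))
      (\<lambda>k. FA (g (f (i2 k))) (uc (b k))) (\<lambda>k. gx (i2 k))"
    by (rule AB.strict_1cell_arr[OF strict_1cell e(3) re uc_lhom[OF m]])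
  also have "\<dots> = str_arr T B \<alpha> L2 L2 (\<lambda>k. str_obj T B (F (b k)) (map (\<lambda>l. lax_ob (restr_u g) (i1 l)) (fib L1 h k)))
      (\<lambda>k. lax_coh S (restr_u g) (b k)) (\<lambda>k. lax_ob (restr_u g) (i2 k))"
  proof (rule str_arr_cong[OF re], intro conjI)
    fix k assume k: "k \<in> set L2"
    have u: "FO (g (f (i2 k))) (str_obj T A (F (b k)) (map (\<lambda>l. ux (i1 l)) (fib L1 h k))) =
        str_obj T B (F (b k)) (map (\<lambda>l. gx (i1 l)) (fib L1 h k))"
      by (rule g_units[OF F_typed[OF d(4)[OF k]] S.typed_col[OF d(4)[OF k]]])
    have "map (\<lambda>l. gx (i1 l)) (fib L1 h k) = map (\<lambda>l. lax_ob (restr_u g) (i1 l)) (fib L1 h k)"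
      using lax_ob_restr_u[OF S.typed_col[OF d(4)[OF k]]] by simp
    then show "FO (g (f (i2 k))) (str_obj T A (F (b k)) (map (\<lambda>l. ux (i1 l)) (fib L1 h k))) =
        str_obj T B (F (b k)) (map (\<lambda>l. lax_ob (restr_u g) (i1 l)) (fib L1 h k))"
      unfolding u by (rule arg_cong)
    show "FA (g (f (i2 k))) (uc (b k)) = lax_coh S (restr_u g) (b k)" using lax_coh_restr_u[OF d(4)[OF k]] by simp
    show "gx (i2 k) = lax_ob (restr_u g) (i2 k)" using lax_ob_restr_u[OF e(2)[OF k]] by simp
  qed
  finally show ?thesis by (simp add: ext_arr_def tgt)
qed

lemma Ext_restr_u: "Ext (restr_u g) = g"
proof
  fix j
  have ext: "g \<in> extensional (Col T)" using strict_1cell by (simp add: AB.strict_1cell_def cell1_def)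
  show "Ext (restr_u g) j = g j"
  proof (cases "j \<in> Col T")
    case j: True
    interpret G: is_functor "D j" "Und B j" "g j" by (rule g_functor[OF j])
    show ?thesis
    proof (rule func_eqI)
      show "FO (Ext (restr_u g) j) = FO (g j)"
      proof
        fix a show "FO (Ext (restr_u g) j) a = FO (g j) a"
        proof (cases "a \<in> Obj (D j)")
          case True
          from D_ObjE[OF this] obtain i n \<alpha> where a: "a = (map i [0..<n], \<alpha>)" and o: "dob S T f [0..<n] i \<alpha> j"
            by blast
          have "map (\<lambda>l. lax_ob (restr_u g) (i l)) [0..<n] = map (\<lambda>l. gx (i l)) [0..<n]"
            using lax_ob_restr_u[OF dobD(2)[OF o]] by simp
          then show ?thesis unfolding a Ext_obj[OF o] restr_u_obj_eq[OF o] by (rule arg_cong)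
        next
          case False
          then show ?thesis using PiE_arb[OF G.fo_maps False] j by (simp add: Ext_def)
        qed
      qed
      show "FA (Ext (restr_u g) j) = FA (g j)"
      proof
        fix m show "FA (Ext (restr_u g) j) m = FA (g j) m"
        proof (cases "m \<in> Arr (D j)")
          case True
          note h = G.A.in_hom_self[OF True]
          obtain i n \<alpha> where b: "Cod (D j) m = (map i [0..<n], \<alpha>)" and o: "dob S T f [0..<n] i \<alpha> j"
            using D_ObjE[OF G.A.cod_obj[OF True]] by blast
          obtain n1 i1 h c where m': "m = darr T F [0..<n1] i1 [0..<n] i \<alpha> h c" and dm: "dmor S [0..<n1] i1 [0..<n] i h c"
            using darrE[OF h[unfolded b] distinct_upt] by blast
          show ?thesis unfolding m' Ext_arr[OF dm o] g_darr[OF dm o] ..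
        next
          case False
          then show ?thesis using PiE_arb[OF G.fa_maps False] j by (simp add: Ext_def)
        qed
      qed
    qed
  next
    case False
    then show ?thesis using ext by (simp add: Ext_def extensional_def)
  qed
qed

text \<open>The coherence of the composite is \<open>g\<close> at the coherence of
  \<open>u\<^sub>F\<close>, preceded by the identity 2-cell of the strict morphism, which
  cancels.\<close>

lemma u_arr_typed:
  assumes i: "i \<in> Col S" and a: "a \<in> Obj (mon_ob S (\<lambda>_. terminal_cat) i)"
  shows "snd (lax_comp S one FB (Fbar_1 S f F A (g, AB.idl g)) (u_lax S T f F)) i a = gc (fst a)"
proof -
  let ?E = "\<lambda>_ :: 'i. terminal_cat" and ?u = "fst (u_lax S T f F)"
  let ?\<alpha> = "fst a" and ?M = "[0..<arity S (fst a)]"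
  let ?h = "(!) (Src S ?\<alpha>)"
  have aa: "a = (?\<alpha>, map (\<lambda>_. ()) ?M)" "?\<alpha> \<in> Ops S" "Tgt S ?\<alpha> = i"
    using terminal_mon_objE[OF a] by (auto simp: map_unit)
  have t: "typed S ?\<alpha> ?h ?M i" using typed_nth[OF aa(2)] aa(3) by simp
  interpret G: is_functor "D (f i)" "Und B (f i)" "g (f i)" by (rule g_functor[OF col_map[OF i]])
  have "FO (mon_1 S ?E ?u i) (?\<alpha>, map (\<lambda>_. ()) ?M) = (?\<alpha>, map (\<lambda>m. FO (?u (?h m)) ()) ?M)"
    by (rule S.mon_1_obj[OF t i]) (use a aa(1) in simp)
  also have "map (\<lambda>m. FO (?u (?h m)) ()) ?M = map (\<lambda>m. ux (?h m)) ?M"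
    using S.typed_col[OF t] by (simp add: u_lax_eq mklax_def)
  finally have m1: "FO (mon_1 S ?E ?u i) a = (?\<alpha>, map (\<lambda>m. ux (?h m)) ?M)" using aa(1) by simp
  have o1: "(?\<alpha>, map (\<lambda>m. ux (?h m)) ?M) \<in> Obj (mon_ob S (pull (Col S) f (Und A)) i)"
    by (rule mon_ob_ObjI[OF t]) (use ux_obj S.typed_col[OF t] in simp)
  have o2: "(F ?\<alpha>, map (\<lambda>m. ux (?h m)) ?M) \<in> Obj (mon_ob T (Und A) (f i))"
    by (rule mon_ob_ObjI[OF F_typed[OF t]]) (use ux_obj S.typed_col[OF t] in simp)
  have "snd (lax_comp S one FB (Fbar_1 S f F A (g, AB.idl g)) (u_lax S T f F)) i a =
      Cmp (Und B (f i)) (FA (g (f i)) (snd (u_lax S T f F) i a)) (AB.idl g (f i) (F ?\<alpha>, map (\<lambda>m. ux (?h m)) ?M))"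
    using i a o1 m1
    by (simp add: lax_comp_def Fbar_1_def vcomp_def lwhisker_def rwhisker_def Fbar_Und Fl_def split_def)
  also have "snd (u_lax S T f F) i a = uc ?\<alpha>"
    using i a by (cases a) (simp add: u_lax_eq mklax_def)
  also have "AB.idl g (f i) (F ?\<alpha>, map (\<lambda>m. ux (?h m)) ?M) = Ide (Und B (f i)) (FO (g (f i)) (str_obj T A (F ?\<alpha>) (map (\<lambda>m. ux (?h m)) ?M)))"
    using o2 col_map[OF i] AB.cod_obj[OF F_typed[OF t] o2, of g] by (simp add: id2_def)
  also have "Cmp (Und B (f i)) (FA (g (f i)) (uc ?\<alpha>)) \<dots> = FA (g (f i)) (uc ?\<alpha>)"
    by (rule G.B.cmp_ide_right[OF G.fa_hom[OF uc_hom[OF t]]])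
  finally show ?thesis using aa(3) by simp
qed

lemma precomp_obj:
  "lax_comp S one FB (Fbar_1 S f F A (g, AB.idl g)) (u_lax S T f F) = restr_u g" (is "?P = _")
proof (rule prod_eqI)
  show "fst ?P = fst (restr_u g)"
  proof
    fix i show "fst ?P i = fst (restr_u g) i"
    proof (cases "i \<in> Col S")
      case i: True
      interpret G: is_functor "D (f i)" "Und B (f i)" "g (f i)" by (rule g_functor[OF col_map[OF i]])
      have "FA (g (f i)) (Ide (D (f i)) (ux i)) = Ide (Und B (f i)) (gx i)"
        using G.fa_ide ux_obj[OF i] by (simp add: Und_A)
      then show ?thesis using i
        by (simp add: lax_comp_def Fbar_1_def comp1_def comp_func_def compose_def u_lax_eq mklax_def restr_u_def Und_A
            restrict_def split_def)
    next
      case False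
      then show ?thesis by (simp add: lax_comp_def Fbar_1_def comp1_def restr_u_def mklax_def split_def)
    qed
  qed
  show "snd ?P = snd (restr_u g)"
  proof (intro ext)
    fix i a show "snd ?P i a = snd (restr_u g) i a"
    proof (cases "i \<in> Col S \<and> a \<in> Obj (mon_ob S (\<lambda>_. terminal_cat) i)")
      case True
      then show ?thesis using u_arr_typed[of i a] by (cases a) (simp add: restr_u_def mklax_def)
    next
      case False
      then show ?thesis
        by (cases a) (auto simp: lax_comp_def Fbar_1_def vcomp_def restr_u_def mklax_def split_def)
    qed
  qed
qed

end

text \<open>On the objects \<open>(i, 1)\<close> the extension is the structure map at a unit
  operation, which returns its argument; on coherence arrows it is \<open>ext_X_uc\<close>.\<close>

lemma restr_u_Ext:
  assumes X: "Alax X"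
  shows "restr_u (Ext X) = X"
proof -
  have "restr_u (Ext X) = mklax S f B (lax_ob X) (lax_coh S X)"
    unfolding restr_u_def
  proof (rule mklax_cong)
    fix i assume i: "i \<in> Col S"
    show "FO (Ext X (f i)) (ux i) = lax_ob X i"
      using Ext_obj[OF dob_unit[OF i], of X] B.str_obj_one[OF col_map[OF i] lax_ob_obj[OF X i]] by simp
  next
    fix \<alpha> assume \<alpha>: "\<alpha> \<in> Ops S"
    note t = typed_nth[OF \<alpha>]
    note u = uc_darr_unit[OF t distinct_upt]
    show "FA (Ext X (f (Tgt S \<alpha>))) (uc \<alpha>) = lax_coh S X \<alpha>"
      unfolding u(1) Ext_arr[OF u(3) dob_unit[OF S.tgt_col[OF \<alpha>]]] by (rule ext_X_uc[OF X t distinct_upt])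
  qed
  then show ?thesis using lax_eq_mklax[OF X] by simp
qed

end

section \<open>2-cells between lax morphisms, and their hom-category\<close>

context opmor_alg
begin

interpretation AB: strict_alg2 T A B
  by unfold_locales (rule A_strict)

abbreviation "cellL \<equiv> cell2 (Col S) (\<lambda>_. terminal_cat) (pull (Col S) f (Und B))"
abbreviation "ME \<equiv> mon_ob S (\<lambda>_. terminal_cat)"

text \<open>The only arrow of the terminal category goes to identities, so naturality is automatic
  and a 2-cell is a family of arrows indexed by colours.\<close>

lemma cellL_iff:
  assumes X: "Alax X" and X': "Alax X'"
  shows "cellL (fst X) (fst X') \<psi> \<longleftrightarrow> \<psi> \<in> extensional (Col S) \<and>
    (\<forall>i\<in>Col S. in_hom (Und B (f i)) (\<psi> i ()) (lax_ob X i) (lax_ob X' i))"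
proof -
  have "is_nat_trans terminal_cat (Und B (f i)) (fst X i) (fst X' i) (\<psi> i) \<longleftrightarrow>
      in_hom (Und B (f i)) (\<psi> i ()) (lax_ob X i) (lax_ob X' i)" if i: "i \<in> Col S" for i
  proof -
    interpret Bi: category "Und B (f i)" by (rule B.Und_category[OF col_map[OF i]])
    have "FA (fst X i) () = Ide (Und B (f i)) (lax_ob X i)" "FA (fst X' i) () = Ide (Und B (f i)) (lax_ob X' i)"
      using g_ide[OF lax_functor[OF X] i] g_ide[OF lax_functor[OF X'] i] by (simp_all add: lax_ob_def)
    then show ?thesis
      using Bi.cmp_ide_left Bi.cmp_ide_right by (auto simp: is_nat_trans_def lax_ob_def extensional_def)
  qed
  then show ?thesis by (auto simp: cell2_def)
qed

lemma cellL_hom: "cellL (fst X) (fst X') \<psi> \<Longrightarrow> i \<in> Col S \<Longrightarrow> in_hom (Und B (f i)) (\<psi> i ()) (lax_ob X i) (lax_ob X' i)"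
  using cell2_in_hom[of "Col S" "\<lambda>_. terminal_cat" "pull (Col S) f (Und B)" "fst X" "fst X'" \<psi> i "()"]
  by (simp add: lax_ob_def)

lemma cellL_lhom:
  assumes "cellL (fst X) (fst X') \<psi>" "\<And>m. m \<in> set M \<Longrightarrow> h m \<in> Col S"
  shows "lhom (Und B) (\<lambda>m. f (h m)) M (\<lambda>m. lax_ob X (h m)) (\<lambda>m. \<psi> (h m) ()) (\<lambda>m. lax_ob X' (h m))"
  unfolding lhom_def using cellL_hom[OF assms(1)] assms(2) by simp

lemma lax_2cell_eval:
  assumes X: "Alax X" and X': "Alax X'" and \<psi>: "cellL (fst X) (fst X') \<psi>"
    and \<alpha>: "typed S \<alpha> h M i" and M: "distinct M"
  shows "vcomp (Col S) ME (Und FB) (snd X') (lwhisker (Col S) ME (Str FB) (mon_2 S (\<lambda>_. terminal_cat) (fst X) (fst X') \<psi>)) i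
      (\<alpha>, replicate (length M) ()) =
    Cmp (Und B (f i)) (lax_coh S X' \<alpha>) (str_arr T B (F \<alpha>) M M (\<lambda>m. lax_ob X (h m)) (\<lambda>m. \<psi> (h m) ()) (\<lambda>m. lax_ob X' (h m)))"
    and "vcomp (Col S) ME (Und FB) (rwhisker (Col S) ME \<psi> (Str one)) (snd X) i (\<alpha>, replicate (length M) ()) =
    Cmp (Und B (f i)) (\<psi> i ()) (lax_coh S X \<alpha>)"
proof -
  note i = typed_tgt_f[OF \<alpha>] and obj = S.terminal_mon_obj[OF \<alpha>]
  have re: "reorders M M" using M by simp
  have "mon_2 S (\<lambda>_. terminal_cat) (fst X) (fst X') \<psi> i (\<alpha>, map (\<lambda>_. ()) M) =
      larr S \<alpha> M M (\<lambda>m. FO (fst X (h m)) ()) (\<lambda>m. \<psi> (h m) ()) (\<lambda>m. FO (fst X' (h m)) ())"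
    by (rule S.mon_2_larr[OF \<alpha> M]) (use i obj in \<open>simp_all add: map_unit\<close>)
  then have "FA (Str FB i) (mon_2 S (\<lambda>_. terminal_cat) (fst X) (fst X') \<psi> i (\<alpha>, replicate (length M) ())) =
      str_arr S FB \<alpha> M M (\<lambda>m. lax_ob X (h m)) (\<lambda>m. \<psi> (h m) ()) (\<lambda>m. lax_ob X' (h m))"
    using i by (simp add: str_arr_def lax_ob_def map_unit)
  also have "\<dots> = str_arr T B (F \<alpha>) M M (\<lambda>m. lax_ob X (h m)) (\<lambda>m. \<psi> (h m) ()) (\<lambda>m. lax_ob X' (h m))"
    by (rule FB_str_arr[OF \<alpha> re cellL_lhom[OF \<psi> S.typed_col[OF \<alpha>]]])
  finally show "vcomp (Col S) ME (Und FB) (snd X') (lwhisker (Col S) ME (Str FB) (mon_2 S (\<lambda>_. terminal_cat) (fst X) (fst X') \<psi>)) i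
      (\<alpha>, replicate (length M) ()) =
    Cmp (Und B (f i)) (lax_coh S X' \<alpha>) (str_arr T B (F \<alpha>) M M (\<lambda>m. lax_ob X (h m)) (\<lambda>m. \<psi> (h m) ()) (\<lambda>m. lax_ob X' (h m)))"
    using i obj by (simp add: vcomp_def lwhisker_def Fbar_Und lax_coh_typed[OF \<alpha>])
  show "vcomp (Col S) ME (Und FB) (rwhisker (Col S) ME \<psi> (Str one)) (snd X) i (\<alpha>, replicate (length M) ()) =
      Cmp (Und B (f i)) (\<psi> i ()) (lax_coh S X \<alpha>)"
    using i obj by (simp add: vcomp_def rwhisker_def Fbar_Und lax_coh_typed[OF \<alpha>])
qed

lemma lax_2cellD:
  assumes X: "Alax X" and X': "Alax X'" and \<psi>: "lax_2cell S one FB X X' \<psi>"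
  shows "cellL (fst X) (fst X') \<psi>"
    and "typed S \<alpha> h M i \<Longrightarrow> distinct M \<Longrightarrow>
      Cmp (Und B (f i)) (lax_coh S X' \<alpha>) (str_arr T B (F \<alpha>) M M (\<lambda>m. lax_ob X (h m)) (\<lambda>m. \<psi> (h m) ()) (\<lambda>m. lax_ob X' (h m))) =
      Cmp (Und B (f i)) (\<psi> i ()) (lax_coh S X \<alpha>)"
proof -
  have *: "cellL (fst X) (fst X') \<psi>"
    "vcomp (Col S) ME (Und FB) (snd X') (lwhisker (Col S) ME (Str FB) (mon_2 S (\<lambda>_. terminal_cat) (fst X) (fst X') \<psi>)) =
     vcomp (Col S) ME (Und FB) (rwhisker (Col S) ME \<psi> (Str one)) (snd X)"
    using \<psi> by (auto simp: lax_2cell_def Fbar_Und split: prod.splits)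
  show "cellL (fst X) (fst X') \<psi>" by (rule *)
  show "Cmp (Und B (f i)) (lax_coh S X' \<alpha>) (str_arr T B (F \<alpha>) M M (\<lambda>m. lax_ob X (h m)) (\<lambda>m. \<psi> (h m) ()) (\<lambda>m. lax_ob X' (h m))) =
      Cmp (Und B (f i)) (\<psi> i ()) (lax_coh S X \<alpha>)" if "typed S \<alpha> h M i" "distinct M"
    using lax_2cell_eval[OF X X' *(1) that] *(2) by simp
qed

lemma lax_2cellI:
  assumes X: "Alax X" and X': "Alax X'" and \<psi>: "cellL (fst X) (fst X') \<psi>"
    and law: "\<And>\<alpha> h M i. typed S \<alpha> h (M :: nat list) i \<Longrightarrow> distinct M \<Longrightarrow>
      Cmp (Und B (f i)) (lax_coh S X' \<alpha>) (str_arr T B (F \<alpha>) M M (\<lambda>m. lax_ob X (h m)) (\<lambda>m. \<psi> (h m) ()) (\<lambda>m. lax_ob X' (h m))) =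
      Cmp (Und B (f i)) (\<psi> i ()) (lax_coh S X \<alpha>)"
  shows "lax_2cell S one FB X X' \<psi>"
proof -
  have "vcomp (Col S) ME (Und FB) (snd X') (lwhisker (Col S) ME (Str FB) (mon_2 S (\<lambda>_. terminal_cat) (fst X) (fst X') \<psi>)) =
     vcomp (Col S) ME (Und FB) (rwhisker (Col S) ME \<psi> (Str one)) (snd X)" (is "?l = ?r")
  proof (intro ext)
    fix i a show "?l i a = ?r i a"
    proof (cases "i \<in> Col S \<and> a \<in> Obj (ME i)")
      case True
      then have aa: "a = (fst a, replicate (length [0..<arity S (fst a)]) ())" "fst a \<in> Ops S" "Tgt S (fst a) = i"
        using terminal_mon_objE[of a i] by auto
      have t: "typed S (fst a) ((!) (Src S (fst a))) [0..<arity S (fst a)] i" using typed_nth[OF aa(2)] aa(3) by simp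
      show ?thesis
        by (subst (1 2) aa(1)) (simp only: lax_2cell_eval[OF X X' \<psi> t distinct_upt] law[OF t distinct_upt])
    next
      case False
      then show ?thesis by (auto simp: vcomp_def)
    qed
  qed
  then show ?thesis using \<psi> by (simp add: lax_2cell_def Fbar_Und split_def)
qed

lemma lax_cell1: "Alax X \<Longrightarrow> cell1 (Col S) (\<lambda>_. terminal_cat) (pull (Col S) f (Und B)) (fst X)"
  by (rule lax_unfold(1))

lemma pull_category: "i \<in> Col S \<Longrightarrow> category (pull (Col S) f (Und B) i)"
  using B.Und_category col_map by simp

abbreviation "idL X \<equiv> id2 (Col S) (\<lambda>_. terminal_cat) (pull (Col S) f (Und B)) (fst X)"
abbreviation "vcL \<equiv> vcomp (Col S) (\<lambda>_. terminal_cat) (pull (Col S) f (Und B))"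

lemma lax_2cell_id:
  assumes X: "Alax X"
  shows "lax_2cell S one FB X X (idL X)"
proof (rule lax_2cellI[OF X X])
  show "cellL (fst X) (fst X) (idL X)" by (rule cell2_id2[OF lax_cell1[OF X]])
  fix \<alpha> h i and M :: "nat list" assume \<alpha>: "typed S \<alpha> h M i" and M: "distinct M"
  note i = typed_tgt_f[OF \<alpha>]
  interpret Bi: category "Und B (f i)" by (rule B.Und_category) (use i in simp)
  note hom = lax_coh_hom[OF X \<alpha>]
  have "str_arr T B (F \<alpha>) M M (\<lambda>m. lax_ob X (h m)) (\<lambda>m. idL X (h m) ()) (\<lambda>m. lax_ob X (h m)) =
      str_arr T B (F \<alpha>) M M (\<lambda>m. lax_ob X (h m)) (\<lambda>m. Ide (Und B (f (h m))) (lax_ob X (h m))) (\<lambda>m. lax_ob X (h m))"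
    by (rule str_arr_cong) (use M S.typed_col[OF \<alpha>] in \<open>simp_all add: id2_def lax_ob_def\<close>)
  also have "\<dots> = Ide (Und B (f i)) (str_obj T B (F \<alpha>) (map (\<lambda>m. lax_ob X (h m)) M))"
    by (rule B.str_arr_ide[OF F_typed[OF \<alpha>] M lax_ob_obj_typed[OF X \<alpha>]])
  finally show "Cmp (Und B (f i)) (lax_coh S X \<alpha>) (str_arr T B (F \<alpha>) M M (\<lambda>m. lax_ob X (h m)) (\<lambda>m. idL X (h m) ()) (\<lambda>m. lax_ob X (h m))) =
      Cmp (Und B (f i)) (idL X i ()) (lax_coh S X \<alpha>)"
    using Bi.cmp_ide_right[OF hom] Bi.cmp_ide_left[OF hom] i by (simp add: id2_def lax_ob_def)
qed

lemma lax_2cell_vcomp: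
  assumes X: "Alax X" "Alax X'" "Alax X''"
    and \<phi>: "lax_2cell S one FB X X' \<phi>" and \<psi>: "lax_2cell S one FB X' X'' \<psi>"
  shows "lax_2cell S one FB X X'' (vcL \<psi> \<phi>)"
proof (rule lax_2cellI[OF X(1,3)])
  note c = lax_2cellD(1)[OF X(1,2) \<phi>] lax_2cellD(1)[OF X(2,3) \<psi>]
  show "cellL (fst X) (fst X'') (vcL \<psi> \<phi>)"
    by (rule cell2_vcomp[OF lax_cell1[OF X(1)] lax_cell1[OF X(2)] lax_cell1[OF X(3)] c])
  fix \<alpha> h i and M :: "nat list" assume \<alpha>: "typed S \<alpha> h M i" and M: "distinct M"
  note i = typed_tgt_f[OF \<alpha>] and t = F_typed[OF \<alpha>]
  interpret Bi: category "Und B (f i)" by (rule B.Und_category) (use i in simp)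
  have re: "reorders M M" using M by simp
  let ?s = "\<lambda>X \<psi> X'. str_arr T B (F \<alpha>) M M (\<lambda>m. lax_ob X (h m)) (\<lambda>m. \<psi> (h m) ()) (\<lambda>m. lax_ob X' (h m))"
  note lh = cellL_lhom[OF c(1) S.typed_col[OF \<alpha>]] cellL_lhom[OF c(2) S.typed_col[OF \<alpha>]]
  have rel: "relab T (F \<alpha>) M M = F \<alpha>" by (rule T.relab_self[OF t M])
  have s1: "in_hom (Und B (f i)) (?s X \<phi> X') (str_obj T B (F \<alpha>) (map (\<lambda>m. lax_ob X (h m)) M)) (str_obj T B (F \<alpha>) (map (\<lambda>m. lax_ob X' (h m)) M))"
    using B.str_arr_hom[OF t re lh(1)] by (simp add: rel)
  have s2: "in_hom (Und B (f i)) (?s X' \<psi> X'') (str_obj T B (F \<alpha>) (map (\<lambda>m. lax_ob X' (h m)) M)) (str_obj T B (F \<alpha>) (map (\<lambda>m. lax_ob X'' (h m)) M))"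
    using B.str_arr_hom[OF t re lh(2)] by (simp add: rel)
  note p = cellL_hom[OF c(1), of i] cellL_hom[OF c(2), of i]
  have p': "in_hom (Und B (f i)) (\<phi> i ()) (lax_ob X i) (lax_ob X' i)" "in_hom (Und B (f i)) (\<psi> i ()) (lax_ob X' i) (lax_ob X'' i)"
    using p i by auto
  have "?s X (vcL \<psi> \<phi>) X'' = str_arr T B (F \<alpha>) M M (\<lambda>m. lax_ob X (h m)) (\<lambda>m. Cmp (Und B (f (h m))) (\<psi> (h m) ()) (\<phi> (h m) ())) (\<lambda>m. lax_ob X'' (h m))"
    by (rule str_arr_cong[OF re]) (use S.typed_col[OF \<alpha>] in \<open>simp add: vcomp_def\<close>)
  also have "\<dots> = Cmp (Und B (f i)) (?s X' \<psi> X'') (?s X \<phi> X')"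
    using B.str_arr_cmp[OF t re re lh(2) lh(1)] by (simp add: rel)
  finally have "Cmp (Und B (f i)) (lax_coh S X'' \<alpha>) (?s X (vcL \<psi> \<phi>) X'') =
      Cmp (Und B (f i)) (Cmp (Und B (f i)) (lax_coh S X'' \<alpha>) (?s X' \<psi> X'')) (?s X \<phi> X')"
    using Bi.cmp_assoc[OF s1 s2 lax_coh_hom[OF X(3) \<alpha>]] by simp
  also have "\<dots> = Cmp (Und B (f i)) (\<psi> i ()) (Cmp (Und B (f i)) (lax_coh S X' \<alpha>) (?s X \<phi> X'))"
    unfolding lax_2cellD(2)[OF X(2,3) \<psi> \<alpha> M]
    using Bi.cmp_assoc[OF s1 lax_coh_hom[OF X(2) \<alpha>] p'(2)] by simp
  also have "\<dots> = Cmp (Und B (f i)) (vcL \<psi> \<phi> i ()) (lax_coh S X \<alpha>)"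
    unfolding lax_2cellD(2)[OF X(1,2) \<phi> \<alpha> M]
    using Bi.cmp_assoc[OF lax_coh_hom[OF X(1) \<alpha>] p'(1) p'(2)] i by (simp add: vcomp_def)
  finally show "Cmp (Und B (f i)) (lax_coh S X'' \<alpha>) (?s X (vcL \<psi> \<phi>) X'') = Cmp (Und B (f i)) (vcL \<psi> \<phi> i ()) (lax_coh S X \<alpha>)" .
qed

lemma Alg_l_category: "category (Alg_l S one FB)"
  unfolding Alg_l_def Fbar_Und Und_terminal
proof (rule cat_of_homs_category, unfold mem_Collect_eq)
  fix X assume "Alax X" then show "lax_2cell S one FB X X (idL X)" by (rule lax_2cell_id)
next
  fix X X' X'' \<phi> \<psi> assume "Alax X" "Alax X'" "Alax X''" "lax_2cell S one FB X X' \<phi>" "lax_2cell S one FB X' X'' \<psi>"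
  then show "lax_2cell S one FB X X'' (vcL \<psi> \<phi>)" by (rule lax_2cell_vcomp)
next
  fix X X' \<phi> assume "Alax X" "Alax X'" "lax_2cell S one FB X X' \<phi>"
  note c = lax_2cellD(1)[OF this]
  show "vcL (idL X') \<phi> = \<phi>" "vcL \<phi> (idL X) = \<phi>"
    by (rule vcomp_id_left[OF pull_category c], assumption, rule vcomp_id_right[OF pull_category c])
next
  fix X0 X1 X2 X3 \<phi> \<psi> \<chi>
  assume X: "Alax X0" "Alax X1" "Alax X2" "Alax X3"
    and c: "lax_2cell S one FB X0 X1 \<phi>" "lax_2cell S one FB X1 X2 \<psi>" "lax_2cell S one FB X2 X3 \<chi>"
  show "vcL \<chi> (vcL \<psi> \<phi>) = vcL (vcL \<chi> \<psi>) \<phi>"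
    by (rule vcomp_assoc[OF pull_category lax_2cellD(1)[OF X(1,2) c(1)] lax_2cellD(1)[OF X(2,3) c(2)]
          lax_2cellD(1)[OF X(3,4) c(3)]])
qed

section \<open>Extension and restriction of 2-cells\<close>

definition whisker_u :: "('j \<Rightarrow> ('i, 't) dobj \<Rightarrow> 'm) \<Rightarrow> 'i \<Rightarrow> unit \<Rightarrow> 'm" where
  "whisker_u \<phi> = (\<lambda>i\<in>Col S. \<lambda>_. \<phi> (f i) (ux i))"

lemma whisker_u_rwhisker: "rwhisker (Col S) (Und one) (Fbar_2 S f \<phi>) (fst (u_lax S T f F)) = whisker_u \<phi>"
  by (auto simp: whisker_u_def rwhisker_def Fbar_2_def u_lax_eq mklax_def restrict_def fun_eq_iff)

text \<open>The component at \<open>(is, \<alpha>)\<close> has no other choice: this object is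
  \<open>\<alpha>\<close> applied to objects \<open>(i, 1)\<close>, so its component must be the
  structure map at \<open>\<alpha>\<close> applied to the components of \<open>\<psi>\<close>.
  Positions again serve as labels.\<close>

definition ext_2cell :: "('i, 's, unit, unit, 'o, 'm) lax \<Rightarrow> ('i, 's, unit, unit, 'o, 'm) lax \<Rightarrow> ('i \<Rightarrow> unit \<Rightarrow> 'm)
    \<Rightarrow> 'j \<Rightarrow> ('i, 't) dobj \<Rightarrow> 'm" where
  "ext_2cell X X' \<psi> = (\<lambda>j\<in>Col T. \<lambda>a\<in>Obj (D j). str_arr T B (snd a) [0..<length (fst a)] [0..<length (fst a)]
     (\<lambda>k. lax_ob X (fst a ! k)) (\<lambda>k. \<psi> (fst a ! k) ()) (\<lambda>k. lax_ob X' (fst a ! k)))"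

lemma ext_2cell_dob:
  assumes o: "dob S T f L i \<alpha> j"
  shows "ext_2cell X X' \<psi> j (map i L, \<alpha>) = str_arr T B \<alpha> L L (\<lambda>l. lax_ob X (i l)) (\<lambda>l. \<psi> (i l) ()) (\<lambda>l. lax_ob X' (i l))"
proof -
  let ?N = "[0..<length L]"
  have inj: "inj_on ((!) L) (set ?N)" using dobD(1)[OF o] by (auto simp: inj_on_def nth_eq_iff_index_eq)
  have "str_arr T B \<alpha> (map ((!) L) ?N) (map ((!) L) ?N) (\<lambda>l. lax_ob X (i l)) (\<lambda>l. \<psi> (i l) ()) (\<lambda>l. lax_ob X' (i l)) =
      str_arr T B \<alpha> ?N ?N (\<lambda>k. lax_ob X (i (L ! k))) (\<lambda>k. \<psi> (i (L ! k)) ()) (\<lambda>k. lax_ob X' (i (L ! k)))"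
    by (rule str_arr_map[OF inj]) simp
  also have "\<dots> = str_arr T B \<alpha> ?N ?N (\<lambda>k. lax_ob X (map i L ! k)) (\<lambda>k. \<psi> (map i L ! k) ()) (\<lambda>k. lax_ob X' (map i L ! k))"
    by (rule str_arr_cong) simp_all
  finally show ?thesis using dob_Obj[OF o] dob_Col[OF o] by (simp add: ext_2cell_def map_nth)
qed

text \<open>By \<open>strict_2cell_law\<close> the structure map applied to the restricted
  components is the component of \<open>\<phi>\<close> at the source of \<open>uc \<alpha>\<close>.
  The condition is then naturality of \<open>\<phi>\<close> at \<open>uc \<alpha>\<close>.\<close>

lemma whisker_u_2cell:
  assumes g: "AB.strict_1cell g" "AB.strict_1cell g'" and \<phi>: "lax_2cell T A B (g, AB.idl g) (g', AB.idl g') \<phi>"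
  shows "lax_2cell S one FB (restr_u g) (restr_u g') (whisker_u \<phi>)"
proof (rule lax_2cellI[OF restr_u_lax[OF g(1)] restr_u_lax[OF g(2)]])
  have c: "cell2 (Col T) (Und A) (Und B) g g' \<phi>" using \<phi> by (simp add: lax_2cell_def)
  have hom: "in_hom (Und B (f i)) (\<phi> (f i) (ux i)) (lax_ob (restr_u g) i) (lax_ob (restr_u g') i)" if "i \<in> Col S" for i
    using cell2_in_hom[OF c col_map[OF that] ux_obj[OF g(1) that]] lax_ob_restr_u[OF that] by simp
  show "cellL (fst (restr_u g)) (fst (restr_u g')) (whisker_u \<phi>)"
    unfolding cellL_iff[OF restr_u_lax[OF g(1)] restr_u_lax[OF g(2)]] using hom by (simp add: whisker_u_def)
  fix \<alpha> h i and M :: "nat list" assume \<alpha>: "typed S \<alpha> h M i" and M: "distinct M"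
  note i = typed_tgt_f[OF \<alpha>] and t = F_typed[OF \<alpha>]
  have lxs: "lax_ob (restr_u g) (h m) = FO (g (f (h m))) (ux (h m))" "lax_ob (restr_u g') (h m) = FO (g' (f (h m))) (ux (h m))"
    "whisker_u \<phi> (h m) () = \<phi> (f (h m)) (ux (h m))" if "m \<in> set M" for m
    using lax_ob_restr_u S.typed_col[OF \<alpha> that] by (auto simp: whisker_u_def)
  have "str_arr T B (F \<alpha>) M M (\<lambda>m. lax_ob (restr_u g) (h m)) (\<lambda>m. whisker_u \<phi> (h m) ()) (\<lambda>m. lax_ob (restr_u g') (h m)) =
      str_arr T B (F \<alpha>) M M (\<lambda>m. FO (g (f (h m))) (ux (h m))) (\<lambda>m. \<phi> (f (h m)) (ux (h m))) (\<lambda>m. FO (g' (f (h m))) (ux (h m)))"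
    by (rule str_arr_cong) (use M lxs in simp_all)
  also have "\<dots> = \<phi> (f i) (str_obj T A (F \<alpha>) (map (\<lambda>m. ux (h m)) M))"
    by (rule AB.strict_2cell_law[OF g \<phi> t M ux_obj[OF g(1) S.typed_col[OF \<alpha>]]])
  finally have s: "str_arr T B (F \<alpha>) M M (\<lambda>m. lax_ob (restr_u g) (h m)) (\<lambda>m. whisker_u \<phi> (h m) ()) (\<lambda>m. lax_ob (restr_u g') (h m)) =
      \<phi> (f i) (str_obj T A (F \<alpha>) (map (\<lambda>m. ux (h m)) M))" .
  have nat: "is_nat_trans (D (f i)) (Und B (f i)) (g (f i)) (g' (f i)) (\<phi> (f i))"
    using c i by (simp add: cell2_def Und_A)
  have whisker_u: "whisker_u \<phi> i () = \<phi> (f i) (ux i)" using i by (simp add: whisker_u_def)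
  show "Cmp (Und B (f i)) (lax_coh S (restr_u g') \<alpha>) (str_arr T B (F \<alpha>) M M (\<lambda>m. lax_ob (restr_u g) (h m)) (\<lambda>m. whisker_u \<phi> (h m) ()) (\<lambda>m. lax_ob (restr_u g') (h m))) =
      Cmp (Und B (f i)) (whisker_u \<phi> i ()) (lax_coh S (restr_u g) \<alpha>)"
    unfolding s whisker_u lax_coh_restr_u[OF \<alpha>]
    by (rule nat[unfolded is_nat_trans_def, THEN conjunct2, THEN conjunct2, rule_format, OF uc_hom[OF \<alpha>], symmetric])
qed

lemma ext_2cell_whisker_u:
  assumes g: "AB.strict_1cell g" "AB.strict_1cell g'" and \<phi>: "lax_2cell T A B (g, AB.idl g) (g', AB.idl g') \<phi>"
  shows "ext_2cell (restr_u g) (restr_u g') (whisker_u \<phi>) = \<phi>"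
proof (intro ext)
  have c: "cell2 (Col T) (Und A) (Und B) g g' \<phi>" using \<phi> by (simp add: lax_2cell_def)
  fix j a show "ext_2cell (restr_u g) (restr_u g') (whisker_u \<phi>) j a = \<phi> j a"
  proof (cases "j \<in> Col T \<and> a \<in> Obj (D j)")
    case True
    then obtain i n \<alpha> where a: "a = (map i [0..<n], \<alpha>)" and o: "dob S T f [0..<n] i \<alpha> j"
      using D_ObjE[of a j] by blast
    note e = dobD[OF o]
    have "ext_2cell (restr_u g) (restr_u g') (whisker_u \<phi>) j a = str_arr T B \<alpha> [0..<n] [0..<n] (\<lambda>l. lax_ob (restr_u g) (i l)) (\<lambda>l. whisker_u \<phi> (i l) ()) (\<lambda>l. lax_ob (restr_u g') (i l))"
      unfolding a by (rule ext_2cell_dob[OF o])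
    also have "\<dots> = str_arr T B \<alpha> [0..<n] [0..<n] (\<lambda>l. FO (g (f (i l))) (ux (i l))) (\<lambda>l. \<phi> (f (i l)) (ux (i l))) (\<lambda>l. FO (g' (f (i l))) (ux (i l)))"
      by (rule str_arr_cong) (use lax_ob_restr_u[OF e(2)] e(2) in \<open>simp_all add: whisker_u_def\<close>)
    also have "\<dots> = \<phi> j (str_obj T A \<alpha> (map (\<lambda>l. ux (i l)) [0..<n]))"
      by (rule AB.strict_2cell_law[OF g \<phi> e(3,1) ux_obj[OF g(1) e(2)]])
    also have "\<dots> = \<phi> j a" unfolding a using A_units[OF e(3,2)] by simp
    finally show ?thesis .
  next
    case False
    then have "\<phi> j a = (if j \<in> Col T then undefined else undefined a)"
      using cell2_ext[OF c, of j a] by (auto simp: Und_A)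
    then show ?thesis using False by (auto simp: ext_2cell_def)
  qed
qed

lemma whisker_u_ext_2cell:
  assumes X: "Alax X" "Alax X'" and \<psi>: "lax_2cell S one FB X X' \<psi>"
  shows "whisker_u (ext_2cell X X' \<psi>) = \<psi>"
proof (intro ext)
  note c = lax_2cellD(1)[OF X \<psi>]
  fix i a show "whisker_u (ext_2cell X X' \<psi>) i a = \<psi> i a"
  proof (cases "i \<in> Col S")
    case i: True
    have "ext_2cell X X' \<psi> (f i) (map (\<lambda>_. i) [()], One T (f i)) =
        str_arr T B (One T (f i)) [()] [()] (\<lambda>_. lax_ob X i) (\<lambda>_. \<psi> i ()) (\<lambda>_. lax_ob X' i)"
      by (rule ext_2cell_dob[OF dob_unit[OF i]])
    also have "\<dots> = \<psi> i ()"
      by (rule B.str_arr_one[OF col_map[OF i]]) (rule cellL_hom[OF c i])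
    finally show ?thesis using i by (simp add: whisker_u_def)
  next
    case False
    then show ?thesis using c by (simp add: whisker_u_def cell2_def extensional_def)
  qed
qed

lemma ext_2cell_hom:
  assumes X: "Alax X" "Alax X'" and \<psi>: "lax_2cell S one FB X X' \<psi>" and o: "dob S T f L i \<alpha> j"
  shows "in_hom (Und B j) (ext_2cell X X' \<psi> j (map i L, \<alpha>)) (str_obj T B \<alpha> (map (\<lambda>l. lax_ob X (i l)) L)) (str_obj T B \<alpha> (map (\<lambda>l. lax_ob X' (i l)) L))"
  unfolding ext_2cell_dob[OF o]
  using B.str_arr_hom[OF dobD(3)[OF o] _ cellL_lhom[OF lax_2cellD(1)[OF X \<psi>] dobD(2)[OF o]], of L] dobD(1)[OF o]
    T.relab_self[OF dobD(3,1)[OF o]] by simp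

text \<open>The two steps of an extended arrow are handled separately: the coherence step by the
  2-cell condition of \<open>\<psi>\<close> at each decoration, the permutation step by naturality
  of the symmetries of \<open>B\<close>.\<close>

lemma ext_2cell_natural:
  assumes X: "Alax X" "Alax X'" and \<psi>: "lax_2cell S one FB X X' \<psi>"
    and m: "dmor S L1 i1 L2 i2 h b" and o: "dob S T f L2 i2 \<alpha> j"
  shows "Cmp (Und B j) (ext_2cell X X' \<psi> j (map i2 L2, \<alpha>)) (ext_arr T B f F (lax_ob X) (lax_coh S X) L1 i1 L2 i2 \<alpha> h b) =
    Cmp (Und B j) (ext_arr T B f F (lax_ob X') (lax_coh S X') L1 i1 L2 i2 \<alpha> h b) (ext_2cell X X' \<psi> j (map i1 L1, dsrc T F L1 L2 h b \<alpha>))"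
proof -
  interpret Bj: category "Und B j" by (rule dob_category[OF X(1) o])
  note d = dmorD[OF m] and e = dobD[OF o] and c = lax_2cellD(1)[OF X \<psi>]
  note o1 = dsrc_dob[OF m o]
  let ?C = "cfib L1 h L2" and ?\<beta> = "Sub T \<alpha> (map (\<lambda>k. F (b k)) L2)"
  let ?x1 = "\<lambda>l. lax_ob X (i1 l)" and ?y1 = "\<lambda>l. lax_ob X' (i1 l)" and ?x2 = "\<lambda>l. lax_ob X (i2 l)" and ?y2 = "\<lambda>l. lax_ob X' (i2 l)"
  let ?p1 = "\<lambda>l. \<psi> (i1 l) ()" and ?p2 = "\<lambda>l. \<psi> (i2 l) ()" and ?g1 = "\<lambda>l. f (i1 l)" and ?g2 = "\<lambda>l. f (i2 l)"
  let ?ox = "\<lambda>k. str_obj T B (F (b k)) (map ?x1 (fib L1 h k))" and ?oy = "\<lambda>k. str_obj T B (F (b k)) (map ?y1 (fib L1 h k))"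
  let ?A = "str_arr T B \<alpha> L2 L2 ?ox (\<lambda>k. lax_coh S X (b k)) ?x2" and ?A' = "str_arr T B \<alpha> L2 L2 ?oy (\<lambda>k. lax_coh S X' (b k)) ?y2"
  let ?P = "str_perm T B ?g1 ?\<beta> ?C L1 ?x1" and ?P' = "str_perm T B ?g1 ?\<beta> ?C L1 ?y1"
  let ?K = "str_arr T B \<alpha> L2 L2 ?x2 ?p2 ?y2" and ?KC = "str_arr T B ?\<beta> ?C ?C ?x1 ?p1 ?y1"
  let ?s = "\<lambda>k. str_arr T B (F (b k)) (fib L1 h k) (fib L1 h k) ?x1 ?p1 ?y1"
  note \<beta> = dsrc_typed[OF m o]
  have re2: "reorders L2 L2" using d(2) by simp
  have C: "distinct ?C" "set ?C = set L1" using d(5) by (auto simp: reorders_def)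
  have reC: "reorders ?C ?C" using C by simp
  have col1: "i1 l \<in> Col S" if "l \<in> set L1" for l by (rule dobD(2)[OF o1 that])
  have relA: "relab T \<alpha> L2 L2 = \<alpha>" by (rule T.relab_self[OF e(3) d(2)])
  have relC: "relab T ?\<beta> ?C ?C = ?\<beta>" by (rule T.relab_self[OF \<beta> C(1)])
  have relF: "relab T (F (b k)) (fib L1 h k) (fib L1 h k) = F (b k)" if "k \<in> set L2" for k
    by (rule T.relab_self[OF F_typed[OF d(4)[OF that]]]) (use d(1) in simp)
  have lh2: "lhom (Und B) ?g2 L2 ?x2 ?p2 ?y2" by (rule cellL_lhom[OF c e(2)])
  have lh1: "lhom (Und B) ?g1 L ?x1 ?p1 ?y1" if "set L \<subseteq> set L1" for L
    by (rule cellL_lhom[OF c]) (use that col1 in auto)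
  have lhs: "lhom (Und B) ?g2 L2 ?ox ?s ?oy"
    unfolding lhom_def
  proof
    fix k assume k: "k \<in> set L2"
    have "in_hom (Und B (?g2 k)) (?s k) (str_obj T B (relab T (F (b k)) (fib L1 h k) (fib L1 h k)) (map ?x1 (fib L1 h k))) (?oy k)"
      by (rule B.str_arr_hom[OF F_typed[OF d(4)[OF k]] _ lh1]) (use d(1) in auto)
    then show "in_hom (Und B (?g2 k)) (?s k) (?ox k) (?oy k)" using relF[OF k] by simp
  qed
  note lA = c_lhom[OF X(1) m] and lA' = c_lhom[OF X(2) m]
  have "Cmp (Und B j) ?K ?A = str_arr T B \<alpha> L2 L2 ?ox (\<lambda>k. Cmp (Und B (?g2 k)) (?p2 k) (lax_coh S X (b k))) ?y2"
    using B.str_arr_cmp[OF e(3) re2 re2 lh2 lA] by (simp add: relA)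
  also have "\<dots> = str_arr T B \<alpha> L2 L2 ?ox (\<lambda>k. Cmp (Und B (?g2 k)) (lax_coh S X' (b k)) (?s k)) ?y2"
    by (rule str_arr_cong[OF re2]) (use lax_2cellD(2)[OF X \<psi> d(4)] d(1) in simp)
  also have "\<dots> = Cmp (Und B j) ?A' (str_arr T B \<alpha> L2 L2 ?ox ?s ?oy)"
    using B.str_arr_cmp[OF e(3) re2 re2 lA' lhs] by (simp add: relA)
  \<comment> \<open>The multiplication law identifies the components of \<open>\<psi>\<close> taken
    fibre by fibre with those taken over the grouped list \<open>?C\<close>, which is the form that
    meets the permutation.\<close>
  also have "str_arr T B \<alpha> L2 L2 ?ox ?s ?oy = ?KC"
  proof -
    have "str_arr T B \<alpha> L2 L2 ?ox ?s ?oy = str_arr T B \<alpha> L2 L2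
        (\<lambda>k. str_obj T B (relab T (F (b k)) (fib L1 h k) (fib L1 h k)) (map ?x1 (fib L1 h k))) ?s ?oy"
      by (rule str_arr_cong[OF re2]) (simp add: relF)
    also have "\<dots> = ?KC"
      unfolding cfib_def
      by (rule B.str_arr_sub[OF e(3) F_typed[OF d(4)] re2 _ _ lh1]) (use d C(1) in \<open>auto simp: cfib_def\<close>)
    finally show ?thesis .
  qed
  finally have KA: "Cmp (Und B j) ?K ?A = Cmp (Und B j) ?A' ?KC" .
  have KCP: "Cmp (Und B j) ?KC ?P = str_arr T B ?\<beta> ?C L1 ?x1 ?p1 ?y1"
    using B.str_arr_str_perm[OF \<beta> reC d(5) lh1] C by (simp add: relC)
  have PK: "Cmp (Und B j) ?P' (str_arr T B (dsrc T F L1 L2 h b \<alpha>) L1 L1 ?x1 ?p1 ?y1) = str_arr T B ?\<beta> ?C L1 ?x1 ?p1 ?y1"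
    unfolding dsrc_def by (rule B.str_perm_str_arr[OF \<beta> d(5) _ lh1]) (use d(1) C in auto)
  have hKC: "in_hom (Und B j) ?KC (str_obj T B ?\<beta> (map ?x1 ?C)) (str_obj T B ?\<beta> (map ?y1 ?C))"
    using B.str_arr_hom[OF \<beta> reC lh1] C by (simp add: relC)
  have hK: "in_hom (Und B j) ?K (str_obj T B \<alpha> (map ?x2 L2)) (str_obj T B \<alpha> (map ?y2 L2))"
    using ext_2cell_hom[OF X \<psi> o] ext_2cell_dob[OF o] by simp
  have hK1: "in_hom (Und B j) (str_arr T B (dsrc T F L1 L2 h b \<alpha>) L1 L1 ?x1 ?p1 ?y1)
      (str_obj T B (dsrc T F L1 L2 h b \<alpha>) (map ?x1 L1)) (str_obj T B (dsrc T F L1 L2 h b \<alpha>) (map ?y1 L1))"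
    using ext_2cell_hom[OF X \<psi> o1] ext_2cell_dob[OF o1] by simp
  note pX = ext_X_parts[OF X(1) m o] and pX' = ext_X_parts[OF X(2) m o]
  have "Cmp (Und B j) (ext_2cell X X' \<psi> j (map i2 L2, \<alpha>)) (ext_arr T B f F (lax_ob X) (lax_coh S X) L1 i1 L2 i2 \<alpha> h b) =
      Cmp (Und B j) (Cmp (Und B j) ?K ?A) ?P"
    unfolding ext_2cell_dob[OF o] ext_X_eq[OF X(1) o] by (rule Bj.cmp_assoc[OF pX(2) pX(1) hK])
  also have "\<dots> = Cmp (Und B j) ?A' (Cmp (Und B j) ?KC ?P)"
    unfolding KA by (rule Bj.cmp_assoc[OF pX(2) hKC pX'(1), symmetric])
  also have "\<dots> = Cmp (Und B j) (Cmp (Und B j) ?A' ?P') (str_arr T B (dsrc T F L1 L2 h b \<alpha>) L1 L1 ?x1 ?p1 ?y1)"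
    unfolding KCP PK[symmetric] by (rule Bj.cmp_assoc[OF hK1 pX'(2) pX'(1)])
  finally show ?thesis unfolding ext_2cell_dob[OF o1] ext_X_eq[OF X(2) o] .
qed

text \<open>Compatibility with the structure maps is the multiplication law of \<open>B\<close> once
  more, because the action on \<open>F \<down> (-)\<close> concatenates the labels over which the
  components are taken.\<close>

lemma ext_2cell_2cell:
  assumes X: "Alax X" "Alax X'" and \<psi>: "lax_2cell S one FB X X' \<psi>"
  shows "lax_2cell T A B (Ext X, AB.idl (Ext X)) (Ext X', AB.idl (Ext X')) (ext_2cell X X' \<psi>)"
  unfolding AB.strict_2cell_iff[OF Ext_strict_1cell[OF X(1)] Ext_strict_1cell[OF X(2)]]
proof (intro conjI ballI)
  note c = lax_2cellD(1)[OF X \<psi>]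
  have "is_nat_trans (D j) (Und B j) (Ext X j) (Ext X' j) (ext_2cell X X' \<psi> j)" if j: "j \<in> Col T" for j
    unfolding is_nat_trans_def
  proof (intro conjI ballI allI impI)
    show "ext_2cell X X' \<psi> j \<in> extensional (Obj (D j))" using j by (simp add: ext_2cell_def)
    fix a assume "a \<in> Obj (D j)"
    from D_ObjE[OF this] obtain i n \<alpha> where a: "a = (map i [0..<n], \<alpha>)" and o: "dob S T f [0..<n] i \<alpha> j"
      by blast
    show "in_hom (Und B j) (ext_2cell X X' \<psi> j a) (FO (Ext X j) a) (FO (Ext X' j) a)"
      unfolding a Ext_obj[OF o] by (rule ext_2cell_hom[OF X \<psi> o])
  next
    fix m a b assume m: "in_hom (D j) m a b"
    obtain i n \<alpha> where b: "b = (map i [0..<n], \<alpha>)" and o: "dob S T f [0..<n] i \<alpha> j"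
      using D_ObjE[OF category.in_hom_obj(2)[OF D_category m]] by blast
    obtain n1 i1 h e where m': "m = darr T F [0..<n1] i1 [0..<n] i \<alpha> h e"
      "a = (map i1 [0..<n1], dsrc T F [0..<n1] [0..<n] h e \<alpha>)" and dm: "dmor S [0..<n1] i1 [0..<n] i h e"
      using darrE[OF m[unfolded b] distinct_upt] by blast
    show "Cmp (Und B j) (ext_2cell X X' \<psi> j b) (FA (Ext X j) m) = Cmp (Und B j) (FA (Ext X' j) m) (ext_2cell X X' \<psi> j a)"
      unfolding m' b Ext_arr[OF dm o] by (rule ext_2cell_natural[OF X \<psi> dm o])
  qed
  then show "cell2 (Col T) (Und A) (Und B) (Ext X) (Ext X') (ext_2cell X X' \<psi>)"
    by (simp add: cell2_def Und_A) (simp add: ext_2cell_def)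
  fix j a assume j: "j \<in> Col T" and a: "a \<in> Obj (mon_ob T (Und A) j)"
  obtain \<gamma> g n and L :: "nat \<Rightarrow> (nat \<times> nat) list" and i \<alpha> where
    aa: "a = (\<gamma>, map (\<lambda>m. (map i (L m), \<alpha> m)) [0..<n])" and \<gamma>: "typed T \<gamma> g [0..<n] j"
    and o': "\<forall>m<n. dob S T f (L m) i (\<alpha> m) (g m)" and L: "distinct (concat (map L [0..<n]))"
    using mon_D_objE[OF a[unfolded Und_A]] by blast
  let ?M = "[0..<n]" and ?y = "\<lambda>m. (map i (L m), \<alpha> m)"
  let ?x = "\<lambda>l. lax_ob X (i l)" and ?x' = "\<lambda>l. lax_ob X' (i l)" and ?p = "\<lambda>l. \<psi> (i l) ()"
  have o: "dob S T f (L m) i (\<alpha> m) (g m)" if "m \<in> set ?M" for m using o' that by simp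
  have yo: "?y m \<in> Obj (Und A (g m))" if "m \<in> set ?M" for m unfolding Und_A by (rule dob_Obj[OF o[OF that]])
  have "FA (Str B j) (mon_2 T (Und A) (Ext X) (Ext X') (ext_2cell X X' \<psi>) j a) =
      str_arr T B \<gamma> ?M ?M (\<lambda>m. FO (Ext X (g m)) (?y m)) (\<lambda>m. ext_2cell X X' \<psi> (g m) (?y m)) (\<lambda>m. FO (Ext X' (g m)) (?y m))"
    unfolding aa by (rule AB.mon_2_str_arr[OF \<gamma> distinct_upt yo])
  also have "\<dots> = str_arr T B \<gamma> ?M ?M (\<lambda>m. str_obj T B (relab T (\<alpha> m) (L m) (L m)) (map ?x (L m)))
      (\<lambda>m. str_arr T B (\<alpha> m) (L m) (L m) ?x ?p ?x') (\<lambda>m. str_obj T B (\<alpha> m) (map ?x' (L m)))"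
  proof (rule str_arr_cong[OF iffD2[OF reorders_refl distinct_upt]], intro conjI)
    fix m assume m: "m \<in> set ?M"
    show "FO (Ext X (g m)) (?y m) = str_obj T B (relab T (\<alpha> m) (L m) (L m)) (map ?x (L m))"
      using Ext_obj[OF o[OF m]] T.relab_self[OF dobD(3,1)[OF o[OF m]]] by simp
  qed (rule ext_2cell_dob[OF o], assumption, rule Ext_obj[OF o])
  also have "\<dots> = str_arr T B (Sub T \<gamma> (map \<alpha> ?M)) (concat (map L ?M)) (concat (map L ?M)) ?x ?p ?x'"
    by (rule B.str_arr_sub[OF \<gamma> dobD(3)[OF o] _ _ L]) (use dobD(1)[OF o] cellL_lhom[OF c dobD(2)[OF o]] in auto)
  also have "\<dots> = ext_2cell X X' \<psi> j (map i (concat (map L ?M)), Sub T \<gamma> (map \<alpha> ?M))"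
    by (rule ext_2cell_dob[OF dob_concat[OF \<gamma> o L], symmetric])
  also have "(map i (concat (map L ?M)), Sub T \<gamma> (map \<alpha> ?M)) = str_obj T A \<gamma> (map ?y ?M)"
    by (rule A_obj[OF \<gamma> o, symmetric])
  also have "\<dots> = FO (Str A j) a" using B.typed_tgt[OF \<gamma>] by (simp add: str_obj_def aa)
  finally show "FA (Str B j) (mon_2 T (Und A) (Ext X) (Ext X') (ext_2cell X X' \<psi>) j a) = ext_2cell X X' \<psi> j (FO (Str A j) a)" .
qed

section \<open>The precomposition functor is bijective on objects and on arrows\<close>

abbreviation "precomp_u \<equiv> precomp S T f F A (u_lax S T f F) B"

lemma Alg_s_sel:
  "Obj (Alg_s T A B) = {G. strict_morphism T A B G}"
  "Arr (Alg_s T A B) = {(G, \<phi>, G'). strict_morphism T A B G \<and> strict_morphism T A B G' \<and> lax_2cell T A B G G' \<phi>}"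
  "in_hom (Alg_s T A B) m G G' \<longleftrightarrow> m \<in> Arr (Alg_s T A B) \<and> fst m = G \<and> snd (snd m) = G'"
  "Ide (Alg_s T A B) G = (G, id2 (Col T) (Und A) (Und B) (fst G), G)"
  "Cmp (Alg_s T A B) (G1, \<psi>, G2) (G0, \<phi>, G1') = (G0, vcomp (Col T) (Und A) (Und B) \<psi> \<phi>, G2)"
  by (auto simp: Alg_s_def cat_of_homs_def in_hom_def)

lemma Alg_l_sel:
  "Obj (Alg_l S one FB) = {X. Alax X}"
  "Arr (Alg_l S one FB) = {(X, \<phi>, X'). Alax X \<and> Alax X' \<and> lax_2cell S one FB X X' \<phi>}"
  "in_hom (Alg_l S one FB) m X X' \<longleftrightarrow> m \<in> Arr (Alg_l S one FB) \<and> fst m = X \<and> snd (snd m) = X'"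
  "Ide (Alg_l S one FB) X = (X, idL X, X)"
  "Cmp (Alg_l S one FB) (X1, \<psi>, X2) (X0, \<phi>, X1') = (X0, vcL \<psi> \<phi>, X2)"
  by (auto simp: Alg_l_def cat_of_homs_def in_hom_def Fbar_Und)

lemma strictD: "strict_morphism T A B G \<Longrightarrow> AB.strict_1cell (fst G) \<and> G = (fst G, AB.idl (fst G))"
  by (simp add: AB.strict_iff)

lemma precomp_u_obj: "strict_morphism T A B G \<Longrightarrow> FO precomp_u G = restr_u (fst G)"
  using strictD[of G] precomp_obj[of "fst G"] by (simp add: precomp_def Let_def Alg_s_sel)

lemma precomp_u_arr:
  "strict_morphism T A B G \<Longrightarrow> strict_morphism T A B G' \<Longrightarrow> lax_2cell T A B G G' \<phi> \<Longrightarrow>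
    FA precomp_u (G, \<phi>, G') = (restr_u (fst G), whisker_u \<phi>, restr_u (fst G'))"
  using strictD[of G] strictD[of G'] precomp_obj[of "fst G"] precomp_obj[of "fst G'"] whisker_u_rwhisker[of \<phi>]
  by (simp add: precomp_def Let_def Alg_s_sel)

lemma whisker_u_2cell': "strict_morphism T A B G \<Longrightarrow> strict_morphism T A B G' \<Longrightarrow> lax_2cell T A B G G' \<phi> \<Longrightarrow>
    lax_2cell S one FB (restr_u (fst G)) (restr_u (fst G')) (whisker_u \<phi>)"
  using whisker_u_2cell[of "fst G" "fst G'" \<phi>] strictD[of G] strictD[of G'] by simp

lemma restr_u_lax': "strict_morphism T A B G \<Longrightarrow> Alax (restr_u (fst G))"
  using restr_u_lax[of "fst G"] strictD[of G] by simp

lemma precomp_u_hom: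
  assumes "m \<in> Arr (Alg_s T A B)"
  shows "FA precomp_u m \<in> Arr (Alg_l S one FB)" "fst (FA precomp_u m) = FO precomp_u (fst m)"
    "snd (snd (FA precomp_u m)) = FO precomp_u (snd (snd m))"
proof -
  obtain G \<phi> G' where m: "m = (G, \<phi>, G')" and G: "strict_morphism T A B G" "strict_morphism T A B G'"
    "lax_2cell T A B G G' \<phi>"
    using assms unfolding Alg_s_sel by blast
  show "FA precomp_u m \<in> Arr (Alg_l S one FB)" "fst (FA precomp_u m) = FO precomp_u (fst m)"
    "snd (snd (FA precomp_u m)) = FO precomp_u (snd (snd m))"
    using restr_u_lax'[OF G(1)] restr_u_lax'[OF G(2)] whisker_u_2cell'[OF G]
    by (simp_all only: m Alg_l_sel(2) precomp_u_arr[OF G] precomp_u_obj[OF G(1)] precomp_u_obj[OF G(2)] fst_conv snd_conv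
        mem_Collect_eq case_prod_conv simp_thms)
qed

lemma precomp_u_functor: "is_functor (Alg_s T A B) (Alg_l S one FB) precomp_u"
proof (intro is_functor.intro is_functor_axioms.intro AB.Alg_s_category Alg_l_category)
  show "FO precomp_u \<in> Obj (Alg_s T A B) \<rightarrow>\<^sub>E Obj (Alg_l S one FB)"
  proof (rule PiE_I)
    show "FO precomp_u G \<in> Obj (Alg_l S one FB)" if "G \<in> Obj (Alg_s T A B)" for G
      using that restr_u_lax strictD[of G] by (simp add: Alg_s_sel Alg_l_sel precomp_u_obj)
    show "FO precomp_u G = undefined" if "G \<notin> Obj (Alg_s T A B)" for G
      using that by (simp add: precomp_def Let_def)
  qed
  show "FA precomp_u \<in> Arr (Alg_s T A B) \<rightarrow>\<^sub>E Arr (Alg_l S one FB)"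
  proof (rule PiE_I)
    show "FA precomp_u m \<in> Arr (Alg_l S one FB)" if "m \<in> Arr (Alg_s T A B)" for m
      by (rule precomp_u_hom(1)[OF that])
    show "FA precomp_u m = undefined" if "m \<notin> Arr (Alg_s T A B)" for m
      using that by (simp add: precomp_def Let_def)
  qed
  show "in_hom (Alg_l S one FB) (FA precomp_u m) (FO precomp_u G) (FO precomp_u G')" if "in_hom (Alg_s T A B) m G G'" for m G G'
    using that precomp_u_hom[of m] by (simp add: Alg_s_sel(3) Alg_l_sel(3))
next
  fix G assume "G \<in> Obj (Alg_s T A B)"
  then have G: "strict_morphism T A B G" by (simp add: Alg_s_sel)
  have strict_1cell: "AB.strict_1cell (fst G)" "G = (fst G, AB.idl (fst G))" using strictD[OF G] by auto
  have "lax_2cell T A B G G (id2 (Col T) (Und A) (Und B) (fst G))"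
    using AB.strict_2cell_id[OF strict_1cell(1)] strict_1cell(2) by simp
  moreover have "whisker_u (id2 (Col T) (Und A) (Und B) (fst G)) = idL (restr_u (fst G))"
    using ux_obj[OF strict_1cell(1)] by (auto simp: whisker_u_def id2_def restr_u_def mklax_def restrict_def fun_eq_iff col_map)
  ultimately show "FA precomp_u (Ide (Alg_s T A B) G) = Ide (Alg_l S one FB) (FO precomp_u G)"
    using G by (simp add: Alg_s_sel Alg_l_sel precomp_u_arr precomp_u_obj)
next
  fix m m' G0 G1 G2
  assume m: "in_hom (Alg_s T A B) m G0 G1" "in_hom (Alg_s T A B) m' G1 G2"
  then obtain \<phi> \<psi> where mm: "m = (G0, \<phi>, G1)" "m' = (G1, \<psi>, G2)" and G: "strict_morphism T A B G0"
      "strict_morphism T A B G1" "strict_morphism T A B G2" "lax_2cell T A B G0 G1 \<phi>" "lax_2cell T A B G1 G2 \<psi>"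
    by (cases m; cases m') (auto simp: Alg_s_sel)
  have strict_1cell: "AB.strict_1cell (fst G0)" "G0 = (fst G0, AB.idl (fst G0))" using strictD[OF G(1)] by auto
  have "in_hom (Alg_s T A B) (Cmp (Alg_s T A B) m' m) G0 G2"
    by (rule category.cmp_hom[OF AB.Alg_s_category m])
  then have "lax_2cell T A B G0 G2 (vcomp (Col T) (Und A) (Und B) \<psi> \<phi>)"
    by (simp add: mm Alg_s_sel)
  moreover have "whisker_u (vcomp (Col T) (Und A) (Und B) \<psi> \<phi>) = vcL (whisker_u \<psi>) (whisker_u \<phi>)"
    using ux_obj[OF strict_1cell(1)] by (auto simp: whisker_u_def vcomp_def restrict_def fun_eq_iff col_map)
  ultimately show "FA precomp_u (Cmp (Alg_s T A B) m' m) = Cmp (Alg_l S one FB) (FA precomp_u m') (FA precomp_u m)"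
    using G by (simp add: mm Alg_s_sel Alg_l_sel precomp_u_arr)
qed

definition strict_ext :: "('i, 's, unit, unit, 'o, 'm) lax \<Rightarrow> ('j, 't, ('i, 't) dobj, ('i, 's, 't) darr, 'o, 'm) lax" where
  "strict_ext X = (Ext X, AB.idl (Ext X))"

lemma strict_ext_strict: "Alax X \<Longrightarrow> strict_morphism T A B (strict_ext X)"
  using Ext_strict_1cell by (simp add: AB.strict_iff strict_ext_def)

lemma strict_ext_restr_u: "strict_morphism T A B G \<Longrightarrow> strict_ext (restr_u (fst G)) = G"
  using strictD[of G] Ext_restr_u[of "fst G"] by (simp add: strict_ext_def)

lemma restr_u_strict_ext: "Alax X \<Longrightarrow> restr_u (fst (strict_ext X)) = X"
  by (simp add: strict_ext_def restr_u_Ext)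

lemma precomp_u_iso: "iso_of_categories (Alg_s T A B) (Alg_l S one FB) precomp_u"
proof (rule bij_iso_of_categories[OF precomp_u_functor])
  show "bij_betw (FO precomp_u) (Obj (Alg_s T A B)) (Obj (Alg_l S one FB))"
    by (rule bij_betw_byWitness[where f' = strict_ext])
      (use strict_ext_strict strict_ext_restr_u restr_u_strict_ext restr_u_lax strictD in \<open>auto simp: Alg_s_sel Alg_l_sel precomp_u_obj\<close>)
  have ext_2cell: "lax_2cell T A B (strict_ext X) (strict_ext X') (ext_2cell X X' \<psi>)" if "Alax X" "Alax X'" "lax_2cell S one FB X X' \<psi>" for X X' \<psi>
    using ext_2cell_2cell[OF that] by (simp add: strict_ext_def)
  have RK: "ext_2cell (restr_u (fst G)) (restr_u (fst G')) (whisker_u \<phi>) = \<phi>"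
    if "strict_morphism T A B G" "strict_morphism T A B G'" "lax_2cell T A B G G' \<phi>" for G G' \<phi>
    using ext_2cell_whisker_u[of "fst G" "fst G'" \<phi>] strictD[OF that(1)] strictD[OF that(2)] that(3) by simp
  show "bij_betw (FA precomp_u) (Arr (Alg_s T A B)) (Arr (Alg_l S one FB))"
  \<comment> \<open>The inverse on arrows takes both ends from the triple, since
    \<open>ext_2cell\<close> needs the objects of \<open>X\<close> and \<open>X'\<close> to form
    arrows of \<open>TB\<close>.\<close>
  proof (rule bij_betw_byWitness[where f' = "\<lambda>(X, \<psi>, X'). (strict_ext X, ext_2cell X X' \<psi>, strict_ext X')"])
    show "\<forall>m\<in>Arr (Alg_s T A B). (case FA precomp_u m of (X, \<psi>, X') \<Rightarrow> (strict_ext X, ext_2cell X X' \<psi>, strict_ext X')) = m"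
      by (auto simp: Alg_s_sel precomp_u_arr strict_ext_restr_u RK)
    show "\<forall>m\<in>Arr (Alg_l S one FB). FA precomp_u (case m of (X, \<psi>, X') \<Rightarrow> (strict_ext X, ext_2cell X X' \<psi>, strict_ext X')) = m"
      by (auto simp: Alg_l_sel precomp_u_arr strict_ext_strict ext_2cell restr_u_strict_ext whisker_u_ext_2cell)
    show "FA precomp_u ` Arr (Alg_s T A B) \<subseteq> Arr (Alg_l S one FB)"
      using is_functor.FA_arr[OF precomp_u_functor] by blast
    show "(\<lambda>(X, \<psi>, X'). (strict_ext X, ext_2cell X X' \<psi>, strict_ext X')) ` Arr (Alg_l S one FB) \<subseteq> Arr (Alg_s T A B)"
      by (auto simp: Alg_s_sel Alg_l_sel strict_ext_strict ext_2cell)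
  qed
qed

end

text \<open>The first two conjuncts give the last its meaning: it concerns strict morphisms out of
  an actual strict algebra, restricted along an actual lax morphism.\<close>

theorem theorem6p4p6:
  fixes S :: "('i, 's) opd" and T :: "('j, 't) opd"
    and f :: "'i \<Rightarrow> 'j" and F :: "'s \<Rightarrow> 't"
  assumes "operad S" and "operad T" and "operad_morphism S T f F"
  shows "strict_algebra T (down_alg S T f F) \<and>
    lax_morphism S (terminal_alg S) (Fbar S f F (down_alg S T f F)) (u_lax S T f F) \<and>
    (\<forall>B :: ('j, 't, 'o, 'm) alg. strict_algebra T B \<longrightarrow>
      iso_of_categories
        (Alg_s T (down_alg S T f F) B)
        (Alg_l S (terminal_alg S) (Fbar S f F B))
        (precomp S T f F (down_alg S T f F) (u_lax S T f F) B))"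
proof -
  have op: "opmor S T f F" by (intro opmor.intro assms)
  show ?thesis
  proof (intro conjI allI impI)
    show "strict_algebra T (down_alg S T f F)" by (rule opmor.A_strict[OF op])
    show "lax_morphism S (terminal_alg S) (Fbar S f F (down_alg S T f F)) (u_lax S T f F)"
      by (rule opmor.u_lax_lax[OF op])
    fix B :: "('j, 't, 'o, 'm) alg" assume B: "strict_algebra T B"
    have "opmor_alg S T f F B"
      by (intro opmor_alg.intro op strict_alg.intro strict_alg_axioms.intro assms(2) B)
    then show "iso_of_categories (Alg_s T (down_alg S T f F) B) (Alg_l S (terminal_alg S) (Fbar S f F B))
        (precomp S T f F (down_alg S T f F) (u_lax S T f F) B)"
      by (rule opmor_alg.precomp_u_iso)
  qed
qed

end
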